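(* Let $(G,K,L,\theta,\phi)$ be a character five such that $K/L$ is abelian of odd order. Then there is a complement $H/L$ of $K/L$ in $G/L$ and a canonical magic character $\psi$ of $H/L$ such that for every subgroup $V/L\leq H/L$ with $|V/L|$ odd, $1_V$ is the unique irreducible constituent of $\psi_V$ which appears with odd multiplicity.
   Context: All groups are finite and characters are complex. $a^x=x^{-1}ax$; $e_\phi=\frac{\phi(1)}{|L|}\sum_{l\in L}\phi(l^{-1})l$. A character five is a quintuple $(G,K,L,\theta,\phi)$ where $G$ is a finite group, $L\leq K$ are normal subgroups of $G$, $\phi\in\operatorname{Irr}(L)$ is invariant in $G$ and fully ramified in $K$ (i.e. there is exactly one irreducible character of $K$ lying above $\phi$), and $\theta$ is this unique character of $K$ above $\phi$. $S=(\mathbb{C}Ke_\phi)^L$ is the centralizer of $L$ in $\mathbb{C}Ke_\phi$; it is isomorphic to $\operatorname{Mat}_n(\mathbb{C})$ with $n^2=|K/L|$, and $G/L$ acts on it by conjugation. A magic representation on a complement $H/L$ of $K/L$ in $G/L$ is a homomorphism $\sigma\colon H/L\to S^*$ with $s^x=s^{\sigma(x)}:=\sigma(x)^{-1}s\sigma(x)$ for all $x\in H/L$, $s\in S$. A magic character is the character $\psi(x)=\operatorname{tr}(\sigma(x))$ of a magic representation $\sigma$, with trace taken in $S\cong\operatorname{Mat}_n(\mathbb{C})$; it is also viewed as a character of $H$ with $L$ in its kernel. Let $|K/L|$ be odd and let $\pi$ be the set of prime divisors of $|K/L|$. A magic character $\psi$ of $H/L$ is canonical if (1) the order of the linear character $\det\psi$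 is a $\pi$-number and (2) for every $p\in\pi$ and every Sylow $p$-subgroup $Q$ of $H$, $1_Q$ is the unique irreducible constituent of $\psi_Q$ appearing with odd multiplicity. *)

theory Defs
  imports
    "HOL-Computational_Algebra.Primes"
    "HOL-Algebra.QuotRing"
    "Jordan_Normal_Form.Determinant"
    "Jordan_Normal_Form.VS_Connect"
begin

section \<open>Groups\<close>

abbreviation subgrp :: "('a, 'b) monoid_scheme \<Rightarrow> 'a set \<Rightarrow> ('a, 'b) monoid_scheme" where
  "subgrp G H \<equiv> G\<lparr>carrier := H\<rparr>"

text \<open>For normal \<open>L\<close>, the factor group \<open>H / L\<close>; its carrier is the set of cosets of \<open>L\<close> in \<open>H\<close>,
  a subset of the carrier of \<open>G Mod L\<close>.\<close>

abbreviation quot :: "('a, 'b) monoid_scheme \<Rightarrow> 'a set \<Rightarrow> 'a set \<Rightarrow> 'a set monoid" where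
  "quot G H L \<equiv> subgrp G H Mod L"

definition is_complement :: "('a, 'b) monoid_scheme \<Rightarrow> 'a set \<Rightarrow> 'a set \<Rightarrow> bool" where
  "is_complement G N A \<longleftrightarrow>
     subgroup A G \<and> A <#>\<^bsub>G\<^esub> N = carrier G \<and> A \<inter> N = {\<one>\<^bsub>G\<^esub>}"

definition sylow_subgroup :: "nat \<Rightarrow> ('a, 'b) monoid_scheme \<Rightarrow> 'a set \<Rightarrow> bool" where
  "sylow_subgroup p G Q \<longleftrightarrow> subgroup Q G \<and> card Q = p ^ multiplicity p (Coset.order G)"

definition pi_number :: "nat set \<Rightarrow> nat \<Rightarrow> bool" where
  "pi_number \<pi> n \<longleftrightarrow> n > 0 \<and> prime_factors n \<subseteq> \<pi>"


section \<open>Complex characters\<close>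

definition mat_trace :: "'k :: comm_monoid_add mat \<Rightarrow> 'k" where
  "mat_trace A = (\<Sum>i<dim_row A. A $$ (i, i))"

definition representation :: "('a, 'b) monoid_scheme \<Rightarrow> nat \<Rightarrow> ('a \<Rightarrow> complex mat) \<Rightarrow> bool" where
  "representation G n \<rho> \<longleftrightarrow> \<rho> \<in> hom G (units_of (ring_mat TYPE(complex) n ()))"

definition irreducible_representation ::
  "('a, 'b) monoid_scheme \<Rightarrow> nat \<Rightarrow> ('a \<Rightarrow> complex mat) \<Rightarrow> bool" where
  "irreducible_representation G n \<rho> \<longleftrightarrow> representation G n \<rho> \<and> n > 0 \<and>
     (\<forall>W. subspace class_ring W (module_vec TYPE(complex) n) \<and>
          (\<forall>g\<in>carrier G. \<forall>w\<in>W. \<rho> g *\<^sub>v w \<in> W) \<longrightarrow>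
          W = {0\<^sub>v n} \<or> W = carrier_vec n)"

text \<open>Characters of \<open>G\<close> are extensional on the carrier of \<open>G\<close>, so that distinct characters are
  distinct functions and the restriction \<open>\<psi>\<^sub>V\<close> is \<^term>\<open>restrict \<psi> V\<close>.\<close>

definition affords :: "('a, 'b) monoid_scheme \<Rightarrow> ('a \<Rightarrow> complex mat) \<Rightarrow> ('a \<Rightarrow> complex) \<Rightarrow> bool" where
  "affords G \<rho> \<chi> \<longleftrightarrow>
     (\<exists>n. representation G n \<rho>) \<and> \<chi> = (\<lambda>g\<in>carrier G. mat_trace (\<rho> g))"

definition Irr :: "('a, 'b) monoid_scheme \<Rightarrow> ('a \<Rightarrow> complex) set" where
  "Irr G = {\<chi>. \<exists>n \<rho>. irreducible_representation G n \<rho> \<and> affords G \<rho> \<chi>}"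

abbreviation trivial_character :: "'a set \<Rightarrow> 'a \<Rightarrow> complex" where
  "trivial_character V \<equiv> (\<lambda>v\<in>V. 1)"

definition irr_decomposition ::
  "('a, 'b) monoid_scheme \<Rightarrow> ('a \<Rightarrow> complex) \<Rightarrow> (('a \<Rightarrow> complex) \<Rightarrow> nat) \<Rightarrow> bool" where
  "irr_decomposition G \<chi> m \<longleftrightarrow>
     finite {\<xi>. m \<xi> \<noteq> 0} \<and> {\<xi>. m \<xi> \<noteq> 0} \<subseteq> Irr G \<and>
     (\<forall>g\<in>carrier G. \<chi> g = (\<Sum>\<xi> | m \<xi> \<noteq> 0. of_nat (m \<xi>) * \<xi> g))"

text \<open>The choice is harmless: for a finite group, a character has exactly one decomposition.\<close>

definition irr_mult ::
  "('a, 'b) monoid_scheme \<Rightarrow> ('a \<Rightarrow> complex) \<Rightarrow> ('a \<Rightarrow> complex) \<Rightarrow> nat" where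
  "irr_mult G \<chi> = (SOME m. irr_decomposition G \<chi> m)"

text \<open>\<open>\<xi> \<in> Irr G\<close> lies above \<open>\<phi> \<in> Irr L\<close>.\<close>

definition lies_above ::
  "('a, 'b) monoid_scheme \<Rightarrow> 'a set \<Rightarrow> ('a \<Rightarrow> complex) \<Rightarrow> ('a \<Rightarrow> complex) \<Rightarrow> bool" where
  "lies_above G L \<xi> \<phi> \<longleftrightarrow> irr_mult (subgrp G L) (restrict \<xi> L) \<phi> \<noteq> 0"

definition trivial_unique_odd :: "('a, 'b) monoid_scheme \<Rightarrow> 'a set \<Rightarrow> ('a \<Rightarrow> complex) \<Rightarrow> bool" where
  "trivial_unique_odd G V \<psi> \<longleftrightarrow>
     {\<xi> \<in> Irr (subgrp G V). odd (irr_mult (subgrp G V) (restrict \<psi> V) \<xi>)} = {trivial_character V}"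

text \<open>\<open>det \<chi>\<close> does not depend on the chosen representation affording \<open>\<chi>\<close>, as any two are similar.\<close>

definition det_character :: "('a, 'b) monoid_scheme \<Rightarrow> ('a \<Rightarrow> complex) \<Rightarrow> 'a \<Rightarrow> complex" where
  "det_character G \<chi> = (\<lambda>g\<in>carrier G. det ((SOME \<rho>. affords G \<rho> \<chi>) g))"

definition linear_character_order :: "('a, 'b) monoid_scheme \<Rightarrow> ('a \<Rightarrow> complex) \<Rightarrow> nat" where
  "linear_character_order G \<mu> = (LEAST k. k > 0 \<and> (\<forall>g\<in>carrier G. \<mu> g ^ k = 1))"


section \<open>The group algebra\<close>

text \<open>The function \<open>a\<close> stands for the formal sum of all \<open>a(g) g\<close> with \<open>g\<close> in \<open>G\<close>.\<close>

definition group_algebra :: "('a, 'b) monoid_scheme \<Rightarrow> ('a \<Rightarrow> complex) ring" where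
  "group_algebra G =
     \<lparr>carrier = {a. \<forall>x. x \<notin> carrier G \<longrightarrow> a x = 0},
      mult = (\<lambda>a b x. if x \<in> carrier G
                      then \<Sum>y\<in>carrier G. a y * b (inv\<^bsub>G\<^esub> y \<otimes>\<^bsub>G\<^esub> x) else 0),
      one = (\<lambda>x. if x = \<one>\<^bsub>G\<^esub> then 1 else 0),
      zero = (\<lambda>x. 0),
      add = (\<lambda>a b x. a x + b x)\<rparr>"

definition ga_of :: "'a \<Rightarrow> 'a \<Rightarrow> complex" where
  "ga_of g = (\<lambda>x. if x = g then 1 else 0)"

definition ga_conj :: "('a, 'b) monoid_scheme \<Rightarrow> ('a \<Rightarrow> complex) \<Rightarrow> 'a \<Rightarrow> 'a \<Rightarrow> complex" where
  "ga_conj G s g = ga_of (inv\<^bsub>G\<^esub> g) \<otimes>\<^bsub>group_algebra G\<^esub> s \<otimes>\<^bsub>group_algebra G\<^esub> ga_of g"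

definition char_idem ::
  "('a, 'b) monoid_scheme \<Rightarrow> 'a set \<Rightarrow> ('a \<Rightarrow> complex) \<Rightarrow> 'a \<Rightarrow> complex" where
  "char_idem G L \<phi> = (\<lambda>l. if l \<in> L
     then \<phi> \<one>\<^bsub>G\<^esub> / of_nat (card L) * \<phi> (inv\<^bsub>G\<^esub> l) else 0)"

text \<open>The algebra \<open>S = (\<complex>K e\<^sub>\<phi>)\<^sup>L\<close>, realised inside \<open>\<complex>G\<close>, where \<open>\<complex>K\<close> consists of the elements
  supported on \<open>K\<close>.\<close>

definition centralizer_algebra ::
  "('a, 'b) monoid_scheme \<Rightarrow> 'a set \<Rightarrow> 'a set \<Rightarrow> ('a \<Rightarrow> complex) \<Rightarrow> ('a \<Rightarrow> complex) ring" where
  "centralizer_algebra G K L \<phi> = (group_algebra G)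
     \<lparr>carrier := {s. (\<exists>a\<in>carrier (group_algebra G). (\<forall>x. x \<notin> K \<longrightarrow> a x = 0) \<and>
                         s = a \<otimes>\<^bsub>group_algebra G\<^esub> char_idem G L \<phi>) \<and>
                     (\<forall>l\<in>L. s \<otimes>\<^bsub>group_algebra G\<^esub> ga_of l = ga_of l \<otimes>\<^bsub>group_algebra G\<^esub> s)},
      one := char_idem G L \<phi>\<rparr>"

text \<open>Isomorphisms of \<open>\<complex>\<close>-algebras from \<open>S\<close> onto the matrix algebra of degree \<open>n\<close>, \<open>n\<^sup>2 = |K / L|\<close>.\<close>

definition matrix_isos ::
  "('a, 'b) monoid_scheme \<Rightarrow> 'a set \<Rightarrow> 'a set \<Rightarrow> ('a \<Rightarrow> complex) \<Rightarrow> (('a \<Rightarrow> complex) \<Rightarrow> complex mat) set"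
  where
  "matrix_isos G K L \<phi> = {F. \<exists>n. n ^ 2 = Coset.order (quot G K L) \<and>
     F \<in> ring_iso (centralizer_algebra G K L \<phi>) (ring_mat TYPE(complex) n ()) \<and>
     (\<forall>c. \<forall>s\<in>carrier (centralizer_algebra G K L \<phi>). F (\<lambda>x. c * s x) = c \<cdot>\<^sub>m F s)}"


section \<open>Character fives and magic characters\<close>

locale character_five = group G for G (structure) +
  fixes K L :: "'a set" and \<theta> \<phi> :: "'a \<Rightarrow> complex"
  assumes finite_carrier: "finite (carrier G)"
    and normal_K: "K \<lhd> G"
    and normal_L: "L \<lhd> G"
    and L_le_K: "L \<subseteq> K"
    and phi_Irr: "\<phi> \<in> Irr (subgrp G L)"
    and phi_invariant: "\<And>g l. g \<in> carrier G \<Longrightarrow> l \<in> L \<Longrightarrow> \<phi> (inv g \<otimes> l \<otimes> g) = \<phi> l"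
    and fully_ramified: "{\<xi> \<in> Irr (subgrp G K). lies_above (subgrp G K) L \<xi> \<phi>} = {\<theta>}"

definition magic_representation ::
  "('a, 'b) monoid_scheme \<Rightarrow> 'a set \<Rightarrow> 'a set \<Rightarrow> ('a \<Rightarrow> complex) \<Rightarrow> 'a set \<Rightarrow>
   ('a set \<Rightarrow> 'a \<Rightarrow> complex) \<Rightarrow> bool" where
  "magic_representation G K L \<phi> H \<sigma> \<longleftrightarrow>
     (let S = centralizer_algebra G K L \<phi> in
        \<sigma> \<in> hom (quot G H L) (units_of S) \<and>
        (\<forall>h\<in>H. \<forall>s\<in>carrier S.
           ga_conj G s h = inv\<^bsub>S\<^esub> (\<sigma> (L #>\<^bsub>G\<^esub> h)) \<otimes>\<^bsub>S\<^esub> s \<otimes>\<^bsub>S\<^esub> \<sigma> (L #>\<^bsub>G\<^esub> h)))"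

text \<open>Magic characters of \<open>H / L\<close> are viewed as characters of \<open>H\<close>.  By the Skolem-Noether theorem
  the trace on \<open>S\<close> does not depend on the choice of the isomorphism.\<close>

definition magic_character ::
  "('a, 'b) monoid_scheme \<Rightarrow> 'a set \<Rightarrow> 'a set \<Rightarrow> ('a \<Rightarrow> complex) \<Rightarrow> 'a set \<Rightarrow> ('a \<Rightarrow> complex) \<Rightarrow> bool"
  where
  "magic_character G K L \<phi> H \<psi> \<longleftrightarrow>
     (\<exists>\<sigma> F. magic_representation G K L \<phi> H \<sigma> \<and> F \<in> matrix_isos G K L \<phi> \<and>
            \<psi> = (\<lambda>h\<in>H. mat_trace (F (\<sigma> (L #>\<^bsub>G\<^esub> h)))))"

definition canonical_magic_character ::
  "('a, 'b) monoid_scheme \<Rightarrow> 'a set \<Rightarrow> 'a set \<Rightarrow> ('a \<Rightarrow> complex) \<Rightarrow> 'a set \<Rightarrow> ('a \<Rightarrow> complex) \<Rightarrow> bool"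
  where
  "canonical_magic_character G K L \<phi> H \<psi> \<longleftrightarrow>
     (let \<pi> = prime_factors (Coset.order (quot G K L)) in
        magic_character G K L \<phi> H \<psi> \<and>
        pi_number \<pi> (linear_character_order (subgrp G H) (det_character (subgrp G H) \<psi>)) \<and>
        (\<forall>p\<in>\<pi>. \<forall>Q. sylow_subgroup p (subgrp G H) Q \<longrightarrow> trivial_unique_odd G Q \<psi>))"

end

theory Submission
  imports
    Defs
    "Jordan_Normal_Form.Schur_Decomposition"
    "Jordan_Normal_Form.Char_Poly"
    "HOL-Algebra.Multiplicative_Group"
    "HOL-Number_Theory.Residues"
begin

text \<open>
  Put \<open>E = K / L\<close>.  A representation affording \<open>\<phi>\<close> extends to a projective representation of \<open>K\<close>
  whose cocycle, since \<open>|E|\<close> is odd, can be normalised to an alternating bicharacter \<open>\<beta>\<close> of \<open>E\<close>.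
  The algebra \<open>S\<close> is the twisted group algebra of \<open>E\<close> for \<open>\<beta>\<close>, with a basis of elements \<open>s\<^sub>x\<close>
  supported on the cosets \<open>x\<close>, and full ramification makes \<open>\<beta>\<close> nondegenerate.  Hence \<open>s\<^sub>x\<close> can be
  mapped to explicit Heisenberg matrices, which gives \<open>S \<cong> Mat\<^sub>n(\<complex>)\<close>.  The elements of \<open>G\<close> that permute
  the \<open>s\<^sub>x\<close> without scalar factors form a group \<open>H\<close>: an element of \<open>G\<close> multiplies the \<open>s\<^sub>x\<close> by a
  linear character of \<open>E\<close>, and by nondegeneracy exactly one element of \<open>E\<close> does the same, so \<open>H / L\<close>
  is a complement.  It acts on \<open>E\<close> by isometries of \<open>\<beta>\<close>, and \<open>T\<^sub>h = \<Sum>\<^sub>x s\<^sub>x\<^sup>-\<^sup>1 s\<^sub>x\<^sub>h\<close> (\<open>xh\<close> being the image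
  of \<open>x\<close> under \<open>h\<close>) induces the action of \<open>h\<close> on \<open>S\<close>.

  Inversion on \<open>E\<close> gives a central involution \<open>z\<close> whose eigenspaces have dimensions \<open>(n \<plusminus> 1) / 2\<close>.
  As these differ by one, dividing \<open>T\<^sub>h\<close> by the quotient of its determinants on the eigenspaces turns
  \<open>h \<mapsto> T\<^sub>h\<close> into a homomorphism with equal determinants on both eigenspaces.  If \<open>h\<close> has odd
  order, then \<open>tr(z \<sigma>(h)) tr(z \<sigma>(h)\<^sup>-\<^sup>1)\<close> counts the \<open>x\<close> inverted by \<open>h\<close>, so it is \<open>1\<close>; over a group of
  odd order the two eigenspaces therefore differ by a linear character, which is trivial because the
  determinants agree, and \<open>\<psi> = 2 \<psi>\<^sub>- + 1\<close>.  For an odd prime \<open>q\<close> not dividing \<open>n\<close> the determinant lies in a ring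
  generated by \<open>1 / (2 n)\<close> and roots of unity of order prime to \<open>q\<close>, which contains no nontrivial root of unity of \<open>q\<close>-power order;
  a twist by a linear character of \<open>2\<close>-power order removes the \<open>2\<close>-part.
\<close>

section \<open>Matrices\<close>

text \<open>Odd order enters as unique extraction of square roots. Conjugation by \<open>k\<close>
  in \<open>K\<close> multiplies \<open>s_x\<close> by the square of a value of
  \<open>\<beta>\<close>, so radicals, isometries and characters can pass between the form and its
  square. Full ramification is used through characters: \<open>\<theta>\<close> times a linear
  character of \<open>K / L\<close> is again irreducible above \<open>\<phi>\<close>, so
  \<open>\<theta>\<close> vanishes off \<open>L\<close>. For a nontrivial \<open>x\<close> in the
  radical, \<open>s_x\<close> would act on a module of \<open>\<theta>\<close> as a scalar of trace
  0, although it is invertible in \<open>S\<close>. The obstacle is that \<open>T_h\<close> is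
  multiplicative only up to scalars, while the determinant must be controlled at every prime outside
  \<open>\<pi>\<close>. So all scalars are taken from determinants of matrices with explicit
  entries, which keeps the representation over one ring with denominators 2 and \<open>n\<close>. At
  the prime 2 this gives nothing, as \<open>-1\<close> lies in every ring; hence the separate twist.
  It is trivial on elements of odd order modulo the kernel and so leaves the parity statement
  intact. As \<open>L\<close> may have even order, oddness is expressed by exponents
  \<open>s\<close> for which \<open>w^s\<close> acts trivially.\<close>

definition msum :: "nat \<Rightarrow> nat \<Rightarrow> ('i \<Rightarrow> complex mat) \<Rightarrow> 'i set \<Rightarrow> complex mat" where
  "msum r c f A = mat r c (\<lambda>ij. \<Sum>a\<in>A. f a $$ ij)"

lemma msum_carrier [simp]: "msum r c f A \<in> carrier_mat r c"
  by (simp add: msum_def)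

lemma msum_dim [simp]: "dim_row (msum r c f A) = r" "dim_col (msum r c f A) = c"
  by (simp_all add: msum_def)

lemma msum_index [simp]: "i < r \<Longrightarrow> j < c \<Longrightarrow> msum r c f A $$ (i, j) = (\<Sum>a\<in>A. f a $$ (i, j))"
  by (simp add: msum_def)

lemma msum_cong: "A = B \<Longrightarrow> (\<And>a. a \<in> B \<Longrightarrow> f a = g a) \<Longrightarrow> msum r c f A = msum r c g B"
  by (simp add: msum_def)

lemma msum_reindex: "bij_betw h A B \<Longrightarrow> msum r c f B = msum r c (\<lambda>a. f (h a)) A"
  by (rule eq_matI) (simp_all add: sum.reindex_bij_betw[symmetric])

lemma mult_mat_index:
  "A \<in> carrier_mat r k \<Longrightarrow> B \<in> carrier_mat k c \<Longrightarrow> i < r \<Longrightarrow> j < c \<Longrightarrow>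
     (A * B) $$ (i, j) = (\<Sum>l<k. A $$ (i, l) * B $$ (l, j))"
  by (simp add: scalar_prod_def lessThan_atLeast0)

lemma mult_msum:
  assumes "X \<in> carrier_mat p r" "\<And>a. a \<in> A \<Longrightarrow> f a \<in> carrier_mat r c"
  shows "X * msum r c f A = msum p c (\<lambda>a. X * f a) A"
proof (rule eq_matI)
  fix i j assume "i < dim_row (msum p c (\<lambda>a. X * f a) A)" "j < dim_col (msum p c (\<lambda>a. X * f a) A)"
  then have ij: "i < p" "j < c" by simp_all
  have "(X * msum r c f A) $$ (i, j) = (\<Sum>l<r. X $$ (i, l) * (\<Sum>a\<in>A. f a $$ (l, j)))"
    using mult_mat_index[OF assms(1) msum_carrier ij] ij by simp
  also have "\<dots> = (\<Sum>a\<in>A. \<Sum>l<r. X $$ (i, l) * f a $$ (l, j))"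
    by (subst sum.swap) (simp add: sum_distrib_left)
  also have "\<dots> = (\<Sum>a\<in>A. (X * f a) $$ (i, j))"
    by (rule sum.cong) (simp_all add: mult_mat_index[OF assms(1) assms(2) ij])
  finally show "(X * msum r c f A) $$ (i, j) = msum p c (\<lambda>a. X * f a) A $$ (i, j)"
    using ij by simp
qed (use assms in auto)

lemma msum_mult:
  assumes "X \<in> carrier_mat c p" "\<And>a. a \<in> A \<Longrightarrow> f a \<in> carrier_mat r c"
  shows "msum r c f A * X = msum r p (\<lambda>a. f a * X) A"
proof (rule eq_matI)
  fix i j assume "i < dim_row (msum r p (\<lambda>a. f a * X) A)" "j < dim_col (msum r p (\<lambda>a. f a * X) A)"
  then have ij: "i < r" "j < p" by simp_all
  have "(msum r c f A * X) $$ (i, j) = (\<Sum>l<c. (\<Sum>a\<in>A. f a $$ (i, l)) * X $$ (l, j))"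
    using mult_mat_index[OF msum_carrier assms(1) ij] ij by simp
  also have "\<dots> = (\<Sum>a\<in>A. \<Sum>l<c. f a $$ (i, l) * X $$ (l, j))"
    by (subst sum.swap) (simp add: sum_distrib_right)
  also have "\<dots> = (\<Sum>a\<in>A. (f a * X) $$ (i, j))"
    by (rule sum.cong) (simp_all add: mult_mat_index[OF assms(2) assms(1) ij])
  finally show "(msum r c f A * X) $$ (i, j) = msum r p (\<lambda>a. f a * X) A $$ (i, j)"
    using ij by simp
qed (use assms in auto)

lemma msum_smult:
  "X \<in> carrier_mat r c \<Longrightarrow> msum r c (\<lambda>a. k a \<cdot>\<^sub>m X) A = (\<Sum>a\<in>A. k a) \<cdot>\<^sub>m X"
  by (rule eq_matI) (auto simp: sum_distrib_right)

section \<open>Traces and factorizations of idempotents\<close>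

lemma mat_trace_carrier: "A \<in> carrier_mat n n \<Longrightarrow> mat_trace A = (\<Sum>i<n. A $$ (i, i))"
  by (auto simp: mat_trace_def)

lemma mat_trace_smult [simp]:
  "A \<in> carrier_mat n n \<Longrightarrow> mat_trace (c \<cdot>\<^sub>m A) = c * mat_trace (A :: complex mat)"
  by (auto simp: mat_trace_def sum_distrib_left)

lemma mat_trace_add:
  "A \<in> carrier_mat n n \<Longrightarrow> B \<in> carrier_mat n n \<Longrightarrow>
     mat_trace (A + B :: complex mat) = mat_trace A + mat_trace B"
  by (auto simp: mat_trace_def sum.distrib)

lemma mat_trace_minus:
  "A \<in> carrier_mat n n \<Longrightarrow> B \<in> carrier_mat n n \<Longrightarrow>
     mat_trace (A - B :: complex mat) = mat_trace A - mat_trace B"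
  by (auto simp: mat_trace_def sum_subtractf)

lemma mat_trace_one [simp]: "mat_trace (1\<^sub>m n :: complex mat) = of_nat n"
  by (simp add: mat_trace_def)

lemma mat_trace_smult_one [simp]: "mat_trace (c \<cdot>\<^sub>m 1\<^sub>m n :: complex mat) = c * of_nat n"
  by (simp add: mat_trace_def)

lemma mat_trace_zero [simp]: "mat_trace (0\<^sub>m n n :: complex mat) = 0"
  by (simp add: mat_trace_def)

lemma mat_trace_msum:
  "mat_trace (msum n n f A) = (\<Sum>a\<in>A. \<Sum>i<n. f a $$ (i, i))"
  unfolding mat_trace_def by (subst sum.swap) simp

lemma mat_trace_msum':
  "(\<And>a. a \<in> A \<Longrightarrow> f a \<in> carrier_mat n n) \<Longrightarrow> mat_trace (msum n n f A) = (\<Sum>a\<in>A. mat_trace (f a))"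
  unfolding mat_trace_msum by (rule sum.cong) (auto simp: mat_trace_carrier[of _ n])

lemma mat_trace_mult:
  assumes "A \<in> carrier_mat r c" "B \<in> carrier_mat c r"
  shows "mat_trace (A * B :: complex mat) = (\<Sum>i<r. \<Sum>j<c. A $$ (i, j) * B $$ (j, i))"
  using assms by (simp add: mat_trace_def scalar_prod_def lessThan_atLeast0)

lemma mat_trace_comm:
  assumes "A \<in> carrier_mat r c" "B \<in> carrier_mat c r"
  shows "mat_trace (A * B :: complex mat) = mat_trace (B * A)"
  unfolding mat_trace_mult[OF assms] mat_trace_mult[OF assms(2,1)]
  by (subst sum.swap) (simp add: mult.commute)

lemma mat_trace_conj:
  assumes "P \<in> carrier_mat n n" "A \<in> carrier_mat n n" "Q \<in> carrier_mat n n" "Q * P = 1\<^sub>m n"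
  shows "mat_trace (P * A * Q :: complex mat) = mat_trace A"
proof -
  have "mat_trace (P * A * Q) = mat_trace (Q * (P * A))"
    using assms by (intro mat_trace_comm) auto
  also have "Q * (P * A) = A"
    using assms assoc_mult_mat[OF assms(3,1,2)] by simp
  finally show ?thesis .
qed

text \<open>Subtracting from an idempotent the rank one idempotent built from one of its nonzero columns
  kills that column and keeps the zero columns.\<close>

lemma idempotent_factorization:
  assumes "E \<in> carrier_mat n n" "E * E = (E :: complex mat)"
  shows "\<exists>k A B. A \<in> carrier_mat n k \<and> B \<in> carrier_mat k n \<and> A * B = E \<and> B * A = 1\<^sub>m k \<and> k \<le> n"
proof -
  have "\<exists>k A B. A \<in> carrier_mat n k \<and> B \<in> carrier_mat k n \<and> A * B = E \<and> B * A = 1\<^sub>m k \<and> k \<le> card J"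
    if "finite J" "E \<in> carrier_mat n n" "E * E = (E :: complex mat)" "\<And>j. j < n \<Longrightarrow> j \<notin> J \<Longrightarrow> col E j = 0\<^sub>v n" for J E
    using that
  proof (induction "card J" arbitrary: J E rule: less_induct)
    case less
    note E = less.prems(2) and EE = less.prems(3)
    show ?case
    proof (cases "E = 0\<^sub>m n n")
      case True
      then show ?thesis
        by (intro exI[of _ 0] exI[of _ "0\<^sub>m n 0"] exI[of _ "0\<^sub>m 0 n"]) (auto intro!: eq_matI)
    next
      case False
      then obtain i j where ij: "i < n" "j < n" "E $$ (i, j) \<noteq> 0"
        using E by (metis carrier_matD eq_matI index_zero_mat)
      have jJ: "j \<in> J"
      proof (rule ccontr)
        assume "j \<notin> J"
        then have "col E j $ i = 0" using less.prems(4)[OF ij(2)] ij by simp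
        then show False using E ij by simp
      qed
      define c where "c = E $$ (i, j)"
      \<comment> \<open>Column \<open>j\<close> and row \<open>i\<close> of \<open>E\<close>, the
        row divided by the pivot \<open>E $$ (i, j)\<close>. Since \<open>E * E = E\<close>, the
        product \<open>f * u\<close> is the 1 by 1 identity, and \<open>u * f\<close> is a rank one
        idempotent absorbed by \<open>E\<close> on both sides.\<close>
      define u where "u = mat n 1 (\<lambda>(k, _). E $$ (k, j))"
      define f where "f = mat 1 n (\<lambda>(_, k). E $$ (i, k) / c)"
      have u: "u \<in> carrier_mat n 1" and f: "f \<in> carrier_mat 1 n" by (auto simp: u_def f_def)
      have EEi: "(\<Sum>l<n. E $$ (a, l) * E $$ (l, b)) = E $$ (a, b)" if "a < n" "b < n" for a b
        using mult_mat_index[OF E E that] EE by simp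
      have Eu: "E * u = u"
      proof (rule eq_matI)
        fix a b assume "a < dim_row u" "b < dim_col u"
        then have ab: "a < n" "b < 1" using u by auto
        have "(E * u) $$ (a, b) = (\<Sum>l<n. E $$ (a, l) * E $$ (l, j))"
          unfolding mult_mat_index[OF E u ab] using ab by (simp add: u_def)
        then show "(E * u) $$ (a, b) = u $$ (a, b)" using ab ij by (simp add: EEi u_def)
      qed (use E u in auto)
      have fE: "f * E = f"
      proof (rule eq_matI)
        fix a b assume "a < dim_row f" "b < dim_col f"
        then have ab: "a < 1" "b < n" using f by auto
        have "(f * E) $$ (a, b) = (\<Sum>l<n. E $$ (i, l) * E $$ (l, b)) / c"
          unfolding mult_mat_index[OF f E ab] using ab by (simp add: f_def sum_divide_distrib)
        then show "(f * E) $$ (a, b) = f $$ (a, b)" using ab ij by (simp add: EEi f_def)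
      qed (use E f in auto)
      have fu: "f * u = 1\<^sub>m 1"
      proof (rule eq_matI)
        fix a b assume "a < dim_row (1\<^sub>m 1 :: complex mat)" "b < dim_col (1\<^sub>m 1 :: complex mat)"
        then have ab: "a = 0" "b = 0" by auto
        have "(f * u) $$ (0, 0) = (\<Sum>l<n. E $$ (i, l) * E $$ (l, j)) / c"
          by (subst mult_mat_index[OF f u]) (simp_all add: f_def u_def sum_divide_distrib)
        then show "(f * u) $$ (a, b) = 1\<^sub>m 1 $$ (a, b)" using ab ij by (simp add: EEi c_def)
      qed (use u f in auto)
      define E' where "E' = E - u * f"
      have uf: "u * f \<in> carrier_mat n n" using u f by simp
      have E': "E' \<in> carrier_mat n n" unfolding E'_def by (rule minus_carrier_mat[OF uf])
      have 1: "E * (u * f) = u * f" "(u * f) * E = u * f" "(u * f) * (u * f) = u * f"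
      proof -
        show "E * (u * f) = u * f" using Eu assoc_mult_mat[OF E u f] by simp
        show "(u * f) * E = u * f" using fE assoc_mult_mat[OF u f E] by simp
        have "(u * f) * (u * f) = u * (f * (u * f))" by (rule assoc_mult_mat[OF u f uf])
        also have "f * (u * f) = f" using assoc_mult_mat[OF f u f] fu f by simp
        finally show "(u * f) * (u * f) = u * f" .
      qed
      have ufE': "f * E' = 0\<^sub>m 1 n" and Eu': "E' * u = 0\<^sub>m n 1"
      proof -
        have "f * E' = f * E - f * (u * f)" unfolding E'_def using f E uf by (simp add: mult_minus_distrib_mat)
        also have "f * (u * f) = f" using assoc_mult_mat[OF f u f] fu f by simp
        finally show "f * E' = 0\<^sub>m 1 n" using fE f by auto
        have "E' * u = E * u - u * f * u" unfolding E'_def using u E uf by (simp add: minus_mult_distrib_mat)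
        also have "u * f * u = u" using assoc_mult_mat[OF u f u] fu u by simp
        finally show "E' * u = 0\<^sub>m n 1" using Eu u by auto
      qed
      have idem: "E' * E' = E'"
      proof -
        have "E' * E' = E' * E - E' * (u * f)" 
          by (subst (2) E'_def) (use E' E uf in \<open>simp add: mult_minus_distrib_mat\<close>)
        also have "E' * (u * f) = 0\<^sub>m n n" using Eu' assoc_mult_mat[OF E' u f] f by simp
        also have "E' * E = E * E - u * f * E" unfolding E'_def using E uf by (simp add: minus_mult_distrib_mat)
        also have "E * E - u * f * E - 0\<^sub>m n n = E'"
          unfolding 1 EE using E u f by (intro eq_matI) (auto simp: E'_def)
        finally show ?thesis .
      qed
      have col': "col E' b = 0\<^sub>v n" if b: "b < n" "b \<notin> J - {j}" for b
      proof (rule eq_vecI)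
        fix a assume a: "a < dim_vec (0\<^sub>v n :: complex vec)"
        have "E' $$ (a, b) = E $$ (a, b) - E $$ (a, j) * (E $$ (i, b) / c)"
          using a b E mult_mat_index[OF u f, of a b] u f by (simp add: E'_def) (simp add: u_def f_def)
        also have "\<dots> = 0"
        proof (cases "b = j")
          case True
          then show ?thesis using ij by (simp add: c_def)
        next
          case False
          then have "col E b = 0\<^sub>v n" using less.prems(4)[of b] b by simp
          then have "\<And>r. r < n \<Longrightarrow> E $$ (r, b) = 0" using E b
            by (metis carrier_matD index_col index_zero_vec(1))
          then show ?thesis using a ij by simp
        qed
        finally show "col E' b $ a = 0\<^sub>v n $ a" using a b E' by simp
      qed (use E' in auto)
      have less': "card (J - {j}) < card J" using card_Diff1_less[OF less.prems(1) jJ] .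
      from less.hyps[OF less' _ E' idem col'] less.prems(1)
      obtain k A B where AB: "A \<in> carrier_mat n k" "B \<in> carrier_mat k n" "A * B = E'" "B * A = 1\<^sub>m k"
        and k: "k \<le> card (J - {j})" by auto
      have fA: "f * A = 0\<^sub>m 1 k"
      proof -
        have "A = E' * A" using AB assoc_mult_mat[OF AB(1,2,1)] by simp
        then have "f * A = f * E' * A" using assoc_mult_mat[OF f E' AB(1)] by simp
        then show ?thesis using ufE' AB by simp
      qed
      have Bu: "B * u = 0\<^sub>m k 1"
      proof -
        have "B = B * E'" using AB assoc_mult_mat[OF AB(2,1,2)] by simp
        then have "B * u = B * (E' * u)" using assoc_mult_mat[OF AB(2) E' u] by simp
        then show ?thesis using Eu' AB by simp
      qed
      \<comment> \<open>The factorization of \<open>E'\<close> is enlarged by the column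
        \<open>u\<close> and the row \<open>f\<close>; the blocks without rows or columns only
        complete the four-block format.\<close>
      define A1 where "A1 = four_block_mat A u (0\<^sub>m 0 k) (0\<^sub>m 0 1)"
      define B1 where "B1 = four_block_mat B (0\<^sub>m k 0) f (0\<^sub>m 1 0)"
      have A1: "A1 \<in> carrier_mat n (k + 1)" and B1: "B1 \<in> carrier_mat (k + 1) n"
        using four_block_carrier_mat[of A n k "0\<^sub>m 0 1" 0 1 u "0\<^sub>m 0 k"] four_block_carrier_mat[of B k n "0\<^sub>m 1 0" 1 0 "0\<^sub>m k 0" f] AB
        by (simp_all add: A1_def B1_def)
      have "A1 * B1 = four_block_mat (A * B + u * f) (A * 0\<^sub>m k 0 + u * 0\<^sub>m 1 0)
          (0\<^sub>m 0 k * B + 0\<^sub>m 0 1 * f) (0\<^sub>m 0 k * 0\<^sub>m k 0 + 0\<^sub>m 0 1 * 0\<^sub>m 1 0)"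
        unfolding A1_def B1_def using AB u f by (intro mult_four_block_mat) auto
      also have "\<dots> = A * B + u * f" 
        using AB u f by (intro eq_matI) auto
      also have "\<dots> = E" unfolding AB(3) E'_def using E u f by (intro eq_matI) auto
      finally have 2: "A1 * B1 = E" .
      have "B1 * A1 = four_block_mat (B * A + 0\<^sub>m k 0 * 0\<^sub>m 0 k) (B * u + 0\<^sub>m k 0 * 0\<^sub>m 0 1)
          (f * A + 0\<^sub>m 1 0 * 0\<^sub>m 0 k) (f * u + 0\<^sub>m 1 0 * 0\<^sub>m 0 1)"
        unfolding A1_def B1_def using AB u f by (intro mult_four_block_mat) auto
      also have "\<dots> = four_block_mat (1\<^sub>m k) (0\<^sub>m k 1) (0\<^sub>m 1 k) (1\<^sub>m 1)"
        using AB fA Bu fu by (auto simp: mat_eq_iff scalar_prod_def)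
      also have "\<dots> = 1\<^sub>m (k + 1)" by (simp only: four_block_one_mat)
      finally have 3: "B1 * A1 = 1\<^sub>m (k + 1)" .
      show ?thesis using k less' by (intro exI[of _ "k + 1"] exI[of _ A1] exI[of _ B1] conjI A1 B1 2 3) simp
    qed
  qed
  from this[of "{..<n}" E] assms show ?thesis by simp
qed

text \<open>Sylvester's identity. Multiplying the block matrix \<open>P\<close> by the unipotent
  \<open>Q\<close> on the right or on the left clears a different block, and the two products have
  the same determinant. It later turns determinants on an eigenspace into determinants of full
  size.\<close>

lemma det_one_plus_mult_comm:
  assumes A: "A \<in> carrier_mat n k" and X: "X \<in> carrier_mat k n"
  shows "det (1\<^sub>m n + A * X :: complex mat) = det (1\<^sub>m k + X * A)"
proof -
  define P where "P = four_block_mat (1\<^sub>m n) (- A) X (1\<^sub>m k)"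
  define Q where "Q = four_block_mat (1\<^sub>m n) A (0\<^sub>m k n) (1\<^sub>m k)"
  have P: "P \<in> carrier_mat (n + k) (n + k)" and Q: "Q \<in> carrier_mat (n + k) (n + k)"
    unfolding P_def Q_def using A X by (auto intro!: four_block_carrier_mat)
  have dQ: "det Q = 1" unfolding Q_def using A by (subst det_four_block_mat_lower_left_zero[of _ n _ k]) auto
  have "P * Q = four_block_mat (1\<^sub>m n * 1\<^sub>m n + (- A) * 0\<^sub>m k n) (1\<^sub>m n * A + (- A) * 1\<^sub>m k)
      (X * 1\<^sub>m n + 1\<^sub>m k * 0\<^sub>m k n) (X * A + 1\<^sub>m k * 1\<^sub>m k)"
    unfolding P_def Q_def using A X by (intro mult_four_block_mat) auto
  also have "\<dots> = four_block_mat (1\<^sub>m n) (0\<^sub>m n k) X (1\<^sub>m k + X * A)"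
    using A X by (intro cong_four_block_mat) (auto simp: mat_eq_iff intro!: comm_add_mat)
  finally have "det (P * Q) = det (1\<^sub>m k + X * A)"
    using A X by (simp add: det_four_block_mat_upper_right_zero[of _ n _ k])
  then have 1: "det P = det (1\<^sub>m k + X * A)" using det_mult[OF P Q] dQ by simp
  have "Q * P = four_block_mat (1\<^sub>m n * 1\<^sub>m n + A * X) (1\<^sub>m n * (- A) + A * 1\<^sub>m k)
      (0\<^sub>m k n * 1\<^sub>m n + 1\<^sub>m k * X) (0\<^sub>m k n * (- A) + 1\<^sub>m k * 1\<^sub>m k)"
    unfolding P_def Q_def using A X by (intro mult_four_block_mat) auto
  also have "\<dots> = four_block_mat (1\<^sub>m n + A * X) (0\<^sub>m n k) X (1\<^sub>m k)"
    using A X by (intro cong_four_block_mat) (auto simp: mat_eq_iff)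
  finally have "det (Q * P) = det (1\<^sub>m n + A * X)"
    using A X by (simp add: det_four_block_mat_upper_right_zero[of _ n _ k])
  then have "det P = det (1\<^sub>m n + A * X)" using det_mult[OF Q P] dQ by simp
  with 1 show ?thesis by simp
qed

section \<open>Triangular form, power sums and determinants\<close>

lemma similar_upper_triangular:
  assumes "A \<in> carrier_mat n n"
  shows "\<exists>P Q B. P \<in> carrier_mat n n \<and> Q \<in> carrier_mat n n \<and> B \<in> carrier_mat n n \<and>
     upper_triangular B \<and> P * Q = 1\<^sub>m n \<and> Q * P = 1\<^sub>m n \<and> (A :: complex mat) = P * B * Q"
proof -
  obtain as where as: "char_poly A = (\<Prod>a\<leftarrow>as. [:- a, 1:])"
    using char_poly_factorized[OF assms] by blast
  obtain B P Q where "schur_decomposition A as = (B, P, Q)" by (cases "schur_decomposition A as") auto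
  from schur_decomposition[OF assms as this] have w: "similar_mat_wit A B P Q" and u: "upper_triangular B"
    by blast+
  from similar_mat_witD2[OF assms w] u show ?thesis by blast
qed

lemma upper_triangular_pow:
  assumes "B \<in> carrier_mat n n" "upper_triangular B"
  shows "(\<forall>i<n. \<forall>j\<le>i. (B ^\<^sub>m m) $$ (i, j) = (if i = j then (B $$ (i, i) :: complex) ^ m else 0))"
proof (induction m)
  case 0
  then show ?case using assms by auto
next
  case (Suc m)
  show ?case
  proof (intro allI impI)
    fix i j assume ij: "i < n" "j \<le> i"
    have Bm: "B ^\<^sub>m m \<in> carrier_mat n n" using assms by simp
    have "(B ^\<^sub>m Suc m) $$ (i, j) = (\<Sum>l<n. (B ^\<^sub>m m) $$ (i, l) * B $$ (l, j))"
      using mult_mat_index[OF Bm assms(1), of i j] ij by simp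
    also have "\<dots> = (\<Sum>l\<in>{i}. (B ^\<^sub>m m) $$ (i, l) * B $$ (l, j))"
    proof (rule sum.mono_neutral_right)
      show "\<forall>l\<in>{..<n} - {i}. (B ^\<^sub>m m) $$ (i, l) * B $$ (l, j) = 0"
      proof
        fix l assume l: "l \<in> {..<n} - {i}"
        show "(B ^\<^sub>m m) $$ (i, l) * B $$ (l, j) = 0"
        proof (cases "l < i")
          case True
          then show ?thesis using Suc.IH ij by auto
        next
          case False
          then have "j < l" "l < n" using l ij by auto
          then show ?thesis using assms by (auto simp: upper_triangular_def)
        qed
      qed
    qed (use ij in auto)
    also have "\<dots> = (if i = j then B $$ (i, i) ^ Suc m else 0)"
      using Suc.IH ij assms by (auto simp: upper_triangular_def)
    finally show "(B ^\<^sub>m Suc m) $$ (i, j) = (if i = j then B $$ (i, i) ^ Suc m else 0)" .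
  qed
qed

text \<open>The list is the diagonal of a triangular form, that is, the eigenvalues with
  multiplicity. In this shape they can be recovered from traces of powers alone.\<close>

lemma trace_pow_det:
  assumes "A \<in> carrier_mat n n"
  shows "\<exists>as :: complex list. length as = n \<and> (\<forall>m. mat_trace (A ^\<^sub>m m) = (\<Sum>a\<leftarrow>as. a ^ m)) \<and> det A = prod_list as"
proof -
  obtain P Q B where *: "P \<in> carrier_mat n n" "Q \<in> carrier_mat n n" "B \<in> carrier_mat n n"
     "upper_triangular B" "P * Q = 1\<^sub>m n" "Q * P = 1\<^sub>m n" "A = P * B * Q"
    using similar_upper_triangular[OF assms] by blast
  have w: "similar_mat_wit A B P Q" using * assms by (auto simp: similar_mat_wit_def Let_def)
  have "mat_trace (A ^\<^sub>m m) = (\<Sum>a\<leftarrow>diag_mat B. a ^ m)" for m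
  proof -
    have "A ^\<^sub>m m = P * B ^\<^sub>m m * Q"
      using similar_mat_wit_pow_id[OF w] by simp
    then have "mat_trace (A ^\<^sub>m m) = mat_trace (B ^\<^sub>m m)"
      using mat_trace_conj[of P n "B ^\<^sub>m m" Q] * by simp
    also have "\<dots> = (\<Sum>i<n. B $$ (i, i) ^ m)"
      using upper_triangular_pow[OF *(3,4), of m] *(3) by (simp add: mat_trace_carrier[of _ n])
    also have "\<dots> = (\<Sum>a\<leftarrow>diag_mat B. a ^ m)"
      using *(3) by (simp add: diag_mat_def sum_list_distinct_conv_sum_set o_def lessThan_atLeast0)
    finally show ?thesis .
  qed
  moreover have "det A = det B"
  proof -
    have "det P * det Q = 1" using det_mult[OF *(1,2)] *(5) by simp
    moreover have "det A = det P * det B * det Q"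
      unfolding *(7) using * by (subst det_mult[of _ n], simp, simp, subst det_mult[of _ n]) auto
    ultimately show ?thesis by (simp add: mult.commute mult.left_commute)
  qed
  moreover have "det B = prod_list (diag_mat B)" using *(3,4) by (simp add: det_upper_triangular)
  moreover have "length (diag_mat B) = n" using *(3) by (simp add: diag_mat_def)
  ultimately show ?thesis by metis
qed

text \<open>Equal power sums give equal sums of the values of any polynomial. A polynomial that
  vanishes at every listed number except \<open>c\<close> then isolates the multiplicity of
  \<open>c\<close>.\<close>

lemma power_sums_mset_eq:
  assumes "\<And>m. (\<Sum>a\<leftarrow>as. a ^ m) = (\<Sum>b\<leftarrow>bs. (b :: complex) ^ m)"
  shows "mset as = mset bs"
proof (rule multiset_eqI)
  fix c
  have poly: "(\<Sum>a\<leftarrow>as. poly p a) = (\<Sum>b\<leftarrow>bs. poly p b)" for p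
  proof -
    have *: "(\<Sum>a\<leftarrow>xs. poly p a) = (\<Sum>i\<le>degree p. Polynomial.coeff p i * (\<Sum>a\<leftarrow>xs. a ^ i))" for xs
      by (induction xs) (simp_all add: poly_altdef sum.distrib distrib_left)
    show ?thesis unfolding * assms ..
  qed
  define p where "p = (\<Prod>d\<in>(set as \<union> set bs) - {c}. [:- d, 1:])"
  have pc: "poly p c \<noteq> 0" by (auto simp: p_def poly_prod)
  have p0: "poly p x = 0" if "x \<in> set as \<union> set bs" "x \<noteq> c" for x
    using that by (auto simp: p_def poly_prod)
  have *: "(\<Sum>a\<leftarrow>xs. poly p a) = of_nat (count (mset xs) c) * poly p c" if "set xs \<subseteq> set as \<union> set bs" for xs
    using that by (induction xs) (auto simp: p0 distrib_right)
  show "count (mset as) c = count (mset bs) c"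
    using poly[of p] *[of as] *[of bs] pc by simp
qed

text \<open>Two representations with the same character can be compared in this way without first
  showing that they are similar; the exponent \<open>m = 0\<close> compares their degrees.\<close>

lemma det_eq_of_trace_pow_eq:
  assumes "A \<in> carrier_mat n n" "B \<in> carrier_mat k k"
    and "\<And>m. mat_trace (A ^\<^sub>m m) = mat_trace (B ^\<^sub>m m :: complex mat)"
  shows "det A = det B"
proof -
  obtain as where as: "\<And>m. mat_trace (A ^\<^sub>m m) = (\<Sum>a\<leftarrow>as. a ^ m)" "det A = prod_list as"
    using trace_pow_det[OF assms(1)] by blast
  obtain bs where bs: "\<And>m. mat_trace (B ^\<^sub>m m) = (\<Sum>a\<leftarrow>bs. a ^ m)" "det B = prod_list bs"
    using trace_pow_det[OF assms(2)] by blast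
  have "mset as = mset bs" using power_sums_mset_eq[of as bs] assms(3) as(1) bs(1) by simp
  then show ?thesis using as(2) bs(2) by (metis prod_mset_prod_list)
qed

section \<open>Cocycles and characters of finite abelian groups\<close>

locale fin_comm_group = comm_group E for E (structure) +
  assumes finite_E: "finite (carrier E)"
begin

lemma card_E_pos: "card (carrier E) > 0"
  using finite_E one_closed by (auto simp: card_gt_0_iff)

lemma pow_card: "x \<in> carrier E \<Longrightarrow> x [^] card (carrier E) = \<one>"
  using pow_order_eq_1[of x] by (simp add: Coset.order_def)

text \<open>The regular representation of \<open>E\<close> on functions, twisted by
  \<open>\<gamma>\<close>. For a symmetric cocycle these operators commute, and each has a power
  that is a nonzero scalar.\<close>

definition twist :: "('a \<Rightarrow> 'a \<Rightarrow> complex) \<Rightarrow> 'a \<Rightarrow> ('a \<Rightarrow> complex) \<Rightarrow> 'a \<Rightarrow> complex" where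
  "twist \<gamma> x v = (\<lambda>u. \<gamma> x u * v (x \<otimes> u))"

text \<open>A joint eigenvector of these commuting operators is a function splitting the cocycle \<open>\<gamma>\<close>.\<close>

context
  fixes \<gamma> :: "'a \<Rightarrow> 'a \<Rightarrow> complex"
  assumes nz: "\<And>x y. x \<in> carrier E \<Longrightarrow> y \<in> carrier E \<Longrightarrow> \<gamma> x y \<noteq> 0"
    and sym: "\<And>x y. x \<in> carrier E \<Longrightarrow> y \<in> carrier E \<Longrightarrow> \<gamma> x y = \<gamma> y x"
    and cocycle: "\<And>x y z. x \<in> carrier E \<Longrightarrow> y \<in> carrier E \<Longrightarrow> z \<in> carrier E \<Longrightarrow>
           \<gamma> x y * \<gamma> (x \<otimes> y) z = \<gamma> y z * \<gamma> x (y \<otimes> z)"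
begin

lemma twist_twist:
  assumes "x \<in> carrier E" "y \<in> carrier E" "u \<in> carrier E"
  shows "twist \<gamma> x (twist \<gamma> y v) u = \<gamma> x y * twist \<gamma> (x \<otimes> y) v u"
proof -
  have "\<gamma> x u * \<gamma> y (x \<otimes> u) = \<gamma> y x * \<gamma> (y \<otimes> x) u" using cocycle[of y x u] assms by simp
  then show ?thesis using assms sym[of x y]
    by (simp add: twist_def m_ac mult.assoc[symmetric])
qed

lemma twist_commute:
  assumes "x \<in> carrier E" "y \<in> carrier E" "u \<in> carrier E"
  shows "twist \<gamma> x (twist \<gamma> y v) u = twist \<gamma> y (twist \<gamma> x v) u"
  using twist_twist[OF assms] twist_twist[OF assms(2,1,3)] sym[OF assms(1,2)] assms by (simp add: m_comm)

lemma twist_cong: "x \<in> carrier E \<Longrightarrow> u \<in> carrier E \<Longrightarrow> (\<And>u. u \<in> carrier E \<Longrightarrow> v u = w u) \<Longrightarrow>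
    twist \<gamma> x v u = twist \<gamma> x w u"
  by (simp add: twist_def)

lemma twist_one: "u \<in> carrier E \<Longrightarrow> twist \<gamma> \<one> v u = \<gamma> \<one> \<one> * v u"
  using cocycle[of \<one> \<one> u] nz[of \<one> u] by (simp add: twist_def)

text \<open>As \<open>x\<close> has finite order, this makes a power of
  \<open>twist \<gamma> x\<close> a nonzero scalar. Eigenvectors can then be written down by a
  finite Fourier sum.\<close>

lemma twist_pow:
  assumes "x \<in> carrier E"
  shows "\<exists>c. c \<noteq> 0 \<and> (\<forall>v. \<forall>u\<in>carrier E. (twist \<gamma> x ^^ i) v u = c * twist \<gamma> (x [^] i) v u)"
proof (induction i)
  case 0
  then show ?case using nz[of \<one> \<one>] by (intro exI[of _ "1 / \<gamma> \<one> \<one>"]) (simp add: twist_one)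
next
  case (Suc i)
  then obtain c where c: "c \<noteq> 0" "\<And>v u. u \<in> carrier E \<Longrightarrow> (twist \<gamma> x ^^ i) v u = c * twist \<gamma> (x [^] i) v u"
    by auto
  have "(twist \<gamma> x ^^ Suc i) v u = c * \<gamma> x (x [^] i) * twist \<gamma> (x [^] Suc i) v u" if u: "u \<in> carrier E" for u v
  proof -
    have "(twist \<gamma> x ^^ Suc i) v u = twist \<gamma> x (\<lambda>u. c * twist \<gamma> (x [^] i) v u) u"
      using twist_cong[OF assms u, of "(twist \<gamma> x ^^ i) v" "\<lambda>u. c * twist \<gamma> (x [^] i) v u"] c(2) by simp
    also have "\<dots> = c * twist \<gamma> x (twist \<gamma> (x [^] i) v) u" by (simp add: twist_def)
    also have "\<dots> = c * (\<gamma> x (x [^] i) * twist \<gamma> (x \<otimes> x [^] i) v u)"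
      using assms u by (simp add: twist_twist)
    also have "x \<otimes> x [^] i = x [^] Suc i" using assms by (simp add: m_comm)
    finally show ?thesis by (simp add: mult.assoc)
  qed
  then show ?case using c(1) nz[of x "x [^] i"] assms by (intro exI[of _ "c * \<gamma> x (x [^] i)"]) simp
qed

lemma twist_pow_sum_shift:
  "twist \<gamma> x (\<lambda>u. \<Sum>i<k. a i * (twist \<gamma> x ^^ i) v u) u = (\<Sum>i<k. a i * (twist \<gamma> x ^^ Suc i) v u)"
  by (simp add: twist_def sum_distrib_left algebra_simps)

text \<open>Let \<open>T = twist \<gamma> x\<close> with \<open>T ^^ k\<close> a scalar
  \<open>d\<close>. Each \<open>k\<close>-th root \<open>a\<close> of \<open>d\<close> gives the sum
  of \<open>(1 / a) ^ i * T^i v\<close>, which is zero or an eigenvector for \<open>a\<close>; over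
  all roots these add up to \<open>k * v\<close>, so one of them is nonzero. Its form as a
  combination of the \<open>T^i v\<close> lets every operator commuting with \<open>T\<close> keep
  the eigenvalue that it had on \<open>v\<close>.\<close>

lemma eigenvector_step:
  assumes x: "x \<in> carrier E" and v: "\<exists>u\<in>carrier E. v u \<noteq> 0"
  shows "\<exists>a c. (\<exists>u\<in>carrier E. (\<Sum>i<card (carrier E). a i * (twist \<gamma> x ^^ i) v u) \<noteq> 0) \<and>
    (\<forall>u\<in>carrier E. twist \<gamma> x (\<lambda>u. \<Sum>i<card (carrier E). a i * (twist \<gamma> x ^^ i) v u) u =
        c * (\<Sum>i<card (carrier E). a i * (twist \<gamma> x ^^ i) v u))"
proof -
  define k where "k = card (carrier E)"
  have k: "k > 0" using card_E_pos by (simp add: k_def)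
  obtain d where d: "d \<noteq> 0" "\<And>v u. u \<in> carrier E \<Longrightarrow> (twist \<gamma> x ^^ k) v u = d * v u"
  proof -
    obtain c where c: "c \<noteq> 0" "\<And>v u. u \<in> carrier E \<Longrightarrow> (twist \<gamma> x ^^ k) v u = c * twist \<gamma> (x [^] k) v u"
      using twist_pow[OF x] by blast
    show thesis
      by (rule that[of "c * \<gamma> \<one> \<one>"]) (use c nz[of \<one> \<one>] pow_card[OF x] in \<open>simp_all add: k_def twist_one\<close>)
  qed
  \<comment> \<open>One \<open>k\<close>-th root of \<open>d\<close>; with the primitive root of
    unity \<open>\<zeta>\<close> the numbers \<open>w * \<zeta> ^ j\<close> run through all of
    them.\<close>
  define w where "w = rcis (root k (cmod d)) (Arg d / real k)"
  have w: "w ^ k = d" using k by (simp add: w_def DeMoivre2 rcis_cmod_Arg)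
  have w0: "w \<noteq> 0" using w d(1) k by (auto simp: power_0_left)
  define \<zeta> where "\<zeta> = cis (2 * pi / real k)"
  have \<zeta>k: "\<zeta> ^ k = 1" using k by (simp add: \<zeta>_def DeMoivre)
  have \<zeta>0: "\<zeta> \<noteq> 0" by (simp add: \<zeta>_def)
  have \<zeta>i: "\<zeta> ^ i \<noteq> 1" if "0 < i" "i < k" for i
  proof
    assume "\<zeta> ^ i = 1"
    then have "cos (2 * pi * (real i / real k)) = 1"
      by (simp add: \<zeta>_def DeMoivre complex_eq_iff algebra_simps)
    then obtain m :: int where "2 * pi * (real i / real k) = real_of_int m * 2 * pi" using iffD1[OF cos_one_2pi_int] by blast
    then have "2 * pi * (real i / real k) = 2 * pi * real_of_int m" by simp
    then have "real i / real k = real_of_int m" using pi_neq_zero by (simp only: mult_cancel_left) simp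
    then have "real i = real_of_int m * real k" using k by (simp add: field_simps)
    then have "int i = m * int k" by (metis of_int_eq_iff of_int_mult of_int_of_nat_eq)
    then have "int k dvd int i" by simp
    then show False using that by (metis dvd_imp_le int_dvd_int_iff not_le)
  qed
  define V where "V j u = (\<Sum>i<k. (1 / (w * \<zeta> ^ j)) ^ i * (twist \<gamma> x ^^ i) v u)" for j u
  have eig: "twist \<gamma> x (V j) u = (w * \<zeta> ^ j) * V j u" if u: "u \<in> carrier E" for j u
  proof -
    define a where "a = w * \<zeta> ^ j"
    have a: "a \<noteq> 0" "a ^ k = d" using w0 \<zeta>0 w \<zeta>k
      by (auto simp: a_def power_mult_distrib) (metis mult.commute power_mult power_one)
    obtain l where l: "k = Suc l" using k by (cases k) auto
    define t where "t i = (twist \<gamma> x ^^ i) v u" for i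
    have tk: "t k = d * t 0" using d(2)[OF u, of v] by (simp add: t_def)
    have "twist \<gamma> x (V j) u = (\<Sum>i<k. (1 / a) ^ i * t (Suc i))"
      unfolding V_def t_def a_def by (rule twist_pow_sum_shift)
    also have "\<dots> = (\<Sum>i<k. a * ((1 / a) ^ Suc i * t (Suc i)))" using a by simp
    also have "\<dots> = a * (\<Sum>i<k. (1 / a) ^ Suc i * t (Suc i))" by (simp add: sum_distrib_left)
    also have "(\<Sum>i<k. (1 / a) ^ Suc i * t (Suc i)) = (\<Sum>i<k. (1 / a) ^ i * t i)"
    proof -
      have "(\<Sum>i<k. (1 / a) ^ Suc i * t (Suc i)) + (1 / a) ^ 0 * t 0 = (\<Sum>i<Suc k. (1 / a) ^ i * t i)"
        by (subst sum.lessThan_Suc_shift) simp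
      also have "\<dots> = (\<Sum>i<k. (1 / a) ^ i * t i) + (1 / a) ^ k * t k" by simp
      also have "(1 / a) ^ k * t k = t 0" using a d(1) by (simp add: tk power_one_over)
      finally show ?thesis by simp
    qed
    also have "(\<Sum>i<k. (1 / a) ^ i * t i) = V j u" by (simp add: V_def t_def a_def)
    finally show ?thesis by (simp add: a_def)
  qed
  have total: "(\<Sum>j<k. V j u) = of_nat k * v u" for u
  proof -
    have "(\<Sum>j<k. V j u) = (\<Sum>i<k. (\<Sum>j<k. (1 / (w * \<zeta> ^ j)) ^ i) * (twist \<gamma> x ^^ i) v u)"
      unfolding V_def by (subst sum.swap) (simp add: sum_distrib_right)
    also have "\<dots> = (\<Sum>i<k. if i = 0 then of_nat k * v u else 0)"
    proof (rule sum.cong)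
      fix i assume i: "i \<in> {..<k}"
      show "(\<Sum>j<k. (1 / (w * \<zeta> ^ j)) ^ i) * (twist \<gamma> x ^^ i) v u = (if i = 0 then of_nat k * v u else 0)"
      proof (cases "i = 0")
        case False
        define q where "q = (1 / \<zeta>) ^ i"
        have "q \<noteq> 1" using \<zeta>i[of i] False i by (auto simp: q_def power_one_over)
        moreover have "q ^ k = 1" 
        proof -
          have "q ^ k = ((1 / \<zeta>) ^ k) ^ i" unfolding q_def by (metis mult.commute power_mult)
          then show ?thesis using \<zeta>k by (simp add: power_one_over)
        qed
        moreover have "(\<Sum>j<k. (1 / (w * \<zeta> ^ j)) ^ i) = (\<Sum>j<k. (1 / w) ^ i * q ^ j)"
        proof (rule sum.cong)
          fix j
          have "1 / (w * \<zeta> ^ j) = 1 / w * (1 / \<zeta>) ^ j" by (simp add: power_one_over)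
          moreover have "((1 / \<zeta>) ^ j) ^ i = ((1 / \<zeta>) ^ i) ^ j" by (metis mult.commute power_mult)
          ultimately show "(1 / (w * \<zeta> ^ j)) ^ i = (1 / w) ^ i * q ^ j"
            unfolding q_def by (simp only: power_mult_distrib)
        qed simp
        ultimately have "(\<Sum>j<k. (1 / (w * \<zeta> ^ j)) ^ i) = 0"
          by (simp add: geometric_sum flip: sum_distrib_left)
        then show ?thesis using False by simp
      qed simp
    qed simp
    also have "\<dots> = of_nat k * v u" using k by (simp add: sum.delta)
    finally show ?thesis .
  qed
  obtain u where u: "u \<in> carrier E" "v u \<noteq> 0" using v by blast
  have "(\<Sum>j<k. V j u) \<noteq> 0" using total[of u] u k by simp
  then obtain j where "V j u \<noteq> 0" by (meson sum.not_neutral_contains_not_neutral)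
  then show ?thesis using eig[of _ j] u unfolding V_def k_def by blast
qed

text \<open>Induction over \<open>X\<close>, each operator being applied to the vector reached so
  far. The final clause says that eigenvalues of the initial vector survive; it makes it possible to
  prescribe one eigenvalue in advance.\<close>

lemma joint_eigenvector:
  assumes "finite X" "X \<subseteq> carrier E" "\<exists>u\<in>carrier E. v u \<noteq> 0"
  shows "\<exists>w. (\<exists>u\<in>carrier E. w u \<noteq> 0) \<and> (\<forall>x\<in>X. \<exists>c. \<forall>u\<in>carrier E. twist \<gamma> x w u = c * w u) \<and>
    (\<forall>y\<in>carrier E. \<forall>c. (\<forall>u\<in>carrier E. twist \<gamma> y v u = c * v u) \<longrightarrow> (\<forall>u\<in>carrier E. twist \<gamma> y w u = c * w u))"
  using assms(1,2)
proof (induction X)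
  case empty
  then show ?case using assms(3) by (intro exI[of _ v]) auto
next
  case (insert x X)
  then obtain w where w: "\<exists>u\<in>carrier E. w u \<noteq> 0" "\<forall>x\<in>X. \<exists>c. \<forall>u\<in>carrier E. twist \<gamma> x w u = c * w u"
    and w': "\<forall>y\<in>carrier E. \<forall>c. (\<forall>u\<in>carrier E. twist \<gamma> y v u = c * v u) \<longrightarrow> (\<forall>u\<in>carrier E. twist \<gamma> y w u = c * w u)"
    by auto
  have x: "x \<in> carrier E" using insert by simp
  from eigenvector_step[OF x w(1)] obtain a c where
    ac: "\<exists>u\<in>carrier E. (\<Sum>i<card (carrier E). a i * (twist \<gamma> x ^^ i) w u) \<noteq> 0"
      "\<forall>u\<in>carrier E. twist \<gamma> x (\<lambda>u. \<Sum>i<card (carrier E). a i * (twist \<gamma> x ^^ i) w u) u =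
        c * (\<Sum>i<card (carrier E). a i * (twist \<gamma> x ^^ i) w u)" by blast
  define w1 where "w1 u = (\<Sum>i<card (carrier E). a i * (twist \<gamma> x ^^ i) w u)" for u
  have keep: "\<forall>u\<in>carrier E. twist \<gamma> y w1 u = c * w1 u"
    if y: "y \<in> carrier E" and e: "\<forall>u\<in>carrier E. twist \<gamma> y w u = c * w u" for y c
  proof -
    have "\<forall>u\<in>carrier E. twist \<gamma> y ((twist \<gamma> x ^^ i) w) u = c * (twist \<gamma> x ^^ i) w u" for i
    proof (induction i)
      case (Suc i)
      show ?case
      proof
        fix u assume u: "u \<in> carrier E"
        have "twist \<gamma> y ((twist \<gamma> x ^^ Suc i) w) u = twist \<gamma> x (twist \<gamma> y ((twist \<gamma> x ^^ i) w)) u"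
          using twist_commute[OF y x u] by simp
        also have "\<dots> = twist \<gamma> x (\<lambda>u. c * (twist \<gamma> x ^^ i) w u) u"
          using Suc by (intro twist_cong[OF x u]) auto
        finally show "twist \<gamma> y ((twist \<gamma> x ^^ Suc i) w) u = c * (twist \<gamma> x ^^ Suc i) w u"
          by (simp add: twist_def)
      qed
    qed (use e in simp)
    then have *: "\<gamma> y u * (twist \<gamma> x ^^ i) w (y \<otimes> u) = c * (twist \<gamma> x ^^ i) w u" if "u \<in> carrier E" for i u
      using that by (simp add: twist_def)
    show ?thesis
    proof
      fix u assume u: "u \<in> carrier E"
      have "twist \<gamma> y w1 u = (\<Sum>i<card (carrier E). a i * (\<gamma> y u * (twist \<gamma> x ^^ i) w (y \<otimes> u)))"
        by (simp add: twist_def w1_def sum_distrib_left mult.left_commute)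
      then show "twist \<gamma> y w1 u = c * w1 u" unfolding *[OF u] by (simp add: w1_def sum_distrib_left mult.left_commute)
    qed
  qed
  have 1: "\<exists>c. \<forall>u\<in>carrier E. twist \<gamma> x w1 u = c * w1 u"
    using ac(2) unfolding w1_def[abs_def] by blast
  have 2: "\<exists>u\<in>carrier E. w1 u \<noteq> 0" using ac(1) by (simp add: w1_def)
  have 3: "\<forall>x\<in>insert x X. \<exists>c. \<forall>u\<in>carrier E. twist \<gamma> x w1 u = c * w1 u"
  proof
    fix y assume "y \<in> insert x X"
    then consider "y = x" | "y \<in> X" by blast
    then show "\<exists>c. \<forall>u\<in>carrier E. twist \<gamma> y w1 u = c * w1 u"
    proof cases
      case 1
      then show ?thesis using \<open>\<exists>c. \<forall>u\<in>carrier E. twist \<gamma> x w1 u = c * w1 u\<close> by simp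
    next
      case y: 2
    then obtain c where "\<forall>u\<in>carrier E. twist \<gamma> y w u = c * w u" using w(2) by blast
    then show ?thesis using keep[of y c] y insert.prems by blast
    qed
  qed
  have 4: "\<forall>y\<in>carrier E. \<forall>c. (\<forall>u\<in>carrier E. twist \<gamma> y v u = c * v u) \<longrightarrow>
      (\<forall>u\<in>carrier E. twist \<gamma> y w1 u = c * w1 u)"
  proof (intro ballI allI impI)
    fix y c u
    assume y: "y \<in> carrier E" and e: "\<forall>u\<in>carrier E. twist \<gamma> y v u = c * v u" and u: "u \<in> carrier E"
    have "\<forall>u\<in>carrier E. twist \<gamma> y w u = c * w u" using w' y e by blast
    from keep[OF y this] u show "twist \<gamma> y w1 u = c * w1 u" ..
  qed
  show ?case by (rule exI[of _ w1], intro conjI, rule 2, rule 3, rule 4)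
qed

text \<open>\<open>f x\<close> is the eigenvalue of \<open>twist \<gamma> x\<close> on a joint
  eigenvector, so \<open>twist_twist\<close> becomes the splitting relation. No \<open>f x\<close>
  vanishes, because \<open>f x * f (inv x)\<close> is a nonzero multiple of \<open>f \<one>\<close>,
  which is \<open>\<gamma> \<one> \<one>\<close>.\<close>

lemma splitting_with_eigenvalue:
  assumes v: "\<exists>u\<in>carrier E. v u \<noteq> 0" and y: "y \<in> carrier E"
    and e: "\<And>u. u \<in> carrier E \<Longrightarrow> twist \<gamma> y v u = c * v u"
  shows "\<exists>f. (\<forall>x\<in>carrier E. f x \<noteq> 0) \<and> f y = c \<and>
     (\<forall>x\<in>carrier E. \<forall>z\<in>carrier E. f x * f z = \<gamma> x z * f (x \<otimes> z))"
proof -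
  from joint_eigenvector[OF finite_E order_refl v] obtain w where
    w12: "\<exists>u\<in>carrier E. w u \<noteq> 0" "\<forall>x\<in>carrier E. \<exists>c. \<forall>u\<in>carrier E. twist \<gamma> x w u = c * w u"
    and w3: "\<forall>y\<in>carrier E. \<forall>c. (\<forall>u\<in>carrier E. twist \<gamma> y v u = c * v u) \<longrightarrow> (\<forall>u\<in>carrier E. twist \<gamma> y w u = c * w u)"
    by (elim exE conjE)
  have "\<forall>u\<in>carrier E. twist \<gamma> y w u = c * w u" using w3[rule_format, OF y] e by blast
  note w = w12 this
  obtain f where f: "\<And>x u. x \<in> carrier E \<Longrightarrow> u \<in> carrier E \<Longrightarrow> twist \<gamma> x w u = f x * w u"
  proof -
    from bchoice[OF w(2)] obtain f where "\<forall>x\<in>carrier E. \<forall>u\<in>carrier E. twist \<gamma> x w u = f x * w u" ..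
    then show thesis using that by blast
  qed
  obtain u where u: "u \<in> carrier E" "w u \<noteq> 0" using w(1) by blast
  have ff: "f x * f z = \<gamma> x z * f (x \<otimes> z)" if "x \<in> carrier E" "z \<in> carrier E" for x z
  proof -
    have "\<gamma> x z * twist \<gamma> (x \<otimes> z) w u = twist \<gamma> x (twist \<gamma> z w) u" using twist_twist[OF that u(1)] by simp
    also have "\<dots> = twist \<gamma> x (\<lambda>u. f z * w u) u" using that u f by (intro twist_cong) auto
    also have "\<dots> = f z * twist \<gamma> x w u" by (simp add: twist_def)
    finally show ?thesis using f that u by simp
  qed
  have "f \<one> = \<gamma> \<one> \<one>" using twist_one[OF u(1), of w] f[of \<one> u] u by simp
  then have f1: "f \<one> \<noteq> 0" using nz[of \<one> \<one>] by simp
  have "f x \<noteq> 0" if x: "x \<in> carrier E" for x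
  proof -
    have "f x * f (inv x) = \<gamma> x (inv x) * f \<one>" using ff[of x "inv x"] x by (simp add: r_inv)
    moreover have "\<gamma> x (inv x) * f \<one> \<noteq> 0" using nz[of x "inv x"] f1 x by simp
    ultimately show ?thesis by (metis mult_zero_left)
  qed
  moreover have "f y = c" using f[OF y u(1)] w(3) u by simp
  ultimately show ?thesis using ff by (intro exI[of _ f] conjI ballI)
qed

lemma symmetric_cocycle_splits:
  "\<exists>f. (\<forall>x\<in>carrier E. f x \<noteq> 0) \<and> (\<forall>x\<in>carrier E. \<forall>z\<in>carrier E. f x * f z = \<gamma> x z * f (x \<otimes> z))"
proof -
  have "\<exists>u\<in>carrier E. (1 :: complex) \<noteq> 0" using one_closed by auto
  then have "\<exists>f. (\<forall>x\<in>carrier E. f x \<noteq> 0) \<and> f \<one> = \<gamma> \<one> \<one> \<and>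
     (\<forall>x\<in>carrier E. \<forall>z\<in>carrier E. f x * f z = \<gamma> x z * f (x \<otimes> z))"
    by (rule splitting_with_eigenvalue[OF _ one_closed twist_one])
  then show ?thesis by (elim exE conjE) (intro exI conjI)
qed

end

text \<open>For the constant cocycle a splitting function is a linear character whose value at
  \<open>x\<close> is an eigenvalue of translation by \<open>x\<close>. So it suffices to produce an
  eigenvalue other than 1.\<close>

lemma characters_separate:
  assumes x: "x \<in> carrier E" "x \<noteq> \<one>"
  shows "\<exists>f :: 'a \<Rightarrow> complex. (\<forall>x\<in>carrier E. f x \<noteq> 0) \<and> f x \<noteq> 1 \<and>
     (\<forall>x\<in>carrier E. \<forall>z\<in>carrier E. f x * f z = f (x \<otimes> z))"
proof -
  define \<gamma> :: "'a \<Rightarrow> 'a \<Rightarrow> complex" where "\<gamma> = (\<lambda>_ _. 1)"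
  have \<gamma>: "\<And>x y. \<gamma> x y = 1" by (simp add: \<gamma>_def)
  define k where "k = card (carrier E)"
  have k: "k > 0" using card_E_pos by (simp add: k_def)
  \<comment> \<open>A difference of two point masses, chosen so that its sum along every orbit of
    translation by \<open>x\<close> telescopes to 0. An eigenvector derived from it for the
    eigenvalue 1 would be constant along these orbits and hence zero.\<close>
  define v :: "'a \<Rightarrow> complex" where "v u = (if u = \<one> then 1 else 0) - (if x \<otimes> u = \<one> then 1 else 0)" for u
  have tw: "(twist \<gamma> x ^^ i) g u = g (x [^] i \<otimes> u)" if "u \<in> carrier E" for i g u
    using that by (induction i arbitrary: u) (simp_all add: twist_def \<gamma> x m_ac)
  have sum0: "(\<Sum>i<k. v (x [^] i \<otimes> u)) = 0" if u: "u \<in> carrier E" for u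
  proof -
    define b :: "nat \<Rightarrow> complex" where "b i = (if x [^] i \<otimes> u = \<one> then 1 else 0)" for i
    have "v (x [^] i \<otimes> u) = b i - b (Suc i)" for i
      using x u by (simp add: v_def b_def m_ac)
    then have "(\<Sum>i<k. v (x [^] i \<otimes> u)) = b 0 - b k" by (simp add: sum_lessThan_telescope')
    also have "b k = b 0" using pow_card x by (simp add: b_def k_def)
    finally show ?thesis by simp
  qed
  have "v \<one> \<noteq> 0" using x by (simp add: v_def)
  then have "\<exists>u\<in>carrier E. v u \<noteq> 0" by blast
  have "\<exists>a c. (\<exists>u\<in>carrier E. (\<Sum>i<card (carrier E). a i * (twist \<gamma> x ^^ i) v u) \<noteq> 0) \<and>
    (\<forall>u\<in>carrier E. twist \<gamma> x (\<lambda>u. \<Sum>i<card (carrier E). a i * (twist \<gamma> x ^^ i) v u) u =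
        c * (\<Sum>i<card (carrier E). a i * (twist \<gamma> x ^^ i) v u))"
    by (rule eigenvector_step) (simp_all add: \<gamma> x \<open>\<exists>u\<in>carrier E. v u \<noteq> 0\<close>)
  then obtain a c where
    ac: "\<exists>u\<in>carrier E. (\<Sum>i<k. a i * (twist \<gamma> x ^^ i) v u) \<noteq> 0"
      "\<forall>u\<in>carrier E. twist \<gamma> x (\<lambda>u. \<Sum>i<k. a i * (twist \<gamma> x ^^ i) v u) u =
        c * (\<Sum>i<k. a i * (twist \<gamma> x ^^ i) v u)" unfolding k_def by (elim exE conjE)
  define w where "w u = (\<Sum>i<k. a i * (twist \<gamma> x ^^ i) v u)" for u
  have w: "\<exists>u\<in>carrier E. w u \<noteq> 0" "\<And>u. u \<in> carrier E \<Longrightarrow> twist \<gamma> x w u = c * w u"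
    using ac unfolding w_def[abs_def] by auto
  have "c \<noteq> 1"
  proof
    assume c: "c = 1"
    have inv: "w (x [^] l \<otimes> u) = w u" if "u \<in> carrier E" for l :: nat and u
    proof (induction l)
      case (Suc l)
      have "w (x \<otimes> (x [^] l \<otimes> u)) = w (x [^] l \<otimes> u)"
        using w(2)[of "x [^] l \<otimes> u"] that x c by (simp add: twist_def \<gamma>)
      moreover have "x [^] Suc l \<otimes> u = x \<otimes> (x [^] l \<otimes> u)" using x that by (simp add: m_ac)
      ultimately show ?case using Suc by simp
    qed (use that in simp)
    obtain u where u: "u \<in> carrier E" "w u \<noteq> 0" using w(1) by blast
    have "of_nat k * w u = (\<Sum>l<k. w (x [^] l \<otimes> u))" using inv[OF u(1)] by simp
    also have "\<dots> = (\<Sum>l<k. \<Sum>i<k. a i * v (x [^] i \<otimes> (x [^] l \<otimes> u)))"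
      using u x by (simp add: w_def tw)
    also have "\<dots> = (\<Sum>i<k. a i * (\<Sum>l<k. v (x [^] l \<otimes> (x [^] i \<otimes> u))))"
      using u x by (subst sum.swap) (simp add: sum_distrib_left m_ac)
    also have "\<dots> = 0" using sum0 u x by simp
    finally show False using u k by simp
  qed
  have "\<exists>f. (\<forall>x\<in>carrier E. f x \<noteq> 0) \<and> f x = c \<and>
     (\<forall>x\<in>carrier E. \<forall>z\<in>carrier E. f x * f z = \<gamma> x z * f (x \<otimes> z))"
    by (rule splitting_with_eigenvalue[where v = w, OF _ _ _ w(1) x(1) w(2)]) (simp_all add: \<gamma>)
  then obtain f where f: "\<forall>x\<in>carrier E. f x \<noteq> 0" "f x = c"
     "\<forall>x\<in>carrier E. \<forall>z\<in>carrier E. f x * f z = \<gamma> x z * f (x \<otimes> z)" by (elim exE conjE)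
  show ?thesis
    by (intro exI[of _ f] conjI) (use f \<open>c \<noteq> 1\<close> in \<open>simp_all add: \<gamma>\<close>)
qed

lemma sum_hom_zero:
  assumes "\<And>x z. x \<in> carrier E \<Longrightarrow> z \<in> carrier E \<Longrightarrow> f (x \<otimes> z) = f x * (f z :: complex)"
    "y \<in> carrier E" "f y \<noteq> 1"
  shows "(\<Sum>x\<in>carrier E. f x) = 0"
proof -
  have "(\<Sum>x\<in>carrier E. f x) = (\<Sum>x\<in>carrier E. f (y \<otimes> x))"
    using inj_on_cmult[OF assms(2)] surj_const_mult[OF assms(2)]
    by (intro sum.reindex_bij_betw[symmetric]) (simp add: bij_betw_def)
  also have "\<dots> = f y * (\<Sum>x\<in>carrier E. f x)" by (simp add: assms sum_distrib_left)
  finally show ?thesis using assms(3) by simp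
qed

lemma hom_pow:
  assumes "\<And>x z. x \<in> carrier E \<Longrightarrow> z \<in> carrier E \<Longrightarrow> f (x \<otimes> z) = f x * (f z :: complex)" "f \<one> = 1" "x \<in> carrier E"
  shows "f (x [^] (i::nat)) = f x ^ i"
  by (induction i) (simp_all add: assms mult.commute)

text \<open>In odd order the commutator form \<open>\<alpha>(x, y) / \<alpha>(y, x)\<close> of a cocycle has an alternating square root
  \<open>\<beta>\<close>, and \<open>\<alpha> / \<beta>\<close> is symmetric, hence splits.\<close>

lemma cocycle_normal_form:
  assumes odd: "odd (card (carrier E))"
    and nz: "\<And>x y. x \<in> carrier E \<Longrightarrow> y \<in> carrier E \<Longrightarrow> \<alpha> x y \<noteq> (0 :: complex)"
    and cocycle: "\<And>x y z. x \<in> carrier E \<Longrightarrow> y \<in> carrier E \<Longrightarrow> z \<in> carrier E \<Longrightarrow>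
           \<alpha> x y * \<alpha> (x \<otimes> y) z = \<alpha> y z * \<alpha> x (y \<otimes> z)"
  shows "\<exists>\<beta> g. (\<forall>x\<in>carrier E. g x \<noteq> 0) \<and>
     (\<forall>x\<in>carrier E. \<forall>y\<in>carrier E. g x * g y * \<alpha> x y = \<beta> x y * g (x \<otimes> y)) \<and>
     (\<forall>x\<in>carrier E. \<forall>y\<in>carrier E. \<forall>z\<in>carrier E. \<beta> (x \<otimes> y) z = \<beta> x z * \<beta> y z) \<and>
     (\<forall>x\<in>carrier E. \<forall>y\<in>carrier E. \<beta> x y * \<beta> y x = 1) \<and> (\<forall>x\<in>carrier E. \<beta> x x = 1)"
proof -
  define N where "N = card (carrier E)"
  define \<omega> where "\<omega> x y = \<alpha> x y / \<alpha> y x" for x y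
  have mult: "\<omega> (x \<otimes> y) z = \<omega> x z * \<omega> y z" if "x \<in> carrier E" "y \<in> carrier E" "z \<in> carrier E" for x y z
  proof -
    \<comment> \<open>The cocycle identity for the orders \<open>(x, y, z)\<close>,
      \<open>(z, x, y)\<close> and \<open>(x, z, y)\<close>; substituted into the quotient
      \<open>\<omega>\<close> they make it multiplicative in the first argument.\<close>
    have 1: "\<alpha> (x \<otimes> y) z = \<alpha> y z * \<alpha> x (y \<otimes> z) / \<alpha> x y"
      using cocycle[OF that] nz that by (simp add: field_simps)
    have 2: "\<alpha> z (x \<otimes> y) = \<alpha> z x * \<alpha> (z \<otimes> x) y / \<alpha> x y"
      using cocycle[OF that(3,1,2)] nz that by (simp add: field_simps)
    have 3: "\<alpha> x (y \<otimes> z) = \<alpha> x z * \<alpha> (z \<otimes> x) y / \<alpha> z y"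
      using cocycle[OF that(1,3,2)] nz that by (simp add: field_simps m_comm)
    show ?thesis unfolding \<omega>_def 1 2 3 using nz that by (simp add: field_simps)
  qed
  have anti: "\<omega> x y * \<omega> y x = 1" if "x \<in> carrier E" "y \<in> carrier E" for x y
    using nz that by (simp add: \<omega>_def)
  have one: "\<omega> \<one> y = 1" if "y \<in> carrier E" for y
  proof -
    have "\<omega> \<one> y \<noteq> 0" using that nz[of \<one> y] nz[of y \<one>] by (simp add: \<omega>_def)
    then show ?thesis using mult[of \<one> \<one> y] that by simp
  qed
  have wN: "\<omega> x y ^ N = 1" if "x \<in> carrier E" "y \<in> carrier E" for x y
    using hom_pow[of "\<lambda>x. \<omega> x y" x N] mult one that pow_card by (simp add: N_def)
  \<comment> \<open>The values of \<open>\<omega>\<close> are \<open>N\<close>-th roots of unity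
    with \<open>N\<close> odd, so this exponent takes their square roots inside the same group.
    Being a power, \<open>\<beta>\<close> inherits multiplicativity and antisymmetry.\<close>
  define \<beta> where "\<beta> x y = \<omega> x y ^ ((N + 1) div 2)" for x y
  have b2: "\<beta> x y ^ 2 = \<omega> x y" if "x \<in> carrier E" "y \<in> carrier E" for x y
  proof -
    have "(N + 1) div 2 * 2 = N + 1" using odd by (intro dvd_div_mult_self) (simp add: N_def)
    then have "\<beta> x y ^ 2 = \<omega> x y ^ (N + 1)" unfolding \<beta>_def by (metis power_mult)
    then show ?thesis using wN[OF that] by simp
  qed
  have bm: "\<beta> (x \<otimes> y) z = \<beta> x z * \<beta> y z" if "x \<in> carrier E" "y \<in> carrier E" "z \<in> carrier E" for x y z
    using mult[OF that] by (simp add: \<beta>_def power_mult_distrib)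
  have ba: "\<beta> x y * \<beta> y x = 1" if "x \<in> carrier E" "y \<in> carrier E" for x y
    using anti[OF that] by (simp add: \<beta>_def flip: power_mult_distrib)
  have b0: "\<beta> x y \<noteq> 0" if "x \<in> carrier E" "y \<in> carrier E" for x y using ba[OF that] by auto
  have bm': "\<beta> z (x \<otimes> y) = \<beta> z x * \<beta> z y" if "x \<in> carrier E" "y \<in> carrier E" "z \<in> carrier E" for x y z
  proof -
    have "\<beta> z (x \<otimes> y) = 1 / \<beta> (x \<otimes> y) z" "\<beta> z x = 1 / \<beta> x z" "\<beta> z y = 1 / \<beta> y z"
      using ba[of z "x \<otimes> y"] ba[of z x] ba[of z y] b0 that by (simp_all add: field_simps)
    then show ?thesis using bm that by simp
  qed
  \<comment> \<open>Since \<open>\<alpha> x y = \<beta> x y ^ 2 * \<alpha> y x\<close>, dividing by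
    \<open>\<beta> x y\<close> leaves \<open>\<beta> x y * \<alpha> y x\<close>, which is
    \<open>\<gamma> y x\<close> by antisymmetry of \<open>\<beta>\<close>. So this quotient is a
    symmetric cocycle.\<close>
  define \<gamma> where "\<gamma> x y = \<alpha> x y / \<beta> x y" for x y
  have "\<exists>f. (\<forall>x\<in>carrier E. f x \<noteq> 0) \<and> (\<forall>x\<in>carrier E. \<forall>z\<in>carrier E. f x * f z = \<gamma> x z * f (x \<otimes> z))"
  proof (rule symmetric_cocycle_splits)
    fix x y assume xy: "x \<in> carrier E" "y \<in> carrier E"
    show "\<gamma> x y \<noteq> 0" using nz b0 xy by (simp add: \<gamma>_def)
    have 1: "\<alpha> x y = \<beta> x y ^ 2 * \<alpha> y x" using b2[OF xy] nz xy by (simp add: \<omega>_def)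
    have "\<gamma> x y = \<beta> x y * \<alpha> y x"
      unfolding \<gamma>_def 1 using b0[OF xy] by (simp add: power2_eq_square)
    moreover have "\<beta> y x = 1 / \<beta> x y" using ba[OF xy] b0[OF xy] by (simp add: field_simps)
    then have "\<gamma> y x = \<beta> x y * \<alpha> y x" by (simp add: \<gamma>_def)
    ultimately show "\<gamma> x y = \<gamma> y x" by simp
  next
    fix x y z assume xyz: "x \<in> carrier E" "y \<in> carrier E" "z \<in> carrier E"
    show "\<gamma> x y * \<gamma> (x \<otimes> y) z = \<gamma> y z * \<gamma> x (y \<otimes> z)"
      using cocycle[OF xyz] xyz by (simp add: \<gamma>_def bm[OF xyz] bm'[of y z x] mult.commute mult.left_commute)
  qed
  then obtain f where f: "\<And>x. x \<in> carrier E \<Longrightarrow> f x \<noteq> 0"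
    "\<And>x z. x \<in> carrier E \<Longrightarrow> z \<in> carrier E \<Longrightarrow> f x * f z = \<gamma> x z * f (x \<otimes> z)" by blast
  have "1 / f x * (1 / f y) * \<alpha> x y = \<beta> x y * (1 / f (x \<otimes> y))" if "x \<in> carrier E" "y \<in> carrier E" for x y
  proof -
    have "f x * f y * \<beta> x y = \<alpha> x y * f (x \<otimes> y)"
      unfolding f(2)[OF that] using b0[OF that] by (simp add: \<gamma>_def)
    then have "\<alpha> x y / (f x * f y) = \<beta> x y / f (x \<otimes> y)"
      using f(1) that by (subst frac_eq_eq) (simp_all add: mult.commute)
    then show ?thesis by simp
  qed
  note A = this
  have B: "\<beta> x x = 1" if "x \<in> carrier E" for x
    using nz[OF that that] by (simp add: \<beta>_def \<omega>_def)
  have C: "1 / f x \<noteq> 0" if "x \<in> carrier E" for x using f(1)[OF that] by simp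
  show ?thesis
    by (intro exI[of _ \<beta>] exI[of _ "\<lambda>x. 1 / f x"] conjI ballI A B C bm ba)
qed

end

section \<open>Roots of unity of order prime to a denominator\<close>

text \<open>The subring of the complex numbers generated by \<open>\<zeta>\<close> and
  \<open>1 / N\<close>. The inductive form reduces congruences modulo \<open>q\<close> to the
  generators.\<close>

inductive_set adjoin :: "complex \<Rightarrow> nat \<Rightarrow> complex set" for \<zeta> :: complex and N :: nat where
  adjoin_gen: "\<zeta> \<in> adjoin \<zeta> N"
| adjoin_recip: "1 / of_nat N \<in> adjoin \<zeta> N"
| adjoin_one: "1 \<in> adjoin \<zeta> N"
| adjoin_uminus: "x \<in> adjoin \<zeta> N \<Longrightarrow> - x \<in> adjoin \<zeta> N"
| adjoin_add: "x \<in> adjoin \<zeta> N \<Longrightarrow> y \<in> adjoin \<zeta> N \<Longrightarrow> x + y \<in> adjoin \<zeta> N"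
| adjoin_mult: "x \<in> adjoin \<zeta> N \<Longrightarrow> y \<in> adjoin \<zeta> N \<Longrightarrow> x * y \<in> adjoin \<zeta> N"

lemma adjoin_zero: "0 \<in> adjoin \<zeta> N"
  using adjoin_add[OF adjoin_one adjoin_uminus[OF adjoin_one]] by simp

lemma adjoin_diff: "x \<in> adjoin \<zeta> N \<Longrightarrow> y \<in> adjoin \<zeta> N \<Longrightarrow> x - y \<in> adjoin \<zeta> N"
  using adjoin_add[OF _ adjoin_uminus, of x \<zeta> N y] by simp

lemma adjoin_power: "x \<in> adjoin \<zeta> N \<Longrightarrow> x ^ k \<in> adjoin \<zeta> N"
  by (induction k) (auto intro: adjoin.intros)

lemma adjoin_of_nat: "of_nat k \<in> adjoin \<zeta> N"
  by (induction k) (auto intro: adjoin.intros adjoin_zero)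

lemma adjoin_of_int: "of_int k \<in> adjoin \<zeta> N"
  by (cases k rule: int_cases2) (auto intro: adjoin.intros adjoin_of_nat)

lemma adjoin_sum: "(\<And>a. a \<in> A \<Longrightarrow> f a \<in> adjoin \<zeta> N) \<Longrightarrow> sum f A \<in> adjoin \<zeta> N"
  by (induction A rule: infinite_finite_induct) (auto intro: adjoin.intros adjoin_zero)

lemma adjoin_prod: "(\<And>a. a \<in> A \<Longrightarrow> f a \<in> adjoin \<zeta> N) \<Longrightarrow> prod f A \<in> adjoin \<zeta> N"
  by (induction A rule: infinite_finite_induct) (auto intro: adjoin.intros)

lemma adjoin_det:
  assumes "A \<in> carrier_mat n n" "\<And>i j. i < n \<Longrightarrow> j < n \<Longrightarrow> A $$ (i, j) \<in> adjoin \<zeta> N"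
  shows "det A \<in> adjoin \<zeta> N"
proof -
  have "p i < n" if "p permutes {0..<n}" "i < n" for p i
    using permutes_in_image[OF that(1), of i] that(2) by simp
  then show ?thesis using assms unfolding det_def
    by (auto intro!: adjoin_sum adjoin_prod adjoin_mult adjoin_of_int simp: sign_def)
qed

lemma root_of_unity_power_mod:
  fixes \<zeta> :: complex
  assumes "\<zeta> ^ m = 1"
  shows "\<zeta> ^ (k mod m) = \<zeta> ^ k"
proof -
  have "\<zeta> ^ k = \<zeta> ^ (m * (k div m) + k mod m)" by simp
  also have "\<dots> = (\<zeta> ^ m) ^ (k div m) * \<zeta> ^ (k mod m)" unfolding power_add power_mult ..
  finally show ?thesis using assms by simp
qed

text \<open>Multiplication by \<open>y\<close>, the value of \<open>p\<close> at
  \<open>\<zeta>\<close>, acts on the tuple of powers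
  \<open>1, \<zeta>, ..., \<zeta> ^ (m - 1)\<close> through an integer matrix, so \<open>y\<close>
  is a root of a monic integer polynomial.\<close>

lemma algebraic_int_poly_root_of_unity:
  fixes p :: "int poly" and \<zeta> :: complex
  assumes "\<zeta> ^ m = 1" "m > 0"
  shows "algebraic_int (poly (map_poly of_int p) \<zeta>)"
proof -
  define y where "y = poly (map_poly of_int p) \<zeta>"
  \<comment> \<open>Row \<open>i\<close> holds the coefficients of \<open>X ^ i * p\<close> after
    exponents are reduced modulo \<open>m\<close>.\<close>
  define A0 :: "int mat" where
    "A0 = mat m m (\<lambda>(i, j). \<Sum>k\<in>{k. k \<le> degree p \<and> (i + k) mod m = j}. poly.coeff p k)"
  define A :: "complex mat" where "A = map_mat of_int A0"
  define v where "v = vec m (\<lambda>i. \<zeta> ^ i)"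
  have A: "A \<in> carrier_mat m m" and A0: "A0 \<in> carrier_mat m m" and v: "v \<in> carrier_vec m"
    by (auto simp: A_def A0_def v_def)
  have mod: "\<zeta> ^ (k mod m) = \<zeta> ^ k" for k
    by (rule root_of_unity_power_mod) fact
  have "A *\<^sub>v v = y \<cdot>\<^sub>v v"
  proof (rule eq_vecI)
    fix i assume "i < dim_vec (y \<cdot>\<^sub>v v)"
    then have i: "i < m" using v by simp
    have "(A *\<^sub>v v) $ i = (\<Sum>j<m. A $$ (i, j) * \<zeta> ^ j)"
      using A v i by (simp add: scalar_prod_def v_def lessThan_atLeast0)
    also have "\<dots> = (\<Sum>j<m. \<Sum>k\<in>{k. k \<le> degree p \<and> (i + k) mod m = j}. of_int (poly.coeff p k) * \<zeta> ^ (i + k))"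
      using i by (intro sum.cong) (auto simp: A_def A0_def sum_distrib_right mod[of "i + _", symmetric])
    also have "\<dots> = (\<Sum>k\<le>degree p. of_int (poly.coeff p k) * \<zeta> ^ (i + k))"
    proof -
      have "(\<Sum>j<m. \<Sum>k\<in>{k \<in> {..degree p}. (i + k) mod m = j}. of_int (poly.coeff p k) * \<zeta> ^ (i + k))
         = (\<Sum>k\<in>{..degree p}. of_int (poly.coeff p k) * \<zeta> ^ (i + k))"
        by (rule sum.group) (use assms in auto)
      then show ?thesis by simp
    qed
    also have "\<dots> = y * \<zeta> ^ i"
      by (simp add: y_def poly_altdef sum_distrib_right sum_distrib_left power_add mult.left_commute mult.commute degree_map_poly coeff_map_poly)
    finally show "(A *\<^sub>v v) $ i = (y \<cdot>\<^sub>v v) $ i" using i by (simp add: v_def)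
  qed (use A v in auto)
  moreover have "v \<noteq> 0\<^sub>v m"
  proof
    assume "v = 0\<^sub>v m"
    then have "v $ 0 = 0" using assms by simp
    then show False using assms by (simp add: v_def)
  qed
  ultimately have "eigenvalue A y" unfolding eigenvalue_def eigenvector_def using A v by auto
  then have root: "poly (char_poly A) y = 0" using eigenvalue_root_char_poly[OF A] by simp
  interpret of_int_hom: inj_comm_ring_hom "of_int :: int \<Rightarrow> complex" by unfold_locales auto
  have "char_poly A = map_poly of_int (char_poly A0)"
    unfolding A_def by (rule of_int_hom.char_poly_hom[OF A0])
  then show ?thesis
    using root degree_monic_char_poly[OF A0] unfolding y_def[symmetric] algebraic_int_altdef_ipoly by auto
qed

lemma adjoin_poly:
  assumes "x \<in> adjoin \<zeta> N" "N > 0"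
  shows "\<exists>j (p :: int poly). x * of_nat N ^ j = poly (map_poly of_int p) \<zeta>"
  using assms(1)
proof induction
  case adjoin_gen
  show ?case by (intro exI[of _ 0] exI[of _ "[:0, 1:]"]) simp
next
  case adjoin_recip
  show ?case by (intro exI[of _ 1] exI[of _ "1"]) (use assms(2) in simp)
next
  case adjoin_one
  show ?case by (intro exI[of _ 0] exI[of _ "1"]) simp
next
  case (adjoin_uminus x)
  then obtain j p where "x * of_nat N ^ j = poly (map_poly of_int p) \<zeta>" by blast
  moreover have "map_poly of_int (- p) = - map_poly (of_int :: int \<Rightarrow> complex) p"
    by (rule poly_eqI) (simp add: coeff_map_poly)
  ultimately show ?case by (intro exI[of _ j] exI[of _ "- p"]) simp
next
  case (adjoin_add x y)
  then obtain j p k q where *: "x * of_nat N ^ j = poly (map_poly of_int p) \<zeta>" 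
      "y * of_nat N ^ k = poly (map_poly of_int q) \<zeta>" by blast
  have "map_poly of_int (smult (int N ^ k) p + smult (int N ^ j) q)
      = smult (of_nat N ^ k) (map_poly of_int p) + smult (of_nat N ^ j) (map_poly (of_int :: int \<Rightarrow> complex) q)"
    by (rule poly_eqI) (simp add: coeff_map_poly)
  then have "(x + y) * of_nat N ^ (j + k) = poly (map_poly of_int (smult (int N ^ k) p + smult (int N ^ j) q)) \<zeta>"
    by (simp add: *[symmetric] power_add algebra_simps)
  then show ?case by blast
next
  case (adjoin_mult x y)
  then obtain j p k q where *: "x * of_nat N ^ j = poly (map_poly of_int p) \<zeta>" 
      "y * of_nat N ^ k = poly (map_poly of_int q) \<zeta>" by blast
  have "map_poly (of_int :: int \<Rightarrow> complex) (p * q) = map_poly of_int p * map_poly of_int q"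
    by (rule poly_eqI) (simp add: coeff_map_poly coeff_mult)
  then have "(x * y) * of_nat N ^ (j + k) = poly (map_poly of_int (p * q)) \<zeta>"
    by (simp add: *[symmetric] power_add algebra_simps)
  then show ?case by blast
qed

text \<open>Clearing powers of \<open>N\<close> would make \<open>N ^ j / q\<close> an algebraic
  integer. Being rational it would be an integer, so \<open>q\<close> would divide a power of
  \<open>N\<close>.\<close>

lemma recip_prime_notin_adjoin:
  assumes "\<zeta> ^ m = 1" "m > 0" "N > 0" "prime q" "\<not> q dvd N"
  shows "1 / of_nat q \<notin> adjoin \<zeta> N"
proof
  assume "1 / of_nat q \<in> adjoin \<zeta> N"
  then obtain j p where *: "1 / of_nat q * of_nat N ^ j = poly (map_poly of_int (p :: int poly)) \<zeta>"
    using adjoin_poly[OF _ assms(3)] by blast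
  define y :: complex where "y = 1 / of_nat q * of_nat N ^ j"
  have "algebraic_int y" using algebraic_int_poly_root_of_unity[OF assms(1,2), of p] * by (simp add: y_def)
  moreover have "y \<in> \<rat>" by (auto simp: y_def)
  ultimately have "y \<in> \<int>" by (rule rational_algebraic_int_is_int)
  then obtain c where "y = of_int c" by (auto elim: Ints_cases)
  then have "of_nat N ^ j = (of_int c * of_nat q :: complex)"
    using assms(4) by (auto simp: y_def field_simps prime_gt_0_nat)
  then have "int N ^ j = c * int q" by (metis of_int_eq_iff of_int_mult of_int_of_nat_eq of_int_power)
  then have "int q dvd int N ^ j" by simp
  then have "q dvd N ^ j" by (metis int_dvd_int_iff of_nat_power)
  then show False using assms(4,5) prime_dvd_power by blast
qed

lemma adjoin_frobenius_add:
  assumes q: "prime q" and xy: "x \<in> adjoin \<zeta> N" "y \<in> adjoin \<zeta> N"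
  shows "\<exists>w\<in>adjoin \<zeta> N. (x + y) ^ q = x ^ q + y ^ q + of_nat q * w"
proof -
  have q2: "q \<ge> 2" using q prime_ge_2_nat by blast
  define g where "g k = of_nat (q choose k) * x ^ k * y ^ (q - k)" for k
  have "(x + y) ^ q = sum g {..q}" by (simp add: binomial_ring g_def)
  also have "{..q} = {0, q} \<union> {1..<q}" using q2 by auto
  also have "sum g \<dots> = sum g {0, q} + sum g {1..<q}" by (rule sum.union_disjoint) auto
  also have "sum g {0, q} = x ^ q + y ^ q" using q2 by (simp add: g_def)
  also have "sum g {1..<q} = of_nat q * (\<Sum>k=1..<q. of_nat ((q choose k) div q) * x ^ k * y ^ (q - k))"
    unfolding sum_distrib_left
  proof (rule sum.cong)
    fix k assume "k \<in> {1..<q}"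
    then have "q dvd (q choose k)" by (intro dvd_choose_prime[OF _ _ _ q]) auto
    then have "of_nat (q choose k) = (of_nat q * of_nat ((q choose k) div q) :: complex)"
      by (metis dvd_mult_div_cancel of_nat_mult)
    then show "g k = of_nat q * (of_nat ((q choose k) div q) * x ^ k * y ^ (q - k))"
      by (simp add: g_def)
  qed simp
  finally have *: "(x + y) ^ q = x ^ q + y ^ q +
      of_nat q * (\<Sum>k=1..<q. of_nat ((q choose k) div q) * x ^ k * y ^ (q - k))" .
  show ?thesis
    by (rule bexI, rule *, intro adjoin_sum adjoin_mult adjoin_power adjoin_of_nat xy)
qed

lemma adjoin_frobenius_add_pow:
  assumes q: "prime q" and xy: "x \<in> adjoin \<zeta> N" "y \<in> adjoin \<zeta> N"
  shows "\<exists>w\<in>adjoin \<zeta> N. (x + y) ^ (q ^ k) = x ^ (q ^ k) + y ^ (q ^ k) + of_nat q * w"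
proof (induction k)
  case 0
  then show ?case using adjoin_zero by (intro bexI[of _ 0]) auto
next
  case (Suc k)
  then obtain w where w: "w \<in> adjoin \<zeta> N" "(x + y) ^ (q ^ k) = x ^ (q ^ k) + y ^ (q ^ k) + of_nat q * w" by blast
  define s where "s = x ^ (q ^ k) + y ^ (q ^ k)"
  have s: "s \<in> adjoin \<zeta> N" using xy by (auto simp: s_def intro!: adjoin_add adjoin_power)
  obtain w1 where w1: "w1 \<in> adjoin \<zeta> N" "(s + of_nat q * w) ^ q = s ^ q + (of_nat q * w) ^ q + of_nat q * w1"
    using adjoin_frobenius_add[OF q s, of "of_nat q * w"] w(1) adjoin_mult adjoin_of_nat by blast
  obtain w2 where w2: "w2 \<in> adjoin \<zeta> N" "s ^ q = (x ^ (q ^ k)) ^ q + (y ^ (q ^ k)) ^ q + of_nat q * w2"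
    using adjoin_frobenius_add[OF q adjoin_power[OF xy(1)] adjoin_power[OF xy(2)]] unfolding s_def by blast
  obtain r where r: "q = Suc r" using q prime_gt_0_nat[of q] by (cases q) auto
  have pw: "z ^ (q ^ Suc k) = (z ^ (q ^ k)) ^ q" for z :: complex
    by (metis power_Suc2 power_mult)
  have "(x + y) ^ (q ^ Suc k) = (s + of_nat q * w) ^ q"
    unfolding pw w(2) s_def ..
  also have "\<dots> = x ^ (q ^ Suc k) + y ^ (q ^ Suc k) + of_nat q * (w2 + of_nat q ^ r * w ^ q + w1)"
  proof -
    have "(of_nat q * w) ^ q = of_nat q * (of_nat q ^ r * w ^ q)"
      unfolding power_mult_distrib by (subst (2) r) simp
    then show ?thesis unfolding w1(2) w2(2) pw by (simp add: algebra_simps)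
  qed
  finally have *: "(x + y) ^ (q ^ Suc k) =
      x ^ (q ^ Suc k) + y ^ (q ^ Suc k) + of_nat q * (w2 + of_nat q ^ r * w ^ q + w1)" .
  show ?case
    by (rule bexI, rule *, intro adjoin_add adjoin_mult adjoin_power adjoin_of_nat w(1) w1(1) w2(1))
qed

text \<open>The \<open>q ^ k\<close>-th power is multiplicative and, modulo \<open>q\<close>,
  additive. So the congruence only has to be checked on generators: \<open>\<zeta>\<close> is fixed
  by assumption, \<open>1 / N\<close> by Fermat's theorem, and signs survive because
  \<open>q\<close> is odd.\<close>

lemma adjoin_frobenius:
  assumes q: "prime q" "odd q" and N: "N > 0" "\<not> q dvd N" and z: "\<zeta> ^ (q ^ k) = \<zeta>" and x: "x \<in> adjoin \<zeta> N"
  shows "\<exists>w\<in>adjoin \<zeta> N. x ^ (q ^ k) = x + of_nat q * w"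
  using x
proof induction
  case adjoin_gen
  show ?case using z adjoin_zero by (intro bexI[of _ 0]) auto
next
  case adjoin_recip
  have "[N ^ (q ^ k) = N] (mod q)"
  proof (induction k)
    case (Suc k)
    have "[N ^ q = N] (mod q)"
    proof -
      have "[N ^ (q - 1) = 1] (mod q)" using fermat_theorem[OF q(1) N(2)] .
      then have "[N ^ (q - 1) * N = 1 * N] (mod q)" by (rule cong_scalar_right)
      moreover have "N ^ (q - 1) * N = N ^ q" using q(1) prime_gt_0_nat[of q]
        by (metis Suc_diff_1 power_Suc2)
      ultimately show ?thesis by simp
    qed
    have "[(N ^ (q ^ k)) ^ q = N ^ q] (mod q)" using Suc by (rule cong_pow)
    with \<open>[N ^ q = N] (mod q)\<close> have "[(N ^ (q ^ k)) ^ q = N] (mod q)" using cong_trans by blast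
    then show ?case by (simp add: power_mult[symmetric] mult.commute)
  qed simp
  then have "int q dvd int N - int (N ^ (q ^ k))"
    by (metis cong_iff_dvd_diff cong_int_iff cong_sym)
  then obtain t where "int N - int (N ^ (q ^ k)) = int q * t" by blast
  then have t: "of_nat N - of_nat N ^ (q ^ k) = (of_nat q * of_int t :: complex)"
    by (metis of_int_diff of_int_mult of_int_of_nat_eq of_nat_power)
  define c :: complex where "c = 1 / of_nat N"
  have c: "of_nat N * c = 1" using N(1) by (simp add: c_def)
  then have cQ: "of_nat N ^ (q ^ k) * c ^ (q ^ k) = 1" by (metis power_mult_distrib power_one)
  \<comment> \<open>Multiplying \<open>N - N ^ (q ^ k)\<close>, a multiple of \<open>q\<close>, by
    \<open>c * c ^ (q ^ k)\<close> turns Fermat's congruence for \<open>N\<close> into one for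
    \<open>1 / N\<close>.\<close>
  have "c ^ (q ^ k) - c = (of_nat N * c) * c ^ (q ^ k) - (of_nat N ^ (q ^ k) * c ^ (q ^ k)) * c"
    unfolding c cQ by simp
  also have "\<dots> = (of_nat N - of_nat N ^ (q ^ k)) * (c * c ^ (q ^ k))"
    by (simp only: left_diff_distrib right_diff_distrib mult.assoc mult.commute mult.left_commute)
  finally have "c ^ (q ^ k) = c + of_nat q * (of_int t * (c * c ^ (q ^ k)))"
    unfolding t diff_eq_eq by (simp only: mult.assoc add.commute)
  then have e: "(1 / of_nat N) ^ (q ^ k) = 1 / of_nat N + of_nat q * (of_int t * ((1 / of_nat N) * (1 / of_nat N) ^ (q ^ k)) :: complex)"
    unfolding c_def .
  show ?case
    by (rule bexI, rule e, intro adjoin_mult adjoin_power adjoin_of_int adjoin.adjoin_recip)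
next
  case adjoin_one
  show ?case using adjoin_zero by (intro bexI[of _ 0]) auto
next
  case (adjoin_uminus x)
  then obtain w where "w \<in> adjoin \<zeta> N" "x ^ (q ^ k) = x + of_nat q * w" by blast
  then show ?case using q(2) adjoin.adjoin_uminus by (intro bexI[of _ "- w"]) auto
next
  case (adjoin_add x y)
  then obtain w v where *: "w \<in> adjoin \<zeta> N" "x ^ (q ^ k) = x + of_nat q * w"
     "v \<in> adjoin \<zeta> N" "y ^ (q ^ k) = y + of_nat q * v" by blast
  obtain u where "u \<in> adjoin \<zeta> N" "(x + y) ^ (q ^ k) = x ^ (q ^ k) + y ^ (q ^ k) + of_nat q * u"
    using adjoin_frobenius_add_pow[OF q(1) adjoin_add.hyps] by blast
  then have u: "u \<in> adjoin \<zeta> N" and e: "(x + y) ^ (q ^ k) = (x + y) + of_nat q * (w + v + u)"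
    unfolding *(2,4) by (simp_all add: algebra_simps)
  show ?case
    by (rule bexI, rule e, intro adjoin.adjoin_add *(1,3) u)
next
  case (adjoin_mult x y)
  then obtain w v where *: "w \<in> adjoin \<zeta> N" "x ^ (q ^ k) = x + of_nat q * w"
     "v \<in> adjoin \<zeta> N" "y ^ (q ^ k) = y + of_nat q * v" by blast
  have "(x * y) ^ (q ^ k) = (x + of_nat q * w) * (y + of_nat q * v)"
    unfolding power_mult_distrib *(2,4) ..
  also have "\<dots> = x * y + of_nat q * (x * v + w * y + of_nat q * w * v)"
    by (simp add: algebra_simps)
  finally have e: "(x * y) ^ (q ^ k) = x * y + of_nat q * (x * v + w * y + of_nat q * w * v)" .
  show ?case
    by (rule bexI, rule e, intro adjoin.adjoin_add adjoin.adjoin_mult adjoin_of_nat *(1,3) adjoin_mult.hyps)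
qed

text \<open>If \<open>\<eta> = 1 - q y\<close> is a primitive \<open>q\<close>-th root of unity, then expanding \<open>0 = 1 + \<eta> + \<dots> + \<eta>\<^bsup>q-1\<^esup>\<close>
  modulo \<open>q\<^sup>2\<close> makes \<open>1 / q\<close> an element of the ring.\<close>

lemma root_of_unity_in_adjoin_eq_1:
  assumes z: "\<zeta> ^ m = 1" "m > 0" and N: "N > 0" "\<not> q dvd N" and qm: "\<not> q dvd m" and q: "prime q" "odd q"
    and e: "\<epsilon> \<in> adjoin \<zeta> N" "\<epsilon> ^ (q ^ a) = 1"
  shows "\<epsilon> = 1"
  using e
proof (induction a arbitrary: \<epsilon>)
  case (Suc a)
  define \<eta> where "\<eta> = \<epsilon> ^ q"
  have "\<eta> = 1"
  proof (rule Suc.IH)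
    show "\<eta> \<in> adjoin \<zeta> N" unfolding \<eta>_def by (rule adjoin_power) fact
    show "\<eta> ^ (q ^ a) = 1" using Suc.prems(2) unfolding \<eta>_def power_mult[symmetric] by simp
  qed
  then have eq: "\<epsilon> ^ q = 1" by (simp add: \<eta>_def)
  have e: "\<epsilon> \<in> adjoin \<zeta> N" by fact
  show ?case
  proof (rule ccontr)
    assume ne: "\<epsilon> \<noteq> 1"
    \<comment> \<open>With \<open>k\<close> the totient of \<open>m\<close>, raising to the power
      \<open>q ^ k\<close> fixes \<open>\<zeta>\<close>, so it is the identity modulo
      \<open>q\<close>. It sends \<open>\<epsilon>\<close> to 1, because
      \<open>\<epsilon> ^ q = 1\<close> and \<open>k > 0\<close>. Hence \<open>\<epsilon>\<close> is
      congruent to 1 modulo \<open>q\<close>.\<close>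
    have "coprime q m" using q qm prime_imp_coprime by blast
    then have "[q ^ totient m = 1] (mod m)" by (rule euler_theorem)
    define k where "k = totient m"
    have k: "k > 0" using z by (simp add: k_def)
    have "\<zeta> ^ (q ^ k) = \<zeta> ^ ((q ^ k) mod m)"
      by (rule root_of_unity_power_mod[symmetric]) fact
    also have "(q ^ k) mod m = 1 mod m" using \<open>[q ^ totient m = 1] (mod m)\<close> by (simp add: cong_def k_def)
    also have "\<zeta> ^ (1 mod m) = \<zeta> ^ 1"
      by (rule root_of_unity_power_mod) fact
    finally have zk: "\<zeta> ^ (q ^ k) = \<zeta>" by simp
    obtain w where w: "w \<in> adjoin \<zeta> N" "\<epsilon> ^ (q ^ k) = \<epsilon> + of_nat q * w"
      using adjoin_frobenius[OF q N zk Suc.prems(1)] by blast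
    have "\<epsilon> ^ (q ^ k) = 1"
    proof -
      obtain l where "k = Suc l" using k by (cases k) auto
      then have "\<epsilon> ^ (q ^ k) = (\<epsilon> ^ q) ^ (q ^ l)" unfolding power_mult[symmetric] by simp
      then show ?thesis using eq by simp
    qed
    then have ew: "\<epsilon> = 1 - of_nat q * w" using w(2) by (simp add: algebra_simps)
    have exp: "\<exists>v\<in>adjoin \<zeta> N. \<epsilon> ^ i = 1 - of_nat i * of_nat q * w + of_nat q ^ 2 * v" for i
    proof (induction i)
      case 0
      then show ?case using adjoin_zero by (intro bexI[of _ 0]) auto
    next
      case (Suc i)
      then obtain v where v: "v \<in> adjoin \<zeta> N" "\<epsilon> ^ i = 1 - of_nat i * of_nat q * w + of_nat q ^ 2 * v" by blast
      have e': "\<epsilon> ^ Suc i = 1 - of_nat (Suc i) * of_nat q * w + of_nat q ^ 2 * (\<epsilon> * v + of_nat i * w * w)"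
      proof -
        have "\<epsilon> ^ Suc i = \<epsilon> * (1 - of_nat i * of_nat q * w) + of_nat q ^ 2 * (\<epsilon> * v)"
          unfolding power_Suc v(2) by (simp add: distrib_left mult.left_commute)
        also have "\<epsilon> * (1 - of_nat i * of_nat q * w)
            = 1 - of_nat (Suc i) * of_nat q * w + of_nat q ^ 2 * (of_nat i * w * w)"
          by (subst ew) (simp add: algebra_simps power2_eq_square)
        finally show ?thesis by (simp add: distrib_left)
      qed
      show ?case
        by (rule bexI, rule e', intro adjoin_add adjoin_mult adjoin_of_nat v(1) w(1) e)
    qed
    then have "\<forall>i. \<exists>v. v \<in> adjoin \<zeta> N \<and> \<epsilon> ^ i = 1 - of_nat i * of_nat q * w + of_nat q ^ 2 * v" by blast
    from choice[OF this] obtain v where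
      vv: "\<forall>i. v i \<in> adjoin \<zeta> N \<and> \<epsilon> ^ i = 1 - of_nat i * of_nat q * w + of_nat q ^ 2 * v i" ..
    have v: "v i \<in> adjoin \<zeta> N" "\<epsilon> ^ i = 1 - of_nat i * of_nat q * w + of_nat q ^ 2 * v i" for i
      using vv by blast+
    \<comment> \<open>For odd \<open>q\<close> the sum \<open>0 + 1 + ... + (q - 1)\<close> is
      \<open>q * h\<close>, so the linear term of the expansion gains a second factor
      \<open>q\<close>. Dividing the whole sum by \<open>q\<close> then shows 1 to be a multiple of
      \<open>q\<close> in the ring.\<close>
    obtain h where h: "q = Suc (2 * h)" using q(2) by (metis oddE Suc_eq_plus1)
    have sumi: "(\<Sum>i<q. of_nat i) = (of_nat q * of_nat h :: complex)"
    proof -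
      have "(\<Sum>i<q. i) = q * h" unfolding h lessThan_Suc_atMost using gauss_sum_nat[of "2 * h"]
        by (simp add: atMost_atLeast0)
      then have "of_nat (\<Sum>i<q. i) = (of_nat (q * h) :: complex)" by (rule arg_cong)
      then show ?thesis by simp
    qed
    have "0 = (\<Sum>i<q. \<epsilon> ^ i)" using ne eq by (simp add: geometric_sum)
    also have "\<dots> = of_nat q - (\<Sum>i<q. of_nat i) * of_nat q * w + of_nat q ^ 2 * (\<Sum>i<q. v i)"
      unfolding v(2) by (simp add: sum.distrib sum_subtractf sum_distrib_left sum_distrib_right)
    finally have "of_nat q * (1 - of_nat q * (of_nat h * w - (\<Sum>i<q. v i))) = (0 :: complex)"
      unfolding sumi by (simp add: algebra_simps power2_eq_square)
    then have "1 / of_nat q = of_nat h * w - (\<Sum>i<q. v i)"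
    proof -
      assume "of_nat q * (1 - of_nat q * (of_nat h * w - (\<Sum>i<q. v i))) = (0 :: complex)"
      then have "of_nat q * (of_nat h * w - (\<Sum>i<q. v i)) = (1 :: complex)"
        using prime_gt_0_nat[OF q(1)] by simp
      then show ?thesis unfolding inverse_eq_divide[symmetric] by (rule inverse_unique)
    qed
    then have rq: "1 / of_nat q = of_nat h * w - (\<Sum>i<q. v i)" .
    have "1 / of_nat q \<in> adjoin \<zeta> N"
      unfolding rq by (intro adjoin_diff adjoin_mult adjoin_of_nat adjoin_sum v(1) w(1))
    then show False using recip_prime_notin_adjoin[OF z N(1) q(1) N(2)] by simp
  qed
qed simp

section \<open>Representations of finite groups\<close>


lemma assoc_mult_sq:
  "A \<in> carrier_mat n n \<Longrightarrow> B \<in> carrier_mat n n \<Longrightarrow> C \<in> carrier_mat n n \<Longrightarrow> A * B * C = A * (B * C)"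
  by (rule assoc_mult_mat)

section \<open>Subspaces and projections onto them\<close>

lemma subspaceI_vec:
  assumes "W \<subseteq> carrier_vec n" "0\<^sub>v n \<in> W" "\<And>v w. v \<in> W \<Longrightarrow> w \<in> W \<Longrightarrow> v + w \<in> W"
    "\<And>c v. v \<in> W \<Longrightarrow> c \<cdot>\<^sub>v v \<in> W"
  shows "VectorSpace.subspace class_ring W (module_vec TYPE(complex) n)"
proof -
  interpret vec_space "TYPE(complex)" n .
  show ?thesis unfolding VectorSpace.subspace_def
    by (intro conjI vec_vs submodule.intro) (use assms vec_module in \<open>auto simp: module_vec_simps\<close>)
qed

lemma subspaceD_vec:
  assumes "VectorSpace.subspace class_ring W (module_vec TYPE(complex) n)"
  shows "W \<subseteq> carrier_vec n" "0\<^sub>v n \<in> W" "\<And>v w. v \<in> W \<Longrightarrow> w \<in> W \<Longrightarrow> v + w \<in> W"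
    "\<And>c v. v \<in> W \<Longrightarrow> c \<cdot>\<^sub>v v \<in> W"
proof -
  have s: "submodule class_ring W (module_vec TYPE(complex) n)"
    using assms by (simp add: VectorSpace.subspace_def)
  show "W \<subseteq> carrier_vec n" "0\<^sub>v n \<in> W" "\<And>v w. v \<in> W \<Longrightarrow> w \<in> W \<Longrightarrow> v + w \<in> W"
      "\<And>c v. v \<in> W \<Longrightarrow> c \<cdot>\<^sub>v v \<in> W"
    using submodule.subset[OF s] submodule.zero_closed[OF s] submodule.m_closed[OF s] submodule.smult_closed[OF s]
    by (auto simp: module_vec_simps)
qed

lemma mat_eq_of_mult_vec_eq:
  assumes "A \<in> carrier_mat r c" "B \<in> carrier_mat r c" "\<And>v. v \<in> carrier_vec c \<Longrightarrow> A *\<^sub>v v = B *\<^sub>v v"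
  shows "A = (B :: complex mat)"
proof (rule eq_matI)
  fix i j assume ij: "i < dim_row B" "j < dim_col B"
  then have j: "j < c" using assms by simp
  have "A *\<^sub>v unit_vec c j = B *\<^sub>v unit_vec c j" by (rule assms(3)) simp
  then have "(A *\<^sub>v unit_vec c j) $ i = (B *\<^sub>v unit_vec c j) $ i" by simp
  then show "A $$ (i, j) = B $$ (i, j)" using ij assms(1,2) j by simp
qed (use assms in auto)

lemma smult_one_mult_vec:
  assumes "w \<in> carrier_vec n"
  shows "(c \<cdot>\<^sub>m 1\<^sub>m n) *\<^sub>v w = c \<cdot>\<^sub>v (w :: complex vec)"
proof (rule eq_vecI)
  fix i assume "i < dim_vec (c \<cdot>\<^sub>v w)"
  then have i: "i < n" using assms by simp
  have "((c \<cdot>\<^sub>m 1\<^sub>m n) *\<^sub>v w) $ i = (\<Sum>j<n. c * (if j = i then 1 else 0) * w $ j)"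
    using assms i by (auto simp: scalar_prod_def lessThan_atLeast0 intro!: sum.cong)
  also have "\<dots> = (\<Sum>j<n. if j = i then c * w $ j else 0)" by (intro sum.cong) auto
  finally have "((c \<cdot>\<^sub>m 1\<^sub>m n) *\<^sub>v w) $ i = (\<Sum>j<n. if j = i then c * w $ j else 0)" .
  then show "((c \<cdot>\<^sub>m 1\<^sub>m n) *\<^sub>v w) $ i = (c \<cdot>\<^sub>v w) $ i" using assms i by simp
qed (use assms in auto)

text \<open>Take an idempotent with image inside \<open>W\<close> whose trace is maximal; traces are
  ranks, bounded by \<open>n\<close> through \<open>idempotent_factorization\<close>. If some
  \<open>w\<close> in \<open>W\<close> were moved, then \<open>w - Q w\<close> would lie in
  \<open>W\<close> and be killed by \<open>Q\<close>, and a rank one idempotent could be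
  added.\<close>

lemma subspace_projection:
  assumes W: "VectorSpace.subspace class_ring W (module_vec TYPE(complex) n)"
  shows "\<exists>Q \<in> carrier_mat n n. (\<forall>w\<in>W. Q *\<^sub>v w = w) \<and> (\<forall>v\<in>carrier_vec n. Q *\<^sub>v v \<in> W)"
proof -
  note Wd = subspaceD_vec[OF W]
  define P where "P Q \<longleftrightarrow> Q \<in> carrier_mat n n \<and> Q * Q = Q \<and> (\<forall>v\<in>carrier_vec n. Q *\<^sub>v v \<in> W)" for Q :: "complex mat"
  define T where "T = {k. \<exists>Q. P Q \<and> mat_trace Q = of_nat k}"
  have "T \<subseteq> {..n}"
  proof
    fix k assume "k \<in> T"
    then obtain Q where Q: "P Q" "mat_trace Q = of_nat k" by (auto simp: T_def)
    then obtain l A B where *: "A \<in> carrier_mat n l" "B \<in> carrier_mat l n" "A * B = Q" "B * A = 1\<^sub>m l" "l \<le> n"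
      using idempotent_factorization[of Q n] unfolding P_def by blast
    have "mat_trace Q = of_nat l" using mat_trace_comm[OF *(1,2)] *(3,4) by simp
    then have "k = l" using Q(2) by (metis of_nat_eq_iff)
    then show "k \<in> {..n}" using *(5) by simp
  qed
  then have fin: "finite T" by (rule finite_subset) simp
  have z: "0\<^sub>m n n *\<^sub>v v = 0\<^sub>v n" if "v \<in> carrier_vec n" for v :: "complex vec"
    using that by (intro eq_vecI) auto
  have "P (0\<^sub>m n n)" using Wd(2) by (simp add: P_def z)
  then have "0 \<in> T" by (auto simp: T_def intro!: exI[of _ "0\<^sub>m n n"])
  then have "Max T \<in> T" using fin by (metis Max_in empty_iff)
  then obtain Q where Q: "P Q" "mat_trace Q = of_nat (Max T)" by (auto simp: T_def)
  have Qc: "Q \<in> carrier_mat n n" and QQ: "Q * Q = Q" and QW: "\<And>v. v \<in> carrier_vec n \<Longrightarrow> Q *\<^sub>v v \<in> W"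
    using Q(1) by (auto simp: P_def)
  have "Q *\<^sub>v w = w" if w: "w \<in> W" for w
  proof (rule ccontr)
    assume ne: "Q *\<^sub>v w \<noteq> w"
    have wc: "w \<in> carrier_vec n" using w Wd(1) by blast
    define u where "u = w + (- 1) \<cdot>\<^sub>v (Q *\<^sub>v w)"
    have uc: "u \<in> carrier_vec n" using wc Qc by (simp add: u_def)
    have uW: "u \<in> W" unfolding u_def by (intro Wd(3,4) w QW wc)
    have "Q *\<^sub>v (Q *\<^sub>v w) = Q *\<^sub>v w" using assoc_mult_mat_vec[OF Qc Qc wc] QQ by simp
    then have Qu: "Q *\<^sub>v u = 0\<^sub>v n" unfolding u_def using wc Qc
      by (subst mult_add_distrib_mat_vec[of _ n n]) (auto simp: mult_mat_vec)
    have "\<exists>i<n. u $ i \<noteq> 0"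
    proof (rule ccontr)
      assume "\<not> ?thesis"
      then have "w = Q *\<^sub>v w" using wc Qc by (intro eq_vecI) (auto simp: u_def)
      then show False using ne by simp
    qed
    then obtain i where i: "i < n" "u $ i \<noteq> 0" by blast
    define U where "U = mat n 1 (\<lambda>(k, _). u $ k)"
    \<comment> \<open>Row \<open>i\<close> of \<open>1 - Q\<close>, scaled by an entry where
      \<open>u\<close> is nonzero. This gives \<open>f * U = 1\<close>, and \<open>f * Q = 0\<close>
      because \<open>Q\<close> is idempotent; together with \<open>Q * U = 0\<close> these make
      \<open>Q + U * f\<close> an idempotent of trace one larger.\<close>
    define f where "f = mat 1 n (\<lambda>(_, k). (1\<^sub>m n - Q) $$ (i, k) / u $ i)"
    have U: "U \<in> carrier_mat n 1" and f: "f \<in> carrier_mat 1 n" by (auto simp: U_def f_def)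
    have Uf: "U * f \<in> carrier_mat n n" using U f by simp
    have sQ: "(\<Sum>l<n. Q $$ (a, l) * u $ l) = 0" if "a < n" for a
    proof -
      have "(Q *\<^sub>v u) $ a = (\<Sum>l<n. Q $$ (a, l) * u $ l)"
        using that Qc uc by (simp add: scalar_prod_def lessThan_atLeast0)
      then show ?thesis using Qu that by simp
    qed
    have QU: "Q * U = 0\<^sub>m n 1"
    proof (rule eq_matI)
      fix a b assume "a < dim_row (0\<^sub>m n 1 :: complex mat)" "b < dim_col (0\<^sub>m n 1 :: complex mat)"
      then have ab: "a < n" "b < 1" by auto
      show "(Q * U) $$ (a, b) = 0\<^sub>m n 1 $$ (a, b)"
        unfolding mult_mat_index[OF Qc U ab] using ab sQ by (simp add: U_def)
    qed (use Qc U in auto)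
    have fU: "f * U = 1\<^sub>m 1"
    proof (rule eq_matI)
      fix a b assume "a < dim_row (1\<^sub>m 1 :: complex mat)" "b < dim_col (1\<^sub>m 1 :: complex mat)"
      then have ab: "a = 0" "b = 0" by auto
      have "(f * U) $$ (0, 0) = (\<Sum>l<n. (1\<^sub>m n - Q) $$ (i, l) / u $ i * u $ l)"
        by (subst mult_mat_index[OF f U]) (simp_all add: f_def U_def)
      also have "\<dots> = ((\<Sum>l<n. 1\<^sub>m n $$ (i, l) * u $ l) - (\<Sum>l<n. Q $$ (i, l) * u $ l)) / u $ i"
        using i Qc by (simp add: sum_subtractf[symmetric] sum_divide_distrib left_diff_distrib diff_divide_distrib)
      also have "(\<Sum>l<n. 1\<^sub>m n $$ (i, l) * u $ l) = (\<Sum>l<n. if l = i then u $ l else 0)"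
        using i by (intro sum.cong) auto
      also have "\<dots> = u $ i" using i by simp
      finally show "(f * U) $$ (a, b) = 1\<^sub>m 1 $$ (a, b)" using ab i sQ[OF i(1)] by simp
    qed (use U f in auto)
    have fQ: "f * Q = 0\<^sub>m 1 n"
    proof (rule eq_matI)
      fix a b assume "a < dim_row (0\<^sub>m 1 n :: complex mat)" "b < dim_col (0\<^sub>m 1 n :: complex mat)"
      then have ab: "a < 1" "b < n" by auto
      have "(\<Sum>l<n. Q $$ (i, l) * Q $$ (l, b)) = Q $$ (i, b)"
        using mult_mat_index[OF Qc Qc i(1) ab(2)] QQ by simp
      moreover have "(f * Q) $$ (a, b) = (\<Sum>l<n. (1\<^sub>m n - Q) $$ (i, l) / u $ i * Q $$ (l, b))"
        unfolding mult_mat_index[OF f Qc ab] using ab by (simp add: f_def)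
      moreover have "\<dots> = ((\<Sum>l<n. 1\<^sub>m n $$ (i, l) * Q $$ (l, b)) - (\<Sum>l<n. Q $$ (i, l) * Q $$ (l, b))) / u $ i"
        using i Qc by (simp add: sum_subtractf[symmetric] sum_divide_distrib left_diff_distrib diff_divide_distrib)
      moreover have "(\<Sum>l<n. 1\<^sub>m n $$ (i, l) * Q $$ (l, b)) = (\<Sum>l<n. if l = i then Q $$ (l, b) else 0)"
        using i by (intro sum.cong) auto
      moreover have "\<dots> = Q $$ (i, b)" using i by simp
      ultimately show "(f * Q) $$ (a, b) = 0\<^sub>m 1 n $$ (a, b)" using ab by simp
    qed (use Qc f in auto)
    define Q' where "Q' = Q + U * f"
    have Q'c: "Q' \<in> carrier_mat n n" using Qc Uf by (simp add: Q'_def)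
    have "Q' * Q' = (Q * Q + U * f * Q) + (Q * (U * f) + U * f * (U * f))"
      unfolding Q'_def using Qc Uf by (simp add: add_mult_distrib_mat[of _ n n] mult_add_distrib_mat[of _ n n])
    also have "Q * (U * f) = 0\<^sub>m n n" using assoc_mult_mat[OF Qc U f] QU f by simp
    also have "U * f * Q = 0\<^sub>m n n" using assoc_mult_mat[OF U f Qc] fQ U by simp
    also have "U * f * (U * f) = U * f"
    proof -
      have "U * f * (U * f) = U * (f * (U * f))" by (rule assoc_mult_mat[OF U f Uf])
      also have "f * (U * f) = f" using assoc_mult_mat[OF f U f] fU f by simp
      finally show ?thesis .
    qed
    finally have idem: "Q' * Q' = Q'" using QQ Qc Uf by (simp add: Q'_def)
    have "Q' *\<^sub>v v \<in> W" if v: "v \<in> carrier_vec n" for v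
    proof -
      have "Q' *\<^sub>v v = Q *\<^sub>v v + (f *\<^sub>v v) $ 0 \<cdot>\<^sub>v u"
      proof (rule eq_vecI)
        fix a assume a: "a < dim_vec (Q *\<^sub>v v + (f *\<^sub>v v) $ 0 \<cdot>\<^sub>v u)"
        then have a: "a < n" using uc by simp
        have "(Q' *\<^sub>v v) $ a = (Q *\<^sub>v v) $ a + (U * f *\<^sub>v v) $ a"
          unfolding Q'_def using a Qc Uf v U f by (simp add: add_mult_distrib_mat_vec[of _ n n])
        also have "U * f *\<^sub>v v = U *\<^sub>v (f *\<^sub>v v)" by (rule assoc_mult_mat_vec[OF U f v])
        also have "(U *\<^sub>v (f *\<^sub>v v)) $ a = u $ a * (f *\<^sub>v v) $ 0"
          using a f v by (simp add: U_def scalar_prod_def)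
        finally show "(Q' *\<^sub>v v) $ a = (Q *\<^sub>v v + (f *\<^sub>v v) $ 0 \<cdot>\<^sub>v u) $ a"
          using a uc Qc by (simp add: mult.commute)
      qed (use Q'c uc in auto)
      then show ?thesis using Wd(3,4) QW[OF v] uW by simp
    qed
    then have "P Q'" using Q'c idem by (simp add: P_def)
    moreover have "mat_trace Q' = of_nat (Suc (Max T))"
      using mat_trace_add[OF Qc Uf] mat_trace_comm[OF U f] fU Q(2) by (simp add: Q'_def)
    ultimately have "Suc (Max T) \<in> T" by (auto simp: T_def)
    then show False using Max_ge[OF fin, of "Suc (Max T)"] by simp
  qed
  then show ?thesis by (intro bexI[of _ Q] conjI ballI QW Qc)
qed

section \<open>Schur's lemma and orthogonality of matrix coefficients\<close>

locale fin_group = group G for G (structure) +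
  assumes finite_G: "finite (carrier G)"
begin

abbreviation gsize :: complex where "gsize \<equiv> of_nat (card (carrier G))"

lemma gsize_nonzero: "gsize \<noteq> 0"
  using finite_G one_closed by auto

lemma rep_carrier: "representation G n \<rho> \<Longrightarrow> g \<in> carrier G \<Longrightarrow> \<rho> g \<in> carrier_mat n n"
  by (auto simp: representation_def hom_def units_of_def Units_def ring_mat_simps)

lemma rep_mult: "representation G n \<rho> \<Longrightarrow> g \<in> carrier G \<Longrightarrow> h \<in> carrier G \<Longrightarrow> \<rho> (g \<otimes> h) = \<rho> g * \<rho> h"
  by (auto simp: representation_def hom_def units_of_def ring_mat_simps)

lemma rep_one:
  assumes "representation G n \<rho>"
  shows "\<rho> \<one> = 1\<^sub>m n"
proof -
  have "\<rho> \<one> \<in> Units (ring_mat TYPE(complex) n ())"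
    using assms by (auto simp: representation_def hom_def units_of_def)
  then obtain Y where Y: "Y \<in> carrier_mat n n" "Y * \<rho> \<one> = 1\<^sub>m n"
    by (auto simp: Units_def ring_mat_simps)
  have c: "\<rho> \<one> \<in> carrier_mat n n" using rep_carrier[OF assms one_closed] .
  have "\<rho> \<one> * \<rho> \<one> = \<rho> \<one>" using rep_mult[OF assms one_closed one_closed] by simp
  then have "Y * (\<rho> \<one> * \<rho> \<one>) = 1\<^sub>m n" using Y(2) by simp
  then show ?thesis using assoc_mult_mat[OF Y(1) c c] Y(2) c by simp
qed

lemma rep_inv:
  assumes "representation G n \<rho>" "g \<in> carrier G"
  shows "\<rho> g * \<rho> (inv g) = 1\<^sub>m n" "\<rho> (inv g) * \<rho> g = 1\<^sub>m n"
  using rep_mult[OF assms(1), of g "inv g"] rep_mult[OF assms(1), of "inv g" g] rep_one[OF assms(1)] assms(2)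
  by simp_all

lemma representationI:
  assumes "\<And>g. g \<in> carrier G \<Longrightarrow> \<rho> g \<in> carrier_mat n n"
    "\<And>g h. g \<in> carrier G \<Longrightarrow> h \<in> carrier G \<Longrightarrow> \<rho> (g \<otimes> h) = \<rho> g * \<rho> h" "\<rho> \<one> = 1\<^sub>m n"
  shows "representation G n \<rho>"
proof -
  have inv: "\<rho> g * \<rho> (inv g) = 1\<^sub>m n" "\<rho> (inv g) * \<rho> g = 1\<^sub>m n" if "g \<in> carrier G" for g
    using assms(2)[of g "inv g"] assms(2)[of "inv g" g] assms(3) that by simp_all
  have "\<rho> g \<in> Units (ring_mat TYPE(complex) n ())" if "g \<in> carrier G" for g
    using inv[OF that] assms(1)[OF that] assms(1)[of "inv g"] that
    by (auto simp: Units_def ring_mat_simps intro!: bexI[of _ "\<rho> (inv g)"])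
  then show ?thesis using assms(2) by (auto simp: representation_def hom_def units_of_def ring_mat_simps)
qed

lemma rep_pow:
  assumes "representation G n \<rho>" "g \<in> carrier G"
  shows "\<rho> (g [^] (k :: nat)) = \<rho> g ^\<^sub>m k"
proof (induction k)
  case 0
  then show ?case using rep_one[OF assms(1)] rep_carrier[OF assms] by simp
next
  case (Suc k)
  then show ?case using rep_mult[OF assms(1), of "g [^] k" g] assms(2) by simp
qed

lemma irrepD: "irreducible_representation G n \<rho> \<Longrightarrow> representation G n \<rho>"
  and irrep_pos: "irreducible_representation G n \<rho> \<Longrightarrow> n > 0"
  by (simp_all add: irreducible_representation_def)

lemma schur:
  assumes irr: "irreducible_representation G n \<rho>" and X: "X \<in> carrier_mat n n"
    and comm: "\<And>g. g \<in> carrier G \<Longrightarrow> X * \<rho> g = \<rho> g * X"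
  shows "\<exists>c. X = c \<cdot>\<^sub>m 1\<^sub>m n"
proof -
  note rep = irrepD[OF irr]
  obtain as where as: "char_poly X = (\<Prod>a\<leftarrow>as. [:- a, 1:])" "length as = n"
    using char_poly_factorized[OF X] by blast
  obtain c cs where "as = c # cs" using as(2) irrep_pos[OF irr] by (cases as) auto
  then have "poly (char_poly X) c = 0" using as(1) by (simp add: poly_prod_list)
  then have "eigenvalue X c" using eigenvalue_root_char_poly[OF X] by simp
  then obtain v where v: "v \<in> carrier_vec n" "v \<noteq> 0\<^sub>v n" "X *\<^sub>v v = c \<cdot>\<^sub>v v"
    using X by (auto simp: eigenvalue_def eigenvector_def)
  define W where "W = {w \<in> carrier_vec n. X *\<^sub>v w = c \<cdot>\<^sub>v w}"
  have "VectorSpace.subspace class_ring W (module_vec TYPE(complex) n)"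
  proof (rule subspaceI_vec)
    show "0\<^sub>v n \<in> W" using X by (auto simp: W_def intro!: eq_vecI)
    show "v + w \<in> W" if "v \<in> W" "w \<in> W" for v w
      using that X by (auto simp: W_def mult_add_distrib_mat_vec smult_add_distrib_vec)
    show "k \<cdot>\<^sub>v v \<in> W" if "v \<in> W" for k v
      using that X by (auto simp: W_def mult_mat_vec smult_smult_assoc mult.commute)
  qed (auto simp: W_def)
  moreover have "\<rho> g *\<^sub>v w \<in> W" if g: "g \<in> carrier G" and w: "w \<in> W" for g w
  proof -
    have wc: "w \<in> carrier_vec n" using w by (simp add: W_def)
    note rg = rep_carrier[OF rep g]
    have "X *\<^sub>v (\<rho> g *\<^sub>v w) = \<rho> g *\<^sub>v (X *\<^sub>v w)"
      using assoc_mult_mat_vec[OF X rg wc] assoc_mult_mat_vec[OF rg X wc] comm[OF g] by simp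
    then show ?thesis using w rg wc by (simp add: W_def mult_mat_vec)
  qed
  ultimately have "W = {0\<^sub>v n} \<or> W = carrier_vec n"
    using irr unfolding irreducible_representation_def by blast
  moreover have "v \<in> W" using v by (simp add: W_def)
  ultimately have "W = carrier_vec n" using v(2) by blast
  then have "X *\<^sub>v w = (c \<cdot>\<^sub>m 1\<^sub>m n) *\<^sub>v w" if "w \<in> carrier_vec n" for w
  proof -
    have "w \<in> W" using that \<open>W = carrier_vec n\<close> by simp
    then show ?thesis using that by (simp add: W_def smult_one_mult_vec)
  qed
  then have "X = c \<cdot>\<^sub>m 1\<^sub>m n" by (intro mat_eq_of_mult_vec_eq[OF X]) auto
  then show ?thesis ..
qed

lemma bij_mult_left: "g \<in> carrier G \<Longrightarrow> bij_betw (\<lambda>h. g \<otimes> h) (carrier G) (carrier G)"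
  by (simp add: bij_betw_def inj_on_cmult surj_const_mult)

lemma average_intertwines:
  assumes r: "representation G n \<rho>" "representation G k \<rho>'" and X: "X \<in> carrier_mat n k" and g: "g \<in> carrier G"
  defines "A \<equiv> msum n k (\<lambda>h. \<rho> h * X * \<rho>' (inv h)) (carrier G)"
  shows "\<rho> g * A = A * \<rho>' g"
proof -
  note c = rep_carrier[OF r(1)] and c' = rep_carrier[OF r(2)]
  have Xc: "\<rho> h * X * \<rho>' (inv h) \<in> carrier_mat n k" if "h \<in> carrier G" for h
    using c[of h] c'[of "inv h"] X that by simp
  have "A = msum n k (\<lambda>h. \<rho> (g \<otimes> h) * X * \<rho>' (inv (g \<otimes> h))) (carrier G)"
    unfolding A_def by (rule msum_reindex[OF bij_mult_left[OF g]])
  then have "A * \<rho>' g = msum n k (\<lambda>h. \<rho> (g \<otimes> h) * X * \<rho>' (inv (g \<otimes> h)) * \<rho>' g) (carrier G)"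
    using msum_mult[OF c'[OF g], of "carrier G" "\<lambda>h. \<rho> (g \<otimes> h) * X * \<rho>' (inv (g \<otimes> h))" n] Xc g by simp
  also have "\<dots> = msum n k (\<lambda>h. \<rho> g * (\<rho> h * X * \<rho>' (inv h))) (carrier G)"
  proof (rule msum_cong)
    fix h assume h: "h \<in> carrier G"
    have c1: "\<rho> g \<in> carrier_mat n n" "\<rho> h \<in> carrier_mat n n" "\<rho>' (inv h) \<in> carrier_mat k k"
      "\<rho>' (inv (g \<otimes> h)) \<in> carrier_mat k k" "\<rho>' g \<in> carrier_mat k k" using c c' g h by simp_all
    have "\<rho>' (inv (g \<otimes> h)) * \<rho>' g = \<rho>' (inv h)"
      using rep_mult[OF r(2), of "inv (g \<otimes> h)" g] g h by (simp add: inv_mult_group m_assoc)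
    then have "\<rho> (g \<otimes> h) * X * \<rho>' (inv (g \<otimes> h)) * \<rho>' g = \<rho> (g \<otimes> h) * X * \<rho>' (inv h)"
    proof -
      have "\<rho> (g \<otimes> h) * X * \<rho>' (inv (g \<otimes> h)) * \<rho>' g = \<rho> (g \<otimes> h) * X * (\<rho>' (inv (g \<otimes> h)) * \<rho>' g)"
        by (rule assoc_mult_mat[of _ n k, OF _ c1(4,5)]) (use c[of "g \<otimes> h"] g h X in simp)
      then show ?thesis using \<open>\<rho>' (inv (g \<otimes> h)) * \<rho>' g = \<rho>' (inv h)\<close> by (simp only:)
    qed
    also have "\<dots> = \<rho> g * \<rho> h * X * \<rho>' (inv h)" using rep_mult[OF r(1) g h] by simp
    also have "\<dots> = \<rho> g * (\<rho> h * X * \<rho>' (inv h))"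
      using assoc_mult_mat[of "\<rho> g" n n "\<rho> h" n X k] assoc_mult_mat[of "\<rho> g" n n "\<rho> h * X" k "\<rho>' (inv h)" k] c1 X by simp
    finally show "\<rho> (g \<otimes> h) * X * \<rho>' (inv (g \<otimes> h)) * \<rho>' g = \<rho> g * (\<rho> h * X * \<rho>' (inv h))" .
  qed simp
  also have "\<dots> = \<rho> g * A" unfolding A_def by (rule mult_msum[OF c[OF g] Xc, symmetric])
  finally show ?thesis by simp
qed

lemma schur_average:
  assumes irr: "irreducible_representation G n \<rho>" and X: "X \<in> carrier_mat n n"
  shows "msum n n (\<lambda>h. \<rho> h * X * \<rho> (inv h)) (carrier G) = (gsize * mat_trace X / of_nat n) \<cdot>\<^sub>m 1\<^sub>m n"
proof -
  note rep = irrepD[OF irr] and n = irrep_pos[OF irr]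
  note c = rep_carrier[OF rep]
  let ?A = "msum n n (\<lambda>h. \<rho> h * X * \<rho> (inv h)) (carrier G)"
  have "\<exists>k. ?A = k \<cdot>\<^sub>m 1\<^sub>m n"
    by (rule schur[OF irr msum_carrier]) (rule average_intertwines[OF rep rep X, symmetric])
  then obtain k where k: "?A = k \<cdot>\<^sub>m 1\<^sub>m n" by (elim exE)
  have c3: "\<rho> h * X * \<rho> (inv h) \<in> carrier_mat n n" if "h \<in> carrier G" for h
    using mult_carrier_mat[OF mult_carrier_mat[OF c[OF that] X] c[OF inv_closed[OF that]]] .
  have "mat_trace ?A = (\<Sum>h\<in>carrier G. mat_trace (\<rho> h * X * \<rho> (inv h)))"
    by (rule mat_trace_msum'[OF c3])
  also have "\<dots> = (\<Sum>h\<in>carrier G. mat_trace X)"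
    using c X rep_inv[OF rep] by (intro sum.cong mat_trace_conj) auto
  finally have "k * of_nat n = gsize * mat_trace X" using k by (simp add: mat_trace_smult_one)
  then have "k = gsize * mat_trace X / of_nat n" using n by (simp add: field_simps)
  then show ?thesis using k by simp
qed

lemma mult_unit_mult_index:
  assumes "A \<in> carrier_mat n n" "B \<in> carrier_mat k k" "i < n" "j < n" "a < k" "b < k"
  shows "(A * mat n k (\<lambda>(x, y). if x = j \<and> y = a then 1 else 0) * B) $$ (i, b) = A $$ (i, j) * (B $$ (a, b) :: complex)"
proof -
  let ?X = "mat n k (\<lambda>(x, y). if x = j \<and> y = a then 1 else 0 :: complex)"
  have X: "?X \<in> carrier_mat n k" by simp
  have AX: "(A * ?X) $$ (i, y) = (if y = a then A $$ (i, j) else 0)" if "y < k" for y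
  proof -
    have "(A * ?X) $$ (i, y) = (\<Sum>l<n. if l = j then (if y = a then A $$ (i, l) else 0) else 0)"
      unfolding mult_mat_index[OF assms(1) X assms(3) that] using that by (intro sum.cong) auto
    then show ?thesis using assms by simp
  qed
  have "(A * ?X * B) $$ (i, b) = (\<Sum>l<k. if l = a then A $$ (i, j) * B $$ (l, b) else 0)"
    unfolding mult_mat_index[OF mult_carrier_mat[OF assms(1) X] assms(2,3,6)]
    by (intro sum.cong) (auto simp: AX)
  then show ?thesis using assms by simp
qed

lemma matrix_coefficients_orthogonal:
  assumes irr: "irreducible_representation G n \<rho>" and ij: "i < n" "j < n" "k < n" "l < n"
  shows "(\<Sum>h\<in>carrier G. \<rho> h $$ (i, j) * \<rho> (inv h) $$ (k, l)) = (if i = l \<and> j = k then gsize / of_nat n else 0)"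
proof -
  note c = rep_carrier[OF irrepD[OF irr]]
  let ?X = "mat n n (\<lambda>(x, y). if x = j \<and> y = k then 1 else 0 :: complex)"
  have "(\<Sum>h\<in>carrier G. \<rho> h $$ (i, j) * \<rho> (inv h) $$ (k, l))
      = msum n n (\<lambda>h. \<rho> h * ?X * \<rho> (inv h)) (carrier G) $$ (i, l)"
    using ij c by (simp add: mult_unit_mult_index)
  also have "\<dots> = gsize * mat_trace ?X / of_nat n * (if i = l then 1 else 0)"
    using schur_average[OF irr, of ?X] ij by simp
  also have "mat_trace ?X = (\<Sum>x<n. if x = j then (if j = k then 1 else 0) else 0)"
    unfolding mat_trace_def by (intro sum.cong) auto
  also have "\<dots> = (if j = k then 1 else 0)" using ij by simp
  finally show ?thesis by simp
qed

lemma fourier_inversion: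
  assumes irr: "irreducible_representation G n \<rho>" and B: "B \<in> carrier_mat n n"
  shows "msum n n (\<lambda>h. mat_trace (\<rho> (inv h) * B) \<cdot>\<^sub>m \<rho> h) (carrier G) = (gsize / of_nat n) \<cdot>\<^sub>m B"
proof (rule eq_matI)
  note c = rep_carrier[OF irrepD[OF irr]]
  fix i j assume "i < dim_row ((gsize / of_nat n) \<cdot>\<^sub>m B)" "j < dim_col ((gsize / of_nat n) \<cdot>\<^sub>m B)"
  then have ij: "i < n" "j < n" using B by auto
  have "msum n n (\<lambda>h. mat_trace (\<rho> (inv h) * B) \<cdot>\<^sub>m \<rho> h) (carrier G) $$ (i, j)
      = (\<Sum>h\<in>carrier G. mat_trace (\<rho> (inv h) * B) * \<rho> h $$ (i, j))"
    using ij by (simp add: carrier_matD[OF c])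
  also have "\<dots> = (\<Sum>h\<in>carrier G. \<Sum>k<n. \<Sum>l<n. B $$ (l, k) * (\<rho> h $$ (i, j) * \<rho> (inv h) $$ (k, l)))"
    using c B by (intro sum.cong) (simp_all add: mat_trace_mult[of _ n n] sum_distrib_right sum_distrib_left mult_ac)
  also have "\<dots> = (\<Sum>k<n. \<Sum>l<n. B $$ (l, k) * (\<Sum>h\<in>carrier G. \<rho> h $$ (i, j) * \<rho> (inv h) $$ (k, l)))"
    unfolding sum_distrib_left by (subst sum.swap, rule sum.cong, simp, subst sum.swap) simp
  also have "\<dots> = (\<Sum>k<n. \<Sum>l<n. if i = l then (if j = k then B $$ (l, k) * (gsize / of_nat n) else 0) else 0)"
    using ij by (intro sum.cong) (auto simp: matrix_coefficients_orthogonal[OF irr])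
  also have "\<dots> = (gsize / of_nat n) * B $$ (i, j)" using ij by simp
  finally show "msum n n (\<lambda>h. mat_trace (\<rho> (inv h) * B) \<cdot>\<^sub>m \<rho> h) (carrier G) $$ (i, j) = ((gsize / of_nat n) \<cdot>\<^sub>m B) $$ (i, j)"
    using ij B by simp
qed (use B in auto)

text \<open>Fourier inversion paired with \<open>A\<close>. With values of a projective extension in
  the places of \<open>A\<close> and \<open>B\<close> it evaluates sums over a coset of the
  subgroup, which is how the coefficients \<open>tau\<close> are controlled.\<close>

lemma sum_trace_trace:
  assumes irr: "irreducible_representation G n \<rho>" and A: "A \<in> carrier_mat n n" and B: "B \<in> carrier_mat n n"
  shows "(\<Sum>h\<in>carrier G. mat_trace (\<rho> (inv h) * B) * mat_trace (A * \<rho> h)) = gsize / of_nat n * mat_trace (A * B)"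
proof -
  note c = rep_carrier[OF irrepD[OF irr]]
  have "mat_trace (A * msum n n (\<lambda>h. mat_trace (\<rho> (inv h) * B) \<cdot>\<^sub>m \<rho> h) (carrier G))
     = mat_trace (msum n n (\<lambda>h. A * (mat_trace (\<rho> (inv h) * B) \<cdot>\<^sub>m \<rho> h)) (carrier G))"
    using c by (subst mult_msum[OF A]) auto
  also have "\<dots> = (\<Sum>h\<in>carrier G. mat_trace (A * (mat_trace (\<rho> (inv h) * B) \<cdot>\<^sub>m \<rho> h)))"
    using c A by (intro mat_trace_msum') auto
  also have "\<dots> = (\<Sum>h\<in>carrier G. mat_trace (\<rho> (inv h) * B) * mat_trace (A * \<rho> h))"
  proof (rule sum.cong)
    fix h assume h: "h \<in> carrier G"
    show "mat_trace (A * (mat_trace (\<rho> (inv h) * B) \<cdot>\<^sub>m \<rho> h)) = mat_trace (\<rho> (inv h) * B) * mat_trace (A * \<rho> h)"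
      using mult_smult_distrib[OF A c[OF h]] mat_trace_smult[OF mult_carrier_mat[OF A c[OF h]]] by simp
  qed simp
  finally show ?thesis
    unfolding fourier_inversion[OF irr B] mult_smult_distrib[OF A B] mat_trace_smult[OF mult_carrier_mat[OF A B]] ..
qed

text \<open>A partner \<open>Y\<close> comes from averaging the matrix unit opposite to a nonzero
  entry of \<open>X\<close>. By Schur's lemma \<open>X * Y\<close> and \<open>Y * X\<close> are
  scalars; the trace of \<open>X * Y\<close> is the group order times that entry, so the scalars are
  nonzero and equal, and \<open>X\<close> is invertible.\<close>

lemma trace_eq_of_intertwiner:
  assumes irr: "irreducible_representation G n \<rho>" "irreducible_representation G k \<rho>'"
    and X: "X \<in> carrier_mat n k" "X \<noteq> 0\<^sub>m n k" and inter: "\<And>g. g \<in> carrier G \<Longrightarrow> \<rho> g * X = X * \<rho>' g"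
  shows "\<exists>Y c. Y \<in> carrier_mat k n \<and> c \<noteq> 0 \<and> X * Y = c \<cdot>\<^sub>m 1\<^sub>m n \<and> Y * X = c \<cdot>\<^sub>m 1\<^sub>m k \<and> n = k"
    and "\<And>g. g \<in> carrier G \<Longrightarrow> mat_trace (\<rho> g) = mat_trace (\<rho>' g)"
proof -
  note rep = irrepD[OF irr(1)] and rep' = irrepD[OF irr(2)]
  note cr = rep_carrier[OF rep] and cr' = rep_carrier[OF rep']
  obtain i j where ij: "i < n" "j < k" "X $$ (i, j) \<noteq> 0"
    using X by (metis carrier_matD eq_matI index_zero_mat)
  define Y0 where "Y0 = mat k n (\<lambda>(x, y). if x = j \<and> y = i then 1 else 0 :: complex)"
  have Y0: "Y0 \<in> carrier_mat k n" by (simp add: Y0_def)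
  define Y where "Y = msum k n (\<lambda>h. \<rho>' h * Y0 * \<rho> (inv h)) (carrier G)"
  have Y: "Y \<in> carrier_mat k n" by (simp add: Y_def)
  have Yi: "\<rho>' g * Y = Y * \<rho> g" if "g \<in> carrier G" for g
    unfolding Y_def by (rule average_intertwines[OF rep' rep Y0 that])
  have "X * Y * \<rho> g = \<rho> g * (X * Y)" if g: "g \<in> carrier G" for g
    using assoc_mult_mat[OF X(1) Y cr[OF g]] assoc_mult_mat[OF X(1) cr'[OF g] Y] assoc_mult_mat[OF cr[OF g] X(1) Y]
      Yi[OF g] inter[OF g] by simp
  then obtain a where a: "X * Y = a \<cdot>\<^sub>m 1\<^sub>m n"
    using schur[OF irr(1) mult_carrier_mat[OF X(1) Y]] by blast
  have "Y * X * \<rho>' g = \<rho>' g * (Y * X)" if g: "g \<in> carrier G" for g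
    using assoc_mult_mat[OF Y X(1) cr'[OF g]] assoc_mult_mat[OF Y cr[OF g] X(1)] assoc_mult_mat[OF cr'[OF g] Y X(1)]
      Yi[OF g] inter[OF g] by simp
  then obtain b where b: "Y * X = b \<cdot>\<^sub>m 1\<^sub>m k"
    using schur[OF irr(2) mult_carrier_mat[OF Y X(1)]] by blast
  have tr: "mat_trace (X * Y) = gsize * X $$ (i, j)"
  proof -
    have c3: "\<rho>' h * Y0 * \<rho> (inv h) \<in> carrier_mat k n" if "h \<in> carrier G" for h
      using mult_carrier_mat[OF mult_carrier_mat[OF cr'[OF that] Y0] cr[OF inv_closed[OF that]]] .
    have "X * Y = msum n n (\<lambda>h. X * (\<rho>' h * Y0 * \<rho> (inv h))) (carrier G)"
      unfolding Y_def by (rule mult_msum[OF X(1) c3])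
    also have "mat_trace \<dots> = (\<Sum>h\<in>carrier G. mat_trace (X * (\<rho>' h * Y0 * \<rho> (inv h))))"
      by (rule mat_trace_msum'[OF mult_carrier_mat[OF X(1) c3]])
    also have "\<dots> = (\<Sum>h\<in>carrier G. mat_trace (X * Y0))"
    proof (rule sum.cong)
      fix h assume h: "h \<in> carrier G"
      have c: "\<rho>' h \<in> carrier_mat k k" "\<rho> (inv h) \<in> carrier_mat n n" "\<rho> h \<in> carrier_mat n n" using cr cr' h by auto
      have "X * (\<rho>' h * Y0 * \<rho> (inv h)) = \<rho> h * (X * Y0) * \<rho> (inv h)"
        using assoc_mult_mat[of X n k "\<rho>' h * Y0" n "\<rho> (inv h)" n] assoc_mult_mat[of X n k "\<rho>' h" k Y0 n]
          assoc_mult_mat[of "\<rho> h" n n X k Y0 n] inter[OF h] c X Y0 by simp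
      then show "mat_trace (X * (\<rho>' h * Y0 * \<rho> (inv h))) = mat_trace (X * Y0)"
        using mat_trace_conj[of "\<rho> h" n "X * Y0" "\<rho> (inv h)"] c X Y0 rep_inv[OF rep h] by simp
    qed simp
    also have "mat_trace (X * Y0) = (\<Sum>x<n. if x = i then X $$ (i, j) else 0)"
      unfolding mat_trace_mult[OF X(1) Y0]
    proof (rule sum.cong)
      fix x assume x: "x \<in> {..<n}"
      have "(\<Sum>y<k. X $$ (x, y) * Y0 $$ (y, x)) = (\<Sum>y<k. if y = j then (if x = i then X $$ (i, j) else 0) else 0)"
        using x by (intro sum.cong) (auto simp: Y0_def)
      then show "(\<Sum>y<k. X $$ (x, y) * Y0 $$ (y, x)) = (if x = i then X $$ (i, j) else 0)" using ij by simp
    qed simp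
    also have "\<dots> = X $$ (i, j)" using ij by simp
    finally show ?thesis by simp
  qed
  have tra: "mat_trace (X * Y) = a * of_nat n" using a by simp
  have a0: "a \<noteq> 0"
  proof
    assume "a = 0"
    then show False using tr tra ij gsize_nonzero by simp
  qed
  have "a \<cdot>\<^sub>m X = X * Y * X"
    unfolding a mult_smult_assoc_mat[OF one_carrier_mat X(1)] using X(1) by simp
  also have "\<dots> = b \<cdot>\<^sub>m X"
    unfolding assoc_mult_mat[OF X(1) Y X(1)] b mult_smult_distrib[OF X(1) one_carrier_mat] using X(1) by simp
  finally have "(a \<cdot>\<^sub>m X) $$ (i, j) = (b \<cdot>\<^sub>m X) $$ (i, j)" by simp
  then have ab: "a = b" using ij X by simp
  have "a * of_nat n = a * of_nat k" using mat_trace_comm[OF X(1) Y] tra b ab by simp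
  then have nk: "n = k" using a0 by simp
  show "\<exists>Y c. Y \<in> carrier_mat k n \<and> c \<noteq> 0 \<and> X * Y = c \<cdot>\<^sub>m 1\<^sub>m n \<and> Y * X = c \<cdot>\<^sub>m 1\<^sub>m k \<and> n = k"
    by (rule exI[of _ Y], rule exI[of _ a]) (use Y a0 a b ab nk in simp)
  fix g assume g: "g \<in> carrier G"
  have "a * mat_trace (\<rho> g) = mat_trace (\<rho> g * (X * Y))"
    unfolding a mult_smult_distrib[OF cr[OF g] one_carrier_mat] using mat_trace_smult cr[OF g] by simp
  also have "\<rho> g * (X * Y) = X * (\<rho>' g * Y)"
    using assoc_mult_mat[OF cr[OF g] X(1) Y] assoc_mult_mat[OF X(1) cr'[OF g] Y] inter[OF g] by simp
  also have "mat_trace \<dots> = mat_trace (\<rho>' g * Y * X)"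
    using cr'[OF g] by (intro mat_trace_comm[OF X(1)]) (simp add: Y mult_carrier_mat[OF _ Y])
  also have "\<rho>' g * Y * X = a \<cdot>\<^sub>m \<rho>' g"
    using assoc_mult_mat[OF cr'[OF g] Y X(1)] b ab mult_smult_distrib[OF cr'[OF g] one_carrier_mat] cr'[OF g] by simp
  also have "mat_trace \<dots> = a * mat_trace (\<rho>' g)" using mat_trace_smult cr'[OF g] by simp
  finally show "mat_trace (\<rho> g) = mat_trace (\<rho>' g)" using a0 by simp
qed

end

section \<open>Complete reducibility and multiplicities\<close>

context fin_group
begin

lemma compressed_representation:
  assumes rep: "representation G n \<rho>" and A: "A \<in> carrier_mat n k" and B: "B \<in> carrier_mat k n"
    and BA: "B * A = 1\<^sub>m k" and comm: "\<And>g. g \<in> carrier G \<Longrightarrow> A * B * \<rho> g = \<rho> g * (A * B)"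
  shows "representation G k (\<lambda>g. B * \<rho> g * A)"
    and "\<And>g. g \<in> carrier G \<Longrightarrow> mat_trace (B * \<rho> g * A) = mat_trace (A * B * \<rho> g)"
proof -
  note c = rep_carrier[OF rep]
  have AB: "A * B \<in> carrier_mat n n" using A B by simp
  show "representation G k (\<lambda>g. B * \<rho> g * A)"
  proof (rule representationI)
    fix g h assume g: "g \<in> carrier G" and h: "h \<in> carrier G"
    have Bg: "B * \<rho> g \<in> carrier_mat k n" and hA: "\<rho> h * A \<in> carrier_mat n k"
      using mult_carrier_mat[OF B c[OF g]] mult_carrier_mat[OF c[OF h] A] .
    have "(B * \<rho> g * A) * (B * \<rho> h * A) = B * \<rho> g * (A * (B * (\<rho> h * A)))"
      using assoc_mult_mat[OF Bg A mult_carrier_mat[OF B hA]] assoc_mult_mat[OF B c[OF h] A] by simp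
    also have "A * (B * (\<rho> h * A)) = A * B * \<rho> h * A"
      using assoc_mult_mat[OF A B hA] assoc_mult_mat[OF AB c[OF h] A] by simp
    also have "\<dots> = \<rho> h * (A * B) * A" using comm[OF h] by simp
    also have "\<dots> = \<rho> h * (A * (B * A))"
      using assoc_mult_mat[OF c[OF h] AB A] assoc_mult_mat[OF A B A] by simp
    also have "\<dots> = \<rho> h * A" using BA A by simp
    also have "B * \<rho> g * (\<rho> h * A) = B * (\<rho> g * \<rho> h) * A"
      using assoc_mult_mat[OF Bg c[OF h] A] assoc_mult_mat[OF B c[OF g] c[OF h]] by simp
    also have "\<rho> g * \<rho> h = \<rho> (g \<otimes> h)" using rep_mult[OF rep g h] by simp
    finally show "B * \<rho> (g \<otimes> h) * A = (B * \<rho> g * A) * (B * \<rho> h * A)" by simp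
  next
    fix g assume g: "g \<in> carrier G"
    show "B * \<rho> g * A \<in> carrier_mat k k"
      by (rule mult_carrier_mat[OF mult_carrier_mat[OF B c[OF g]] A])
  next
    show "B * \<rho> \<one> * A = 1\<^sub>m k" using rep_one[OF rep] A B BA by simp
  qed
  fix g assume g: "g \<in> carrier G"
  have "mat_trace (B * \<rho> g * A) = mat_trace (A * (B * \<rho> g))"
    by (rule mat_trace_comm[OF mult_carrier_mat[OF B c[OF g]] A])
  also have "A * (B * \<rho> g) = A * B * \<rho> g" using assoc_mult_mat[OF A B c[OF g]] by simp
  finally show "mat_trace (B * \<rho> g * A) = mat_trace (A * B * \<rho> g)" .
qed

text \<open>Maschke's argument. Every conjugate \<open>T h\<close> of a projection \<open>Q\<close>
  onto \<open>W\<close> again projects onto \<open>W\<close>, so \<open>Q * T h = T h\<close> and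
  \<open>T h * Q = Q\<close>. The average \<open>P\<close> inherits both relations, which make it
  idempotent and different from 0 and 1.\<close>

lemma invariant_projection:
  assumes rep: "representation G n \<rho>" and W: "VectorSpace.subspace class_ring W (module_vec TYPE(complex) n)"
    and inv: "\<And>g w. g \<in> carrier G \<Longrightarrow> w \<in> W \<Longrightarrow> \<rho> g *\<^sub>v w \<in> W"
    and ne: "W \<noteq> {0\<^sub>v n}" "W \<noteq> carrier_vec n"
  shows "\<exists>P\<in>carrier_mat n n. P * P = P \<and> P \<noteq> 0\<^sub>m n n \<and> P \<noteq> 1\<^sub>m n \<and> (\<forall>g\<in>carrier G. P * \<rho> g = \<rho> g * P)"
proof -
  note c = rep_carrier[OF rep] and Wd = subspaceD_vec[OF W]
  obtain Q where Q: "Q \<in> carrier_mat n n" and Qw: "\<And>w. w \<in> W \<Longrightarrow> Q *\<^sub>v w = w"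
      and QW: "\<And>v. v \<in> carrier_vec n \<Longrightarrow> Q *\<^sub>v v \<in> W"
    using subspace_projection[OF W] by (elim bexE conjE) simp
  define T where "T h = \<rho> h * Q * \<rho> (inv h)" for h
  have T: "T h \<in> carrier_mat n n" if "h \<in> carrier G" for h
    unfolding T_def using mult_carrier_mat[OF mult_carrier_mat[OF c[OF that] Q] c[OF inv_closed[OF that]]] .
  have Tv: "T h *\<^sub>v v = \<rho> h *\<^sub>v (Q *\<^sub>v (\<rho> (inv h) *\<^sub>v v))" if h: "h \<in> carrier G" and v: "v \<in> carrier_vec n" for h v
    unfolding T_def using assoc_mult_mat_vec[OF mult_carrier_mat[OF c[OF h] Q] c[OF inv_closed[OF h]] v]
      assoc_mult_mat_vec[OF c[OF h] Q mult_mat_vec_carrier[OF c[OF inv_closed[OF h]] v]] by simp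
  have QT: "Q * T h = T h" if h: "h \<in> carrier G" for h
  proof (rule mat_eq_of_mult_vec_eq[OF mult_carrier_mat[OF Q T[OF h]] T[OF h]])
    fix v :: "complex vec" assume v: "v \<in> carrier_vec n"
    have "T h *\<^sub>v v \<in> W" unfolding Tv[OF h v]
      by (intro inv h QW mult_mat_vec_carrier[OF c[OF inv_closed[OF h]] v])
    then show "Q * T h *\<^sub>v v = T h *\<^sub>v v" using assoc_mult_mat_vec[OF Q T[OF h] v] Qw by simp
  qed
  have TQ: "T h * Q = Q" if h: "h \<in> carrier G" for h
  proof (rule mat_eq_of_mult_vec_eq[OF mult_carrier_mat[OF T[OF h] Q] Q])
    fix v :: "complex vec" assume v: "v \<in> carrier_vec n"
    note Qv = mult_mat_vec_carrier[OF Q v]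
    have "\<rho> (inv h) *\<^sub>v (Q *\<^sub>v v) \<in> W" by (intro inv inv_closed h QW v)
    then have "T h *\<^sub>v (Q *\<^sub>v v) = \<rho> h *\<^sub>v (\<rho> (inv h) *\<^sub>v (Q *\<^sub>v v))" using Tv[OF h Qv] Qw by simp
    also have "\<dots> = Q *\<^sub>v v"
      using assoc_mult_mat_vec[OF c[OF h] c[OF inv_closed[OF h]] Qv] rep_inv(1)[OF rep h] Qv by simp
    finally show "T h * Q *\<^sub>v v = Q *\<^sub>v v" using assoc_mult_mat_vec[OF T[OF h] Q v] by simp
  qed
  define S where "S = msum n n T (carrier G)"
  define P where "P = (1 / gsize) \<cdot>\<^sub>m S"
  have S: "S \<in> carrier_mat n n" by (simp add: S_def)
  have P: "P \<in> carrier_mat n n" using S by (simp add: P_def)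
  have "Q * S = msum n n (\<lambda>h. Q * T h) (carrier G)" unfolding S_def by (rule mult_msum[OF Q]) (rule T)
  also have "\<dots> = S" unfolding S_def by (rule msum_cong) (simp_all add: QT)
  finally have QS: "Q * S = S" .
  have "S * Q = msum n n (\<lambda>h. T h * Q) (carrier G)" unfolding S_def by (rule msum_mult[OF Q]) (rule T)
  also have "\<dots> = msum n n (\<lambda>h. 1 \<cdot>\<^sub>m Q) (carrier G)"
    by (rule msum_cong) (use Q in \<open>auto simp: TQ\<close>)
  also have "\<dots> = gsize \<cdot>\<^sub>m Q" by (subst msum_smult[OF Q]) simp
  finally have SQ: "S * Q = gsize \<cdot>\<^sub>m Q" .
  have QP: "Q * P = P" unfolding P_def mult_smult_distrib[OF Q S] QS ..
  have PQ: "P * Q = Q" unfolding P_def mult_smult_assoc_mat[OF S Q] SQ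
    using gsize_nonzero Q by (intro eq_matI) auto
  have "P * P = P * (Q * P)" using QP by simp
  also have "\<dots> = P" using assoc_mult_mat[OF P Q P] PQ QP by simp
  finally have PP: "P * P = P" .
  have P0: "P \<noteq> 0\<^sub>m n n"
  proof
    assume "P = 0\<^sub>m n n"
    then have Q0: "Q = 0\<^sub>m n n" using PQ Q by simp
    have "w \<in> {0\<^sub>v n}" if "w \<in> W" for w
    proof -
      have "w \<in> carrier_vec n" using that Wd(1) by (rule subsetD[rotated])
      then have "0\<^sub>m n n *\<^sub>v w = 0\<^sub>v n" by (intro eq_vecI) auto
      then show ?thesis using Qw[OF that] unfolding Q0 by simp
    qed
    then have "W \<subseteq> {0\<^sub>v n}" by (rule subsetI)
    then have "W = {0\<^sub>v n}" using Wd(2) by (intro equalityI) simp_all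
    then show False using ne(1) by simp
  qed
  have P1: "P \<noteq> 1\<^sub>m n"
  proof
    assume "P = 1\<^sub>m n"
    then have "Q = 1\<^sub>m n" using QP Q by simp
    then have "v \<in> W" if "v \<in> carrier_vec n" for v using QW[OF that] that by simp
    then have "carrier_vec n \<subseteq> W" by (rule subsetI)
    then have "W = carrier_vec n" using Wd(1) by (intro equalityI)
    then show False using ne(2) by simp
  qed
  have "P * \<rho> g = \<rho> g * P" if g: "g \<in> carrier G" for g
    unfolding P_def mult_smult_assoc_mat[OF S c[OF g]] mult_smult_distrib[OF c[OF g] S]
    using average_intertwines[OF rep rep Q g] unfolding S_def T_def[abs_def] by simp
  then show ?thesis using P PP P0 P1 by (intro bexI[of _ P] conjI ballI)
qed

lemma irr_decomposition_add:
  assumes "irr_decomposition G \<chi> m" "irr_decomposition G \<chi>' m'"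
    and eq: "\<And>g. g \<in> carrier G \<Longrightarrow> \<psi> g = \<chi> g + \<chi>' g"
  shows "irr_decomposition G \<psi> (\<lambda>\<xi>. m \<xi> + m' \<xi>)"
proof -
  define F F' where "F = {\<xi>. m \<xi> \<noteq> 0}" and "F' = {\<xi>. m' \<xi> \<noteq> 0}"
  have F: "finite F" "F \<subseteq> Irr G" "\<And>g. g \<in> carrier G \<Longrightarrow> \<chi> g = (\<Sum>\<xi>\<in>F. of_nat (m \<xi>) * \<xi> g)"
    and F': "finite F'" "F' \<subseteq> Irr G" "\<And>g. g \<in> carrier G \<Longrightarrow> \<chi>' g = (\<Sum>\<xi>\<in>F'. of_nat (m' \<xi>) * \<xi> g)"
    using assms(1,2) by (simp_all add: irr_decomposition_def F_def F'_def)
  have U: "{\<xi>. m \<xi> + m' \<xi> \<noteq> 0} = F \<union> F'" by (auto simp: F_def F'_def)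
  have "\<psi> g = (\<Sum>\<xi>\<in>F \<union> F'. of_nat (m \<xi> + m' \<xi>) * \<xi> g)" if g: "g \<in> carrier G" for g
  proof -
    have "(\<Sum>\<xi>\<in>F \<union> F'. of_nat (m \<xi> + m' \<xi>) * \<xi> g)
        = (\<Sum>\<xi>\<in>F \<union> F'. of_nat (m \<xi>) * \<xi> g) + (\<Sum>\<xi>\<in>F \<union> F'. of_nat (m' \<xi>) * \<xi> g)"
      by (simp add: distrib_right sum.distrib)
    also have "(\<Sum>\<xi>\<in>F \<union> F'. of_nat (m \<xi>) * \<xi> g) = (\<Sum>\<xi>\<in>F. of_nat (m \<xi>) * \<xi> g)"
      using F(1) F'(1) by (intro sum.mono_neutral_right) (auto simp: F_def)
    also have "(\<Sum>\<xi>\<in>F \<union> F'. of_nat (m' \<xi>) * \<xi> g) = (\<Sum>\<xi>\<in>F'. of_nat (m' \<xi>) * \<xi> g)"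
      using F(1) F'(1) by (intro sum.mono_neutral_right) (auto simp: F'_def)
    finally show ?thesis using eq[OF g] F(3)[OF g] F'(3)[OF g] by simp
  qed
  then show ?thesis unfolding irr_decomposition_def U using F F' by simp
qed

lemma sum_trace_inverse:
  assumes irr: "irreducible_representation G n \<rho>"
  shows "(\<Sum>h\<in>carrier G. mat_trace (\<rho> h) * mat_trace (\<rho> (inv h))) = gsize"
proof -
  note c = rep_carrier[OF irrepD[OF irr]]
  have "(\<Sum>h\<in>carrier G. mat_trace (\<rho> h) * mat_trace (\<rho> (inv h)))
      = (\<Sum>h\<in>carrier G. mat_trace (\<rho> (inv h) * 1\<^sub>m n) * mat_trace (1\<^sub>m n * \<rho> h))"
    using c by (intro sum.cong) (simp_all add: right_mult_one_mat[OF c] left_mult_one_mat[OF c])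
  also have "\<dots> = gsize / of_nat n * mat_trace (1\<^sub>m n * 1\<^sub>m n)" by (rule sum_trace_trace[OF irr]) simp_all
  also have "\<dots> = gsize" using irrep_pos[OF irr] by simp
  finally show ?thesis .
qed

text \<open>Averages of matrix units are intertwiners. If all of them vanish, then so do the sums of
  products of diagonal coefficients, which add up to the product of the two traces.\<close>

lemma sum_trace_zero_or_intertwiner:
  assumes rep: "representation G n \<rho>" "representation G k \<rho>'"
  shows "(\<Sum>h\<in>carrier G. mat_trace (\<rho> h) * mat_trace (\<rho>' (inv h))) = 0 \<or>
    (\<exists>X\<in>carrier_mat n k. X \<noteq> 0\<^sub>m n k \<and> (\<forall>g\<in>carrier G. \<rho> g * X = X * \<rho>' g))"
proof (rule disjCI)
  assume no: "\<not> (\<exists>X\<in>carrier_mat n k. X \<noteq> 0\<^sub>m n k \<and> (\<forall>g\<in>carrier G. \<rho> g * X = X * \<rho>' g))"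
  note c = rep_carrier[OF rep(1)] and c' = rep_carrier[OF rep(2)]
  have zero: "(\<Sum>h\<in>carrier G. \<rho> h $$ (i, i) * \<rho>' (inv h) $$ (j, j)) = 0" if ij: "i < n" "j < k" for i j
  proof -
    define X where "X = mat n k (\<lambda>(x, y). if x = i \<and> y = j then 1 else 0 :: complex)"
    have X: "X \<in> carrier_mat n k" by (simp add: X_def)
    define A where "A = msum n k (\<lambda>h. \<rho> h * X * \<rho>' (inv h)) (carrier G)"
    have "\<forall>g\<in>carrier G. \<rho> g * A = A * \<rho>' g"
      unfolding A_def by (intro ballI average_intertwines[OF rep X])
    moreover have "A \<in> carrier_mat n k" by (simp add: A_def)
    ultimately have "A = 0\<^sub>m n k" using no by blast
    then have "A $$ (i, j) = 0" using ij by simp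
    moreover have "A $$ (i, j) = (\<Sum>h\<in>carrier G. \<rho> h $$ (i, i) * \<rho>' (inv h) $$ (j, j))"
      unfolding A_def X_def msum_index[OF ij]
      by (intro sum.cong refl mult_unit_mult_index c c' inv_closed ij)
    ultimately show ?thesis by simp
  qed
  have "(\<Sum>h\<in>carrier G. mat_trace (\<rho> h) * mat_trace (\<rho>' (inv h)))
      = (\<Sum>h\<in>carrier G. \<Sum>i<n. \<Sum>j<k. \<rho> h $$ (i, i) * \<rho>' (inv h) $$ (j, j))"
    by (intro sum.cong) (simp_all add: mat_trace_carrier[OF c] mat_trace_carrier[OF c'] sum_product)
  also have "\<dots> = (\<Sum>i<n. \<Sum>j<k. \<Sum>h\<in>carrier G. \<rho> h $$ (i, i) * \<rho>' (inv h) $$ (j, j))"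
    by (subst sum.swap, rule sum.cong, simp, rule sum.swap)
  also have "\<dots> = 0" using zero by simp
  finally show "(\<Sum>h\<in>carrier G. mat_trace (\<rho> h) * mat_trace (\<rho>' (inv h))) = 0" .
qed

lemma intertwiner_exists:
  assumes irr: "irreducible_representation G n \<rho>" "irreducible_representation G k \<rho>'"
    and tr: "\<And>g. g \<in> carrier G \<Longrightarrow> mat_trace (\<rho> g) = mat_trace (\<rho>' g)"
  shows "\<exists>X\<in>carrier_mat n k. X \<noteq> 0\<^sub>m n k \<and> (\<forall>g\<in>carrier G. \<rho> g * X = X * \<rho>' g)"
  using sum_trace_zero_or_intertwiner[OF irrepD[OF irr(1)] irrepD[OF irr(2)]] sum_trace_inverse[OF irr(1)]
    gsize_nonzero by (simp add: tr)

text \<open>The inner product uses the value at the inverse in place of the complex conjugate, so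
  unitarity never enters.\<close>

lemma Irr_orthonormal:
  assumes "\<xi> \<in> Irr G" "\<xi>' \<in> Irr G"
  shows "(\<Sum>h\<in>carrier G. \<xi> h * \<xi>' (inv h)) = (if \<xi> = \<xi>' then gsize else 0)"
proof -
  obtain n \<rho> where irr: "irreducible_representation G n \<rho>" and \<xi>: "\<xi> = (\<lambda>g\<in>carrier G. mat_trace (\<rho> g))"
    using assms(1) by (auto simp: Irr_def affords_def)
  obtain k \<rho>' where irr': "irreducible_representation G k \<rho>'" and \<xi>': "\<xi>' = (\<lambda>g\<in>carrier G. mat_trace (\<rho>' g))"
    using assms(2) by (auto simp: Irr_def affords_def)
  show ?thesis
  proof (cases "\<xi> = \<xi>'")
    case True
    then show ?thesis using sum_trace_inverse[OF irr] by (simp add: True[symmetric]) (simp add: \<xi>)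
  next
    case False
    have "(\<Sum>h\<in>carrier G. mat_trace (\<rho> h) * mat_trace (\<rho>' (inv h))) = 0"
    proof (rule ccontr)
      assume "\<not> ?thesis"
      then obtain X where X: "X \<in> carrier_mat n k" "X \<noteq> 0\<^sub>m n k" and int: "\<forall>g\<in>carrier G. \<rho> g * X = X * \<rho>' g"
        using sum_trace_zero_or_intertwiner[OF irrepD[OF irr] irrepD[OF irr']] by blast
      have "mat_trace (\<rho> g) = mat_trace (\<rho>' g)" if "g \<in> carrier G" for g
        by (rule trace_eq_of_intertwiner(2)[OF irr irr' X _ that]) (rule bspec[OF int])
      then have "\<xi> = \<xi>'" unfolding \<xi> \<xi>' by (intro restrict_ext)
      then show False using False by simp
    qed
    then show ?thesis using False by (simp add: \<xi> \<xi>')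
  qed
qed

lemma irr_decomposition_coeff:
  assumes d: "irr_decomposition G \<chi> m" and \<xi>: "\<xi> \<in> Irr G"
  shows "(\<Sum>h\<in>carrier G. \<chi> h * \<xi> (inv h)) = of_nat (m \<xi>) * gsize"
proof -
  define F where "F = {\<xi>. m \<xi> \<noteq> 0}"
  have F: "finite F" "F \<subseteq> Irr G" "\<And>g. g \<in> carrier G \<Longrightarrow> \<chi> g = (\<Sum>\<xi>\<in>F. of_nat (m \<xi>) * \<xi> g)"
    using d by (simp_all add: irr_decomposition_def F_def)
  have "(\<Sum>h\<in>carrier G. \<chi> h * \<xi> (inv h)) = (\<Sum>h\<in>carrier G. \<Sum>\<xi>'\<in>F. of_nat (m \<xi>') * (\<xi>' h * \<xi> (inv h)))"
    by (intro sum.cong) (simp_all add: F(3) sum_distrib_right mult.assoc)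
  also have "\<dots> = (\<Sum>\<xi>'\<in>F. of_nat (m \<xi>') * (\<Sum>h\<in>carrier G. \<xi>' h * \<xi> (inv h)))"
    by (subst sum.swap) (simp add: sum_distrib_left)
  also have "\<dots> = (\<Sum>\<xi>'\<in>F. if \<xi>' = \<xi> then of_nat (m \<xi>') * gsize else 0)"
    using F(2) \<xi> by (intro sum.cong) (auto simp: Irr_orthonormal)
  also have "\<dots> = of_nat (m \<xi>) * gsize" using F(1) by (simp add: F_def)
  finally show ?thesis .
qed

text \<open>The inner products with irreducible characters determine every coefficient of a
  decomposition, so the choice in \<open>irr_mult\<close> has only one candidate. Parities can then
  be read off any explicit decomposition.\<close>

lemma irr_mult_eq:
  assumes d: "irr_decomposition G \<chi> m"
  shows "irr_mult G \<chi> = m"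
proof -
  have "m' = m" if d': "irr_decomposition G \<chi> m'" for m'
  proof
    fix \<xi>
    show "m' \<xi> = m \<xi>"
    proof (cases "\<xi> \<in> Irr G")
      case True
      have "of_nat (m' \<xi>) * gsize = of_nat (m \<xi>) * gsize"
        using irr_decomposition_coeff[OF d True] irr_decomposition_coeff[OF d' True] by simp
      then show ?thesis using gsize_nonzero by (simp only: mult_cancel_right of_nat_eq_iff) simp
    next
      case False
      then show ?thesis using d d' unfolding irr_decomposition_def by (metis (mono_tags, lifting) mem_Collect_eq subsetD)
    qed
  qed
  then show ?thesis unfolding irr_mult_def using d by (intro some_equality) 
qed

lemma irr_decomposition_exists:
  assumes "representation G n \<rho>"
  shows "\<exists>m. irr_decomposition G (\<lambda>g\<in>carrier G. mat_trace (\<rho> g)) m"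
  using assms
proof (induction n arbitrary: \<rho> rule: less_induct)
  case (less n)
  note rep = less.prems
  note c = rep_carrier[OF rep]
  consider "n = 0" | "irreducible_representation G n \<rho>" | "n > 0" "\<not> irreducible_representation G n \<rho>" by blast
  then show ?case
  proof cases
    case 1
    \<comment> \<open>Degree 0 does occur: the smaller eigenspace of \<open>zed\<close> vanishes
      when \<open>deg = 1\<close>.\<close>
    have "mat_trace (\<rho> g) = 0" if "g \<in> carrier G" for g
      using c[OF that] 1 by (simp add: mat_trace_def)
    then show ?thesis by (intro exI[of _ "\<lambda>_. 0"]) (simp add: irr_decomposition_def)
  next
    case 2
    define \<xi> where "\<xi> = (\<lambda>g\<in>carrier G. mat_trace (\<rho> g))"
    have "\<xi> \<in> Irr G" using 2 rep by (auto simp: Irr_def affords_def \<xi>_def)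
    moreover have "{\<xi>'. (if \<xi>' = \<xi> then 1 else 0 :: nat) \<noteq> 0} = {\<xi>}" by auto
    ultimately have *: "irr_decomposition G \<xi> (\<lambda>\<xi>'. if \<xi>' = \<xi> then 1 else 0)"
      by (simp add: irr_decomposition_def)
    show ?thesis unfolding \<xi>_def[symmetric] by (rule exI, rule *)
  next
    case 3
    then obtain W where W: "VectorSpace.subspace class_ring W (module_vec TYPE(complex) n)"
        "\<forall>g\<in>carrier G. \<forall>w\<in>W. \<rho> g *\<^sub>v w \<in> W" "W \<noteq> {0\<^sub>v n}" "W \<noteq> carrier_vec n"
      using rep unfolding irreducible_representation_def by blast
    obtain P where P: "P \<in> carrier_mat n n" "P * P = P" "P \<noteq> 0\<^sub>m n n" "P \<noteq> 1\<^sub>m n"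
        and Pc: "\<And>g. g \<in> carrier G \<Longrightarrow> P * \<rho> g = \<rho> g * P"
    proof -
      have "\<exists>P\<in>carrier_mat n n. P * P = P \<and> P \<noteq> 0\<^sub>m n n \<and> P \<noteq> 1\<^sub>m n \<and> (\<forall>g\<in>carrier G. P * \<rho> g = \<rho> g * P)"
        by (rule invariant_projection[OF rep W(1) _ W(3,4)]) (use W(2) in simp)
      then show thesis using that by (elim bexE conjE) simp
    qed
    define P' where "P' = 1\<^sub>m n - P"
    have P': "P' \<in> carrier_mat n n" using P(1) unfolding P'_def by (intro minus_carrier_mat)
    have P'P': "P' * P' = P'"
    proof -
      have "P' * P' = P' * 1\<^sub>m n - P' * P"
        by (subst (2) P'_def) (rule mult_minus_distrib_mat[OF P' one_carrier_mat P(1)])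
      also have "P' * P = 1\<^sub>m n * P - P * P"
        unfolding P'_def by (rule minus_mult_distrib_mat[OF one_carrier_mat P(1) P(1)])
      finally show ?thesis using P P' by (intro eq_matI) auto
    qed
    have P'c: "P' * \<rho> g = \<rho> g * P'" if g: "g \<in> carrier G" for g
      unfolding P'_def minus_mult_distrib_mat[OF one_carrier_mat P(1) c[OF g]]
        mult_minus_distrib_mat[OF c[OF g] one_carrier_mat P(1)] using Pc[OF g] c[OF g] by simp
    obtain k A B where A: "A \<in> carrier_mat n k" and B: "B \<in> carrier_mat k n" and AB: "A * B = P" and BA: "B * A = 1\<^sub>m k"
      using idempotent_factorization[OF P(1,2)] by (elim exE conjE)
    obtain k' A' B' where A': "A' \<in> carrier_mat n k'" and B': "B' \<in> carrier_mat k' n" and AB': "A' * B' = P'" and BA': "B' * A' = 1\<^sub>m k'"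
      using idempotent_factorization[OF P' P'P'] by (elim exE conjE)
    have tr: "mat_trace P = of_nat k" "mat_trace P' = of_nat k'"
      using mat_trace_comm[OF A B] mat_trace_comm[OF A' B'] AB BA AB' BA' by simp_all
    have "mat_trace P' = of_nat n - mat_trace P"
      unfolding P'_def using mat_trace_minus[OF one_carrier_mat P(1)] by simp
    then have "of_nat k' = (of_nat n - of_nat k :: complex)" unfolding tr .
    then have "of_nat (k + k') = (of_nat n :: complex)" by simp
    then have kk: "k + k' = n" by (simp only: of_nat_eq_iff)
    have "k \<noteq> 0"
    proof
      assume k: "k = 0"
      then have "P = 0\<^sub>m n n" unfolding AB[symmetric] using A B by (intro eq_matI) (auto simp: scalar_prod_def)
      then show False using P(3) by simp
    qed
    moreover have "k' \<noteq> 0"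
    proof
      assume k: "k' = 0"
      then have "P' = 0\<^sub>m n n" unfolding AB'[symmetric] using A' B' by (intro eq_matI) (auto simp: scalar_prod_def)
      then have "P = 1\<^sub>m n" 
      proof -
        have "P = 1\<^sub>m n - P'" using P(1) by (intro eq_matI) (auto simp: P'_def)
        then show ?thesis using \<open>P' = 0\<^sub>m n n\<close> by (intro eq_matI) auto
      qed
      then show False using P(4) by simp
    qed
    ultimately have lt: "k < n" "k' < n" using kk by auto
    have r1: "representation G k (\<lambda>g. B * \<rho> g * A)"
      by (rule compressed_representation(1)[OF rep A B BA]) (unfold AB, rule Pc)
    have t1: "mat_trace (B * \<rho> g * A) = mat_trace (P * \<rho> g)" if "g \<in> carrier G" for g
      unfolding AB[symmetric] by (rule compressed_representation(2)[OF rep A B BA _ that]) (unfold AB, rule Pc)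
    have r2: "representation G k' (\<lambda>g. B' * \<rho> g * A')"
      by (rule compressed_representation(1)[OF rep A' B' BA']) (unfold AB', rule P'c)
    have t2: "mat_trace (B' * \<rho> g * A') = mat_trace (P' * \<rho> g)" if "g \<in> carrier G" for g
      unfolding AB'[symmetric] by (rule compressed_representation(2)[OF rep A' B' BA' _ that]) (unfold AB', rule P'c)
    obtain m1 where m1: "irr_decomposition G (\<lambda>g\<in>carrier G. mat_trace (B * \<rho> g * A)) m1"
      using less.IH[OF lt(1) r1] by (elim exE)
    obtain m2 where m2: "irr_decomposition G (\<lambda>g\<in>carrier G. mat_trace (B' * \<rho> g * A')) m2"
      using less.IH[OF lt(2) r2] by (elim exE)
    have sum: "mat_trace (\<rho> g) = mat_trace (B * \<rho> g * A) + mat_trace (B' * \<rho> g * A')" if g: "g \<in> carrier G" for g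
    proof -
      have "P' * \<rho> g = \<rho> g - P * \<rho> g"
        unfolding P'_def using minus_mult_distrib_mat[OF one_carrier_mat P(1) c[OF g]] c[OF g] by simp
      then have "mat_trace (P' * \<rho> g) = mat_trace (\<rho> g) - mat_trace (P * \<rho> g)"
        using mat_trace_minus[OF c[OF g] mult_carrier_mat[OF P(1) c[OF g]]] by simp
      then show ?thesis using t1[OF g] t2[OF g] by simp
    qed
    show ?thesis
      by (rule exI, rule irr_decomposition_add[OF m1 m2]) (simp add: sum)
  qed
qed

end

section \<open>Heisenberg matrices of an alternating form\<close>

lemma one_smult_mat: "(1 :: complex) \<cdot>\<^sub>m A = A"
  by (rule eq_matI) auto

lemma smult_smult_mat: "k \<cdot>\<^sub>m (l \<cdot>\<^sub>m A) = (k * l) \<cdot>\<^sub>m (A :: complex mat)"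
  by (rule eq_matI) auto

lemma ex1_unique: "\<exists>!i. P i \<Longrightarrow> P a \<Longrightarrow> P b \<Longrightarrow> a = b"
  by blast

locale alternating_form = fin_comm_group E for E (structure) +
  fixes \<beta> :: "'a \<Rightarrow> 'a \<Rightarrow> complex"
  assumes \<beta>_mult: "\<And>x y z. x \<in> carrier E \<Longrightarrow> y \<in> carrier E \<Longrightarrow> z \<in> carrier E \<Longrightarrow> \<beta> (x \<otimes> y) z = \<beta> x z * \<beta> y z"
    and \<beta>_anti: "\<And>x y. x \<in> carrier E \<Longrightarrow> y \<in> carrier E \<Longrightarrow> \<beta> x y * \<beta> y x = 1"
    and \<beta>_self: "\<And>x. x \<in> carrier E \<Longrightarrow> \<beta> x x = 1"
    and nondegenerate: "\<And>x. x \<in> carrier E \<Longrightarrow> (\<And>y. y \<in> carrier E \<Longrightarrow> \<beta> x y = 1) \<Longrightarrow> x = \<one>"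
    and odd_order: "odd (card (carrier E))"
begin

lemma \<beta>_nz: "x \<in> carrier E \<Longrightarrow> y \<in> carrier E \<Longrightarrow> \<beta> x y \<noteq> 0"
  using \<beta>_anti[of x y] by (metis mult_zero_left zero_neq_one)

lemma \<beta>_flip: "x \<in> carrier E \<Longrightarrow> y \<in> carrier E \<Longrightarrow> \<beta> x y = 1 / \<beta> y x"
  using \<beta>_anti[of x y] \<beta>_nz[of y x] by (simp add: eq_divide_eq)

lemma \<beta>_mult_right:
  assumes "x \<in> carrier E" "y \<in> carrier E" "z \<in> carrier E"
  shows "\<beta> x (y \<otimes> z) = \<beta> x y * \<beta> x z"
  using \<beta>_flip[of x "y \<otimes> z"] \<beta>_flip[of x y] \<beta>_flip[of x z] \<beta>_mult[of y z x] assms by simp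

lemma \<beta>_one_left: "y \<in> carrier E \<Longrightarrow> \<beta> \<one> y = 1"
  using \<beta>_mult[of \<one> \<one> y] \<beta>_nz[of \<one> y] by simp

lemma \<beta>_one_right: "y \<in> carrier E \<Longrightarrow> \<beta> y \<one> = 1"
  using \<beta>_flip[of y \<one>] by (simp add: \<beta>_one_left)

lemma \<beta>_inv_left: "x \<in> carrier E \<Longrightarrow> y \<in> carrier E \<Longrightarrow> \<beta> (inv x) y = 1 / \<beta> x y"
  using \<beta>_mult[of "inv x" x y] \<beta>_nz[of x y] by (simp add: \<beta>_one_left l_inv eq_divide_eq)

lemma \<beta>_inv_right: "x \<in> carrier E \<Longrightarrow> y \<in> carrier E \<Longrightarrow> \<beta> x (inv y) = 1 / \<beta> x y"
  using \<beta>_flip[of x "inv y"] \<beta>_flip[of x y] by (simp add: \<beta>_inv_left \<beta>_nz)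

lemmas \<beta>_simps = \<beta>_mult \<beta>_mult_right \<beta>_one_left \<beta>_one_right \<beta>_inv_left \<beta>_inv_right

lemma \<beta>_pow_left: "x \<in> carrier E \<Longrightarrow> y \<in> carrier E \<Longrightarrow> \<beta> (x [^] (k :: nat)) y = \<beta> x y ^ k"
  by (rule hom_pow) (simp_all add: \<beta>_simps)

lemma \<beta>_pow_card: "x \<in> carrier E \<Longrightarrow> y \<in> carrier E \<Longrightarrow> \<beta> x y ^ card (carrier E) = 1"
  using \<beta>_pow_left[of x y "card (carrier E)"] by (simp add: pow_card \<beta>_one_left)

lemma halve: 
  assumes "x \<in> carrier E"
  shows "(x \<otimes> x) [^] ((card (carrier E) + 1) div 2) = x"
proof -
  have "2 * ((card (carrier E) + 1) div 2) = card (carrier E) + 1"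
    using odd_order by (intro dvd_mult_div_cancel) simp
  moreover have "x \<otimes> x = x [^] (2 :: nat)" using assms by (simp add: numeral_2_eq_2)
  ultimately have "(x \<otimes> x) [^] ((card (carrier E) + 1) div 2) = x [^] (card (carrier E) + 1)"
    using assms by (simp only: nat_pow_pow)
  also have "\<dots> = x" using assms pow_card by (simp add: nat_pow_mult[symmetric])
  finally show ?thesis .
qed

lemma \<beta>_sq_eq_1:
  assumes "x \<in> carrier E" "y \<in> carrier E" "\<beta> x y * \<beta> x y = 1"
  shows "\<beta> x y = 1"
proof -
  have "\<beta> x y = \<beta> ((x \<otimes> x) [^] ((card (carrier E) + 1) div 2)) y" unfolding halve[OF assms(1)] ..
  also have "\<dots> = (\<beta> x y * \<beta> x y) ^ ((card (carrier E) + 1) div 2)"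
    using assms(1,2) \<beta>_pow_left[of "x \<otimes> x" y] by (simp only: \<beta>_mult m_closed)
  finally show ?thesis using assms(3) by simp
qed

lemma nondegenerate_witness:
  assumes "x \<in> carrier E" "x \<noteq> \<one>"
  shows "\<exists>y\<in>carrier E. \<beta> x y \<noteq> 1"
proof (rule ccontr)
  assume "\<not> ?thesis"
  then have "\<beta> x y = 1" if "y \<in> carrier E" for y using that by simp
  then have "x = \<one>" by (rule nondegenerate[OF assms(1)])
  then show False using assms(2) by simp
qed

lemma sum_\<beta>:
  assumes x: "x \<in> carrier E"
  shows "(\<Sum>y\<in>carrier E. \<beta> x y) = (if x = \<one> then of_nat (card (carrier E)) else 0)"
proof (cases "x = \<one>")
  case True
  have "(\<Sum>y\<in>carrier E. \<beta> x y) = (\<Sum>y\<in>carrier E. 1)"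
    unfolding True by (intro sum.cong refl \<beta>_one_left)
  then show ?thesis using True by simp
next
  case False
  obtain y where "y \<in> carrier E" "\<beta> x y \<noteq> 1" using nondegenerate_witness[OF x False] by (elim bexE)
  then have "(\<Sum>y\<in>carrier E. \<beta> x y) = 0"
    using x by (intro sum_hom_zero[of "\<beta> x" y] \<beta>_mult_right)
  then show ?thesis using False by simp
qed

text \<open>A maximal totally isotropic set coincides with its orthogonal complement.\<close>

lemma lagrangian_exists:
  "\<exists>A. A \<subseteq> carrier E \<and> (\<forall>x\<in>carrier E. x \<in> A \<longleftrightarrow> (\<forall>a\<in>A. \<beta> a x = 1))"
proof -
  define I where "I = {A. A \<subseteq> carrier E \<and> (\<forall>a\<in>A. \<forall>b\<in>A. \<beta> a b = 1)}"
  have fin: "finite I" by (rule finite_subset[of _ "Pow (carrier E)"]) (auto simp: I_def finite_E)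
  have "{} \<in> I" by (simp add: I_def)
  then have "I \<noteq> {}" by auto
  from finite_has_maximal[OF fin this] obtain A where A: "A \<in> I" "\<forall>B\<in>I. A \<subseteq> B \<longrightarrow> A = B" by (elim bexE)
  have AE: "A \<subseteq> carrier E" and iso: "\<And>a b. a \<in> A \<Longrightarrow> b \<in> A \<Longrightarrow> \<beta> a b = 1" using A(1) by (auto simp: I_def)
  have "x \<in> A" if x: "x \<in> carrier E" "\<forall>a\<in>A. \<beta> a x = 1" for x
  proof -
    have "\<beta> x a = 1" if "a \<in> A" for a using \<beta>_flip[of x a] x that AE by (simp add: subsetD)
    then have "insert x A \<in> I" using AE x iso by (simp add: I_def \<beta>_self)
    then have "A = insert x A" using A(2) by (meson subset_insertI)
    then show ?thesis by auto
  qed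
  then show ?thesis using AE iso by (intro exI[of _ A] conjI ballI iffI) simp_all
qed

definition lagr :: "'a set" where
  "lagr = (SOME A. A \<subseteq> carrier E \<and> (\<forall>x\<in>carrier E. x \<in> A \<longleftrightarrow> (\<forall>a\<in>A. \<beta> a x = 1)))"

definition deg :: nat where "deg = card lagr"

lemma lagr_sub: "lagr \<subseteq> carrier E"
  and lagr_iff: "x \<in> carrier E \<Longrightarrow> x \<in> lagr \<longleftrightarrow> (\<forall>a\<in>lagr. \<beta> a x = 1)"
  using someI_ex[OF lagrangian_exists] unfolding lagr_def[symmetric] by simp_all

lemma lagr_closed: "x \<in> lagr \<Longrightarrow> x \<in> carrier E"
  using lagr_sub by (rule subsetD)

lemma lagr_\<beta>: "x \<in> lagr \<Longrightarrow> y \<in> lagr \<Longrightarrow> \<beta> x y = 1"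
  using lagr_iff[of y] lagr_closed[of y] by simp

lemma lagr_mult: "x \<in> lagr \<Longrightarrow> y \<in> lagr \<Longrightarrow> x \<otimes> y \<in> lagr"
  using lagr_iff[of "x \<otimes> y"] by (simp add: \<beta>_simps lagr_closed lagr_\<beta>)

lemma lagr_inv: "x \<in> lagr \<Longrightarrow> inv x \<in> lagr"
  using lagr_iff[of "inv x"] by (simp add: \<beta>_simps lagr_closed lagr_\<beta>)

lemma lagr_one: "\<one> \<in> lagr"
  using lagr_iff[of \<one>] by (simp add: \<beta>_simps lagr_closed)

lemma lagr_subgroup: "subgroup lagr E"
  by (intro subgroup.intro lagr_sub lagr_mult lagr_inv lagr_one)

lemma lagr_pow: "x \<in> lagr \<Longrightarrow> x [^] (k :: nat) \<in> lagr"
  by (induction k) (simp_all add: lagr_one lagr_mult)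

lemma lagr_sq: "x \<in> carrier E \<Longrightarrow> x \<otimes> x \<in> lagr \<Longrightarrow> x \<in> lagr"
  using lagr_pow[of "x \<otimes> x" "(card (carrier E) + 1) div 2"] by (simp only: halve)

lemma finite_lagr: "finite lagr"
  using finite_E lagr_sub by (rule finite_subset[rotated])

lemma deg_pos: "deg > 0"
  using finite_lagr lagr_one by (auto simp: deg_def card_gt_0_iff)

lemma lagr_shift: "a \<in> lagr \<Longrightarrow> bij_betw (\<lambda>x. a \<otimes> x) lagr lagr"
proof (rule bij_betwI[where g = "\<lambda>x. inv a \<otimes> x"])
  assume a: "a \<in> lagr"
  show "(\<lambda>x. a \<otimes> x) \<in> lagr \<rightarrow> lagr" "(\<lambda>x. inv a \<otimes> x) \<in> lagr \<rightarrow> lagr"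
    using a lagr_mult lagr_inv by auto
  show "inv a \<otimes> (a \<otimes> x) = x" if "x \<in> lagr" for x
    using that a lagr_closed by (simp add: m_assoc[symmetric])
  show "a \<otimes> (inv a \<otimes> x) = x" if "x \<in> lagr" for x
    using that a lagr_closed by (simp add: m_assoc[symmetric])
qed

lemma sum_lagr: 
  assumes u: "u \<in> carrier E"
  shows "(\<Sum>a\<in>lagr. \<beta> a u) = (if u \<in> lagr then of_nat deg else 0)"
proof (cases "u \<in> lagr")
  case False
  then obtain b where b: "b \<in> lagr" "\<beta> b u \<noteq> 1" unfolding lagr_iff[OF u] by auto
  have "(\<Sum>a\<in>lagr. \<beta> a u) = (\<Sum>a\<in>lagr. \<beta> (b \<otimes> a) u)"
    by (rule sum.reindex_bij_betw[OF lagr_shift[OF b(1)], symmetric])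
  also have "\<dots> = \<beta> b u * (\<Sum>a\<in>lagr. \<beta> a u)"
    using b u by (simp add: \<beta>_mult lagr_closed sum_distrib_left)
  finally show ?thesis using b False by simp
qed (simp add: lagr_\<beta> deg_def)

text \<open>The sum of \<open>\<beta> a u\<close> over \<open>a\<close> in \<open>lagr\<close> and
  \<open>u\<close> in \<open>E\<close> is evaluated twice. Summing over \<open>a\<close> first
  leaves each \<open>u\<close> in \<open>lagr\<close> with weight \<open>deg\<close>; summing over
  \<open>u\<close> first leaves only \<open>a = \<one>\<close>, by nondegeneracy.\<close>

lemma deg_square: "deg * deg = card (carrier E)"
proof -
  have "(\<Sum>u\<in>carrier E. \<Sum>a\<in>lagr. \<beta> a u) = (\<Sum>u\<in>carrier E. if u \<in> lagr then of_nat deg else 0)"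
    by (intro sum.cong refl sum_lagr)
  also have "\<dots> = (\<Sum>u\<in>lagr. of_nat deg)"
    using lagr_sub finite_E by (intro sum.mono_neutral_cong_right) auto
  also have "\<dots> = of_nat (deg * deg)" by (simp add: deg_def)
  finally have 1: "(\<Sum>u\<in>carrier E. \<Sum>a\<in>lagr. \<beta> a u) = of_nat (deg * deg)" .
  have "(\<Sum>u\<in>carrier E. \<Sum>a\<in>lagr. \<beta> a u) = (\<Sum>a\<in>lagr. \<Sum>u\<in>carrier E. \<beta> a u)" by (rule sum.swap)
  also have "\<dots> = (\<Sum>a\<in>lagr. if a = \<one> then of_nat (card (carrier E)) else 0)"
    by (intro sum.cong refl sum_\<beta> lagr_closed)
  also have "\<dots> = of_nat (card (carrier E))" using lagr_one finite_lagr by simp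
  finally show ?thesis using 1 by (metis of_nat_eq_iff)
qed

lemma transversal_exists:
  "\<exists>t. (\<forall>i<deg. t i \<in> carrier E) \<and> (\<forall>y\<in>carrier E. \<exists>!i. i < deg \<and> inv (t i) \<otimes> y \<in> lagr)"
proof -
  interpret L: subgroup lagr E by (rule lagr_subgroup)
  have "card (rcosets lagr) * deg = deg * deg"
    using lagrange[OF lagr_subgroup] by (simp add: deg_def[symmetric] deg_square Coset.order_def)
  then have card: "card (rcosets lagr) = deg" using deg_pos by simp
  have fin: "finite (rcosets lagr)" using finite_E by (simp add: RCOSETS_def)
  obtain f where f: "bij_betw f {..<deg} (rcosets lagr)"
    using ex_bij_betw_nat_finite[OF fin] card by (auto simp: lessThan_atLeast0)
  have "\<forall>i\<in>{..<deg}. \<exists>t. t \<in> carrier E \<and> f i = lagr #> t"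
    using bij_betwE[OF f] by (auto simp: RCOSETS_def)
  from bchoice[OF this] obtain t where "\<forall>i\<in>{..<deg}. t i \<in> carrier E \<and> f i = lagr #> t i" ..
  then have t: "\<And>i. i < deg \<Longrightarrow> t i \<in> carrier E" "\<And>i. i < deg \<Longrightarrow> f i = lagr #> t i" by simp_all
  have iff: "inv (t i) \<otimes> y \<in> lagr \<longleftrightarrow> f i = lagr #> y" if i: "i < deg" and y: "y \<in> carrier E" for i y
  proof -
    have "inv (t i) \<otimes> y \<in> lagr \<longleftrightarrow> y \<otimes> inv (t i) \<in> lagr" using t(1)[OF i] y by (simp add: m_comm)
    also have "\<dots> \<longleftrightarrow> y \<in> lagr #> t i" using t(1)[OF i] y L.rcos_module[OF is_group, of "t i" y] by simp
    also have "\<dots> \<longleftrightarrow> lagr #> t i = lagr #> y"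
      using repr_independence[OF _ t(1)[OF i] lagr_subgroup, of y] rcos_self[OF y lagr_subgroup] by auto
    finally show ?thesis using t(2)[OF i] by simp
  qed
  have "\<exists>!i. i < deg \<and> inv (t i) \<otimes> y \<in> lagr" if y: "y \<in> carrier E" for y
  proof -
    have "lagr #> y \<in> rcosets lagr" using y lagr_sub by (intro rcosetsI)
    then have "lagr #> y \<in> f ` {..<deg}" using bij_betw_imp_surj_on[OF f] by simp
    then obtain i where i: "i < deg" "f i = lagr #> y" by auto
    show ?thesis
    proof (rule ex1I[of _ i])
      show "i < deg \<and> inv (t i) \<otimes> y \<in> lagr" using i iff y by simp
      fix j assume "j < deg \<and> inv (t j) \<otimes> y \<in> lagr"
      then have "j < deg" "f j = f i" using iff[of j y] y i by simp_all
      then show "j = i" using f i(1) by (auto simp: bij_betw_def inj_on_def)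
    qed
  qed
  then show ?thesis using t(1) by (intro exI[of _ t] conjI allI impI ballI)
qed

definition trv :: "nat \<Rightarrow> 'a" where
  "trv = (SOME t. (\<forall>i<deg. t i \<in> carrier E) \<and> (\<forall>y\<in>carrier E. \<exists>!i. i < deg \<and> inv (t i) \<otimes> y \<in> lagr))"

lemma trv_closed: "i < deg \<Longrightarrow> trv i \<in> carrier E"
  and trv_ex1: "y \<in> carrier E \<Longrightarrow> \<exists>!i. i < deg \<and> inv (trv i) \<otimes> y \<in> lagr"
  using someI_ex[OF transversal_exists] unfolding trv_def[symmetric] by simp_all

lemma trv_eq: "i < deg \<Longrightarrow> j < deg \<Longrightarrow> inv (trv i) \<otimes> trv j \<in> lagr \<Longrightarrow> i = j"
  using ex1_unique[OF trv_ex1[of "trv j"], of i j] trv_closed[of j] lagr_one by (simp add: l_inv)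

definition adm :: "'a \<Rightarrow> nat \<Rightarrow> nat \<Rightarrow> bool" where
  "adm x i j \<longleftrightarrow> inv (trv i) \<otimes> (x \<otimes> trv j) \<in> lagr"

text \<open>The twisted group algebra with \<open>s_x s_y = \<beta>(x, y) s_xy\<close>, represented
  by induction from the trivial character of \<open>lagr\<close>. With \<open>t = trv\<close> and a
  vector \<open>e\<close> fixed by \<open>lagr\<close>, the basis is \<open>s_(t j) e\<close>. If
  \<open>x t_j = t_i a\<close> with \<open>a\<close> in \<open>lagr\<close>, which is what
  \<open>adm x i j\<close> says, then \<open>s_x\<close> maps basis vector \<open>j\<close> to
  \<open>\<beta>(x, t_j) / \<beta>(t_i, a)\<close> times basis vector \<open>i\<close>; the
  displayed entry is this scalar.\<close>

definition heis :: "'a \<Rightarrow> complex mat" where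
  "heis x = mat deg deg (\<lambda>(i, j).
     if adm x i j then \<beta> x (trv i \<otimes> trv j) * \<beta> (trv j) (trv i) else 0)"

lemma heis_carrier [simp]: "heis x \<in> carrier_mat deg deg"
  by (simp add: heis_def)

lemma heis_index: "i < deg \<Longrightarrow> j < deg \<Longrightarrow> heis x $$ (i, j) =
    (if adm x i j then \<beta> x (trv i \<otimes> trv j) * \<beta> (trv j) (trv i) else 0)"
  by (simp add: heis_def)

lemma adm_ex1: "x \<in> carrier E \<Longrightarrow> j < deg \<Longrightarrow> \<exists>!i. i < deg \<and> adm x i j"
  unfolding adm_def by (rule trv_ex1) (simp add: trv_closed)

lemma adm_trans:
  assumes "x \<in> carrier E" "y \<in> carrier E" "i < deg" "j < deg" "k < deg" "adm y j k"
  shows "adm x i j \<longleftrightarrow> adm (x \<otimes> y) i k"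
proof -
  define a where "a = inv (trv j) \<otimes> (y \<otimes> trv k)"
  define b where "b = inv (trv i) \<otimes> (x \<otimes> trv j)"
  note t = trv_closed[OF assms(3)] trv_closed[OF assms(4)] trv_closed[OF assms(5)]
  have a: "a \<in> lagr" using assms(6) by (simp add: a_def adm_def)
  have b: "b \<in> carrier E" using t assms by (simp add: b_def)
  have ab: "inv (trv i) \<otimes> (x \<otimes> y \<otimes> trv k) = b \<otimes> a"
  proof -
    have "b \<otimes> a = inv (trv i) \<otimes> x \<otimes> (trv j \<otimes> inv (trv j)) \<otimes> (y \<otimes> trv k)"
      unfolding a_def b_def using t assms(1,2) by (simp only: m_assoc inv_closed m_closed)
    then show ?thesis using t assms(1,2) by (simp add: m_assoc r_inv)
  qed
  have "b \<in> lagr" if "b \<otimes> a \<in> lagr"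
  proof -
    have "b \<otimes> a \<otimes> inv a \<in> lagr" by (rule lagr_mult[OF that lagr_inv[OF a]])
    moreover have "b \<otimes> a \<otimes> inv a = b" using lagr_closed[OF a] b by (simp add: m_assoc r_inv)
    ultimately show ?thesis by (simp only:)
  qed
  then have "b \<in> lagr \<longleftrightarrow> b \<otimes> a \<in> lagr" using lagr_mult[OF _ a] by (rule iffI[rotated])
  then show ?thesis unfolding adm_def ab b_def[symmetric] .
qed

text \<open>By bimultiplicativity the two sides differ exactly by the value of
  \<open>\<beta>\<close> at the pair \<open>inv (trv i) \<otimes> (x \<otimes> trv j)\<close>,
  \<open>inv (trv j) \<otimes> (y \<otimes> trv k)\<close>. Both lie in \<open>lagr\<close>, so this
  value is 1.\<close>

lemma heis_mult_entry:
  assumes "x \<in> carrier E" "y \<in> carrier E" "i < deg" "j < deg" "k < deg" "adm x i j" "adm y j k"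
  shows "\<beta> x (trv i \<otimes> trv j) * \<beta> (trv j) (trv i) * (\<beta> y (trv j \<otimes> trv k) * \<beta> (trv k) (trv j)) =
    \<beta> x y * (\<beta> (x \<otimes> y) (trv i \<otimes> trv k) * \<beta> (trv k) (trv i))"
proof -
  note t = trv_closed[OF assms(3)] trv_closed[OF assms(4)] trv_closed[OF assms(5)]
  note xy = assms(1,2)
  have "\<beta> (inv (trv i) \<otimes> (x \<otimes> trv j)) (inv (trv j) \<otimes> (y \<otimes> trv k)) = 1"
    using assms(6,7) by (intro lagr_\<beta>) (simp_all add: adm_def)
  then have "1 / (1 / \<beta> (trv i) (trv j) * (\<beta> x (trv j) * \<beta> (trv j) (trv j))) * 
      (1 / \<beta> (trv i) y * (\<beta> x y * \<beta> (trv j) y) * (1 / \<beta> (trv i) (trv k) * (\<beta> x (trv k) * \<beta> (trv j) (trv k)))) = 1"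
    using t xy by (simp add: \<beta>_simps)
  then have "1 / (1 / \<beta> (trv i) (trv j) * \<beta> x (trv j)) * 
      (\<beta> y (trv i) * (\<beta> x y * (1 / \<beta> y (trv j))) * (1 / \<beta> (trv i) (trv k) * (\<beta> x (trv k) * \<beta> (trv j) (trv k)))) = 1"
    using \<beta>_flip[of "trv i" y] \<beta>_flip[of "trv j" y] \<beta>_self[of "trv j"] t xy by simp
  moreover have "P * Xi * Xk * Yi * Yk / B = Xi * Xj * Yj * Yk / (A * C)"
    if "1 / (1 / A * Xj) * (Yi * (P * (1 / Yj)) * (1 / B * (Xk * C))) = 1"
      "A \<noteq> 0" "B \<noteq> 0" "C \<noteq> 0" "Xj \<noteq> 0" "Yj \<noteq> 0" for A B C P Xi Xj Xk Yi Yj Yk :: complex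
  proof -
    have "(A * Yi * P * Xk * C) / (Xj * Yj * B) = 1" using that(1) by (simp add: mult_ac)
    then have "A * Yi * P * Xk * C = Xj * Yj * B" using that(2-6) by (simp add: divide_eq_eq)
    moreover have "P * Xi * Xk * Yi * Yk * (A * C) = (A * Yi * P * Xk * C) * (Xi * Yk)" by (simp only: mult_ac)
    ultimately have "P * Xi * Xk * Yi * Yk * (A * C) = Xi * Xj * Yj * Yk * B" by (simp only: mult_ac)
    then show ?thesis using that(2-6) by (simp add: frac_eq_eq)
  qed
  ultimately have "\<beta> x y * \<beta> x (trv i) * \<beta> x (trv k) * \<beta> y (trv i) * \<beta> y (trv k) / \<beta> (trv i) (trv k)
    = \<beta> x (trv i) * \<beta> x (trv j) * \<beta> y (trv j) * \<beta> y (trv k) / (\<beta> (trv i) (trv j) * \<beta> (trv j) (trv k))"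
    using \<beta>_nz t xy by simp
  then show ?thesis
    unfolding \<beta>_flip[OF t(2,1)] \<beta>_flip[OF t(3,2)] \<beta>_flip[OF t(3,1)]
    using t xy by (simp add: \<beta>_simps mult_ac)
qed

lemma heis_mult:
  assumes "x \<in> carrier E" "y \<in> carrier E"
  shows "heis x * heis y = \<beta> x y \<cdot>\<^sub>m heis (x \<otimes> y)"
proof (rule eq_matI)
  fix i k assume "i < dim_row (\<beta> x y \<cdot>\<^sub>m heis (x \<otimes> y))" "k < dim_col (\<beta> x y \<cdot>\<^sub>m heis (x \<otimes> y))"
  then have ik: "i < deg" "k < deg" by (simp_all add: heis_def)
  obtain j where j: "j < deg" "adm y j k"
    using adm_ex1[OF assms(2) ik(2)] by (elim ex1E conjE)
  have uni: "l = j" if "l < deg" "adm y l k" for l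
    using ex1_unique[OF adm_ex1[OF assms(2) ik(2)], of l j] that j by simp
  have "(heis x * heis y) $$ (i, k) = (\<Sum>l<deg. heis x $$ (i, l) * heis y $$ (l, k))"
    by (rule mult_mat_index[OF heis_carrier heis_carrier ik])
  also have "\<dots> = (\<Sum>l<deg. if l = j then heis x $$ (i, j) * heis y $$ (j, k) else 0)"
  proof (rule sum.cong)
    fix l assume "l \<in> {..<deg}"
    then have l: "l < deg" by simp
    show "heis x $$ (i, l) * heis y $$ (l, k) = (if l = j then heis x $$ (i, j) * heis y $$ (j, k) else 0)"
    proof (cases "l = j")
      case False
      then have "\<not> adm y l k" using uni[OF l] by auto
      then show ?thesis using False l ik by (simp add: heis_index)
    qed simp
  qed simp
  also have "\<dots> = heis x $$ (i, j) * heis y $$ (j, k)" using j by simp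
  also have "\<dots> = \<beta> x y * heis (x \<otimes> y) $$ (i, k)"
  proof (cases "adm x i j")
    case True
    then have "adm (x \<otimes> y) i k" using adm_trans[OF assms ik(1) j(1) ik(2) j(2)] by simp
    then show ?thesis using heis_mult_entry[OF assms ik(1) j(1) ik(2) True j(2)] True j ik
      by (simp add: heis_index)
  next
    case False
    then have "\<not> adm (x \<otimes> y) i k" using adm_trans[OF assms ik(1) j(1) ik(2) j(2)] by simp
    then show ?thesis using False j ik by (simp add: heis_index)
  qed
  finally show "(heis x * heis y) $$ (i, k) = (\<beta> x y \<cdot>\<^sub>m heis (x \<otimes> y)) $$ (i, k)"
    using ik by (simp add: carrier_matD[OF heis_carrier])
qed (simp_all add: heis_def)

lemma heis_one: "heis \<one> = 1\<^sub>m deg"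
proof (rule eq_matI)
  fix i j assume "i < dim_row (1\<^sub>m deg :: complex mat)" "j < dim_col (1\<^sub>m deg :: complex mat)"
  then have ij: "i < deg" "j < deg" by simp_all
  have "adm \<one> i j \<longleftrightarrow> i = j"
    using trv_eq[OF ij] lagr_one trv_closed[OF ij(1)] trv_closed[OF ij(2)] by (auto simp: adm_def l_inv)
  then show "heis \<one> $$ (i, j) = 1\<^sub>m deg $$ (i, j)"
    using ij trv_closed by (simp add: heis_index \<beta>_simps \<beta>_self)
qed (simp_all add: heis_def)

lemma heis_inv: "x \<in> carrier E \<Longrightarrow> heis x * heis (inv x) = 1\<^sub>m deg"
  "x \<in> carrier E \<Longrightarrow> heis (inv x) * heis x = 1\<^sub>m deg"
  using heis_mult[of x "inv x"] heis_mult[of "inv x" x] by (simp_all add: heis_one \<beta>_simps \<beta>_self r_inv l_inv one_smult_mat)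

text \<open>Conjugation by \<open>heis y\<close> multiplies \<open>heis x\<close> by the inverse
  square of \<open>\<beta> x y\<close> and preserves the trace. For \<open>x\<close> other than
  \<open>\<one>\<close> some \<open>y\<close> gives a factor different from 1, by nondegeneracy and
  odd order.\<close>

lemma heis_trace:
  assumes x: "x \<in> carrier E"
  shows "mat_trace (heis x) = (if x = \<one> then of_nat deg else 0)"
proof (cases "x = \<one>")
  case False
  obtain y where y: "y \<in> carrier E" "\<beta> x y \<noteq> 1" using nondegenerate_witness[OF x False] by (elim bexE)
  have "heis y * heis x * heis (inv y) = (\<beta> y x * \<beta> (y \<otimes> x) (inv y)) \<cdot>\<^sub>m heis (y \<otimes> x \<otimes> inv y)"
    using x y by (simp add: heis_mult mult_smult_assoc_mat[of _ deg deg _ deg] smult_smult_mat)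
  also have "y \<otimes> x \<otimes> inv y = x" using x y by (simp add: m_comm[of y x] m_assoc r_inv)
  finally have "mat_trace (heis x) = (\<beta> y x * \<beta> (y \<otimes> x) (inv y)) * mat_trace (heis x)"
    using mat_trace_conj[of "heis y" deg "heis x" "heis (inv y)"] heis_inv(2)[OF y(1)] mat_trace_smult[OF heis_carrier]
    by simp
  moreover have "\<beta> y x * \<beta> (y \<otimes> x) (inv y) = 1 / (\<beta> x y * \<beta> x y)"
    using x y \<beta>_flip[of y x] by (simp add: \<beta>_simps \<beta>_self)
  ultimately have "\<beta> x y * \<beta> x y * mat_trace (heis x) = mat_trace (heis x)"
    using \<beta>_nz[OF x y(1)] by (simp add: eq_divide_eq mult.commute)
  then have "(\<beta> x y * \<beta> x y - 1) * mat_trace (heis x) = 0" by (simp add: left_diff_distrib)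
  moreover have "\<beta> x y * \<beta> x y \<noteq> 1" using \<beta>_sq_eq_1[OF x y(1)] y(2) by argo
  ultimately show ?thesis using False by simp
qed (simp add: heis_one)

text \<open>The matrix units are linear combinations of the \<open>heis x\<close>, entry by entry.\<close>

lemma heis_entries_orthogonal:
  assumes ij: "i < deg" "j < deg" "k < deg" "l < deg"
  shows "(\<Sum>y\<in>carrier E. heis (inv y) $$ (i, j) * heis y $$ (k, l)) = (if i = l \<and> j = k then of_nat deg else 0)"
proof -
  note t = trv_closed[OF ij(1)] trv_closed[OF ij(2)] trv_closed[OF ij(3)] trv_closed[OF ij(4)]
  define u where "u = trv k \<otimes> trv l \<otimes> inv (trv i \<otimes> trv j)"
  define c where "c = \<beta> (trv j) (trv i) * \<beta> (trv l) (trv k)"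
  have u: "u \<in> carrier E" using t by (simp add: u_def)
  define Y where "Y = {y \<in> carrier E. adm (inv y) i j \<and> adm y k l}"
  have "(\<Sum>y\<in>carrier E. heis (inv y) $$ (i, j) * heis y $$ (k, l))
      = (\<Sum>y\<in>carrier E. if adm (inv y) i j \<and> adm y k l then c * \<beta> y u else 0)"
  proof (rule sum.cong)
    fix y assume y: "y \<in> carrier E"
    show "heis (inv y) $$ (i, j) * heis y $$ (k, l) = (if adm (inv y) i j \<and> adm y k l then c * \<beta> y u else 0)"
      using y t ij by (simp add: heis_index u_def c_def \<beta>_simps mult_ac)
  qed simp
  also have "\<dots> = (\<Sum>y\<in>Y. c * \<beta> y u)"
    unfolding Y_def using finite_E by (intro sum.mono_neutral_cong_right) auto
  finally have main: "(\<Sum>y\<in>carrier E. heis (inv y) $$ (i, j) * heis y $$ (k, l)) = (\<Sum>y\<in>Y. c * \<beta> y u)" .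
  \<comment> \<open>The admissible \<open>y\<close> form a coset of \<open>lagr\<close>, if there
    are any. On it the summands are a constant times a character of \<open>lagr\<close>, whose sum
    vanishes unless \<open>u\<close> lies in \<open>lagr\<close>.\<close>
  have Ysum: "(\<Sum>y\<in>Y. c * \<beta> y u) = c * \<beta> y0 u * (if u \<in> lagr then of_nat deg else 0)" if y0: "y0 \<in> Y" for y0
  proof -
    have y0': "y0 \<in> carrier E" "inv (trv i) \<otimes> (inv y0 \<otimes> trv j) \<in> lagr" "inv (trv k) \<otimes> (y0 \<otimes> trv l) \<in> lagr"
      using y0 by (simp_all add: Y_def adm_def)
    have bij: "bij_betw (\<lambda>a. a \<otimes> y0) lagr Y"
    proof (rule bij_betwI[where g = "\<lambda>y. y \<otimes> inv y0"])
      show "(\<lambda>a. a \<otimes> y0) \<in> lagr \<rightarrow> Y"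
      proof
        fix a assume a: "a \<in> lagr"
        note a' = lagr_closed[OF a]
        have "inv (trv i) \<otimes> (inv (a \<otimes> y0) \<otimes> trv j) = inv a \<otimes> (inv (trv i) \<otimes> (inv y0 \<otimes> trv j))"
          using a' y0' t by (simp add: inv_mult m_ac)
        moreover have "inv (trv k) \<otimes> (a \<otimes> y0 \<otimes> trv l) = a \<otimes> (inv (trv k) \<otimes> (y0 \<otimes> trv l))"
          using a' y0' t by (simp add: m_ac)
        ultimately show "a \<otimes> y0 \<in> Y"
          using a a' y0' by (simp add: Y_def adm_def lagr_mult lagr_inv)
      qed
      show "(\<lambda>y. y \<otimes> inv y0) \<in> Y \<rightarrow> lagr"
      proof
        fix y assume "y \<in> Y"
        then have y: "y \<in> carrier E" "inv (trv k) \<otimes> (y \<otimes> trv l) \<in> lagr" by (simp_all add: Y_def adm_def)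
        have "inv (trv k) \<otimes> (y \<otimes> trv l) \<otimes> inv (inv (trv k) \<otimes> (y0 \<otimes> trv l)) \<in> lagr"
          by (intro lagr_mult lagr_inv y y0')
        also have "inv (trv k) \<otimes> (y \<otimes> trv l) \<otimes> inv (inv (trv k) \<otimes> (y0 \<otimes> trv l))
           = (inv (trv k) \<otimes> inv (inv (trv k))) \<otimes> ((trv l \<otimes> inv (trv l)) \<otimes> (y \<otimes> inv y0))"
          using y(1) y0'(1) t by (simp only: inv_mult m_ac inv_closed m_closed)
        also have "\<dots> = y \<otimes> inv y0" using y(1) y0'(1) t by (simp only: r_inv inv_closed l_one m_closed)
        finally show "y \<otimes> inv y0 \<in> lagr" .
      qed
      show "a \<otimes> y0 \<otimes> inv y0 = a" if "a \<in> lagr" for a using lagr_closed[OF that] y0'(1) by (simp add: m_assoc r_inv)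
      show "y \<otimes> inv y0 \<otimes> y0 = y" if "y \<in> Y" for y using that y0'(1) by (simp add: Y_def m_assoc l_inv)
    qed
    have "(\<Sum>y\<in>Y. c * \<beta> y u) = (\<Sum>a\<in>lagr. c * \<beta> (a \<otimes> y0) u)"
      by (rule sum.reindex_bij_betw[OF bij, symmetric])
    also have "\<dots> = c * \<beta> y0 u * (\<Sum>a\<in>lagr. \<beta> a u)"
      using y0' u by (simp add: \<beta>_mult lagr_closed sum_distrib_left mult_ac)
    finally show ?thesis using sum_lagr[OF u] by simp
  qed
  show ?thesis
  proof (cases "i = l \<and> j = k")
    case True
    then have il: "l = i" "k = j" by simp_all
    define y0 where "y0 = trv j \<otimes> inv (trv i)"
    have y0: "y0 \<in> carrier E" using t by (simp add: y0_def)
    have "inv (trv i) \<otimes> (inv y0 \<otimes> trv j) = (inv (trv i) \<otimes> trv i) \<otimes> (inv (trv j) \<otimes> trv j)"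
      unfolding y0_def using t by (simp add: inv_mult m_ac)
    moreover have "inv (trv j) \<otimes> (y0 \<otimes> trv i) = \<one>"
      unfolding y0_def using t by (simp add: m_assoc l_inv)
    ultimately have "y0 \<in> Y" using y0 t lagr_one by (simp add: Y_def adm_def il l_inv)
    moreover have "u = \<one>"
      unfolding u_def il m_comm[OF t(2,1)] by (rule r_inv) (use t in simp)
    moreover have "c = 1" using t \<beta>_anti by (simp add: c_def il)
    ultimately show ?thesis using main Ysum[of y0] y0 True lagr_one by (simp add: \<beta>_simps)
  next
    case False
    have "(\<Sum>y\<in>Y. c * \<beta> y u) = 0"
    proof (cases "Y = {}")
      case False
      then obtain y0 where y0: "y0 \<in> Y" by blast
      have "u \<notin> lagr"
      proof
        assume uA: "u \<in> lagr"
        have y0': "y0 \<in> carrier E" "inv (trv i) \<otimes> (inv y0 \<otimes> trv j) \<in> lagr" "inv (trv k) \<otimes> (y0 \<otimes> trv l) \<in> lagr"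
          using y0 by (simp_all add: Y_def adm_def)
        \<comment> \<open>These three members of \<open>lagr\<close> multiply to the square of
          \<open>inv (trv i) \<otimes> trv l\<close>. Odd order removes the square, which gives
          \<open>i = l\<close>, and then \<open>u\<close> itself gives \<open>j = k\<close>.\<close>
        have "u \<otimes> ((inv (trv i) \<otimes> (inv y0 \<otimes> trv j)) \<otimes> (inv (trv k) \<otimes> (y0 \<otimes> trv l))) \<in> lagr"
          by (intro lagr_mult uA y0')
        also have "u \<otimes> ((inv (trv i) \<otimes> (inv y0 \<otimes> trv j)) \<otimes> (inv (trv k) \<otimes> (y0 \<otimes> trv l)))
          = (trv k \<otimes> inv (trv k)) \<otimes> ((trv j \<otimes> inv (trv j)) \<otimes> ((y0 \<otimes> inv y0) \<otimes>
             ((inv (trv i) \<otimes> trv l) \<otimes> (inv (trv i) \<otimes> trv l))))"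
          unfolding u_def using t y0'(1) by (simp only: inv_mult m_ac inv_closed m_closed)
        also have "\<dots> = (inv (trv i) \<otimes> trv l) \<otimes> (inv (trv i) \<otimes> trv l)"
          using t y0'(1) by (simp only: r_inv l_one inv_closed m_closed)
        finally have "inv (trv i) \<otimes> trv l \<in> lagr" by (rule lagr_sq[rotated]) (use t in simp)
        then have il: "i = l" by (rule trv_eq[OF ij(1,4)])
        have "u = (trv l \<otimes> inv (trv l)) \<otimes> (inv (trv j) \<otimes> trv k)"
          unfolding u_def il using t by (simp add: inv_mult m_ac)
        then have "inv (trv j) \<otimes> trv k \<in> lagr" using uA t by (simp add: r_inv)
        then have "j = k" by (rule trv_eq[OF ij(2,3)])
        then show False using il \<open>\<not> (i = l \<and> j = k)\<close> by simp
      qed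
      then show ?thesis using Ysum[OF y0] by simp
    qed simp
    then show ?thesis unfolding main if_not_P[OF \<open>\<not> (i = l \<and> j = k)\<close>] .
  qed
qed

text \<open>The analogue of the Schur average for the projective representation \<open>heis\<close>.
  Obtained entry by entry, it replaces irreducibility: a matrix commuting with all
  \<open>heis y\<close> equals its own average and is therefore scalar.\<close>

lemma heis_average:
  assumes X: "X \<in> carrier_mat deg deg"
  shows "msum deg deg (\<lambda>y. heis (inv y) * X * heis y) (carrier E) = (of_nat deg * mat_trace X) \<cdot>\<^sub>m 1\<^sub>m deg"
proof (rule eq_matI)
  fix a b assume "a < dim_row ((of_nat deg * mat_trace X) \<cdot>\<^sub>m 1\<^sub>m deg)" "b < dim_col ((of_nat deg * mat_trace X) \<cdot>\<^sub>m 1\<^sub>m deg)"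
  then have ab: "a < deg" "b < deg" by simp_all
  have e: "(heis (inv y) * X * heis y) $$ (a, b)
      = (\<Sum>k<deg. \<Sum>j<deg. X $$ (j, k) * (heis (inv y) $$ (a, j) * heis y $$ (k, b)))" for y
  proof -
    have "(heis (inv y) * X * heis y) $$ (a, b) = (\<Sum>k<deg. (heis (inv y) * X) $$ (a, k) * heis y $$ (k, b))"
      by (rule mult_mat_index[OF mult_carrier_mat[OF heis_carrier X] heis_carrier ab])
    also have "\<dots> = (\<Sum>k<deg. (\<Sum>j<deg. heis (inv y) $$ (a, j) * X $$ (j, k)) * heis y $$ (k, b))"
      using ab by (intro sum.cong) (simp_all add: mult_mat_index[OF heis_carrier X] del: index_mult_mat)
    finally show ?thesis by (simp add: sum_distrib_left sum_distrib_right mult_ac)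
  qed
  have "msum deg deg (\<lambda>y. heis (inv y) * X * heis y) (carrier E) $$ (a, b)
      = (\<Sum>y\<in>carrier E. \<Sum>k<deg. \<Sum>j<deg. X $$ (j, k) * (heis (inv y) $$ (a, j) * heis y $$ (k, b)))"
    using ab by (simp add: e del: index_mult_mat)
  also have "\<dots> = (\<Sum>k<deg. \<Sum>j<deg. X $$ (j, k) * (\<Sum>y\<in>carrier E. heis (inv y) $$ (a, j) * heis y $$ (k, b)))"
    unfolding sum_distrib_left by (subst sum.swap, rule sum.cong, simp, rule sum.swap)
  also have "\<dots> = (\<Sum>k<deg. \<Sum>j<deg. if j = k then (if a = b then of_nat deg * X $$ (k, k) else 0) else 0)"
    using ab by (intro sum.cong) (auto simp: heis_entries_orthogonal)
  also have "\<dots> = (if a = b then of_nat deg * mat_trace X else 0)"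
    using X by (simp add: mat_trace_carrier[OF X] sum_distrib_left)
  finally show "msum deg deg (\<lambda>y. heis (inv y) * X * heis y) (carrier E) $$ (a, b)
      = ((of_nat deg * mat_trace X) \<cdot>\<^sub>m 1\<^sub>m deg) $$ (a, b)" using ab by simp
qed simp_all

end

section \<open>The Weil representation\<close>

lemma idempotent_complement:
  assumes P: "P \<in> carrier_mat n n" "P * P = (P :: complex mat)"
  shows "(1\<^sub>m n - P) \<in> carrier_mat n n" "(1\<^sub>m n - P) * (1\<^sub>m n - P) = 1\<^sub>m n - P"
proof -
  define P' where "P' = 1\<^sub>m n - P"
  have P': "P' \<in> carrier_mat n n" using P(1) unfolding P'_def by (intro minus_carrier_mat)
  have "P' * P' = P' * 1\<^sub>m n - P' * P"
    by (subst (2) P'_def) (rule mult_minus_distrib_mat[OF P' one_carrier_mat P(1)])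
  also have "P' * P = 1\<^sub>m n * P - P * P"
    unfolding P'_def by (rule minus_mult_distrib_mat[OF one_carrier_mat P(1) P(1)])
  finally have "P' * P' = P'" using P P' by (intro eq_matI) auto
  with P' show "(1\<^sub>m n - P) \<in> carrier_mat n n" "(1\<^sub>m n - P) * (1\<^sub>m n - P) = 1\<^sub>m n - P"
    by (simp_all add: P'_def)
qed

lemma compressed_mult:
  assumes A: "A \<in> carrier_mat n k" and B: "B \<in> carrier_mat k n" and BA: "B * A = 1\<^sub>m k"
    and X: "X \<in> carrier_mat n n" and Y: "Y \<in> carrier_mat n n" and comm: "A * B * Y = Y * (A * B)"
  shows "B * (X * Y) * A = (B * X * A) * (B * Y * A :: complex mat)"
proof -
  have AB: "A * B \<in> carrier_mat n n" using A B by simp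
  have BX: "B * X \<in> carrier_mat k n" and YA: "Y * A \<in> carrier_mat n k"
    using mult_carrier_mat[OF B X] mult_carrier_mat[OF Y A] .
  have "(B * X * A) * (B * Y * A) = B * X * (A * (B * (Y * A)))"
    using assoc_mult_mat[OF BX A mult_carrier_mat[OF B YA]] assoc_mult_mat[OF B Y A] by simp
  also have "A * (B * (Y * A)) = A * B * Y * A"
    using assoc_mult_mat[OF A B YA] assoc_mult_mat[OF AB Y A] by simp
  also have "\<dots> = Y * (A * B) * A" using comm by simp
  also have "\<dots> = Y * (A * (B * A))"
    using assoc_mult_mat[OF Y AB A] assoc_mult_mat[OF A B A] by simp
  also have "\<dots> = Y * A" using BA A by simp
  also have "B * X * (Y * A) = B * (X * Y) * A"
    using assoc_mult_mat[OF BX Y A] assoc_mult_mat[OF B X Y] by simp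
  finally show ?thesis by simp
qed

lemma compressed_smult:
  assumes A: "A \<in> carrier_mat n k" and B: "B \<in> carrier_mat k n" and X: "X \<in> carrier_mat n n"
  shows "B * (c \<cdot>\<^sub>m X) * A = c \<cdot>\<^sub>m (B * X * A :: complex mat)"
  unfolding mult_smult_distrib[OF B X] mult_smult_assoc_mat[OF mult_carrier_mat[OF B X] A] ..

lemma compressed_carrier:
  "A \<in> carrier_mat n k \<Longrightarrow> B \<in> carrier_mat k n \<Longrightarrow> X \<in> carrier_mat n n \<Longrightarrow> B * X * A \<in> carrier_mat k k"
  by (intro mult_carrier_mat)

lemma one_plus_minus_one: "X \<in> carrier_mat k k \<Longrightarrow> 1\<^sub>m k + (X - 1\<^sub>m k) = (X :: complex mat)"
  by (intro eq_matI) auto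

text \<open>The right side depends on \<open>A\<close> and \<open>B\<close> only through the
  idempotent \<open>A * B\<close>. This matters because the factors come from an existence
  statement, and nothing is known about their entries.\<close>

lemma compressed_det:
  assumes A: "A \<in> carrier_mat n k" and B: "B \<in> carrier_mat k n" and BA: "B * A = 1\<^sub>m k"
    and X: "X \<in> carrier_mat n n"
  shows "det (B * X * A) = det (1\<^sub>m n + (A * B * X - A * B) :: complex mat)"
proof -
  have BX: "B * X \<in> carrier_mat k n" by (rule mult_carrier_mat[OF B X])
  have D: "B * X - B \<in> carrier_mat k n" by (rule minus_carrier_mat[OF B])
  have "A * (B * X - B) = A * B * X - A * B"
    unfolding mult_minus_distrib_mat[OF A BX B] using assoc_mult_mat[OF A B X] by simp
  then have "det (1\<^sub>m n + (A * B * X - A * B)) = det (1\<^sub>m k + (B * X - B) * A)"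
    using det_one_plus_mult_comm[OF A D] by simp
  also have "(B * X - B) * A = B * X * A - 1\<^sub>m k" unfolding minus_mult_distrib_mat[OF BX B A] BA ..
  also have "1\<^sub>m k + (B * X * A - 1\<^sub>m k) = B * X * A"
    by (rule one_plus_minus_one[OF compressed_carrier[OF A B X]])
  finally show ?thesis by simp
qed

lemma compressed_trace:
  assumes A: "A \<in> carrier_mat n k" and B: "B \<in> carrier_mat k n" and X: "X \<in> carrier_mat n n"
  shows "mat_trace (B * X * A :: complex mat) = mat_trace (A * B * X)"
proof -
  have "mat_trace (B * X * A) = mat_trace (A * (B * X))"
    by (rule mat_trace_comm[OF mult_carrier_mat[OF B X] A])
  then show ?thesis using assoc_mult_mat[OF A B X] by simp
qed

section \<open>Isometries and their intertwiners\<close>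

context alternating_form
begin

definition isom :: "('a \<Rightarrow> 'a) \<Rightarrow> bool" where
  "isom g \<longleftrightarrow> (\<forall>x\<in>carrier E. g x \<in> carrier E) \<and>
     (\<forall>x\<in>carrier E. \<forall>y\<in>carrier E. g (x \<otimes> y) = g x \<otimes> g y) \<and>
     (\<forall>x\<in>carrier E. \<forall>y\<in>carrier E. \<beta> (g x) (g y) = \<beta> x y)"

lemma isomD:
  assumes "isom g" "x \<in> carrier E"
  shows "g x \<in> carrier E" "y \<in> carrier E \<Longrightarrow> g (x \<otimes> y) = g x \<otimes> g y"
    "y \<in> carrier E \<Longrightarrow> \<beta> (g x) (g y) = \<beta> x y"
  using assms by (simp_all add: isom_def)

lemma isom_one: "isom g \<Longrightarrow> g \<one> = \<one>"
  using isomD(1)[of g \<one>] isomD(2)[of g \<one> \<one>] l_cancel_one[of "g \<one>" "g \<one>"] by simp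

lemma isom_inv: 
  assumes "isom g" "x \<in> carrier E"
  shows "g (inv x) = inv (g x)"
proof -
  have "g (inv x) \<otimes> g x = \<one>"
    using isomD(2)[OF assms(1) inv_closed[OF assms(2)] assms(2), symmetric] assms isom_one[OF assms(1)] by (simp add: l_inv)
  then show ?thesis using isomD(1)[OF assms] isomD(1)[OF assms(1) inv_closed[OF assms(2)]] by (intro inv_equality[symmetric])
qed

definition fixpts :: "('a \<Rightarrow> 'a) \<Rightarrow> 'a set" where "fixpts g = {x \<in> carrier E. g x = x}"

lemma fixpts_subgroup: "isom g \<Longrightarrow> subgroup (fixpts g) E"
  by (intro subgroup.intro) (auto simp: fixpts_def isomD isom_one isom_inv)

lemma card_fixpts_pos: "isom g \<Longrightarrow> card (fixpts g) > 0"
  using finite_E isom_one[of g] by (auto simp: card_gt_0_iff fixpts_def)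

lemma card_fixpts_dvd: "isom g \<Longrightarrow> card (fixpts g) dvd card (carrier E)"
  using lagrange[OF fixpts_subgroup] by (metis Coset.order_def dvd_triv_right)

definition intertw :: "('a \<Rightarrow> 'a) \<Rightarrow> complex mat" where
  "intertw g = msum deg deg (\<lambda>x. heis (inv x) * heis (g x)) (carrier E)"

lemma intertw_carrier [simp]: "intertw g \<in> carrier_mat deg deg"
  by (simp add: intertw_def)

lemma heis_hmult [simp]: "heis x * heis y \<in> carrier_mat deg deg"
  by (rule mult_carrier_mat[OF heis_carrier heis_carrier])

lemma bij_shift: "y \<in> carrier E \<Longrightarrow> bij_betw (\<lambda>x. x \<otimes> y) (carrier E) (carrier E)"
  by (rule bij_betwI[where g = "\<lambda>x. x \<otimes> inv y"]) (auto simp: m_assoc r_inv l_inv)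

text \<open>For an isometry \<open>g\<close> the families \<open>heis y\<close> and
  \<open>heis (g y)\<close> have the same cocycle, and \<open>intertw g\<close> averages the
  identity matrix between them. Reindexing by \<open>x \<otimes> y\<close> produces the scalars
  \<open>1 / \<beta> y x\<close> and \<open>1 / \<beta> x y\<close>, which cancel.\<close>

lemma intertw_commute:
  assumes g: "isom g" and y: "y \<in> carrier E"
  shows "heis y * intertw g = intertw g * heis (g y)"
proof -
  note gc = isomD(1)[OF g]
  have "heis y * intertw g = msum deg deg (\<lambda>x. heis y * (heis (inv x) * heis (g x))) (carrier E)"
    unfolding intertw_def by (rule mult_msum[OF heis_carrier]) (rule heis_hmult)
  also have "\<dots> = msum deg deg (\<lambda>x. heis y * (heis (inv (x \<otimes> y)) * heis (g (x \<otimes> y)))) (carrier E)"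
    by (rule msum_reindex[OF bij_shift[OF y]])
  also have "\<dots> = msum deg deg (\<lambda>x. heis (inv x) * heis (g x) * heis (g y)) (carrier E)"
  proof (rule msum_cong)
    fix x assume x: "x \<in> carrier E"
    have b: "\<beta> y x \<noteq> 0" "\<beta> x y \<noteq> 0" using \<beta>_nz x y by simp_all
    have "heis (inv y) * heis (inv x) = \<beta> y x \<cdot>\<^sub>m heis (inv (x \<otimes> y))"
      using x y by (simp add: heis_mult \<beta>_simps inv_mult m_comm)
    then have 1: "heis (inv (x \<otimes> y)) = (1 / \<beta> y x) \<cdot>\<^sub>m (heis (inv y) * heis (inv x))"
      using b by (simp add: smult_smult_mat one_smult_mat)
    have "heis (g x) * heis (g y) = \<beta> x y \<cdot>\<^sub>m heis (g (x \<otimes> y))"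
      using isomD(2,3)[OF g x y] gc x y by (simp add: heis_mult)
    then have 2: "heis (g (x \<otimes> y)) = (1 / \<beta> x y) \<cdot>\<^sub>m (heis (g x) * heis (g y))"
      using b by (simp add: smult_smult_mat one_smult_mat)
    have "heis y * (heis (inv (x \<otimes> y)) * heis (g (x \<otimes> y)))
        = (1 / \<beta> y x * (1 / \<beta> x y)) \<cdot>\<^sub>m (heis y * (heis (inv y) * heis (inv x) * (heis (g x) * heis (g y))))"
      unfolding 1 2 mult_smult_assoc_mat[OF heis_hmult smult_carrier_mat[OF heis_hmult]]
        mult_smult_distrib[OF heis_hmult heis_hmult] smult_smult_mat
      by (rule mult_smult_distrib[OF heis_carrier mult_carrier_mat[OF heis_hmult heis_hmult]])
    also have "1 / \<beta> y x * (1 / \<beta> x y) = 1" using \<beta>_anti[OF x y] by (simp add: mult.commute)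
    also have "heis y * (heis (inv y) * heis (inv x) * (heis (g x) * heis (g y)))
        = (heis y * heis (inv y)) * (heis (inv x) * heis (g x) * heis (g y))"
      by (simp only: assoc_mult_sq[of _ deg] heis_carrier mult_carrier_mat[OF heis_carrier heis_carrier]
          mult_carrier_mat[OF heis_carrier heis_hmult])
    also have "\<dots> = heis (inv x) * heis (g x) * heis (g y)"
      unfolding heis_inv(1)[OF y] by (rule left_mult_one_mat[OF mult_carrier_mat[OF heis_hmult heis_carrier]])
    finally show "heis y * (heis (inv (x \<otimes> y)) * heis (g (x \<otimes> y))) = heis (inv x) * heis (g x) * heis (g y)"
      by (simp only: one_smult_mat)
  qed simp
  also have "\<dots> = intertw g * heis (g y)"
    unfolding intertw_def by (rule msum_mult[OF heis_carrier, symmetric]) (rule heis_hmult)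
  finally show ?thesis .
qed

lemma commutant_scalar:
  assumes X: "X \<in> carrier_mat deg deg" and comm: "\<And>y. y \<in> carrier E \<Longrightarrow> heis y * X = X * heis y"
  shows "X = (mat_trace X / of_nat deg) \<cdot>\<^sub>m 1\<^sub>m deg"
proof -
  have d: "of_nat deg \<noteq> (0 :: complex)" using deg_pos by simp
  have "msum deg deg (\<lambda>y. heis (inv y) * X * heis y) (carrier E) = msum deg deg (\<lambda>y. 1 \<cdot>\<^sub>m X) (carrier E)"
  proof (rule msum_cong)
    fix y assume y: "y \<in> carrier E"
    have "heis (inv y) * X * heis y = heis (inv y) * heis y * X"
      using assoc_mult_mat[OF heis_carrier X heis_carrier] assoc_mult_mat[OF heis_carrier heis_carrier X] comm[OF y] by simp
    then show "heis (inv y) * X * heis y = 1 \<cdot>\<^sub>m X" using heis_inv(2)[OF y] X by (simp add: one_smult_mat)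
  qed simp
  also have "\<dots> = of_nat (card (carrier E)) \<cdot>\<^sub>m X" by (subst msum_smult[OF X]) simp
  finally have "of_nat (card (carrier E)) \<cdot>\<^sub>m X = (of_nat deg * mat_trace X) \<cdot>\<^sub>m 1\<^sub>m deg"
    using heis_average[OF X] by simp
  then have "(1 / of_nat (card (carrier E))) \<cdot>\<^sub>m (of_nat (card (carrier E)) \<cdot>\<^sub>m X)
      = (1 / of_nat (card (carrier E))) \<cdot>\<^sub>m ((of_nat deg * mat_trace X) \<cdot>\<^sub>m 1\<^sub>m deg)" by (simp only:)
  moreover have "(1 / of_nat (card (carrier E))) * of_nat (card (carrier E)) = (1 :: complex)"
    using card_E_pos by simp
  moreover have "(1 / of_nat (card (carrier E))) * (of_nat deg * mat_trace X) = mat_trace X / of_nat deg"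
    using d by (simp add: deg_square[symmetric])
  ultimately show ?thesis by (simp only: smult_smult_mat one_smult_mat)
qed

lemma intertw_trace:
  assumes g: "isom g"
  shows "mat_trace (intertw g) = of_nat deg * of_nat (card (fixpts g))"
proof -
  have "mat_trace (intertw g) = (\<Sum>x\<in>carrier E. mat_trace (heis (inv x) * heis (g x)))"
    unfolding intertw_def by (rule mat_trace_msum'[OF heis_hmult])
  also have "\<dots> = (\<Sum>x\<in>carrier E. if x \<in> fixpts g then of_nat deg else 0)"
  proof (rule sum.cong)
    fix x assume x: "x \<in> carrier E"
    note gx = isomD(1)[OF g x]
    have "inv x \<otimes> g x = \<one> \<longleftrightarrow> g x = x" using x gx by (metis inv_closed inv_equality inv_inv l_inv m_comm)
    then show "mat_trace (heis (inv x) * heis (g x)) = (if x \<in> fixpts g then of_nat deg else 0)"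
      using x gx mat_trace_smult[OF heis_carrier, of "\<beta> (inv x) (g x)" "inv x \<otimes> g x"]
      by (auto simp: heis_mult heis_trace fixpts_def \<beta>_simps \<beta>_self)
  qed simp
  also have "\<dots> = (\<Sum>x\<in>fixpts g. of_nat deg)"
    using finite_E by (intro sum.mono_neutral_cong_right) (auto simp: fixpts_def)
  finally show ?thesis by (simp add: mult.commute)
qed

text \<open>Moving \<open>intertw g\<close> across the factors \<open>heis (inv y)\<close> turns the
  product into the average of \<open>intertw g\<close>. This is scalar by
  \<open>heis_average\<close>, and the scalar is determined by the trace, a count of fixed points;
  in particular it is nonzero.\<close>

lemma intertw_inverse:
  assumes g: "isom g" and g': "isom g'" and inv: "\<And>x. x \<in> carrier E \<Longrightarrow> g (g' x) = x" "\<And>x. x \<in> carrier E \<Longrightarrow> g' (g x) = x"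
  shows "intertw g * intertw g' = (of_nat (deg * deg * card (fixpts g))) \<cdot>\<^sub>m 1\<^sub>m deg"
proof -
  note gc = isomD(1)[OF g] isomD(1)[OF g']
  have bij: "bij_betw g' (carrier E) (carrier E)"
    by (rule bij_betwI[where g = g]) (use gc inv in auto)
  have "intertw g * intertw g' = msum deg deg (\<lambda>y. intertw g * (heis (inv y) * heis (g' y))) (carrier E)"
    by (subst (2) intertw_def) (rule mult_msum[OF intertw_carrier heis_hmult])
  also have "\<dots> = msum deg deg (\<lambda>y. heis (inv (g' y)) * intertw g * heis (g' y)) (carrier E)"
  proof (rule msum_cong)
    fix y assume y: "y \<in> carrier E"
    have "heis (inv (g' y)) * intertw g = intertw g * heis (inv y)"
      using intertw_commute[OF g inv_closed[OF gc(2)[OF y]]] isom_inv[OF g gc(2)[OF y]] inv(1)[OF y] by simp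
    then show "intertw g * (heis (inv y) * heis (g' y)) = heis (inv (g' y)) * intertw g * heis (g' y)"
      using assoc_mult_mat[OF intertw_carrier heis_carrier heis_carrier] by simp
  qed simp
  also have "\<dots> = msum deg deg (\<lambda>x. heis (inv x) * intertw g * heis x) (carrier E)"
    by (rule msum_reindex[OF bij, symmetric])
  also have "\<dots> = (of_nat deg * mat_trace (intertw g)) \<cdot>\<^sub>m 1\<^sub>m deg" by (rule heis_average[OF intertw_carrier])
  finally show ?thesis unfolding intertw_trace[OF g] by (simp add: mult.assoc)
qed

text \<open>The familiar rule that the squared modulus of a Weil character is a number of fixed
  points, in a form unaffected by rescaling \<open>W\<close>. The average of \<open>W\<close> is a
  multiple of the trace of \<open>W\<close>; multiplying by \<open>W'\<close> and taking traces
  again counts fixed points.\<close>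

lemma trace_times_trace_inverse:
  assumes W: "W \<in> carrier_mat deg deg" "W' \<in> carrier_mat deg deg" and WW: "W' * W = 1\<^sub>m deg"
    and g: "isom g" and comm: "\<And>y. y \<in> carrier E \<Longrightarrow> heis y * W = W * heis (g y)"
  shows "mat_trace W * mat_trace W' = of_nat (card (fixpts g))"
proof -
  have d: "of_nat deg \<noteq> (0 :: complex)" using deg_pos by simp
  have c3: "heis (inv y) * W * heis y \<in> carrier_mat deg deg" for y
    by (rule mult_carrier_mat[OF mult_carrier_mat[OF heis_carrier W(1)] heis_carrier])
  have "W' * msum deg deg (\<lambda>y. heis (inv y) * W * heis y) (carrier E)
     = msum deg deg (\<lambda>y. W' * (heis (inv y) * W * heis y)) (carrier E)"
    by (rule mult_msum[OF W(2) c3])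
  also have "\<dots> = msum deg deg (\<lambda>y. heis (inv (g y)) * heis y) (carrier E)"
  proof (rule msum_cong)
    fix y assume y: "y \<in> carrier E"
    have "heis (inv y) * W = W * heis (inv (g y))" using comm[of "inv y"] y isom_inv[OF g y] by simp
    then have "W' * (heis (inv y) * W * heis y) = (W' * W) * (heis (inv (g y)) * heis y)"
      using assoc_mult_mat[OF W(1) heis_carrier heis_carrier] assoc_mult_mat[OF W(2,1) heis_hmult] by simp
    then show "W' * (heis (inv y) * W * heis y) = heis (inv (g y)) * heis y"
      unfolding WW using left_mult_one_mat[OF heis_hmult] by simp
  qed simp
  finally have "mat_trace (W' * ((of_nat deg * mat_trace W) \<cdot>\<^sub>m 1\<^sub>m deg))
      = mat_trace (msum deg deg (\<lambda>y. heis (inv (g y)) * heis y) (carrier E))"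
    unfolding heis_average[OF W(1)] by simp
  moreover have "mat_trace (msum deg deg (\<lambda>y. heis (inv (g y)) * heis y) (carrier E)) = of_nat deg * of_nat (card (fixpts g))"
  proof -
    have "mat_trace (msum deg deg (\<lambda>y. heis (inv (g y)) * heis y) (carrier E))
      = (\<Sum>y\<in>carrier E. mat_trace (heis (inv (g y)) * heis y))" by (rule mat_trace_msum'[OF heis_hmult])
    also have "\<dots> = (\<Sum>y\<in>carrier E. if y \<in> fixpts g then of_nat deg else 0)"
    proof (rule sum.cong)
      fix x assume x: "x \<in> carrier E"
      note gx = isomD(1)[OF g x]
      have "inv (g x) \<otimes> x = \<one> \<longleftrightarrow> g x = x" using x gx by (metis inv_closed inv_equality inv_inv l_inv m_comm)
      then show "mat_trace (heis (inv (g x)) * heis x) = (if x \<in> fixpts g then of_nat deg else 0)"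
        using x gx mat_trace_smult[OF heis_carrier, of "\<beta> (inv (g x)) x" "inv (g x) \<otimes> x"]
        by (auto simp: heis_mult heis_trace fixpts_def \<beta>_simps \<beta>_self)
    qed simp
    also have "\<dots> = (\<Sum>x\<in>fixpts g. of_nat deg)"
      using finite_E by (intro sum.mono_neutral_cong_right) (auto simp: fixpts_def)
    finally show ?thesis by (simp add: mult.commute)
  qed
  moreover have "W' * ((of_nat deg * mat_trace W) \<cdot>\<^sub>m 1\<^sub>m deg) = (of_nat deg * mat_trace W) \<cdot>\<^sub>m W'"
    unfolding mult_smult_distrib[OF W(2) one_carrier_mat] using W(2) by simp
  ultimately have "of_nat deg * (mat_trace W * mat_trace W') = of_nat deg * (of_nat (card (fixpts g)) :: complex)"
    using mat_trace_smult[OF W(2)] by (simp add: mult.assoc)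
  then show ?thesis using d by (simp only: mult_cancel_left) simp
qed

text \<open>Inversion is an isometry; its normalised intertwiner splits the space into eigenspaces of
  dimensions \<open>(deg + 1) / 2\<close> and \<open>(deg - 1) / 2\<close>.\<close>

lemma isom_inverse: "isom (\<lambda>x. inv x)"
  by (simp add: isom_def inv_mult \<beta>_simps)

lemma fixpts_inverse: "fixpts (\<lambda>x. inv x) = {\<one>}"
proof -
  have "x = \<one>" if x: "x \<in> carrier E" "inv x = x" for x
  proof -
    have "x \<otimes> x = \<one>" using r_inv[OF x(1)] x(2) by simp
    then show ?thesis using halve[OF x(1)] by simp
  qed
  then show ?thesis by (auto simp: fixpts_def)
qed

text \<open>Inversion has a single fixed point, so the factor \<open>1 / deg\<close> makes the
  square the identity and also the trace 1. The trace settles the sign, and thereby which eigenspace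
  is the larger one.\<close>

definition zed :: "complex mat" where "zed = (1 / of_nat deg) \<cdot>\<^sub>m intertw (\<lambda>x. inv x)"

lemma zed_carrier [simp]: "zed \<in> carrier_mat deg deg"
  by (simp add: zed_def)

lemma zed_trace: "mat_trace zed = 1"
  unfolding zed_def mat_trace_smult[OF intertw_carrier] intertw_trace[OF isom_inverse] fixpts_inverse
  using deg_pos by simp

lemma zed_square: "zed * zed = 1\<^sub>m deg"
proof -
  have "zed * zed = (1 / of_nat deg * (1 / of_nat deg)) \<cdot>\<^sub>m (intertw (\<lambda>x. inv x) * intertw (\<lambda>x. inv x))"
    unfolding zed_def mult_smult_assoc_mat[OF intertw_carrier smult_carrier_mat[OF intertw_carrier]]
      mult_smult_distrib[OF intertw_carrier intertw_carrier] smult_smult_mat ..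
  also have "intertw (\<lambda>x. inv x) * intertw (\<lambda>x. inv x) = (of_nat (deg * deg * card (fixpts (\<lambda>x. inv x)))) \<cdot>\<^sub>m 1\<^sub>m deg"
    by (rule intertw_inverse[OF isom_inverse isom_inverse]) simp_all
  finally show ?thesis using deg_pos unfolding fixpts_inverse smult_smult_mat by (simp add: one_smult_mat)
qed

lemma heis_zed: "y \<in> carrier E \<Longrightarrow> heis y * zed = zed * heis (inv y)"
  unfolding zed_def mult_smult_assoc_mat[OF intertw_carrier heis_carrier] mult_smult_distrib[OF heis_carrier intertw_carrier]
  by (simp only: intertw_commute[OF isom_inverse])

text \<open>The summand for \<open>x\<close> in \<open>zed\<close> is, up to the scalar, the square
  of \<open>heis (inv x)\<close>. Moving \<open>W\<close> across it replaces \<open>x\<close> by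
  \<open>g x\<close>, which only permutes the summands.\<close>

lemma zed_commute:
  assumes W: "W \<in> carrier_mat deg deg" and g: "isom g" "bij_betw g (carrier E) (carrier E)"
    and comm: "\<And>y. y \<in> carrier E \<Longrightarrow> heis y * W = W * heis (g y)"
  shows "zed * W = W * zed"
proof -
  note gc = isomD(1)[OF g(1)]
  have "intertw (\<lambda>x. inv x) * W = msum deg deg (\<lambda>x. heis (inv x) * heis (inv x) * W) (carrier E)"
    unfolding intertw_def by (rule msum_mult[OF W heis_hmult])
  also have "\<dots> = msum deg deg (\<lambda>x. W * (heis (inv (g x)) * heis (inv (g x)))) (carrier E)"
  proof (rule msum_cong)
    fix x assume x: "x \<in> carrier E"
    have c: "heis (inv x) * W = W * heis (inv (g x))" using comm[of "inv x"] isom_inv[OF g(1) x] x by simp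
    have "heis (inv x) * heis (inv x) * W = heis (inv x) * (heis (inv x) * W)"
      by (rule assoc_mult_mat[OF heis_carrier heis_carrier W])
    also have "\<dots> = heis (inv x) * (W * heis (inv (g x)))" by (simp only: c)
    also have "\<dots> = heis (inv x) * W * heis (inv (g x))"
      by (rule assoc_mult_mat[OF heis_carrier W heis_carrier, symmetric])
    also have "\<dots> = W * heis (inv (g x)) * heis (inv (g x))" by (simp only: c)
    also have "\<dots> = W * (heis (inv (g x)) * heis (inv (g x)))"
      by (rule assoc_mult_mat[OF W heis_carrier heis_carrier])
    finally show "heis (inv x) * heis (inv x) * W = W * (heis (inv (g x)) * heis (inv (g x)))" .
  qed simp
  also have "\<dots> = msum deg deg (\<lambda>x. W * (heis (inv x) * heis (inv x))) (carrier E)"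
    by (rule msum_reindex[OF g(2), symmetric])
  also have "\<dots> = W * intertw (\<lambda>x. inv x)"
    unfolding intertw_def by (rule mult_msum[OF W heis_hmult, symmetric])
  finally have "intertw (\<lambda>x. inv x) * W = W * intertw (\<lambda>x. inv x)" .
  then show ?thesis
    unfolding zed_def mult_smult_assoc_mat[OF intertw_carrier W] mult_smult_distrib[OF W intertw_carrier] by simp
qed

definition eplus :: "complex mat" where "eplus = (1 / 2) \<cdot>\<^sub>m (1\<^sub>m deg + zed)"
definition eminus :: "complex mat" where "eminus = 1\<^sub>m deg - eplus"

lemma eplus_carrier [simp]: "eplus \<in> carrier_mat deg deg"
  by (simp add: eplus_def)

lemma eplus_idem: "eplus * eplus = eplus"
proof -
  have z: "zed \<in> carrier_mat deg deg" by simp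
  have s: "1\<^sub>m deg + zed \<in> carrier_mat deg deg" by simp
  have "(1\<^sub>m deg + zed) * (1\<^sub>m deg + zed) = 1\<^sub>m deg * (1\<^sub>m deg + zed) + zed * (1\<^sub>m deg + zed)"
    by (rule add_mult_distrib_mat[OF one_carrier_mat z s])
  also have "zed * (1\<^sub>m deg + zed) = zed * 1\<^sub>m deg + zed * zed"
    by (rule mult_add_distrib_mat[OF z one_carrier_mat z])
  also have "1\<^sub>m deg * (1\<^sub>m deg + zed) + (zed * 1\<^sub>m deg + zed * zed) = 2 \<cdot>\<^sub>m (1\<^sub>m deg + zed)"
    unfolding zed_square left_mult_one_mat[OF s] right_mult_one_mat[OF z]
    by (intro eq_matI) (simp_all add: carrier_matD[OF zed_carrier])
  finally have "eplus * eplus = (1 / 2 * (1 / 2) * 2) \<cdot>\<^sub>m (1\<^sub>m deg + zed)"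
    unfolding eplus_def mult_smult_assoc_mat[OF s smult_carrier_mat[OF s]] mult_smult_distrib[OF s s] smult_smult_mat
    by (simp only: smult_smult_mat mult.assoc)
  then show ?thesis by (simp add: eplus_def)
qed

lemma eminus_carrier [simp]: "eminus \<in> carrier_mat deg deg"
  and eminus_idem: "eminus * eminus = eminus"
  unfolding eminus_def by (rule idempotent_complement[OF eplus_carrier eplus_idem])+

lemma eplus_trace_mult:
  assumes W: "W \<in> carrier_mat deg deg"
  shows "mat_trace (eplus * W) = (mat_trace W + mat_trace (zed * W)) / 2"
    "mat_trace (eminus * W) = (mat_trace W - mat_trace (zed * W)) / 2"
proof -
  have s: "1\<^sub>m deg + zed \<in> carrier_mat deg deg" by simp
  have zW: "zed * W \<in> carrier_mat deg deg" by (rule mult_carrier_mat[OF zed_carrier W])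
  have eW: "eplus * W \<in> carrier_mat deg deg" by (rule mult_carrier_mat[OF eplus_carrier W])
  have "eplus * W = (1 / 2) \<cdot>\<^sub>m (W + zed * W)"
    unfolding eplus_def mult_smult_assoc_mat[OF s W] add_mult_distrib_mat[OF one_carrier_mat zed_carrier W]
      left_mult_one_mat[OF W] ..
  then show 1: "mat_trace (eplus * W) = (mat_trace W + mat_trace (zed * W)) / 2"
    using mat_trace_smult[OF add_carrier_mat[OF zW], of "1 / 2" W] mat_trace_add[OF W zW] by simp
  have "eminus * W = W - eplus * W"
    unfolding eminus_def minus_mult_distrib_mat[OF one_carrier_mat eplus_carrier W] left_mult_one_mat[OF W] ..
  then have "mat_trace (eminus * W) = mat_trace W - mat_trace (eplus * W)"
    using mat_trace_minus[OF W eW] by simp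
  then show "mat_trace (eminus * W) = (mat_trace W - mat_trace (zed * W)) / 2" unfolding 1 by (simp add: field_simps)
qed

lemma eplus_commute:
  assumes W: "W \<in> carrier_mat deg deg" and z: "zed * W = W * zed"
  shows "eplus * W = W * eplus" "eminus * W = W * eminus"
proof -
  have s: "1\<^sub>m deg + zed \<in> carrier_mat deg deg" by simp
  show 1: "eplus * W = W * eplus"
    unfolding eplus_def mult_smult_assoc_mat[OF s W] mult_smult_distrib[OF W s]
      add_mult_distrib_mat[OF one_carrier_mat zed_carrier W] mult_add_distrib_mat[OF W one_carrier_mat zed_carrier]
      left_mult_one_mat[OF W] right_mult_one_mat[OF W] z ..
  show "eminus * W = W * eminus"
    unfolding eminus_def minus_mult_distrib_mat[OF one_carrier_mat eplus_carrier W]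
      mult_minus_distrib_mat[OF W one_carrier_mat eplus_carrier] left_mult_one_mat[OF W] right_mult_one_mat[OF W] 1 ..
qed

text \<open>The dimensions are the traces of the idempotents. Writing them as \<open>Suc k\<close>
  and \<open>k\<close> records that they are consecutive, the fact on which the normalisation of the
  scalars rests.\<close>

lemma eigenspace_factorizations:
  "\<exists>k Ap Bp Am Bm. Ap \<in> carrier_mat deg (Suc k) \<and> Bp \<in> carrier_mat (Suc k) deg \<and> Ap * Bp = eplus \<and> Bp * Ap = 1\<^sub>m (Suc k) \<and>
     Am \<in> carrier_mat deg k \<and> Bm \<in> carrier_mat k deg \<and> Am * Bm = eminus \<and> Bm * Am = 1\<^sub>m k"
proof -
  obtain kp Ap Bp where p: "Ap \<in> carrier_mat deg kp" "Bp \<in> carrier_mat kp deg" "Ap * Bp = eplus" "Bp * Ap = 1\<^sub>m kp"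
    using idempotent_factorization[OF eplus_carrier eplus_idem] by (elim exE conjE)
  obtain km Am Bm where m: "Am \<in> carrier_mat deg km" "Bm \<in> carrier_mat km deg" "Am * Bm = eminus" "Bm * Am = 1\<^sub>m km"
    using idempotent_factorization[OF eminus_carrier eminus_idem] by (elim exE conjE)
  have "of_nat kp = mat_trace (eplus * 1\<^sub>m deg)"
    using mat_trace_comm[OF p(1,2)] p(3,4) right_mult_one_mat[OF eplus_carrier] by simp
  then have kp: "of_nat kp = (of_nat deg + 1 :: complex) / 2"
    unfolding eplus_trace_mult[OF one_carrier_mat] right_mult_one_mat[OF zed_carrier] zed_trace by simp
  have "of_nat km = mat_trace (eminus * 1\<^sub>m deg)"
    using mat_trace_comm[OF m(1,2)] m(3,4) right_mult_one_mat[OF eminus_carrier] by simp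
  then have km: "of_nat km = (of_nat deg - 1 :: complex) / 2"
    unfolding eplus_trace_mult[OF one_carrier_mat] right_mult_one_mat[OF zed_carrier] zed_trace by simp
  have "of_nat kp = (of_nat (Suc km) :: complex)" unfolding kp of_nat_Suc km by (simp add: field_simps)
  then have "kp = Suc km" by (simp only: of_nat_eq_iff)
  then show ?thesis using p m by (intro exI[of _ km] exI[of _ Ap] exI[of _ Bp] exI[of _ Am] exI[of _ Bm]) simp
qed

end

section \<open>Groups of isometries and the ring of matrix entries\<close>

lemma coprime_powers_eq_1:
  fixes z :: complex
  assumes "z ^ a = 1" "z ^ b = 1" "coprime a b"
  shows "z = 1"
proof -
  have "z ^ gcd a b = 1"
  proof (cases "a = 0")
    case True
    then show ?thesis using assms(2) by simp
  next
    case False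
    obtain x y where "a * x = b * y + gcd a b" using bezout_nat[OF False, of b] by blast
    then have "z ^ (a * x) = z ^ (b * y) * z ^ gcd a b" by (simp add: power_add)
    then show ?thesis using assms(1,2) by (simp add: power_mult)
  qed
  then show ?thesis using assms(3) by simp
qed

text \<open>A right action, as it arises from \<open>inv h \<otimes> x \<otimes> h\<close>. With
  this order the relation \<open>heis y * W = W * heis (act h y)\<close> is compatible with products
  \<open>W_h * W_k\<close>.\<close>

locale isometric_action = alternating_form E \<beta> + H: fin_group H
  for E (structure) and \<beta> and H :: "('h, 'c) monoid_scheme" +
  fixes act :: "'h \<Rightarrow> 'a \<Rightarrow> 'a"
  assumes act_isom: "\<And>h. h \<in> carrier H \<Longrightarrow> isom (act h)"
    and act_one: "\<And>x. x \<in> carrier E \<Longrightarrow> act \<one>\<^bsub>H\<^esub> x = x"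
    and act_mult: "\<And>h k x. h \<in> carrier H \<Longrightarrow> k \<in> carrier H \<Longrightarrow> x \<in> carrier E \<Longrightarrow>
           act (h \<otimes>\<^bsub>H\<^esub> k) x = act k (act h x)"
begin

lemma act_closed: "h \<in> carrier H \<Longrightarrow> x \<in> carrier E \<Longrightarrow> act h x \<in> carrier E"
  using isomD(1)[OF act_isom] .

lemma act_inv: 
  assumes "h \<in> carrier H" "x \<in> carrier E"
  shows "act h (act (inv\<^bsub>H\<^esub> h) x) = x" "act (inv\<^bsub>H\<^esub> h) (act h x) = x"
  using act_mult[of "inv\<^bsub>H\<^esub> h" h x] act_mult[of h "inv\<^bsub>H\<^esub> h" x] assms act_one[OF assms(2)]
  by (simp_all add: H.l_inv H.r_inv)

lemma act_bij: "h \<in> carrier H \<Longrightarrow> bij_betw (act h) (carrier E) (carrier E)"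
  by (rule bij_betwI[where g = "act (inv\<^bsub>H\<^esub> h)"]) (auto simp: act_closed act_inv)

definition proj :: "'h \<Rightarrow> complex mat" where "proj h = intertw (act h)"

lemma proj_carrier [simp]: "proj h \<in> carrier_mat deg deg"
  by (simp add: proj_def)

lemma proj_commute: "h \<in> carrier H \<Longrightarrow> y \<in> carrier E \<Longrightarrow> heis y * proj h = proj h * heis (act h y)"
  unfolding proj_def by (rule intertw_commute[OF act_isom])

definition proj_norm :: "'h \<Rightarrow> nat" where "proj_norm h = deg * deg * card (fixpts (act h))"

lemma proj_norm_pos: "h \<in> carrier H \<Longrightarrow> proj_norm h > 0"
  using deg_pos card_fixpts_pos[OF act_isom] by (simp add: proj_norm_def)

lemma proj_inv: "h \<in> carrier H \<Longrightarrow> proj h * proj (inv\<^bsub>H\<^esub> h) = of_nat (proj_norm h) \<cdot>\<^sub>m 1\<^sub>m deg"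
  unfolding proj_def proj_norm_def by (rule intertw_inverse) (simp_all add: act_isom act_inv)

lemma det_proj_nonzero:
  assumes "h \<in> carrier H" 
  shows "det (proj h) \<noteq> 0"
proof
  assume "det (proj h) = 0"
  then have "det (of_nat (proj_norm h) \<cdot>\<^sub>m 1\<^sub>m deg :: complex mat) = 0"
    using det_mult[OF proj_carrier proj_carrier, of h "inv\<^bsub>H\<^esub> h"] proj_inv[OF assms] by simp
  then show False using proj_norm_pos[OF assms] by (simp add: det_smult)
qed

text \<open>Multiplied by the intertwiner of the inverse of the group product, the matrix
  \<open>proj h * proj k\<close> commutes with all \<open>heis y\<close> and becomes a scalar.
  Determinants show that the resulting factor is nonzero.\<close>

lemma proj_mult:
  assumes h: "h \<in> carrier H" and k: "k \<in> carrier H"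
  shows "\<exists>c. c \<noteq> 0 \<and> proj h * proj k = c \<cdot>\<^sub>m proj (h \<otimes>\<^bsub>H\<^esub> k)"
proof -
  define hk where "hk = h \<otimes>\<^bsub>H\<^esub> k"
  have hkc: "hk \<in> carrier H" and ic: "inv\<^bsub>H\<^esub> hk \<in> carrier H" using h k by (simp_all add: hk_def)
  have P: "proj h * proj k \<in> carrier_mat deg deg" by (rule mult_carrier_mat[OF proj_carrier proj_carrier])
  define X where "X = proj h * proj k * proj (inv\<^bsub>H\<^esub> hk)"
  have X: "X \<in> carrier_mat deg deg" unfolding X_def by (rule mult_carrier_mat[OF P proj_carrier])
  have Xy: "heis y * X = X * heis y" if y: "y \<in> carrier E" for y
  proof -
    note c1 = act_closed[OF h y]
    have "heis y * (proj h * proj k) = proj h * proj k * heis (act hk y)"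
    proof -
      have "heis y * (proj h * proj k) = proj h * heis (act h y) * proj k"
        using assoc_mult_mat[OF heis_carrier proj_carrier proj_carrier, of y h k] proj_commute[OF h y] by simp
      also have "\<dots> = proj h * (proj k * heis (act k (act h y)))"
        using assoc_mult_mat[OF proj_carrier heis_carrier proj_carrier, of h "act h y" k] proj_commute[OF k c1] by simp
      also have "\<dots> = proj h * proj k * heis (act hk y)"
        using assoc_mult_mat[OF proj_carrier proj_carrier heis_carrier, of h k] act_mult[OF h k y] by (simp add: hk_def)
      finally show ?thesis .
    qed
    then have "heis y * X = proj h * proj k * heis (act hk y) * proj (inv\<^bsub>H\<^esub> hk)"
      unfolding X_def using assoc_mult_mat[OF heis_carrier P proj_carrier, of y "inv\<^bsub>H\<^esub> hk"] by simp
    also have "\<dots> = proj h * proj k * (proj (inv\<^bsub>H\<^esub> hk) * heis (act (inv\<^bsub>H\<^esub> hk) (act hk y)))"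
      using assoc_mult_mat[OF P heis_carrier proj_carrier, of "act hk y" "inv\<^bsub>H\<^esub> hk"]
        proj_commute[OF ic act_closed[OF hkc y]] by simp
    also have "\<dots> = X * heis y"
      unfolding act_inv(2)[OF hkc y] X_def using assoc_mult_mat[OF P proj_carrier heis_carrier, of "inv\<^bsub>H\<^esub> hk" y] by simp
    finally show ?thesis .
  qed
  define a where "a = mat_trace X / of_nat deg"
  have a: "X = a \<cdot>\<^sub>m 1\<^sub>m deg" unfolding a_def by (rule commutant_scalar[OF X]) (rule Xy)
  define r :: complex where "r = of_nat (proj_norm (inv\<^bsub>H\<^esub> hk))"
  have r: "r \<noteq> 0" using proj_norm_pos[OF ic] by (simp add: r_def)
  have "X * proj hk = proj h * proj k * (proj (inv\<^bsub>H\<^esub> hk) * proj hk)"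
    unfolding X_def by (rule assoc_mult_mat[OF P proj_carrier proj_carrier])
  also have "proj (inv\<^bsub>H\<^esub> hk) * proj hk = r \<cdot>\<^sub>m 1\<^sub>m deg"
    using proj_inv[OF ic] hkc by (simp add: r_def)
  also have "proj h * proj k * (r \<cdot>\<^sub>m 1\<^sub>m deg) = r \<cdot>\<^sub>m (proj h * proj k)"
    unfolding mult_smult_distrib[OF P one_carrier_mat] right_mult_one_mat[OF P] ..
  finally have e: "a \<cdot>\<^sub>m proj hk = r \<cdot>\<^sub>m (proj h * proj k)"
    unfolding a mult_smult_assoc_mat[OF one_carrier_mat proj_carrier] left_mult_one_mat[OF proj_carrier] .
  have "(1 / r) \<cdot>\<^sub>m (a \<cdot>\<^sub>m proj hk) = (1 / r * r) \<cdot>\<^sub>m (proj h * proj k)" unfolding e smult_smult_mat ..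
  then have main: "proj h * proj k = (1 / r * a) \<cdot>\<^sub>m proj hk"
    using r by (simp add: smult_smult_mat one_smult_mat)
  have "det (proj h * proj k) \<noteq> 0"
    unfolding det_mult[OF proj_carrier proj_carrier] using det_proj_nonzero[OF h] det_proj_nonzero[OF k] by simp
  then have "1 / r * a \<noteq> 0"
    unfolding main det_smult using deg_pos proj_carrier[of hk] by (auto simp: power_0_left)
  then show ?thesis using main by (intro exI[of _ "1 / r * a"]) (simp add: hk_def)
qed

lemma proj_trivial:
  assumes "\<And>x. x \<in> carrier E \<Longrightarrow> act h x = x"
  shows "proj h = of_nat (card (carrier E)) \<cdot>\<^sub>m 1\<^sub>m deg"
proof -
  have "proj h = msum deg deg (\<lambda>x. 1 \<cdot>\<^sub>m 1\<^sub>m deg) (carrier E)"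
    unfolding proj_def intertw_def by (rule msum_cong) (simp_all add: assms heis_inv one_smult_mat)
  then show ?thesis using msum_smult[OF one_carrier_mat, where k = "\<lambda>_. 1" and A = "carrier E"] by simp
qed

lemma proj_zed: "h \<in> carrier H \<Longrightarrow> zed * proj h = proj h * zed"
  by (rule zed_commute[OF proj_carrier act_isom act_bij proj_commute])

definition root :: complex where "root = cis (2 * pi / real (card (carrier E)))"

lemma root_pow: "root ^ card (carrier E) = 1"
  using card_E_pos by (simp add: root_def DeMoivre)

text \<open>The values of \<open>\<beta>\<close> are powers of \<open>root\<close>. The denominator
  2 comes from the eigenprojections; \<open>deg\<close> comes from \<open>zed\<close> and from
  inverting the matrices \<open>proj h\<close>.\<close>

abbreviation ints :: "complex set" where "ints \<equiv> adjoin root (2 * deg)"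

lemma \<beta>_ints: "x \<in> carrier E \<Longrightarrow> y \<in> carrier E \<Longrightarrow> \<beta> x y \<in> ints"
proof -
  assume xy: "x \<in> carrier E" "y \<in> carrier E"
  have "\<beta> x y \<in> {z. z ^ card (carrier E) = 1}" using \<beta>_pow_card[OF xy] by simp
  then have "\<beta> x y \<in> (\<lambda>k. cis (2 * pi * real k / real (card (carrier E)))) ` {..<card (carrier E)}"
    using bij_betw_imp_surj_on[OF bij_betw_roots_unity[OF card_E_pos]] by simp
  then obtain k where "\<beta> x y = cis (2 * pi * real k / real (card (carrier E)))" by (elim imageE)
  then have "\<beta> x y = root ^ k" by (simp add: root_def DeMoivre mult_ac)
  then show ?thesis by (simp add: adjoin_power adjoin_gen)
qed

lemma recip_deg_ints: "1 / of_nat deg \<in> ints" "1 / 2 \<in> ints"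
proof -
  have "1 / of_nat deg = 2 * (1 / of_nat (2 * deg) :: complex)" using deg_pos by simp
  moreover have "2 * (1 / of_nat (2 * deg) :: complex) \<in> ints"
    using adjoin_mult[OF adjoin_of_nat[of 2] adjoin_recip] unfolding of_nat_numeral .
  ultimately show "1 / of_nat deg \<in> ints" by (simp only:)
  have "1 / 2 = of_nat deg * (1 / of_nat (2 * deg) :: complex)" using deg_pos by simp
  moreover have "of_nat deg * (1 / of_nat (2 * deg) :: complex) \<in> ints"
    by (rule adjoin_mult[OF adjoin_of_nat adjoin_recip])
  ultimately show "1 / 2 \<in> ints" by (simp only:)
qed

lemma heis_ints: "x \<in> carrier E \<Longrightarrow> i < deg \<Longrightarrow> j < deg \<Longrightarrow> heis x $$ (i, j) \<in> ints"
  by (simp add: heis_index \<beta>_ints trv_closed adjoin_mult adjoin_zero)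

lemma mult_ints:
  assumes "A \<in> carrier_mat deg deg" "B \<in> carrier_mat deg deg" "i < deg" "j < deg"
    "\<And>i j. i < deg \<Longrightarrow> j < deg \<Longrightarrow> A $$ (i, j) \<in> ints" "\<And>i j. i < deg \<Longrightarrow> j < deg \<Longrightarrow> B $$ (i, j) \<in> ints"
  shows "(A * B) $$ (i, j) \<in> ints"
  unfolding mult_mat_index[OF assms(1-4)] using assms(3-6) by (intro adjoin_sum adjoin_mult) simp_all

lemma intertw_ints:
  assumes g: "isom g" and ij: "i < deg" "j < deg"
  shows "intertw g $$ (i, j) \<in> ints"
  unfolding intertw_def msum_index[OF ij]
  by (intro adjoin_sum mult_ints heis_carrier ij heis_ints inv_closed isomD(1)[OF g]) assumption+

lemma eplus_ints: 
  assumes ij: "i < deg" "j < deg"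
  shows "eplus $$ (i, j) \<in> ints" "eminus $$ (i, j) \<in> ints"
proof -
  have o: "1\<^sub>m deg $$ (i, j) \<in> ints" using ij by (simp add: adjoin_one adjoin_zero)
  have "zed $$ (i, j) = 1 / of_nat deg * intertw (\<lambda>x. inv x) $$ (i, j)"
    unfolding zed_def using ij by (simp add: carrier_matD[OF intertw_carrier])
  then have z: "zed $$ (i, j) \<in> ints"
    using intertw_ints[OF isom_inverse ij] recip_deg_ints(1) by (simp only: adjoin_mult)
  have "eplus $$ (i, j) = 1 / 2 * (1\<^sub>m deg $$ (i, j) + zed $$ (i, j))"
    unfolding eplus_def using ij by (simp add: carrier_matD[OF zed_carrier])
  then show e: "eplus $$ (i, j) \<in> ints" by (simp only: adjoin_mult adjoin_add o z recip_deg_ints(2))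
  have "eminus $$ (i, j) = 1\<^sub>m deg $$ (i, j) - eplus $$ (i, j)"
    unfolding eminus_def using ij by (simp add: carrier_matD[OF eplus_carrier])
  then show "eminus $$ (i, j) \<in> ints" by (simp only: adjoin_diff o e)
qed

text \<open>The fixed points form a subgroup of \<open>E\<close>, so their number divides
  \<open>deg * deg\<close>, and \<open>proj_norm h\<close> divides the fourth power of
  \<open>deg\<close>.\<close>

lemma recip_proj_norm_ints: "h \<in> carrier H \<Longrightarrow> 1 / of_nat (proj_norm h) \<in> ints"
proof -
  assume h: "h \<in> carrier H"
  obtain m where m: "card (carrier E) = card (fixpts (act h)) * m" using card_fixpts_dvd[OF act_isom[OF h]] by (elim dvdE)
  have m0: "m > 0" using m card_E_pos by (cases m) auto
  have "deg * deg * (deg * deg) = proj_norm h * m" using m by (simp add: proj_norm_def deg_square[symmetric])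
  then have "of_nat (deg * deg * (deg * deg)) = (of_nat (proj_norm h * m) :: complex)" by (simp only:)
  then have e: "of_nat (proj_norm h) * of_nat m = (of_nat deg * of_nat deg * (of_nat deg * of_nat deg) :: complex)"
    by (simp only: of_nat_mult)
  have "1 / of_nat (proj_norm h) = of_nat m / (of_nat (proj_norm h) * of_nat m :: complex)"
    using m0 by simp
  also have "\<dots> = of_nat m * (1 / of_nat deg * (1 / of_nat deg) * (1 / of_nat deg * (1 / of_nat deg)))"
    unfolding e by simp
  finally show ?thesis by (simp only: adjoin_mult adjoin_of_nat recip_deg_ints(1))
qed

end

section \<open>Determinants on the two eigenspaces and the linear representation\<close>

locale split_action = isometric_action E \<beta> H act
  for E (structure) and \<beta> and H :: "('h, 'c) monoid_scheme" and act +
  fixes k Ap Bp Am Bm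
  assumes Ap: "Ap \<in> carrier_mat deg (Suc k)" and Bp: "Bp \<in> carrier_mat (Suc k) deg"
    and ABp: "Ap * Bp = eplus" and BAp: "Bp * Ap = 1\<^sub>m (Suc k)"
    and Am: "Am \<in> carrier_mat deg k" and Bm: "Bm \<in> carrier_mat k deg"
    and ABm: "Am * Bm = eminus" and BAm: "Bm * Am = 1\<^sub>m k"
begin

definition dplus where "dplus X = det (Bp * X * Ap)"
definition dminus where "dminus X = det (Bm * X * Am)"

lemma dplus_mult:
  assumes "X \<in> carrier_mat deg deg" "Y \<in> carrier_mat deg deg" "zed * Y = Y * zed"
  shows "dplus (X * Y) = dplus X * dplus Y"
proof -
  have "Ap * Bp * Y = Y * (Ap * Bp)" unfolding ABp by (rule eplus_commute(1)[OF assms(2,3)])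
  from compressed_mult[OF Ap Bp BAp assms(1,2) this] show ?thesis
    unfolding dplus_def
    using det_mult[OF compressed_carrier[OF Ap Bp assms(1)] compressed_carrier[OF Ap Bp assms(2)]] by simp
qed

lemma dminus_mult:
  assumes "X \<in> carrier_mat deg deg" "Y \<in> carrier_mat deg deg" "zed * Y = Y * zed"
  shows "dminus (X * Y) = dminus X * dminus Y"
proof -
  have "Am * Bm * Y = Y * (Am * Bm)" unfolding ABm by (rule eplus_commute(2)[OF assms(2,3)])
  from compressed_mult[OF Am Bm BAm assms(1,2) this] show ?thesis
    unfolding dminus_def
    using det_mult[OF compressed_carrier[OF Am Bm assms(1)] compressed_carrier[OF Am Bm assms(2)]] by simp
qed

lemma dplus_smult: "X \<in> carrier_mat deg deg \<Longrightarrow> dplus (c \<cdot>\<^sub>m X) = c ^ Suc k * dplus X"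
  unfolding dplus_def using compressed_smult[OF Ap Bp, of X c] carrier_matD(2)[OF compressed_carrier[OF Ap Bp, of X]]
  by (simp only: det_smult)

lemma dminus_smult: "X \<in> carrier_mat deg deg \<Longrightarrow> dminus (c \<cdot>\<^sub>m X) = c ^ k * dminus X"
  unfolding dminus_def using compressed_smult[OF Am Bm, of X c] carrier_matD(2)[OF compressed_carrier[OF Am Bm, of X]]
  by (simp only: det_smult)

lemma dplus_one: "dplus (1\<^sub>m deg) = 1" and dminus_one: "dminus (1\<^sub>m deg) = 1"
  unfolding dplus_def dminus_def right_mult_one_mat[OF Bp] right_mult_one_mat[OF Bm] BAp BAm by simp_all

text \<open>Only the idempotents \<open>eplus\<close> and \<open>eminus\<close> enter, by
  \<open>compressed_det\<close>. Their entries are explicit members of the ring, whereas those of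
  \<open>Ap\<close>, \<open>Bp\<close>, \<open>Am\<close> and \<open>Bm\<close> need not be.\<close>

lemma dplus_ints:
  assumes X: "X \<in> carrier_mat deg deg" and e: "\<And>i j. i < deg \<Longrightarrow> j < deg \<Longrightarrow> X $$ (i, j) \<in> ints"
  shows "dplus X \<in> ints" "dminus X \<in> ints"
proof -
  have D: "det (1\<^sub>m deg + (P * X - P)) \<in> ints"
    if P: "P \<in> carrier_mat deg deg" "\<And>i j. i < deg \<Longrightarrow> j < deg \<Longrightarrow> P $$ (i, j) \<in> ints" for P
  proof (rule adjoin_det)
    show "1\<^sub>m deg + (P * X - P) \<in> carrier_mat deg deg" by (intro add_carrier_mat minus_carrier_mat P)
    fix i j assume ij: "i < deg" "j < deg"
    have "(1\<^sub>m deg + (P * X - P)) $$ (i, j) = 1\<^sub>m deg $$ (i, j) + ((P * X) $$ (i, j) - P $$ (i, j))"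
      using ij P(1) X by (simp del: index_mult_mat(1))
    moreover have "(P * X) $$ (i, j) \<in> ints" by (rule mult_ints[OF P(1) X ij P(2) e])
    moreover have "1\<^sub>m deg $$ (i, j) \<in> ints" using ij by (simp add: adjoin_one adjoin_zero)
    ultimately show "(1\<^sub>m deg + (P * X - P)) $$ (i, j) \<in> ints"
      using P(2)[OF ij] by (simp only: adjoin_add adjoin_diff)
  qed
  show "dplus X \<in> ints"
    unfolding dplus_def compressed_det[OF Ap Bp BAp X] ABp by (rule D[OF eplus_carrier]) (rule eplus_ints(1))
  show "dminus X \<in> ints"
    unfolding dminus_def compressed_det[OF Am Bm BAm X] ABm by (rule D[OF eminus_carrier]) (rule eplus_ints(2))
qed

lemma dplus_proj_inv:
  assumes h: "h \<in> carrier H"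
  shows "dplus (proj h) * dplus (proj (inv\<^bsub>H\<^esub> h)) = of_nat (proj_norm h) ^ Suc k"
    "dminus (proj h) * dminus (proj (inv\<^bsub>H\<^esub> h)) = of_nat (proj_norm h) ^ k"
  using dplus_mult[OF proj_carrier proj_carrier proj_zed[OF H.inv_closed[OF h]], of h]
    dminus_mult[OF proj_carrier proj_carrier proj_zed[OF H.inv_closed[OF h]], of h]
  unfolding proj_inv[OF h] dplus_smult[OF one_carrier_mat] dminus_smult[OF one_carrier_mat] dplus_one dminus_one
  by simp_all

lemma dplus_proj_nonzero:
  assumes h: "h \<in> carrier H"
  shows "dplus (proj h) \<noteq> 0" "dminus (proj h) \<noteq> 0"
proof -
  have n: "(of_nat (proj_norm h) :: complex) ^ i \<noteq> 0" for i using proj_norm_pos[OF h] by simp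
  show "dplus (proj h) \<noteq> 0" using dplus_proj_inv(1)[OF h] n[of "Suc k"] by (metis mult_zero_left)
  show "dminus (proj h) \<noteq> 0" using dplus_proj_inv(2)[OF h] n[of k] by (metis mult_zero_left)
qed

text \<open>Rescaling \<open>proj h\<close> by \<open>c\<close> multiplies the quotient of the two determinants by \<open>1 / c\<close>, because the
  eigenspaces have consecutive dimensions; so this choice of scalar is canonical, hence multiplicative.\<close>

definition ratio where "ratio h = dminus (proj h) / dplus (proj h)"

definition weil where "weil h = ratio h \<cdot>\<^sub>m proj h"

lemma weil_carrier [simp]: "weil h \<in> carrier_mat deg deg"
  by (simp add: weil_def)

lemma weil_mult:
  assumes h: "h \<in> carrier H" and l: "l \<in> carrier H"
  shows "weil (h \<otimes>\<^bsub>H\<^esub> l) = weil h * weil l"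
proof -
  obtain c where c: "c \<noteq> 0" "proj h * proj l = c \<cdot>\<^sub>m proj (h \<otimes>\<^bsub>H\<^esub> l)"
    using proj_mult[OF h l] by (elim exE conjE)
  have p: "dplus (proj h) * dplus (proj l) = c ^ Suc k * dplus (proj (h \<otimes>\<^bsub>H\<^esub> l))"
    using dplus_mult[OF proj_carrier proj_carrier proj_zed[OF l], of h] dplus_smult[OF proj_carrier] c(2) by simp
  have m: "dminus (proj h) * dminus (proj l) = c ^ k * dminus (proj (h \<otimes>\<^bsub>H\<^esub> l))"
    using dminus_mult[OF proj_carrier proj_carrier proj_zed[OF l], of h] dminus_smult[OF proj_carrier] c(2) by simp
  have "ratio h * ratio l = (dminus (proj h) * dminus (proj l)) / (dplus (proj h) * dplus (proj l))"
    by (simp add: ratio_def)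
  also have "\<dots> = ratio (h \<otimes>\<^bsub>H\<^esub> l) / c" unfolding p m ratio_def using c(1) by simp
  finally have r: "ratio h * ratio l * c = ratio (h \<otimes>\<^bsub>H\<^esub> l)" using c(1) by simp
  have "weil h * weil l = (ratio h * ratio l) \<cdot>\<^sub>m (proj h * proj l)"
    unfolding weil_def mult_smult_assoc_mat[OF proj_carrier smult_carrier_mat[OF proj_carrier]]
      mult_smult_distrib[OF proj_carrier proj_carrier] smult_smult_mat ..
  then show ?thesis unfolding c(2) smult_smult_mat r weil_def ..
qed

lemma weil_trivial:
  assumes "\<And>x. x \<in> carrier E \<Longrightarrow> act h x = x"
  shows "weil h = 1\<^sub>m deg"
proof -
  have pt: "proj h = of_nat (card (carrier E)) \<cdot>\<^sub>m 1\<^sub>m deg" by (rule proj_trivial) (rule assms)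
  have "ratio h = 1 / of_nat (card (carrier E))"
    unfolding ratio_def pt dplus_smult[OF one_carrier_mat] dminus_smult[OF one_carrier_mat]
      dplus_one dminus_one using card_E_pos by simp
  then have "weil h = (1 / of_nat (card (carrier E)) * of_nat (card (carrier E))) \<cdot>\<^sub>m 1\<^sub>m deg"
    unfolding weil_def pt smult_smult_mat by simp
  then show ?thesis using card_E_pos by (simp add: one_smult_mat)
qed

lemma weil_representation: "representation H deg weil"
  by (rule H.representationI) (simp_all add: weil_mult weil_trivial act_one)

lemma weil_commute: "h \<in> carrier H \<Longrightarrow> y \<in> carrier E \<Longrightarrow> heis y * weil h = weil h * heis (act h y)"
  unfolding weil_def mult_smult_assoc_mat[OF proj_carrier heis_carrier] mult_smult_distrib[OF heis_carrier proj_carrier]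
  by (simp only: proj_commute)

lemma weil_zed: "h \<in> carrier H \<Longrightarrow> zed * weil h = weil h * zed"
  unfolding weil_def mult_smult_assoc_mat[OF proj_carrier zed_carrier] mult_smult_distrib[OF zed_carrier proj_carrier]
  by (simp only: proj_zed)

lemma ratio_nonzero: "h \<in> carrier H \<Longrightarrow> ratio h \<noteq> 0"
  unfolding ratio_def using dplus_proj_nonzero by simp

text \<open>Of the \<open>Suc k\<close> factors \<open>ratio h\<close> on the larger eigenspace, one
  replaces \<open>dplus (proj h)\<close> by \<open>dminus (proj h)\<close>. The other
  \<open>k\<close> are exactly the scaling on the smaller eigenspace.\<close>

lemma weil_det_equal:
  assumes h: "h \<in> carrier H"
  shows "dplus (weil h) = dminus (weil h)" "dplus (weil h) \<noteq> 0"
proof -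
  have "dplus (weil h) = ratio h ^ k * (ratio h * dplus (proj h))"
    unfolding weil_def dplus_smult[OF proj_carrier] by simp
  also have "ratio h * dplus (proj h) = dminus (proj h)"
    unfolding ratio_def using dplus_proj_nonzero(1)[OF h] by simp
  finally show "dplus (weil h) = dminus (weil h)"
    unfolding weil_def dminus_smult[OF proj_carrier] .
  show "dplus (weil h) \<noteq> 0"
    unfolding weil_def dplus_smult[OF proj_carrier] using ratio_nonzero[OF h] dplus_proj_nonzero(1)[OF h] by simp
qed

lemma proj_ints: "h \<in> carrier H \<Longrightarrow> i < deg \<Longrightarrow> j < deg \<Longrightarrow> proj h $$ (i, j) \<in> ints"
  unfolding proj_def by (rule intertw_ints[OF act_isom])

text \<open>Dividing by \<open>dplus (proj h)\<close> stays inside the ring: its inverse is the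
  value of \<open>dplus\<close> at the intertwiner of the inverse element, over a power of
  \<open>proj_norm h\<close>.\<close>

lemma ratio_ints:
  assumes h: "h \<in> carrier H"
  shows "ratio h \<in> ints"
proof -
  have "1 / dplus (proj h) = dplus (proj (inv\<^bsub>H\<^esub> h)) * (1 / of_nat (proj_norm h)) ^ Suc k"
    using dplus_proj_inv(1)[OF h] dplus_proj_nonzero(1)[OF h] proj_norm_pos[OF h]
    unfolding power_one_over by (simp only: divide_eq_eq eq_divide_eq) (simp add: mult_ac)
  moreover have "ratio h = dminus (proj h) * (1 / dplus (proj h))" by (simp add: ratio_def)
  ultimately have "ratio h = dminus (proj h) * (dplus (proj (inv\<^bsub>H\<^esub> h)) * (1 / of_nat (proj_norm h)) ^ Suc k)" by simp
  moreover have "dminus (proj h) \<in> ints" by (rule dplus_ints(2)[OF proj_carrier]) (rule proj_ints[OF h])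
  moreover have "dplus (proj (inv\<^bsub>H\<^esub> h)) \<in> ints"
    by (rule dplus_ints(1)[OF proj_carrier]) (rule proj_ints[OF H.inv_closed[OF h]])
  ultimately show ?thesis
    using recip_proj_norm_ints[OF h] by (simp only: adjoin_mult adjoin_power)
qed

lemma det_weil_ints:
  assumes h: "h \<in> carrier H"
  shows "det (weil h) \<in> ints"
proof (rule adjoin_det[OF weil_carrier])
  fix i j assume ij: "i < deg" "j < deg"
  have "weil h $$ (i, j) = ratio h * proj h $$ (i, j)"
    unfolding weil_def using ij by (simp add: carrier_matD[OF proj_carrier])
  then show "weil h $$ (i, j) \<in> ints" by (simp only: adjoin_mult ratio_ints[OF h] proj_ints[OF h ij])
qed

text \<open>Both the order \<open>deg * deg\<close> of \<open>root\<close> and the denominator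
  \<open>2 * deg\<close> of the ring are prime to \<open>q\<close>, so the ring holds no nontrivial
  root of unity of \<open>q\<close>-power order.\<close>

lemma det_weil_prime_power_eq_1:
  assumes h: "h \<in> carrier H" and q: "prime q" "odd q" "\<not> q dvd deg" and "det (weil h) ^ (q ^ a) = 1"
  shows "det (weil h) = 1"
proof (rule root_of_unity_in_adjoin_eq_1[OF root_pow card_E_pos _ _ _ q(1,2) det_weil_ints[OF h] assms(5)])
  show "0 < 2 * deg" using deg_pos by simp
  have "\<not> q dvd 2"
  proof
    assume "q dvd 2"
    then have "q \<le> 2" by (simp add: dvd_imp_le)
    then have "q = 2" using prime_ge_2_nat[OF q(1)] by simp
    then show False using q(2) by simp
  qed
  then show "\<not> q dvd 2 * deg" using q(3) unfolding prime_dvd_mult_iff[OF q(1)] by simp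
  show "\<not> q dvd card (carrier E)" using q(3) unfolding deg_square[symmetric] prime_dvd_mult_iff[OF q(1)] by simp
qed

end

section \<open>Restriction to subgroups and characters of norm one\<close>

lemma (in fin_group) subgrp_fin_group: "subgroup W G \<Longrightarrow> fin_group (subgrp G W)"
  using subgroup.subgroup_is_group[of W G] finite_subset[OF subgroup.subset finite_G] is_group
  by (simp add: fin_group_def fin_group_axioms_def)

lemma (in fin_group) restrict_representation:
  assumes "representation G n \<rho>" "subgroup W G"
  shows "representation (subgrp G W) n \<rho>"
proof -
  interpret V: fin_group "subgrp G W" by (rule subgrp_fin_group[OF assms(2)])
  have c: "w \<in> W \<Longrightarrow> w \<in> carrier G" for w using subgroup.mem_carrier[OF assms(2)] .
  show ?thesis
    by (rule V.representationI) (simp_all add: rep_carrier[OF assms(1)] rep_mult[OF assms(1)] rep_one[OF assms(1)] c)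
qed

text \<open>Norm 1 says that the squares of the integers \<open>m \<xi> - m' \<xi>\<close> add up to
  1, so just one of them is nonzero, with value 1 or -1. The value 1 at the identity fixes the sign
  and the degree. Sum and difference of multiplicities have the same parity, which gives the last
  clause.\<close>

lemma (in fin_group) virtual_character_norm_one:
  assumes p: "irr_decomposition G \<chi> m" and q: "irr_decomposition G \<chi>' m'"
    and norm: "\<And>g. g \<in> carrier G \<Longrightarrow> (\<chi> g - \<chi>' g) * (\<chi> (inv g) - \<chi>' (inv g)) = 1"
    and one: "\<chi> \<one> - \<chi>' \<one> = 1"
  shows "\<exists>\<xi> \<rho>. \<xi> \<in> Irr G \<and> representation G 1 \<rho> \<and> (\<forall>g\<in>carrier G. \<xi> g = mat_trace (\<rho> g) \<and> \<xi> g = \<chi> g - \<chi>' g) \<and>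
     (\<forall>\<eta>. odd (m \<eta> + m' \<eta>) \<longleftrightarrow> \<eta> = \<xi>)"
proof -
  define d where "d \<xi> = int (m \<xi>) - int (m' \<xi>)" for \<xi>
  define F where "F = {\<xi>. m \<xi> \<noteq> 0} \<union> {\<xi>. m' \<xi> \<noteq> 0}"
  have fin: "finite F" and FI: "F \<subseteq> Irr G" using p q by (simp_all add: F_def irr_decomposition_def)
  have p': "\<chi> g = (\<Sum>\<xi>\<in>F. of_nat (m \<xi>) * \<xi> g)" if "g \<in> carrier G" for g
  proof -
    have "\<chi> g = (\<Sum>\<xi> | m \<xi> \<noteq> 0. of_nat (m \<xi>) * \<xi> g)" using p that by (simp add: irr_decomposition_def)
    also have "\<dots> = (\<Sum>\<xi>\<in>F. of_nat (m \<xi>) * \<xi> g)" using fin by (intro sum.mono_neutral_left) (auto simp: F_def)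
    finally show ?thesis .
  qed
  have q': "\<chi>' g = (\<Sum>\<xi>\<in>F. of_nat (m' \<xi>) * \<xi> g)" if "g \<in> carrier G" for g
  proof -
    have "\<chi>' g = (\<Sum>\<xi> | m' \<xi> \<noteq> 0. of_nat (m' \<xi>) * \<xi> g)" using q that by (simp add: irr_decomposition_def)
    also have "\<dots> = (\<Sum>\<xi>\<in>F. of_nat (m' \<xi>) * \<xi> g)" using fin by (intro sum.mono_neutral_left) (auto simp: F_def)
    finally show ?thesis .
  qed
  have diff: "\<chi> g - \<chi>' g = (\<Sum>\<xi>\<in>F. of_int (d \<xi>) * \<xi> g)" if "g \<in> carrier G" for g
    unfolding p'[OF that] q'[OF that] by (simp add: d_def sum_subtractf left_diff_distrib)
  have "(\<Sum>\<xi>\<in>F. of_int (d \<xi>) * (of_int (d \<xi>) * gsize))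
      = (\<Sum>\<xi>\<in>F. of_int (d \<xi>) * (\<Sum>\<eta>\<in>F. of_int (d \<eta>) * (\<Sum>g\<in>carrier G. \<xi> g * \<eta> (inv g))))"
  proof (rule sum.cong)
    fix \<xi> assume x: "\<xi> \<in> F"
    have "(\<Sum>\<eta>\<in>F. of_int (d \<eta>) * (\<Sum>g\<in>carrier G. \<xi> g * \<eta> (inv g))) = (\<Sum>\<eta>\<in>F. if \<eta> = \<xi> then of_int (d \<eta>) * gsize else 0)"
      using x FI by (intro sum.cong refl) (simp add: Irr_orthonormal subsetD)
    then show "of_int (d \<xi>) * (of_int (d \<xi>) * gsize) = of_int (d \<xi>) * (\<Sum>\<eta>\<in>F. of_int (d \<eta>) * (\<Sum>g\<in>carrier G. \<xi> g * \<eta> (inv g)))"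
      using x fin by simp
  qed simp
  also have "\<dots> = (\<Sum>\<xi>\<in>F. \<Sum>\<eta>\<in>F. \<Sum>g\<in>carrier G. (of_int (d \<xi>) * \<xi> g) * (of_int (d \<eta>) * \<eta> (inv g)))"
    by (simp add: sum_distrib_left mult_ac)
  also have "\<dots> = (\<Sum>\<xi>\<in>F. \<Sum>g\<in>carrier G. \<Sum>\<eta>\<in>F. (of_int (d \<xi>) * \<xi> g) * (of_int (d \<eta>) * \<eta> (inv g)))"
    by (rule sum.cong[OF refl]) (rule sum.swap)
  also have "\<dots> = (\<Sum>g\<in>carrier G. \<Sum>\<xi>\<in>F. \<Sum>\<eta>\<in>F. (of_int (d \<xi>) * \<xi> g) * (of_int (d \<eta>) * \<eta> (inv g)))"
    by (rule sum.swap)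
  also have "\<dots> = (\<Sum>g\<in>carrier G. (\<chi> g - \<chi>' g) * (\<chi> (inv g) - \<chi>' (inv g)))"
    by (intro sum.cong refl) (simp only: diff inv_closed sum_product)
  also have "\<dots> = gsize" using norm by simp
  finally have "gsize * of_int (\<Sum>\<xi>\<in>F. d \<xi> * d \<xi>) = gsize * 1" by (simp add: sum_distrib_left mult_ac)
  then have "of_int (\<Sum>\<xi>\<in>F. d \<xi> * d \<xi>) = (1 :: complex)" using gsize_nonzero by (simp only: mult_cancel_left) simp
  then have sq: "(\<Sum>\<xi>\<in>F. d \<xi> * d \<xi>) = 1" by (simp only: of_int_eq_1_iff)
  then have "\<exists>\<xi>\<in>F. d \<xi> \<noteq> 0" by (metis (no_types, lifting) mult_zero_left sum.neutral zero_neq_one)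
  then obtain \<xi> where \<xi>: "\<xi> \<in> F" "d \<xi> \<noteq> 0" by (elim bexE)
  have "(\<Sum>\<eta>\<in>F. d \<eta> * d \<eta>) = d \<xi> * d \<xi> + (\<Sum>\<eta>\<in>F - {\<xi>}. d \<eta> * d \<eta>)"
    by (rule sum.remove[OF fin \<xi>(1)])
  moreover have ge: "(\<Sum>\<eta>\<in>F - {\<xi>}. d \<eta> * d \<eta>) \<ge> 0" by (intro sum_nonneg) simp
  moreover have "d \<xi> * d \<xi> > 0" using \<xi>(2) by (metis not_square_less_zero linorder_neqE_linordered_idom mult_eq_0_iff)
  ultimately have "(\<Sum>\<eta>\<in>F - {\<xi>}. d \<eta> * d \<eta>) = 0" using sq by linarith
  then have "\<forall>\<eta>\<in>F - {\<xi>}. d \<eta> * d \<eta> = 0" using fin by (subst (asm) sum_nonneg_eq_0_iff) simp_all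
  then have d0: "d \<eta> = 0" if "\<eta> \<in> F" "\<eta> \<noteq> \<xi>" for \<eta> using that by simp
  have val: "\<chi> g - \<chi>' g = of_int (d \<xi>) * \<xi> g" if g: "g \<in> carrier G" for g
  proof -
    have "(\<Sum>\<eta>\<in>F. of_int (d \<eta>) * \<eta> g) = (\<Sum>\<eta>\<in>F. if \<eta> = \<xi> then of_int (d \<xi>) * \<xi> g else 0)"
      using d0 by (intro sum.cong refl) simp
    then show ?thesis using diff[OF g] \<xi>(1) fin by simp
  qed
  obtain n \<rho> where irr: "irreducible_representation G n \<rho>" and \<xi>\<rho>: "\<xi> = (\<lambda>g\<in>carrier G. mat_trace (\<rho> g))"
    using \<xi>(1) FI by (auto simp: Irr_def affords_def)
  have "of_int (d \<xi>) * of_nat n = (1 :: complex)"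
    using val[OF one_closed] one rep_one[OF irrepD[OF irr]] by (simp add: \<xi>\<rho>)
  then have "of_int (d \<xi> * int n) = (1 :: complex)" by simp
  then have "d \<xi> * int n = 1" by (simp only: of_int_eq_1_iff)
  then have dn: "d \<xi> = 1" "n = 1" by (auto simp: zmult_eq_1_iff)
  have par: "odd (m \<eta> + m' \<eta>) \<longleftrightarrow> odd (d \<eta>)" for \<eta> by (simp add: d_def)
  have "odd (m \<eta> + m' \<eta>) \<longleftrightarrow> \<eta> = \<xi>" for \<eta>
  proof (cases "\<eta> \<in> F")
    case True
    then show ?thesis unfolding par using d0[of \<eta>] dn by (cases "\<eta> = \<xi>") simp_all
  next
    case False
    then have "d \<eta> = 0" by (simp add: F_def d_def)
    then show ?thesis unfolding par using False \<xi>(1) by (cases "\<eta> = \<xi>") simp_all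
  qed
  moreover have "\<xi> \<in> Irr G" using \<xi>(1) FI by (rule subsetD[rotated])
  moreover have "representation G 1 \<rho>" using irrepD[OF irr] dn by simp
  ultimately show ?thesis
    using val dn by (intro exI[of _ \<xi>] exI[of _ \<rho>]) (simp add: \<xi>\<rho>)
qed

lemma mat_trace_pow_1:
  assumes "A \<in> carrier_mat 1 1"
  shows "mat_trace (A ^\<^sub>m k) = (mat_trace A :: complex) ^ k"
proof (induction k)
  case (Suc k)
  have Ak: "A ^\<^sub>m k \<in> carrier_mat 1 1" using assms by simp
  have "mat_trace (A ^\<^sub>m k * A) = mat_trace (A ^\<^sub>m k) * mat_trace A"
    unfolding mat_trace_mult[OF Ak assms] mat_trace_carrier[OF assms] mat_trace_carrier[OF Ak] by simp
  then show ?case using Suc by simp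
qed (use assms in simp)

context split_action
begin

lemma act_pow_inv:
  assumes h: "h \<in> carrier H" and y: "y \<in> carrier E" "act h y = inv y"
  shows "act (h [^]\<^bsub>H\<^esub> (i::nat)) y = (if even i then y else inv y)"
proof (induction i)
  case (Suc i)
  have "act (h [^]\<^bsub>H\<^esub> Suc i) y = act h (act (h [^]\<^bsub>H\<^esub> i) y)"
    using act_mult[of "h [^]\<^bsub>H\<^esub> i" h y] h y by simp
  also have "\<dots> = (if even i then act h y else act h (inv y))" unfolding Suc by simp
  also have "\<dots> = (if even (Suc i) then y else inv y)"
    using isom_inv[OF act_isom[OF h] y(1)] y by simp
  finally show ?case .
qed (use y act_one in simp)

lemma zed_weil_trace_norm:
  assumes h: "h \<in> carrier H" and s: "odd s" "\<And>x. x \<in> carrier E \<Longrightarrow> act (h [^]\<^bsub>H\<^esub> (s::nat)) x = x"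
  shows "mat_trace (zed * weil h) * mat_trace (zed * weil (inv\<^bsub>H\<^esub> h)) = 1"
proof -
  define g where "g y = act h (inv y)" for y
  have g: "isom g"
    using act_isom[OF h] isom_inverse by (simp add: g_def isom_def act_closed[OF h])
  \<comment> \<open>A fixed point of \<open>g\<close> is inverted by \<open>h\<close>. Applying
    \<open>h\<close> an odd number \<open>s\<close> of times inverts it again but also fixes it, so
    it equals its own inverse and is trivial in odd order.\<close>
  have "y = \<one>" if y: "y \<in> carrier E" "g y = y" for y
  proof -
    have "inv (act h y) = y" using isom_inv[OF act_isom[OF h] y(1)] y(2) by (simp add: g_def)
    then have "act h y = inv y" using inv_inv[OF act_closed[OF h y(1)]] by simp
    from act_pow_inv[OF h y(1) this, of s] have "inv y = y" using s(1) s(2)[OF y(1)] by simp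
    then have "y \<in> fixpts (\<lambda>x. inv x)" using y(1) by (simp add: fixpts_def)
    then show ?thesis by (simp add: fixpts_inverse)
  qed
  then have fixg: "fixpts g = {\<one>}" using isom_one[OF g] by (auto simp: fixpts_def)
  have hi: "inv\<^bsub>H\<^esub> h \<in> carrier H" using h by simp
  have W: "zed * weil h \<in> carrier_mat deg deg" "weil (inv\<^bsub>H\<^esub> h) * zed \<in> carrier_mat deg deg"
    by (rule mult_carrier_mat[OF zed_carrier weil_carrier], rule mult_carrier_mat[OF weil_carrier zed_carrier])
  have "weil (inv\<^bsub>H\<^esub> h) * zed * (zed * weil h) = weil (inv\<^bsub>H\<^esub> h) * (zed * zed * weil h)"
    using assoc_mult_mat[OF weil_carrier zed_carrier W(1)] assoc_mult_mat[OF zed_carrier zed_carrier weil_carrier] by simp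
  also have "\<dots> = weil (inv\<^bsub>H\<^esub> h) * weil h" unfolding zed_square left_mult_one_mat[OF weil_carrier] ..
  also have "\<dots> = 1\<^sub>m deg" by (rule H.rep_inv(2)[OF weil_representation h])
  finally have inv1: "weil (inv\<^bsub>H\<^esub> h) * zed * (zed * weil h) = 1\<^sub>m deg" .
  have comm: "heis y * (zed * weil h) = zed * weil h * heis (g y)" if y: "y \<in> carrier E" for y
  proof -
    have "heis y * (zed * weil h) = zed * heis (inv y) * weil h"
      unfolding heis_zed[OF y, symmetric] by (rule assoc_mult_mat[OF heis_carrier zed_carrier weil_carrier, symmetric])
    also have "\<dots> = zed * (weil h * heis (act h (inv y)))"
      using assoc_mult_mat[OF zed_carrier heis_carrier weil_carrier] weil_commute[OF h inv_closed[OF y]] by simp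
    also have "\<dots> = zed * weil h * heis (g y)"
      unfolding g_def by (rule assoc_mult_mat[OF zed_carrier weil_carrier heis_carrier, symmetric])
    finally show ?thesis .
  qed
  have "mat_trace (zed * weil h) * mat_trace (weil (inv\<^bsub>H\<^esub> h) * zed) = of_nat (card (fixpts g))"
    by (rule trace_times_trace_inverse[OF W inv1 g comm])
  then show ?thesis unfolding fixg weil_zed[OF hi, symmetric] by simp
qed

text \<open>On a subgroup of odd order modulo the kernel of the action, the characters of the two eigenspaces
  differ by a generalised character of norm one and degree one, that is by a linear character; it is
  trivial since both eigenspaces have the same determinant.\<close>

lemma weil_trivial_unique_odd:
  assumes W: "subgroup W H" and s: "odd s" "\<And>w x. w \<in> W \<Longrightarrow> x \<in> carrier E \<Longrightarrow> act (w [^]\<^bsub>H\<^esub> (s::nat)) x = x"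
    and \<psi>: "\<And>w. w \<in> W \<Longrightarrow> \<psi> w = mat_trace (weil w)"
  shows "trivial_unique_odd H W \<psi>"
proof -
  interpret V: fin_group "subgrp H W" by (rule H.subgrp_fin_group[OF W])
  have WH: "w \<in> carrier H" if "w \<in> W" for w using subgroup.mem_carrier[OF W that] .
  have invV: "inv\<^bsub>subgrp H W\<^esub> w = inv\<^bsub>H\<^esub> w" if "w \<in> W" for w
    using H.m_inv_consistent[OF W that] by simp
  define P where "P w = Bp * weil w * Ap" for w
  define N where "N w = Bm * weil w * Am" for w
  have Pc: "P w \<in> carrier_mat (Suc k) (Suc k)" and Nc: "N w \<in> carrier_mat k k" for w
    unfolding P_def N_def by (rule compressed_carrier[OF Ap Bp weil_carrier], rule compressed_carrier[OF Am Bm weil_carrier])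
  have rP: "representation H (Suc k) P"
    unfolding P_def by (rule H.compressed_representation(1)[OF weil_representation Ap Bp BAp])
      (unfold ABp, rule eplus_commute(1)[OF weil_carrier weil_zed])
  have rN: "representation H k N"
    unfolding N_def by (rule H.compressed_representation(1)[OF weil_representation Am Bm BAm])
      (unfold ABm, rule eplus_commute(2)[OF weil_carrier weil_zed])
  note rPW = H.restrict_representation[OF rP W] and rNW = H.restrict_representation[OF rN W]
  have tP: "mat_trace (P w) = (mat_trace (weil w) + mat_trace (zed * weil w)) / 2" for w
    unfolding P_def compressed_trace[OF Ap Bp weil_carrier] ABp by (rule eplus_trace_mult(1)[OF weil_carrier])
  have tN: "mat_trace (N w) = (mat_trace (weil w) - mat_trace (zed * weil w)) / 2" for w
    unfolding N_def compressed_trace[OF Am Bm weil_carrier] ABm by (rule eplus_trace_mult(2)[OF weil_carrier])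
  have diff: "mat_trace (P w) - mat_trace (N w) = mat_trace (zed * weil w)" for w
    unfolding tP tN by (simp add: field_simps)
  define \<chi> where "\<chi> = (\<lambda>w\<in>carrier (subgrp H W). mat_trace (P w))"
  define \<chi>' where "\<chi>' = (\<lambda>w\<in>carrier (subgrp H W). mat_trace (N w))"
  obtain m where m: "irr_decomposition (subgrp H W) \<chi> m"
    using V.irr_decomposition_exists[OF rPW] unfolding \<chi>_def by (elim exE)
  obtain m' where m': "irr_decomposition (subgrp H W) \<chi>' m'"
    using V.irr_decomposition_exists[OF rNW] unfolding \<chi>'_def by (elim exE)
  have "\<exists>\<xi> \<rho>. \<xi> \<in> Irr (subgrp H W) \<and> representation (subgrp H W) 1 \<rho> \<and>
     (\<forall>g\<in>carrier (subgrp H W). \<xi> g = mat_trace (\<rho> g) \<and> \<xi> g = \<chi> g - \<chi>' g) \<and>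
     (\<forall>\<eta>. odd (m \<eta> + m' \<eta>) \<longleftrightarrow> \<eta> = \<xi>)"
  proof (rule V.virtual_character_norm_one[OF m m'])
    fix w assume "w \<in> carrier (subgrp H W)"
    then have w: "w \<in> W" by simp
    have wi: "inv\<^bsub>H\<^esub> w \<in> W" using subgroup.m_inv_closed[OF W w] .
    show "(\<chi> w - \<chi>' w) * (\<chi> (inv\<^bsub>subgrp H W\<^esub> w) - \<chi>' (inv\<^bsub>subgrp H W\<^esub> w)) = 1"
    proof -
      have "mat_trace (zed * weil w) * mat_trace (zed * weil (inv\<^bsub>H\<^esub> w)) = 1"
        by (rule zed_weil_trace_norm[OF WH[OF w] s(1)]) (rule s(2)[OF w])
      then show ?thesis unfolding invV[OF w] using w wi by (simp add: \<chi>_def \<chi>'_def diff)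
    qed
  next
    have "\<one>\<^bsub>H\<^esub> \<in> W" using subgroup.one_closed[OF W] .
    then show "\<chi> \<one>\<^bsub>subgrp H W\<^esub> - \<chi>' \<one>\<^bsub>subgrp H W\<^esub> = 1"
      by (simp add: \<chi>_def \<chi>'_def diff H.rep_one[OF weil_representation] right_mult_one_mat[OF zed_carrier] zed_trace)
  qed
  then obtain \<xi> \<rho> where \<xi>: "\<xi> \<in> Irr (subgrp H W)" and \<rho>: "representation (subgrp H W) 1 \<rho>"
    and vals: "\<forall>g\<in>carrier (subgrp H W). \<xi> g = mat_trace (\<rho> g) \<and> \<xi> g = \<chi> g - \<chi>' g"
    and odd: "\<forall>\<eta>. odd (m \<eta> + m' \<eta>) \<longleftrightarrow> \<eta> = \<xi>" by (elim exE conjE)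
  have \<xi>\<rho>: "\<xi> w = mat_trace (\<rho> w)" if "w \<in> W" for w
    by (rule conjunct1[OF bspec[OF vals]]) (simp add: that)
  have \<xi>\<chi>: "\<xi> w = \<chi> w - \<chi>' w" if "w \<in> W" for w
    by (rule conjunct2[OF bspec[OF vals]]) (simp add: that)
  have \<xi>1: "\<xi> w = 1" if w: "w \<in> W" for w
  proof -
    have wV: "w \<in> carrier (subgrp H W)" using w by simp
    obtain as where as: "\<forall>i. mat_trace (P w ^\<^sub>m i) = (\<Sum>a\<leftarrow>as. a ^ i)" "det (P w) = prod_list as"
      using trace_pow_det[OF Pc[of w]] by (elim exE conjE)
    obtain bs where bs: "\<forall>i. mat_trace (N w ^\<^sub>m i) = (\<Sum>a\<leftarrow>bs. a ^ i)" "det (N w) = prod_list bs"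
      using trace_pow_det[OF Nc[of w]] by (elim exE conjE)
    \<comment> \<open>On the powers of \<open>w\<close> the two characters differ by
      \<open>\<xi> w ^ i\<close>. So the eigenvalues on the larger eigenspace are those on the
      smaller one together with \<open>\<xi> w\<close>, and equality of the determinants forces
      \<open>\<xi> w = 1\<close>.\<close>
    have "(\<Sum>a\<leftarrow>as. a ^ i) = (\<Sum>b\<leftarrow>\<xi> w # bs. b ^ i)" for i :: nat
    proof -
      define v where "v = w [^]\<^bsub>subgrp H W\<^esub> i"
      have v: "v \<in> W" using V.nat_pow_closed[OF wV, of i] by (simp add: v_def)
      have "(\<Sum>a\<leftarrow>as. a ^ i) = mat_trace (P v)" using as(1) V.rep_pow[OF rPW wV] by (simp add: v_def)
      also have "\<dots> = \<xi> v + mat_trace (N v)" using \<xi>\<chi>[OF v] v by (simp add: \<chi>_def \<chi>'_def)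
      also have "\<xi> v = \<xi> w ^ i"
        using \<xi>\<rho>[OF v] \<xi>\<rho>[OF w] V.rep_pow[OF \<rho> wV, of i] mat_trace_pow_1[OF V.rep_carrier[OF \<rho> wV], of i] by (simp add: v_def)
      also have "mat_trace (N v) = (\<Sum>b\<leftarrow>bs. b ^ i)" using bs(1) V.rep_pow[OF rNW wV] by (simp add: v_def)
      finally show ?thesis by simp
    qed
    then have "mset as = mset (\<xi> w # bs)" by (rule power_sums_mset_eq)
    then have "prod_list as = prod_list (\<xi> w # bs)" by (metis prod_mset_prod_list)
    then have "det (P w) = \<xi> w * det (N w)" using as(2) bs(2) by simp
    moreover have "det (P w) = det (N w)" "det (P w) \<noteq> 0"
      using weil_det_equal[OF WH[OF w]] by (simp_all add: P_def N_def dplus_def dminus_def)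
    ultimately show ?thesis by simp
  qed
  have triv: "\<xi> = trivial_character W"
  proof
    fix w
    obtain n \<rho>' where "\<xi> = (\<lambda>g\<in>carrier (subgrp H W). mat_trace (\<rho>' g))" using \<xi> by (auto simp: Irr_def affords_def)
    then have "\<xi> w = undefined" if "w \<notin> W" using that by simp
    then show "\<xi> w = trivial_character W w" using \<xi>1 by (cases "w \<in> W") simp_all
  qed
  have "irr_decomposition (subgrp H W) (restrict \<psi> W) (\<lambda>\<eta>. m \<eta> + m' \<eta>)"
  proof (rule V.irr_decomposition_add[OF m m'])
    fix w assume "w \<in> carrier (subgrp H W)"
    then show "restrict \<psi> W w = \<chi> w + \<chi>' w" by (simp add: \<psi> \<chi>_def \<chi>'_def tP tN field_simps)
  qed
  from V.irr_mult_eq[OF this] have "irr_mult (subgrp H W) (restrict \<psi> W) \<eta> = m \<eta> + m' \<eta>" for \<eta> by simp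
  then have "{\<eta> \<in> Irr (subgrp H W). odd (irr_mult (subgrp H W) (restrict \<psi> W) \<eta>)} = {\<xi>}"
    using odd \<xi> by auto
  then show ?thesis by (simp only: trivial_unique_odd_def triv)
qed

end

section \<open>Removing the 2-part of the determinant\<close>

context isometric_action
begin

text \<open>In the determinant clause \<open>N\<close> is the part of the group order prime to
  \<open>q\<close>, so the clause says that the order of the determinant is prime to
  \<open>q\<close>. In the last clause an odd exponent \<open>s\<close> replaces odd order of
  \<open>W\<close>, because \<open>W\<close> may contain a kernel of even order.\<close>

theorem canonical_weil_representation:
  "\<exists>\<Sigma>. representation H deg \<Sigma> \<and>
     (\<forall>h\<in>carrier H. \<forall>y\<in>carrier E. heis y * \<Sigma> h = \<Sigma> h * heis (act h y)) \<and>
     (\<forall>h\<in>carrier H. (\<forall>x\<in>carrier E. act h x = x) \<longrightarrow> \<Sigma> h = 1\<^sub>m deg) \<and>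
     (\<forall>h\<in>carrier H. \<forall>q a N. prime q \<and> \<not> q dvd deg \<and> card (carrier H) = q ^ a * N \<and> \<not> q dvd N \<longrightarrow> det (\<Sigma> h) ^ N = 1) \<and>
     (\<forall>W \<psi> s. subgroup W H \<and> odd s \<and> (\<forall>w\<in>W. \<forall>x\<in>carrier E. act (w [^]\<^bsub>H\<^esub> (s::nat)) x = x) \<and>
        (\<forall>w\<in>W. \<psi> w = mat_trace (\<Sigma> w)) \<longrightarrow> trivial_unique_odd H W \<psi>)"
proof -
  obtain k Ap Bp Am Bm where "Ap \<in> carrier_mat deg (Suc k)" "Bp \<in> carrier_mat (Suc k) deg" "Ap * Bp = eplus"
     "Bp * Ap = 1\<^sub>m (Suc k)" "Am \<in> carrier_mat deg k" "Bm \<in> carrier_mat k deg" "Am * Bm = eminus" "Bm * Am = 1\<^sub>m k"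
    using eigenspace_factorizations by (elim exE conjE)
  then interpret split_action E \<beta> H act k Ap Bp Am Bm by unfold_locales
  define \<mu> where "\<mu> h = det (weil h)" for h
  define M where "M = card (carrier H)"
  have \<mu>m: "\<mu> (h \<otimes>\<^bsub>H\<^esub> l) = \<mu> h * \<mu> l" if "h \<in> carrier H" "l \<in> carrier H" for h l
    unfolding \<mu>_def weil_mult[OF that] by (rule det_mult[OF weil_carrier weil_carrier])
  have \<mu>1: "\<mu> h = 1" if "\<And>x. x \<in> carrier E \<Longrightarrow> act h x = x" for h
  proof -
    have "weil h = 1\<^sub>m deg" by (rule weil_trivial) (rule that)
    then show ?thesis unfolding \<mu>_def by simp
  qed
  have \<mu>p: "\<mu> (h [^]\<^bsub>H\<^esub> (i::nat)) = \<mu> h ^ i" if "h \<in> carrier H" for h i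
    using that by (induction i) (simp_all add: \<mu>m \<mu>1 act_one mult.commute)
  have \<mu>M: "\<mu> h ^ M = 1" if "h \<in> carrier H" for h
  proof -
    have "h [^]\<^bsub>H\<^esub> M = \<one>\<^bsub>H\<^esub>" using H.pow_order_eq_1[OF that] by (simp add: M_def Coset.order_def)
    then show ?thesis using \<mu>p[OF that, of M] \<mu>1[of "\<one>\<^bsub>H\<^esub>"] act_one by simp
  qed
  have M0: "M \<noteq> 0" using H.finite_G H.one_closed by (auto simp: M_def)
  obtain b r where br: "M = 2 ^ b * r" "odd r"
  proof -
    obtain r where "M = 2 ^ multiplicity 2 M * r" "\<not> 2 dvd r"
      by (rule multiplicity_decompose'[of M 2]) (use M0 in simp_all)
    then show thesis using that by blast
  qed
  have ddeg: "odd deg" using odd_order deg_square by (metis even_mult_iff)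
  \<comment> \<open>The exponent of the twist by \<open>\<mu>\<close>. Divisibility by the odd part
    \<open>r\<close> makes \<open>\<mu> ^ j\<close> a character of 2-power order; since the twist
    changes the determinant to \<open>\<mu> ^ (j * deg + 1)\<close>, the second condition removes
    the 2-part.\<close>
  obtain j where j: "r dvd j" "2 ^ b dvd j * deg + 1"
  proof -
    have "coprime (r * deg) (2 ^ b)" using br(2) ddeg by simp
    from cong_solve_coprime_nat[OF this] obtain x where "[r * deg * x = Suc 0] (mod 2 ^ b)" by (elim exE)
    then have x: "[r * deg * x = 1] (mod 2 ^ b)" by simp
    \<comment> \<open>Here \<open>x\<close> inverts \<open>r * deg\<close> modulo
      \<open>2 ^ b\<close>, and \<open>2 ^ b - 1\<close> serves as -1 within the natural numbers.
      The exponent \<open>r * i\<close> then satisfies both conditions.\<close>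
    define i where "i = x * (2 ^ b - 1)"
    have "[r * deg * x * (2 ^ b - 1) + 1 = 1 * (2 ^ b - 1) + 1] (mod 2 ^ b)"
      by (intro cong_add cong_mult x cong_refl)
    also have "1 * (2 ^ b - 1) + 1 = (2 ^ b :: nat)" by simp
    finally have "2 ^ b dvd r * deg * x * (2 ^ b - 1) + 1" by (simp add: cong_def dvd_eq_mod_eq_0)
    then show thesis using that[of "r * i"] by (simp add: i_def mult_ac)
  qed
  define \<Sigma> where "\<Sigma> h = \<mu> h ^ j \<cdot>\<^sub>m weil h" for h
  have \<Sigma>c: "\<Sigma> h \<in> carrier_mat deg deg" for h by (simp add: \<Sigma>_def)
  have \<Sigma>1: "\<Sigma> h = 1\<^sub>m deg" if "\<And>x. x \<in> carrier E \<Longrightarrow> act h x = x" for h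
  proof -
    have "weil h = 1\<^sub>m deg" by (rule weil_trivial) (rule that)
    moreover have "\<mu> h = 1" by (rule \<mu>1) (rule that)
    ultimately show ?thesis unfolding \<Sigma>_def by (simp add: one_smult_mat)
  qed
  have det\<Sigma>: "det (\<Sigma> h) = \<mu> h ^ (j * deg + 1)" for h
    unfolding \<Sigma>_def det_smult by (simp add: \<mu>_def[symmetric] carrier_matD[OF weil_carrier] power_mult)
  have rep: "representation H deg \<Sigma>"
  proof (rule H.representationI)
    fix h l assume hl: "h \<in> carrier H" "l \<in> carrier H"
    show "\<Sigma> (h \<otimes>\<^bsub>H\<^esub> l) = \<Sigma> h * \<Sigma> l"
      unfolding \<Sigma>_def mult_smult_assoc_mat[OF weil_carrier smult_carrier_mat[OF weil_carrier]]
        mult_smult_distrib[OF weil_carrier weil_carrier] smult_smult_mat weil_mult[OF hl, symmetric] \<mu>m[OF hl] power_mult_distrib ..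
  qed (simp_all add: \<Sigma>c \<Sigma>1 act_one)
  have comm: "heis y * \<Sigma> h = \<Sigma> h * heis (act h y)" if "h \<in> carrier H" "y \<in> carrier E" for h y
    unfolding \<Sigma>_def mult_smult_assoc_mat[OF weil_carrier heis_carrier] mult_smult_distrib[OF heis_carrier weil_carrier]
    by (simp only: weil_commute[OF that])
  have dets: "det (\<Sigma> h) ^ N = 1"
    if h: "h \<in> carrier H" and q: "prime q" "\<not> q dvd deg" "M = q ^ a * N" "\<not> q dvd N" for h q a N
  proof (cases "q = 2")
    case True
    \<comment> \<open>For \<open>q = 2\<close> the number \<open>N\<close> supplies the odd part
      \<open>r\<close> of \<open>M\<close>, and the choice of \<open>j\<close> supplies
      \<open>2 ^ b\<close>.\<close>
    have "M dvd (j * deg + 1) * N"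
    proof -
      have N: "odd N" using q(4) True by simp
      have e: "2 ^ b * r = 2 ^ a * N" using br(1) q(3) True by simp
      have "2 ^ b dvd (2::nat) ^ a * N" by (simp add: e[symmetric])
      then have "2 ^ b dvd (2::nat) ^ a" using N by (simp add: coprime_dvd_mult_left_iff)
      have "r dvd 2 ^ a * N" by (simp add: e[symmetric])
      then have "r dvd N" using br(2) by (simp add: coprime_dvd_mult_right_iff)
      then show ?thesis unfolding br(1) by (intro mult_dvd_mono j(2))
    qed
    then obtain t where "(j * deg + 1) * N = M * t" by (elim dvdE)
    then have "det (\<Sigma> h) ^ N = (\<mu> h ^ M) ^ t" unfolding det\<Sigma> power_mult[symmetric] by (simp only:)
    then show ?thesis using \<mu>M[OF h] by simp
  next
    case False
    then have "q > 2" using prime_ge_2_nat[OF q(1)] by simp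
    then have oq: "odd q" using q(1) by (rule prime_odd_nat[rotated])
    have hN: "h [^]\<^bsub>H\<^esub> N \<in> carrier H" using h by simp
    \<comment> \<open>At the \<open>N\<close>-th power of \<open>h\<close> the untwisted determinant
      has \<open>q\<close>-power order and lies in the ring, so it is 1. The twisted determinant is
      a power of the untwisted one and is handled along with it.\<close>
    have "\<mu> (h [^]\<^bsub>H\<^esub> N) ^ (q ^ a) = \<mu> h ^ M"
      unfolding \<mu>p[OF h] q(3) power_mult[symmetric] mult.commute[of N "q ^ a"] ..
    then have "\<mu> (h [^]\<^bsub>H\<^esub> N) = 1"
      using det_weil_prime_power_eq_1[OF hN q(1) oq q(2)] \<mu>M[OF h] by (simp add: \<mu>_def)
    then have "(\<mu> h ^ N) ^ (j * deg + 1) = 1" unfolding \<mu>p[OF h] by simp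
    then show ?thesis unfolding det\<Sigma> power_mult[symmetric] mult.commute[of N] .
  qed
  have odd: "trivial_unique_odd H W \<psi>"
    if W: "subgroup W H" and s: "odd s" "\<forall>w\<in>W. \<forall>x\<in>carrier E. act (w [^]\<^bsub>H\<^esub> (s::nat)) x = x"
      and \<psi>: "\<forall>w\<in>W. \<psi> w = mat_trace (\<Sigma> w)" for W \<psi> s
  proof (rule weil_trivial_unique_odd[OF W s(1)])
    fix w x assume "w \<in> W" "x \<in> carrier E"
    then show "act (w [^]\<^bsub>H\<^esub> s) x = x" using s(2) by simp
  next
    fix w assume w: "w \<in> W"
    have wH: "w \<in> carrier H" using subgroup.mem_carrier[OF W w] .
    \<comment> \<open>The order of \<open>\<mu> w ^ r\<close> divides both the odd number
      \<open>s\<close> and \<open>2 ^ b\<close>, so it is 1. Since \<open>r\<close> divides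
      \<open>j\<close>, the twist is trivial on \<open>W\<close>, and \<open>weil\<close> and its
      twisted version have equal traces there.\<close>
    have "\<mu> w ^ s = 1" using \<mu>p[OF wH, of s] \<mu>1[of "w [^]\<^bsub>H\<^esub> s"] s(2) w by simp
    moreover have "(\<mu> w ^ r) ^ s = (\<mu> w ^ s) ^ r" unfolding power_mult[symmetric] mult.commute[of r s] ..
    ultimately have "(\<mu> w ^ r) ^ s = 1" by simp
    moreover have "(\<mu> w ^ r) ^ (2 ^ b) = 1" using \<mu>M[OF wH] unfolding br(1) power_mult[symmetric] mult.commute[of r "2 ^ b"] .
    moreover have "coprime s (2 ^ b)" using s(1) by simp
    ultimately have "\<mu> w ^ r = 1" by (rule coprime_powers_eq_1)
    then have "\<mu> w ^ j = 1" using j(1) by (elim dvdE) (simp add: power_mult)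
    then show "\<psi> w = mat_trace (weil w)" using \<psi> w by (simp add: \<Sigma>_def one_smult_mat)
  qed
  show ?thesis
  proof (rule exI[of _ \<Sigma>], intro conjI ballI allI impI)
    fix h assume "h \<in> carrier H" and "\<forall>x\<in>carrier E. act h x = x"
    then show "\<Sigma> h = 1\<^sub>m deg" by (intro \<Sigma>1) simp
  next
    fix h q a N
    assume "h \<in> carrier H" and "prime q \<and> \<not> q dvd deg \<and> card (carrier H) = q ^ a * N \<and> \<not> q dvd N"
    then show "det (\<Sigma> h) ^ N = 1" unfolding M_def[symmetric] by (elim conjE) (rule dets)
  next
    fix W \<psi> s
    assume "subgroup W H \<and> odd s \<and> (\<forall>w\<in>W. \<forall>x\<in>carrier E. act (w [^]\<^bsub>H\<^esub> (s::nat)) x = x) \<and> (\<forall>w\<in>W. \<psi> w = mat_trace (\<Sigma> w))"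
    then show "trivial_unique_odd H W \<psi>" by (elim conjE) (rule odd)
  qed (rule rep, rule comm)
qed

end

section \<open>Coset representatives and the projective extension of the character\<close>

lemma smult_left_cancel:
  assumes "c \<cdot>\<^sub>m A = c' \<cdot>\<^sub>m A" "A \<in> carrier_mat d d" "B \<in> carrier_mat d d" "A * B = 1\<^sub>m d" "d > 0"
  shows "c = (c' :: complex)"
proof -
  have "c \<cdot>\<^sub>m (A * B) = c' \<cdot>\<^sub>m (A * B)"
    using mult_smult_assoc_mat[OF assms(2,3)] assms(1) by metis
  then have "(c \<cdot>\<^sub>m 1\<^sub>m d) $$ (0, 0) = (c' \<cdot>\<^sub>m 1\<^sub>m d) $$ (0, 0)" using assms(4) by simp
  then show ?thesis using assms(5) by simp
qed

locale abelian_five = character_five G K L \<theta> \<phi> for G (structure) and K L \<theta> \<phi> +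
  assumes comm: "comm_group (quot G K L)" and odd_index: "odd (Coset.order (quot G K L))"
begin

abbreviation E where "E \<equiv> quot G K L"

abbreviation q where "q x \<equiv> L #> x"

lemma subgroup_K: "subgroup K G" and subgroup_L: "subgroup L G"
  using normal_K normal_L by (simp_all add: normal_imp_subgroup)

sublocale fin_group G
  by unfold_locales (rule finite_carrier)

lemma K_closed: "k \<in> K \<Longrightarrow> k \<in> carrier G" using subgroup.mem_carrier[OF subgroup_K] .
lemma K_mult: "k \<in> K \<Longrightarrow> l \<in> K \<Longrightarrow> k \<otimes> l \<in> K" using subgroup.m_closed[OF subgroup_K] .
lemma K_inv: "k \<in> K \<Longrightarrow> inv k \<in> K" using subgroup.m_inv_closed[OF subgroup_K] .
lemma K_one: "\<one> \<in> K" using subgroup.one_closed[OF subgroup_K] .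
lemma K_conj: "k \<in> K \<Longrightarrow> g \<in> carrier G \<Longrightarrow> g \<otimes> k \<otimes> inv g \<in> K"
  using normal.inv_op_closed2[OF normal_K] .
lemma K_conj': "k \<in> K \<Longrightarrow> g \<in> carrier G \<Longrightarrow> inv g \<otimes> k \<otimes> g \<in> K"
  using normal.inv_op_closed1[OF normal_K] .
lemma L_K: "l \<in> L \<Longrightarrow> l \<in> K" using L_le_K by auto
lemma L_closed: "k \<in> L \<Longrightarrow> k \<in> carrier G" using subgroup.mem_carrier[OF subgroup_L] .
lemma L_mult: "k \<in> L \<Longrightarrow> l \<in> L \<Longrightarrow> k \<otimes> l \<in> L" using subgroup.m_closed[OF subgroup_L] .
lemma L_inv: "k \<in> L \<Longrightarrow> inv k \<in> L" using subgroup.m_inv_closed[OF subgroup_L] .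
lemma L_one: "\<one> \<in> L" using subgroup.one_closed[OF subgroup_L] .
lemma L_conj: "k \<in> L \<Longrightarrow> g \<in> carrier G \<Longrightarrow> g \<otimes> k \<otimes> inv g \<in> L"
  using normal.inv_op_closed2[OF normal_L] .
lemma L_conj': "k \<in> L \<Longrightarrow> g \<in> carrier G \<Longrightarrow> inv g \<otimes> k \<otimes> g \<in> L"
  using normal.inv_op_closed1[OF normal_L] .
lemma finite_K: "finite K" using finite_subset[OF subgroup.subset[OF subgroup_K] finite_G] .
lemma finite_L: "finite L" using finite_subset[OF subgroup.subset[OF subgroup_L] finite_G] .

lemma q_mult: "x \<in> carrier G \<Longrightarrow> y \<in> carrier G \<Longrightarrow> q x <#> q y = q (x \<otimes> y)"
  using normal.rcos_sum[OF normal_L] .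

lemma q_eq_iff:
  assumes "x \<in> carrier G" "y \<in> carrier G"
  shows "q x = q y \<longleftrightarrow> inv x \<otimes> y \<in> L"
proof
  assume "q x = q y"
  then have "y \<in> q x" using rcos_self[OF assms(2) subgroup_L] by simp
  then obtain l where l: "l \<in> L" "y = l \<otimes> x" by (auto simp: r_coset_def)
  then show "inv x \<otimes> y \<in> L" using L_conj'[OF l(1) assms(1)] assms L_closed[OF l(1)] by (simp add: m_assoc)
next
  assume l: "inv x \<otimes> y \<in> L"
  have "x \<otimes> (inv x \<otimes> y) \<otimes> inv x = y \<otimes> inv x" using assms by (simp add: m_assoc[symmetric])
  then have "y \<otimes> inv x \<in> L" using L_conj[OF l assms(1)] by simp
  moreover have "y = y \<otimes> inv x \<otimes> x" using assms by (simp add: m_assoc)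
  ultimately have "y \<in> q x" unfolding r_coset_def by blast
  then show "q x = q y" by (rule repr_independence[OF _ _ subgroup_L]) (use assms in simp)
qed

lemma q_mult_L:
  assumes "x \<in> carrier G" "l \<in> L"
  shows "q (x \<otimes> l) = q x"
  using q_eq_iff[of x "x \<otimes> l"] assms L_closed[OF assms(2)] by (simp add: m_assoc[symmetric])

lemma q_one: "q \<one> = L" using coset_mult_one[OF subgroup.subset[OF subgroup_L]] .

lemma q_eq_L_iff: "x \<in> carrier G \<Longrightarrow> q x = L \<longleftrightarrow> x \<in> L"
  using q_eq_iff[of \<one> x] q_one by auto

lemma mem_q_iff: "x \<in> carrier G \<Longrightarrow> y \<in> q x \<longleftrightarrow> y \<in> carrier G \<and> q y = q x"
proof
  assume x: "x \<in> carrier G" and y: "y \<in> q x"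
  have "y \<in> carrier G" using r_coset_subset_G[OF subgroup.subset[OF subgroup_L] x] y by (rule subsetD)
  moreover have "q x = q y" by (rule repr_independence[OF y x subgroup_L])
  ultimately show "y \<in> carrier G \<and> q y = q x" by simp
next
  assume "y \<in> carrier G \<and> q y = q x"
  then show "y \<in> q x" using rcos_self[of y, OF _ subgroup_L] by simp
qed

lemma carrier_E: "carrier E = q ` K"
  by (auto simp: FactGroup_def RCOSETS_def r_coset_def)

lemma mult_E: "x \<in> carrier G \<Longrightarrow> y \<in> carrier G \<Longrightarrow> q x \<otimes>\<^bsub>E\<^esub> q y = q (x \<otimes> y)"
  using q_mult[of x y] by (simp add: FactGroup_def set_mult_def)

lemma one_E: "\<one>\<^bsub>E\<^esub> = L" by (simp add: FactGroup_def)

lemma q_E: "k \<in> K \<Longrightarrow> q k \<in> carrier E" unfolding carrier_E by simp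

sublocale E: fin_comm_group E
  using comm finite_K by (simp add: fin_comm_group_def fin_comm_group_axioms_def carrier_E)

lemma inv_E: "k \<in> K \<Longrightarrow> inv\<^bsub>E\<^esub> (q k) = q (inv k)"
  by (rule E.inv_equality) (simp_all only: q_E K_inv K_closed mult_E one_E q_one l_inv inv_closed)

definition rp where "rp X = (SOME k. k \<in> K \<and> q k = X)"

lemma rp: "X \<in> carrier E \<Longrightarrow> rp X \<in> K \<and> q (rp X) = X"
  unfolding rp_def by (rule someI_ex) (auto simp: carrier_E)

sublocale Lg: fin_group "subgrp G L" by (rule subgrp_fin_group[OF subgroup_L])
sublocale Kg: fin_group "subgrp G K" by (rule subgrp_fin_group[OF subgroup_K])

lemma inv_L: "l \<in> L \<Longrightarrow> inv\<^bsub>subgrp G L\<^esub> l = inv l" and inv_K: "k \<in> K \<Longrightarrow> inv\<^bsub>subgrp G K\<^esub> k = inv k"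
  using m_inv_consistent[OF subgroup_L] m_inv_consistent[OF subgroup_K] by simp_all

end

section \<open>The projective extension of the representation affording the character\<close>

locale afforded_five = abelian_five G K L \<theta> \<phi> for G (structure) and K L \<theta> \<phi> +
  fixes d \<rho>
  assumes irr: "irreducible_representation (subgrp G L) d \<rho>"
    and phi: "\<phi> = (\<lambda>l\<in>carrier (subgrp G L). mat_trace (\<rho> l))"
begin

lemma rho_carrier: "l \<in> L \<Longrightarrow> \<rho> l \<in> carrier_mat d d"
  using Lg.rep_carrier[OF Lg.irrepD[OF irr]] by simp

lemma rho_mult: "l \<in> L \<Longrightarrow> m \<in> L \<Longrightarrow> \<rho> (l \<otimes> m) = \<rho> l * \<rho> m"
  using Lg.rep_mult[OF Lg.irrepD[OF irr]] by simp

lemma rho_inv: "l \<in> L \<Longrightarrow> \<rho> l * \<rho> (inv l) = 1\<^sub>m d" "l \<in> L \<Longrightarrow> \<rho> (inv l) * \<rho> l = 1\<^sub>m d"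
  using Lg.rep_inv[OF Lg.irrepD[OF irr], of l] inv_L[of l] by simp_all

lemma d_pos: "d > 0" using Lg.irrep_pos[OF irr] .

text \<open>\<open>M\<close> is a candidate for the value at \<open>y\<close> of an extension of
  \<open>\<rho>\<close>: it conjugates \<open>\<rho>\<close> in the way an element \<open>y\<close>
  would.\<close>

definition twists where
  "twists y M \<longleftrightarrow> M \<in> carrier_mat d d \<and> (\<exists>N\<in>carrier_mat d d. M * N = 1\<^sub>m d \<and> N * M = 1\<^sub>m d) \<and>
     (\<forall>l\<in>L. \<rho> l * M = M * \<rho> (inv y \<otimes> l \<otimes> y))"

lemma twists_carrier: "twists y M \<Longrightarrow> M \<in> carrier_mat d d" by (simp add: twists_def)

lemma twists_commute: "twists y M \<Longrightarrow> l \<in> L \<Longrightarrow> \<rho> l * M = M * \<rho> (inv y \<otimes> l \<otimes> y)"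
  by (simp add: twists_def)

lemma twists_mult:
  assumes "twists y M" "twists w N" "y \<in> carrier G" "w \<in> carrier G"
  shows "twists (y \<otimes> w) (M * N)"
proof -
  obtain M' where M': "M' \<in> carrier_mat d d" "M * M' = 1\<^sub>m d" "M' * M = 1\<^sub>m d" using assms(1) by (auto simp: twists_def)
  obtain N' where N': "N' \<in> carrier_mat d d" "N * N' = 1\<^sub>m d" "N' * N = 1\<^sub>m d" using assms(2) by (auto simp: twists_def)
  note M = twists_carrier[OF assms(1)] and N = twists_carrier[OF assms(2)]
  have MN: "M * N \<in> carrier_mat d d" "N' * M' \<in> carrier_mat d d"
    by (rule mult_carrier_mat[OF M N], rule mult_carrier_mat[OF N'(1) M'(1)])
  have "M * N * (N' * M') = M * (N * N' * M')"
    using assoc_mult_sq[OF M N MN(2)] assoc_mult_sq[OF N N'(1) M'(1)] by simp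
  then have 1: "M * N * (N' * M') = 1\<^sub>m d" using M' N' by simp
  have "N' * M' * (M * N) = N' * (M' * M * N)"
    using assoc_mult_sq[OF N'(1) M'(1) MN(1)] assoc_mult_sq[OF M'(1) M N] by simp
  then have 2: "N' * M' * (M * N) = 1\<^sub>m d" using M' N' N by simp
  have 3: "\<rho> l * (M * N) = M * N * \<rho> (inv (y \<otimes> w) \<otimes> l \<otimes> (y \<otimes> w))" if l: "l \<in> L" for l
  proof -
    have l': "inv y \<otimes> l \<otimes> y \<in> L" by (rule L_conj'[OF l assms(3)])
    have l'': "inv w \<otimes> (inv y \<otimes> l \<otimes> y) \<otimes> w \<in> L" by (rule L_conj'[OF l' assms(4)])
    have "\<rho> l * (M * N) = M * (\<rho> (inv y \<otimes> l \<otimes> y) * N)"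
      using assoc_mult_sq[OF rho_carrier[OF l] M N] twists_commute[OF assms(1) l] assoc_mult_sq[OF M rho_carrier[OF l'] N] by simp
    also have "\<dots> = M * N * \<rho> (inv w \<otimes> (inv y \<otimes> l \<otimes> y) \<otimes> w)"
      unfolding twists_commute[OF assms(2) l'] by (rule assoc_mult_sq[OF M N rho_carrier[OF l''], symmetric])
    also have "inv w \<otimes> (inv y \<otimes> l \<otimes> y) \<otimes> w = inv (y \<otimes> w) \<otimes> l \<otimes> (y \<otimes> w)"
      using assms(3,4) L_closed[OF l] by (simp add: m_assoc inv_mult_group)
    finally show ?thesis .
  qed
  show ?thesis unfolding twists_def using MN 1 2 3 by blast
qed

lemma twists_rho:
  assumes "l \<in> L"
  shows "twists l (\<rho> l)"
proof -
  have "\<rho> m * \<rho> l = \<rho> l * \<rho> (inv l \<otimes> m \<otimes> l)" if m: "m \<in> L" for m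
    using rho_mult[OF m assms] rho_mult[OF assms L_conj'[OF m L_closed[OF assms]]] assms m L_closed
    by (simp add: m_assoc[symmetric])
  then show ?thesis unfolding twists_def using rho_carrier[OF assms] rho_carrier[OF L_inv[OF assms]] rho_inv[OF assms] by blast
qed

text \<open>The quotient of two candidates commutes with \<open>\<rho>\<close>, so Schur's lemma
  makes it a scalar. This is the origin of the cocycle.\<close>

lemma twists_unique:
  assumes "twists y M" "twists y N" "y \<in> carrier G"
  shows "\<exists>c. c \<noteq> 0 \<and> M = c \<cdot>\<^sub>m N"
proof -
  obtain M' where M': "M' \<in> carrier_mat d d" "M * M' = 1\<^sub>m d" using assms(1) by (auto simp: twists_def)
  obtain N' where N': "N' \<in> carrier_mat d d" "N * N' = 1\<^sub>m d" "N' * N = 1\<^sub>m d" using assms(2) by (auto simp: twists_def)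
  note M = twists_carrier[OF assms(1)] and N = twists_carrier[OF assms(2)]
  have "M * N' * \<rho> l = \<rho> l * (M * N')" if l: "l \<in> L" for l
  proof -
    have l': "inv y \<otimes> l \<otimes> y \<in> L" by (rule L_conj'[OF l assms(3)])
    note c = rho_carrier[OF l] and c' = rho_carrier[OF l']
    have "N' * (\<rho> l * N) = N' * N * \<rho> (inv y \<otimes> l \<otimes> y)"
      unfolding twists_commute[OF assms(2) l] by (rule assoc_mult_sq[OF N'(1) N c', symmetric])
    then have "N' * (\<rho> l * N) = \<rho> (inv y \<otimes> l \<otimes> y)" using N'(3) c' by simp
    then have "N' * (\<rho> l * N) * N' = \<rho> (inv y \<otimes> l \<otimes> y) * N'" by simp
    moreover have "N' * (\<rho> l * N) * N' = N' * \<rho> l"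
      using assoc_mult_sq[OF N'(1) mult_carrier_mat[OF c N] N'(1)] assoc_mult_sq[OF c N N'(1)] N'(2) c by simp
    ultimately have "N' * \<rho> l = \<rho> (inv y \<otimes> l \<otimes> y) * N'" by simp
    then have "M * N' * \<rho> l = M * \<rho> (inv y \<otimes> l \<otimes> y) * N'"
      using assoc_mult_sq[OF M N'(1) c] assoc_mult_sq[OF M c' N'(1)] by simp
    also have "\<dots> = \<rho> l * M * N'" unfolding twists_commute[OF assms(1) l] ..
    finally show ?thesis using assoc_mult_sq[OF c M N'(1)] by simp
  qed
  then obtain c where c: "M * N' = c \<cdot>\<^sub>m 1\<^sub>m d"
    using Lg.schur[OF irr mult_carrier_mat[OF M N'(1)]] by auto
  have "M = M * (N' * N)" using N'(3) M by simp
  also have "\<dots> = c \<cdot>\<^sub>m 1\<^sub>m d * N" using assoc_mult_sq[OF M N'(1) N] c by simp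
  also have "\<dots> = c \<cdot>\<^sub>m N" using mult_smult_assoc_mat[OF one_carrier_mat N, of c] N by simp
  finally have eq: "M = c \<cdot>\<^sub>m N" .
  have "c \<noteq> 0"
  proof
    assume "c = 0"
    then have "0 \<cdot>\<^sub>m (N * M') = (1\<^sub>m d :: complex mat)"
      using M'(2) mult_smult_assoc_mat[OF N M'(1), of c] eq by simp
    then have "(0 \<cdot>\<^sub>m (N * M')) $$ (0, 0) = (1\<^sub>m d :: complex mat) $$ (0, 0)" by simp
    then show False using d_pos N M'(1) by simp
  qed
  with eq show ?thesis by (intro exI[of _ c] conjI)
qed

text \<open>Invariance of \<open>\<phi>\<close> says that \<open>\<rho>\<close> and its conjugate by
  \<open>y\<close> have the same character. Both are irreducible, so a nonzero intertwiner exists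
  and is invertible up to a scalar.\<close>

lemma twists_exists:
  assumes y: "y \<in> carrier G"
  shows "\<exists>M. twists y M"
proof -
  define \<rho>' where "\<rho>' l = \<rho> (inv y \<otimes> l \<otimes> y)" for l
  have cl: "inv y \<otimes> l \<otimes> y \<in> L" if "l \<in> L" for l by (rule L_conj'[OF that y])
  have rep': "representation (subgrp G L) d \<rho>'"
  proof (rule Lg.representationI)
    fix g h assume "g \<in> carrier (subgrp G L)" "h \<in> carrier (subgrp G L)"
    then have gh: "g \<in> L" "h \<in> L" by simp_all
    have "inv y \<otimes> (g \<otimes> h) \<otimes> y = (inv y \<otimes> g \<otimes> y) \<otimes> (inv y \<otimes> h \<otimes> y)"
      using y gh[THEN L_closed] by (simp add: m_assoc[symmetric]) (simp add: m_assoc)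
    then show "\<rho>' (g \<otimes>\<^bsub>subgrp G L\<^esub> h) = \<rho>' g * \<rho>' h" using rho_mult[OF cl[OF gh(1)] cl[OF gh(2)]] by (simp add: \<rho>'_def)
  next
    show "\<rho>' \<one>\<^bsub>subgrp G L\<^esub> = 1\<^sub>m d" using y Lg.rep_one[OF Lg.irrepD[OF irr]] by (simp add: \<rho>'_def)
  qed (simp add: \<rho>'_def rho_carrier cl)
  have irr': "irreducible_representation (subgrp G L) d \<rho>'"
    unfolding irreducible_representation_def
  proof (intro conjI allI impI rep' d_pos)
    fix W
    assume W: "VectorSpace.subspace class_ring W (module_vec TYPE(complex) d) \<and>
      (\<forall>g\<in>carrier (subgrp G L). \<forall>w\<in>W. \<rho>' g *\<^sub>v w \<in> W)"
    have "\<rho> l *\<^sub>v w \<in> W" if "l \<in> L" "w \<in> W" for l w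
    proof -
      have "inv y \<otimes> (y \<otimes> l \<otimes> inv y) \<otimes> y = l"
        using y L_closed[OF that(1)] by (simp add: m_assoc) (simp add: m_assoc[symmetric])
      moreover have "\<rho>' (y \<otimes> l \<otimes> inv y) *\<^sub>v w \<in> W" using W L_conj[OF that(1) y] that(2) by simp
      ultimately show ?thesis unfolding \<rho>'_def by simp
    qed
    then show "W = {0\<^sub>v d} \<or> W = carrier_vec d"
      using irr W unfolding irreducible_representation_def by simp
  qed
  have tr: "mat_trace (\<rho> l) = mat_trace (\<rho>' l)" if "l \<in> carrier (subgrp G L)" for l
    using phi_invariant[OF y, of l] that cl[of l] by (simp add: phi \<rho>'_def)
  obtain X where X: "X \<in> carrier_mat d d" "X \<noteq> 0\<^sub>m d d"
    and int: "\<And>l. l \<in> carrier (subgrp G L) \<Longrightarrow> \<rho> l * X = X * \<rho>' l"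
    using Lg.intertwiner_exists[OF irr irr' tr] by blast
  obtain Y c where Y: "Y \<in> carrier_mat d d" "c \<noteq> 0" "X * Y = c \<cdot>\<^sub>m 1\<^sub>m d" "Y * X = c \<cdot>\<^sub>m 1\<^sub>m d"
  proof -
    have "\<exists>Y c. Y \<in> carrier_mat d d \<and> c \<noteq> 0 \<and> X * Y = c \<cdot>\<^sub>m 1\<^sub>m d \<and> Y * X = c \<cdot>\<^sub>m 1\<^sub>m d \<and> d = d"
      by (rule Lg.trace_eq_of_intertwiner(1)[OF irr irr' X]) (rule int)
    then show thesis by (elim exE conjE) (rule that)
  qed
  have "X * (1 / c \<cdot>\<^sub>m Y) = 1\<^sub>m d" "1 / c \<cdot>\<^sub>m Y * X = 1\<^sub>m d"
    unfolding mult_smult_distrib[OF X(1) Y(1)] mult_smult_assoc_mat[OF Y(1) X(1)] Y(3,4) smult_smult_mat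
    using Y(2) by (simp_all add: one_smult_mat)
  then have "twists y X"
    unfolding twists_def using X(1) Y(1) int by (intro conjI bexI[of _ "1 / c \<cdot>\<^sub>m Y"]) (simp_all add: \<rho>'_def)
  then show ?thesis by blast
qed

text \<open>Candidates are chosen on coset representatives only and spread over each coset by
  \<open>\<rho>\<close>, so that the cocycle depends on cosets. Rescaling by a function
  \<open>g\<close> on \<open>K / L\<close> then brings it to the normal form without disturbing
  \<open>\<rho>\<close> on \<open>L\<close>.\<close>

lemma projective_extension:
  "\<exists>\<rho>' \<beta>. (\<forall>y\<in>K. \<rho>' y \<in> carrier_mat d d) \<and> (\<forall>l\<in>L. \<rho>' l = \<rho> l) \<and>
     (\<forall>y\<in>K. \<forall>w\<in>K. \<rho>' y * \<rho>' w = \<beta> (q y) (q w) \<cdot>\<^sub>m \<rho>' (y \<otimes> w)) \<and>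
     (\<forall>x\<in>carrier E. \<forall>y\<in>carrier E. \<forall>z\<in>carrier E. \<beta> (x \<otimes>\<^bsub>E\<^esub> y) z = \<beta> x z * \<beta> y z) \<and>
     (\<forall>x\<in>carrier E. \<forall>y\<in>carrier E. \<beta> x y * \<beta> y x = 1) \<and> (\<forall>x\<in>carrier E. \<beta> x x = 1)"
proof -
  have "\<forall>X\<in>carrier E. \<exists>M. twists (rp X) M" 
    by (rule ballI, rule twists_exists, rule K_closed, rule conjunct1[OF rp])
  then obtain P where P: "\<forall>X\<in>carrier E. twists (rp X) (P X)" by (elim bchoice[THEN exE])
  have rK: "rp (q y) \<in> K" and rG: "rp (q y) \<in> carrier G" and rL: "inv (rp (q y)) \<otimes> y \<in> L" if "y \<in> K" for y
    using rp[OF q_E[OF that]] K_closed[OF that] K_closed q_eq_iff[of "rp (q y)" y] by auto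
  \<comment> \<open>This form gives \<open>R (y \<otimes> l) = R y * \<rho> l\<close>, from which
    the factor in a product is seen to depend only on the two cosets.\<close>
  define R where "R y = P (q y) * \<rho> (inv (rp (q y)) \<otimes> y)" for y
  have R: "twists y (R y)" if y: "y \<in> K" for y
  proof -
    have "twists (rp (q y) \<otimes> (inv (rp (q y)) \<otimes> y)) (R y)"
      unfolding R_def by (rule twists_mult[OF P[rule_format, OF q_E[OF y]] twists_rho[OF rL[OF y]] rG[OF y] L_closed[OF rL[OF y]]])
    then show ?thesis using rG[OF y] K_closed[OF y] by (simp add: m_assoc[symmetric])
  qed
  note Rc = twists_carrier[OF R]
  have RL: "R (y \<otimes> l) = R y * \<rho> l" if y: "y \<in> K" and l: "l \<in> L" for y l
  proof -
    have "inv (rp (q y)) \<otimes> (y \<otimes> l) = inv (rp (q y)) \<otimes> y \<otimes> l"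
      using rG[OF y] K_closed[OF y] L_closed[OF l] by (simp add: m_assoc)
    then show ?thesis unfolding R_def q_mult_L[OF K_closed[OF y] l] 
      using rho_mult[OF rL[OF y] l] assoc_mult_sq[OF twists_carrier[OF P[rule_format, OF q_E[OF y]]] rho_carrier[OF rL[OF y]] rho_carrier[OF l]]
      by simp
  qed
  have "\<exists>a. a \<noteq> 0 \<and> R (rp X) * R (rp Y) = a \<cdot>\<^sub>m R (rp X \<otimes> rp Y)" if X: "X \<in> carrier E" and Y: "Y \<in> carrier E" for X Y
  proof -
    note x = rp[OF X, THEN conjunct1] and y = rp[OF Y, THEN conjunct1]
    show ?thesis by (rule twists_unique[OF twists_mult[OF R[OF x] R[OF y] K_closed[OF x] K_closed[OF y]] R[OF K_mult[OF x y]] K_closed[OF K_mult[OF x y]]])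
  qed
  then have "\<forall>X\<in>carrier E. \<exists>a. \<forall>Y\<in>carrier E. a Y \<noteq> 0 \<and> R (rp X) * R (rp Y) = a Y \<cdot>\<^sub>m R (rp X \<otimes> rp Y)"
    by (intro ballI bchoice) simp
  then obtain \<alpha> where \<alpha>: "\<forall>X\<in>carrier E. \<forall>Y\<in>carrier E. \<alpha> X Y \<noteq> 0 \<and> R (rp X) * R (rp Y) = \<alpha> X Y \<cdot>\<^sub>m R (rp X \<otimes> rp Y)"
    by (elim bchoice[THEN exE])
  have RR: "R y * R w = \<alpha> (q y) (q w) \<cdot>\<^sub>m R (y \<otimes> w)" if y: "y \<in> K" and w: "w \<in> K" for y w
  proof -
    define y0 w0 l m where "y0 = rp (q y)" and "w0 = rp (q w)" and "l = inv y0 \<otimes> y" and "m = inv w0 \<otimes> w"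
    have c: "y0 \<in> K" "w0 \<in> K" "l \<in> L" "m \<in> L" using rK[OF y] rK[OF w] rL[OF y] rL[OF w] by (simp_all add: y0_def w0_def l_def m_def)
    have yw: "y = y0 \<otimes> l" "w = w0 \<otimes> m" using c(1,2)[THEN K_closed] y[THEN K_closed] w[THEN K_closed]
      by (simp_all add: l_def m_def m_assoc[symmetric])
    note cG = c(1,2)[THEN K_closed] c(3,4)[THEN L_closed]
    define l' where "l' = inv w0 \<otimes> l \<otimes> w0"
    have l': "l' \<in> L" unfolding l'_def by (rule L_conj'[OF c(3) cG(2)])
    note mc = Rc[OF c(1)] Rc[OF c(2)] rho_carrier[OF c(3)] rho_carrier[OF c(4)] rho_carrier[OF l']
    have "R y * R w = R y0 * (\<rho> l * R w0 * \<rho> m)"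
      unfolding yw RL[OF c(1,3)] RL[OF c(2,4)]
      using assoc_mult_sq[OF mc(1) mc(3) mult_carrier_mat[OF mc(2,4)]] assoc_mult_sq[OF mc(3,2,4)] by simp
    also have "\<rho> l * R w0 * \<rho> m = R w0 * \<rho> (l' \<otimes> m)"
      unfolding twists_commute[OF R[OF c(2)] c(3), folded l'_def] rho_mult[OF l' c(4)] by (rule assoc_mult_sq[OF mc(2,5,4)])
    also have "R y0 * (R w0 * \<rho> (l' \<otimes> m)) = \<alpha> (q y) (q w) \<cdot>\<^sub>m R (y0 \<otimes> w0) * \<rho> (l' \<otimes> m)"
      using assoc_mult_sq[OF mc(1,2) rho_carrier[OF L_mult[OF l' c(4)]]] \<alpha> q_E[OF y] q_E[OF w] by (simp add: y0_def w0_def)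
    also have "\<dots> = \<alpha> (q y) (q w) \<cdot>\<^sub>m R (y0 \<otimes> w0 \<otimes> (l' \<otimes> m))"
      unfolding RL[OF K_mult[OF c(1,2)] L_mult[OF l' c(4)]]
      by (rule mult_smult_assoc_mat[OF Rc[OF K_mult[OF c(1,2)]] rho_carrier[OF L_mult[OF l' c(4)]]])
    also have "y0 \<otimes> w0 \<otimes> (l' \<otimes> m) = y \<otimes> w"
    proof -
      have "w0 \<otimes> l' = l \<otimes> w0" using cG by (simp add: l'_def m_assoc[symmetric])
      then have "w0 \<otimes> (l' \<otimes> m) = l \<otimes> w0 \<otimes> m" using cG L_closed[OF l'] by (simp add: m_assoc[symmetric])
      then show ?thesis unfolding yw using cG L_closed[OF l'] by (simp add: m_assoc)
    qed
    finally show ?thesis .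
  qed
  obtain Ri where Ri: "Ri y \<in> carrier_mat d d" "R y * Ri y = 1\<^sub>m d" "Ri y * R y = 1\<^sub>m d" if "y \<in> K" for y
  proof -
    have "\<forall>y\<in>K. \<exists>N. N \<in> carrier_mat d d \<and> R y * N = 1\<^sub>m d \<and> N * R y = 1\<^sub>m d"
      using R unfolding twists_def Bex_def by (intro ballI) simp
    then obtain Ri where "\<forall>y\<in>K. Ri y \<in> carrier_mat d d \<and> R y * Ri y = 1\<^sub>m d \<and> Ri y * R y = 1\<^sub>m d" by (elim bchoice[THEN exE])
    then show thesis by (intro that[of Ri]) simp_all
  qed
  have cocycle: "\<alpha> X Y * \<alpha> (X \<otimes>\<^bsub>E\<^esub> Y) Z = \<alpha> Y Z * \<alpha> X (Y \<otimes>\<^bsub>E\<^esub> Z)"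
    if X: "X \<in> carrier E" and Y: "Y \<in> carrier E" and Z: "Z \<in> carrier E" for X Y Z
  proof -
    obtain x y z where K: "x \<in> K" "y \<in> K" "z \<in> K" and eq: "X = q x" "Y = q y" "Z = q z"
      using X Y Z unfolding carrier_E by (elim imageE) (rule that)
    note G = K[THEN K_closed]
    note xyz = K_mult[OF K_mult[OF K(1,2)] K(3)]
    have "R x * R y * R z = (\<alpha> X Y * \<alpha> (X \<otimes>\<^bsub>E\<^esub> Y) Z) \<cdot>\<^sub>m R (x \<otimes> y \<otimes> z)"
      unfolding eq mult_E[OF G(1,2)] RR[OF K(1,2)] mult_smult_assoc_mat[OF Rc[OF K_mult[OF K(1,2)]] Rc[OF K(3)]]
        RR[OF K_mult[OF K(1,2)] K(3)] smult_smult_mat ..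
    moreover have "R x * (R y * R z) = (\<alpha> Y Z * \<alpha> X (Y \<otimes>\<^bsub>E\<^esub> Z)) \<cdot>\<^sub>m R (x \<otimes> y \<otimes> z)"
      unfolding eq mult_E[OF G(2,3)] RR[OF K(2,3)] mult_smult_distrib[OF Rc[OF K(1)] Rc[OF K_mult[OF K(2,3)]]]
        RR[OF K(1) K_mult[OF K(2,3)]] smult_smult_mat m_assoc[OF G] ..
    moreover note assoc_mult_sq[OF Rc[OF K(1)] Rc[OF K(2)] Rc[OF K(3)]]
    ultimately have "(\<alpha> X Y * \<alpha> (X \<otimes>\<^bsub>E\<^esub> Y) Z) \<cdot>\<^sub>m R (x \<otimes> y \<otimes> z) = (\<alpha> Y Z * \<alpha> X (Y \<otimes>\<^bsub>E\<^esub> Z)) \<cdot>\<^sub>m R (x \<otimes> y \<otimes> z)" by simp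
    then show ?thesis by (rule smult_left_cancel[OF _ Rc[OF xyz] Ri(1,2)[OF xyz] d_pos])
  qed
  have "\<exists>\<beta> g. (\<forall>x\<in>carrier E. g x \<noteq> 0) \<and>
     (\<forall>x\<in>carrier E. \<forall>y\<in>carrier E. g x * g y * \<alpha> x y = \<beta> x y * g (x \<otimes>\<^bsub>E\<^esub> y)) \<and>
     (\<forall>x\<in>carrier E. \<forall>y\<in>carrier E. \<forall>z\<in>carrier E. \<beta> (x \<otimes>\<^bsub>E\<^esub> y) z = \<beta> x z * \<beta> y z) \<and>
     (\<forall>x\<in>carrier E. \<forall>y\<in>carrier E. \<beta> x y * \<beta> y x = 1) \<and> (\<forall>x\<in>carrier E. \<beta> x x = 1)"
  proof (rule E.cocycle_normal_form)
    show "odd (card (carrier E))" using odd_index unfolding Coset.order_def .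
    show "\<alpha> x y \<noteq> 0" if "x \<in> carrier E" "y \<in> carrier E" for x y using \<alpha> that by simp
  qed (rule cocycle)
  then obtain \<beta> g where g0: "\<forall>x\<in>carrier E. g x \<noteq> 0"
    and g: "\<forall>x\<in>carrier E. \<forall>y\<in>carrier E. g x * g y * \<alpha> x y = \<beta> x y * g (x \<otimes>\<^bsub>E\<^esub> y)"
    and \<beta>1: "\<forall>x\<in>carrier E. \<forall>y\<in>carrier E. \<forall>z\<in>carrier E. \<beta> (x \<otimes>\<^bsub>E\<^esub> y) z = \<beta> x z * \<beta> y z"
    and \<beta>2: "\<forall>x\<in>carrier E. \<forall>y\<in>carrier E. \<beta> x y * \<beta> y x = 1" and \<beta>3: "\<forall>x\<in>carrier E. \<beta> x x = 1" 
    by (elim exE conjE)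
  define \<rho>' where "\<rho>' y = g (q y) \<cdot>\<^sub>m R y" for y
  have c': "\<rho>' y \<in> carrier_mat d d" if "y \<in> K" for y unfolding \<rho>'_def by (rule smult_carrier_mat[OF Rc[OF that]])
  have m': "\<rho>' y * \<rho>' w = \<beta> (q y) (q w) \<cdot>\<^sub>m \<rho>' (y \<otimes> w)" if y: "y \<in> K" and w: "w \<in> K" for y w
  proof -
    have "\<rho>' y * \<rho>' w = (g (q y) * g (q w) * \<alpha> (q y) (q w)) \<cdot>\<^sub>m R (y \<otimes> w)"
      unfolding \<rho>'_def mult_smult_assoc_mat[OF Rc[OF y] smult_carrier_mat[OF Rc[OF w]]]
        mult_smult_distrib[OF Rc[OF y] Rc[OF w]] smult_smult_mat RR[OF y w] mult.assoc ..
    also have "g (q y) * g (q w) * \<alpha> (q y) (q w) = \<beta> (q y) (q w) * g (q (y \<otimes> w))"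
      using bspec[OF bspec[OF g q_E[OF y]] q_E[OF w]] unfolding mult_E[OF K_closed[OF y] K_closed[OF w]] .
    finally show ?thesis unfolding \<rho>'_def smult_smult_mat .
  qed
  \<comment> \<open>As \<open>\<beta>\<close> is 1 on the trivial coset,
    \<open>\<rho>' \<one>\<close> is an invertible idempotent. Hence the rescaling preserves the
    values on \<open>L\<close> exactly and not just up to a scalar.\<close>
  have one: "\<rho>' \<one> = 1\<^sub>m d"
  proof -
    obtain N where N: "N \<in> carrier_mat d d" "\<rho>' \<one> * N = 1\<^sub>m d"
    proof
      show "1 / g (q \<one>) \<cdot>\<^sub>m Ri \<one> \<in> carrier_mat d d" by (rule smult_carrier_mat[OF Ri(1)[OF K_one]])
      show "\<rho>' \<one> * (1 / g (q \<one>) \<cdot>\<^sub>m Ri \<one>) = 1\<^sub>m d"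
        unfolding \<rho>'_def mult_smult_assoc_mat[OF Rc[OF K_one] smult_carrier_mat[OF Ri(1)[OF K_one]]]
          mult_smult_distrib[OF Rc[OF K_one] Ri(1)[OF K_one]] smult_smult_mat Ri(2)[OF K_one]
        using g0 q_E[OF K_one] by (simp add: one_smult_mat)
    qed
    have "\<beta> (q \<one>) (q \<one>) = 1" using \<beta>3 q_E[OF K_one] by (rule bspec)
    then have "\<rho>' \<one> * \<rho>' \<one> = \<rho>' \<one>" using m'[OF K_one K_one] by (simp add: one_smult_mat)
    then have "\<rho>' \<one> * (\<rho>' \<one> * N) = \<rho>' \<one> * N" using assoc_mult_sq[OF c'[OF K_one] c'[OF K_one] N(1)] by simp
    then show ?thesis unfolding N(2) right_mult_one_mat[OF c'[OF K_one]] .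
  qed
  have L': "\<rho>' l = \<rho> l" if l: "l \<in> L" for l
  proof -
    have "\<rho>' (\<one> \<otimes> l) = \<rho>' \<one> * \<rho> l"
      unfolding \<rho>'_def RL[OF K_one l] q_mult_L[OF one_closed l] by (rule mult_smult_assoc_mat[OF Rc[OF K_one] rho_carrier[OF l], symmetric])
    then show ?thesis using one rho_carrier[OF l] L_closed[OF l] by simp
  qed
  show ?thesis
    by (rule exI[of _ \<rho>'], rule exI[of _ \<beta>], intro conjI \<beta>1 \<beta>2 \<beta>3 ballI)
      (rule c', assumption, rule L', assumption, rule m', assumption+)
qed

end

section \<open>The basis elements of the centralizer algebra, coset by coset\<close>

context abelian_five
begin

lemma q_conj:
  assumes "x \<in> carrier G" "y \<in> carrier G" "g \<in> carrier G" "q x = q y"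
  shows "q (g \<otimes> x \<otimes> inv g) = q (g \<otimes> y \<otimes> inv g)"
proof -
  have "q (g \<otimes> z \<otimes> inv g) = q g <#> q z <#> q (inv g)" if "z \<in> carrier G" for z
    unfolding q_mult[OF assms(3) that] by (rule q_mult[symmetric]) (simp_all add: that assms(3))
  from this[OF assms(1)] this[OF assms(2)] show ?thesis unfolding assms(4) by simp
qed

lemma bij_conj:
  assumes x: "x \<in> carrier G" and g: "g \<in> carrier G"
  shows "bij_betw (\<lambda>y. g \<otimes> y \<otimes> inv g) (q x) (q (g \<otimes> x \<otimes> inv g))"
proof (rule bij_betwI[where g = "\<lambda>y. inv g \<otimes> y \<otimes> g"])
  show "(\<lambda>y. g \<otimes> y \<otimes> inv g) \<in> q x \<rightarrow> q (g \<otimes> x \<otimes> inv g)"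
  proof
    fix y assume "y \<in> q x"
    then have y: "y \<in> carrier G" "q y = q x" using x by (simp_all add: mem_q_iff)
    then show "g \<otimes> y \<otimes> inv g \<in> q (g \<otimes> x \<otimes> inv g)"
      using q_conj[OF y(1) x g y(2)] x g by (simp add: mem_q_iff)
  qed
  show "(\<lambda>y. inv g \<otimes> y \<otimes> g) \<in> q (g \<otimes> x \<otimes> inv g) \<rightarrow> q x"
  proof
    fix y assume "y \<in> q (g \<otimes> x \<otimes> inv g)"
    then have y: "y \<in> carrier G" "q y = q (g \<otimes> x \<otimes> inv g)" using x g by (simp_all add: mem_q_iff)
    have "q (inv g \<otimes> y \<otimes> inv (inv g)) = q (inv g \<otimes> (g \<otimes> x \<otimes> inv g) \<otimes> inv (inv g))"
      by (rule q_conj) (use x y g in simp_all)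
    moreover have "inv g \<otimes> (g \<otimes> x \<otimes> inv g) \<otimes> g = x"
      using x g by (simp add: m_assoc) (simp add: m_assoc[symmetric])
    ultimately show "inv g \<otimes> y \<otimes> g \<in> q x" using x y g by (simp add: mem_q_iff)
  qed
  show "inv g \<otimes> (g \<otimes> y \<otimes> inv g) \<otimes> g = y" if "y \<in> q x" for y
    using that x g by (simp add: mem_q_iff m_assoc) (simp add: m_assoc[symmetric])
  show "g \<otimes> (inv g \<otimes> y \<otimes> g) \<otimes> inv g = y" if "y \<in> q (g \<otimes> x \<otimes> inv g)" for y
    using that x g by (simp add: mem_q_iff m_assoc) (simp add: m_assoc[symmetric])
qed

lemma bij_coset: 
  assumes "x \<in> carrier G"
  shows "bij_betw (\<lambda>l. x \<otimes> l) L (q x)"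
proof (rule bij_betwI[where g = "\<lambda>y. inv x \<otimes> y"])
  show "(\<lambda>l. x \<otimes> l) \<in> L \<rightarrow> q x" using assms L_closed by (intro funcsetI) (simp add: mem_q_iff q_mult_L)
  show "(\<lambda>y. inv x \<otimes> y) \<in> q x \<rightarrow> L"
  proof
    fix y assume "y \<in> q x"
    then show "inv x \<otimes> y \<in> L" using assms q_eq_iff[OF assms, of y] by (simp add: mem_q_iff)
  qed
  show "inv x \<otimes> (x \<otimes> l) = l" if "l \<in> L" for l
    using assms L_closed[OF that] by (simp add: m_assoc[symmetric])
  show "x \<otimes> (inv x \<otimes> y) = y" if "y \<in> q x" for y
    using assms that by (simp add: mem_q_iff m_assoc[symmetric])
qed

lemma q_sub_K: "x \<in> K \<Longrightarrow> y \<in> q x \<Longrightarrow> y \<in> K"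
  using K_mult L_K by (auto simp: r_coset_def)

end

text \<open>\<open>\<gamma>\<close> is the transposed cocycle of \<open>R\<close>. The elements
  \<open>s_x\<close> will have coefficients formed with \<open>R (inv y)\<close>, and inversion
  reverses products, so that \<open>s_x s_y = \<gamma>(x, y) s_xy\<close> holds with the arguments
  in natural order.\<close>

locale projective_five = afforded_five G K L \<theta> \<phi> d \<rho> for G (structure) and K L \<theta> \<phi> d \<rho> +
  fixes R \<gamma>
  assumes R_carrier: "\<And>y. y \<in> K \<Longrightarrow> R y \<in> carrier_mat d d"
    and R_L: "\<And>l. l \<in> L \<Longrightarrow> R l = \<rho> l"
    and R_mult: "\<And>y w. y \<in> K \<Longrightarrow> w \<in> K \<Longrightarrow> R y * R w = \<gamma> (L #> w) (L #> y) \<cdot>\<^sub>m R (y \<otimes> w)"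
    and \<gamma>_mult: "\<And>x y z. x \<in> carrier (quot G K L) \<Longrightarrow> y \<in> carrier (quot G K L) \<Longrightarrow> z \<in> carrier (quot G K L) \<Longrightarrow>
        \<gamma> (x \<otimes>\<^bsub>quot G K L\<^esub> y) z = \<gamma> x z * \<gamma> y z"
    and \<gamma>_anti: "\<And>x y. x \<in> carrier (quot G K L) \<Longrightarrow> y \<in> carrier (quot G K L) \<Longrightarrow> \<gamma> x y * \<gamma> y x = 1"
    and \<gamma>_self: "\<And>x. x \<in> carrier (quot G K L) \<Longrightarrow> \<gamma> x x = 1"
begin

lemma \<gamma>_nz: "x \<in> carrier E \<Longrightarrow> y \<in> carrier E \<Longrightarrow> \<gamma> x y \<noteq> 0"
  using \<gamma>_anti[of x y] by auto

lemma \<gamma>_flip: "x \<in> carrier E \<Longrightarrow> y \<in> carrier E \<Longrightarrow> \<gamma> x y = 1 / \<gamma> y x"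
  using \<gamma>_anti[of x y] \<gamma>_nz[of y x] by (simp add: field_simps)

lemma \<gamma>_q_left: 
  assumes "x \<in> K" "y \<in> K" "z \<in> K"
  shows "\<gamma> (q (x \<otimes> y)) (q z) = \<gamma> (q x) (q z) * \<gamma> (q y) (q z)"
  using \<gamma>_mult[of "q x" "q y" "q z"] assms by (simp only: q_E mult_E K_closed)

lemma \<gamma>_q_right: 
  assumes "x \<in> K" "y \<in> K" "z \<in> K"
  shows "\<gamma> (q z) (q (x \<otimes> y)) = \<gamma> (q z) (q x) * \<gamma> (q z) (q y)"
proof -
  have "\<gamma> (q z) (q (x \<otimes> y)) = 1 / (\<gamma> (q x) (q z) * \<gamma> (q y) (q z))"
    unfolding \<gamma>_q_left[OF assms, symmetric] by (rule \<gamma>_flip) (simp_all only: q_E assms K_mult)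
  also have "\<dots> = \<gamma> (q z) (q x) * \<gamma> (q z) (q y)"
    unfolding \<gamma>_flip[OF q_E[OF assms(3)] q_E[OF assms(1)]] \<gamma>_flip[OF q_E[OF assms(3)] q_E[OF assms(2)]] by simp
  finally show ?thesis .
qed

lemma \<gamma>_one:
  assumes "z \<in> K" "l \<in> L"
  shows "\<gamma> (q l) (q z) = 1" "\<gamma> (q z) (q l) = 1"
proof -
  have l: "q l = q \<one>" unfolding q_one q_eq_L_iff[OF L_closed[OF assms(2)]] by (rule assms(2))
  have "\<gamma> (q \<one>) (q z) = \<gamma> (q \<one>) (q z) * \<gamma> (q \<one>) (q z)" using \<gamma>_q_left[OF K_one K_one assms(1)] by simp
  then show "\<gamma> (q l) (q z) = 1" using \<gamma>_nz[OF q_E[OF K_one] q_E[OF assms(1)]] unfolding l by simp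
  then show "\<gamma> (q z) (q l) = 1" using \<gamma>_flip[OF q_E[OF assms(1)] q_E[OF L_K[OF assms(2)]]] by simp
qed

lemma \<gamma>_inv:
  assumes "x \<in> K" "z \<in> K"
  shows "\<gamma> (q (inv x)) (q z) = 1 / \<gamma> (q x) (q z)" "\<gamma> (q z) (q (inv x)) = 1 / \<gamma> (q z) (q x)"
proof -
  have "\<gamma> (q x) (q z) * \<gamma> (q (inv x)) (q z) = 1" 
    using \<gamma>_q_left[OF assms(1) K_inv[OF assms(1)] assms(2)]
    unfolding r_inv[OF K_closed[OF assms(1)]] \<gamma>_one(1)[OF assms(2) L_one] by (rule sym)
  then show "\<gamma> (q (inv x)) (q z) = 1 / \<gamma> (q x) (q z)" by (intro eq_divide_imp \<gamma>_nz q_E assms) (simp only: mult.commute)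
  have "\<gamma> (q z) (q x) * \<gamma> (q z) (q (inv x)) = 1" 
    using \<gamma>_q_right[OF assms(1) K_inv[OF assms(1)] assms(2)]
    unfolding r_inv[OF K_closed[OF assms(1)]] \<gamma>_one(2)[OF assms(2) L_one] by (rule sym)
  then show "\<gamma> (q z) (q (inv x)) = 1 / \<gamma> (q z) (q x)" by (intro eq_divide_imp \<gamma>_nz q_E assms) (simp only: mult.commute)
qed

lemma R_one: "R \<one> = 1\<^sub>m d"
  using R_L[OF L_one] Lg.rep_one[OF Lg.irrepD[OF irr]] by simp

lemma R_mult_L:
  assumes "y \<in> K" "l \<in> L"
  shows "R (y \<otimes> l) = R y * \<rho> l" "R (l \<otimes> y) = \<rho> l * R y"
  using R_mult[OF assms(1) L_K[OF assms(2)]] R_mult[OF L_K[OF assms(2)] assms(1)] \<gamma>_one[OF assms] R_L[OF assms(2)]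
  by (simp_all add: one_smult_mat)

lemma R_mult_same:
  assumes "x \<in> K" "y \<in> q x"
  shows "R (inv x) * R y = R (inv x \<otimes> y)"
proof -
  have y: "y \<in> K" by (rule q_sub_K[OF assms])
  have "q y = q x" using assms by (simp add: mem_q_iff K_closed)
  then have "\<gamma> (q y) (q (inv x)) = 1" using \<gamma>_inv(2)[OF assms(1) assms(1)] \<gamma>_self[OF q_E[OF assms(1)]] by simp
  then show ?thesis using R_mult[OF K_inv[OF assms(1)] y] by (simp add: one_smult_mat)
qed

lemma R_inv: 
  assumes "x \<in> K"
  shows "R x * R (inv x) = 1\<^sub>m d" "R (inv x) * R x = 1\<^sub>m d"
  using R_mult_same[OF assms, of x] R_mult_same[OF K_inv[OF assms], of "inv x"] K_closed[OF assms] R_one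
  by (simp_all add: mem_q_iff)

text \<open>The coefficients of \<open>s_x\<close>, the sum of \<open>tau y\<close> times
  \<open>y\<close> over the coset of \<open>x\<close>. On \<open>L\<close> they are the coefficients
  of the idempotent \<open>e_\<phi>\<close>, as \<open>d\<close> is the degree of
  \<open>\<phi>\<close>.\<close>

definition tau where "tau y = of_nat d / of_nat (card L) * mat_trace (R (inv y))"

lemma card_L: "(of_nat (card L) :: complex) \<noteq> 0"
  using Lg.gsize_nonzero by simp

text \<open>As \<open>A\<close> is arbitrary, this says that the sum of \<open>tau y\<close> times
  \<open>R y\<close> over a coset is the identity matrix. It is the orthogonality relation on
  \<open>L\<close>, translated by \<open>x\<close>.\<close>

lemma tau_sum_trace:
  assumes x: "x \<in> K" and A: "A \<in> carrier_mat d d"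
  shows "(\<Sum>y\<in>q x. tau y * mat_trace (A * R y)) = mat_trace A"
proof -
  note xG = K_closed[OF x] and Rx = R_carrier[OF x] and Rx' = R_carrier[OF K_inv[OF x]]
  have "(\<Sum>y\<in>q x. tau y * mat_trace (A * R y)) = (\<Sum>l\<in>L. tau (x \<otimes> l) * mat_trace (A * R (x \<otimes> l)))"
    by (rule sum.reindex_bij_betw[OF bij_coset[OF xG], symmetric])
  also have "\<dots> = (\<Sum>l\<in>L. of_nat d / of_nat (card L) * (mat_trace (\<rho> (inv l) * R (inv x)) * mat_trace (A * R x * \<rho> l)))"
  proof (rule sum.cong[OF refl])
    fix l assume l: "l \<in> L"
    have "inv (x \<otimes> l) = inv l \<otimes> inv x" using xG L_closed[OF l] by (simp add: inv_mult_group)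
    then show "tau (x \<otimes> l) * mat_trace (A * R (x \<otimes> l)) = of_nat d / of_nat (card L) * (mat_trace (\<rho> (inv l) * R (inv x)) * mat_trace (A * R x * \<rho> l))"
      using R_mult_L(2)[OF K_inv[OF x] L_inv[OF l]] R_mult_L(1)[OF x l] assoc_mult_sq[OF A Rx rho_carrier[OF l]] by (simp add: tau_def)
  qed
  also have "\<dots> = of_nat d / of_nat (card L) * (\<Sum>l\<in>L. mat_trace (\<rho> (inv l) * R (inv x)) * mat_trace (A * R x * \<rho> l))"
    by (rule sum_distrib_left[symmetric])
  also have "(\<Sum>l\<in>L. mat_trace (\<rho> (inv l) * R (inv x)) * mat_trace (A * R x * \<rho> l)) = of_nat (card L) / of_nat d * mat_trace (A * R x * R (inv x))"
    using Lg.sum_trace_trace[OF irr mult_carrier_mat[OF A Rx] Rx'] by (simp add: inv_L)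
  also have "A * R x * R (inv x) = A" unfolding assoc_mult_sq[OF A Rx Rx'] R_inv(1)[OF x] by (rule right_mult_one_mat[OF A])
  finally show ?thesis using card_L d_pos by simp
qed

lemma tau_nonzero:
  assumes "x \<in> K"
  shows "\<exists>y\<in>q x. tau y \<noteq> 0"
proof (rule ccontr)
  assume "\<not> ?thesis"
  then have "(\<Sum>y\<in>q x. tau y * mat_trace (1\<^sub>m d * R y)) = 0" by simp
  then show False using tau_sum_trace[OF assms one_carrier_mat] d_pos by simp
qed

text \<open>The relation \<open>s_x s_w = \<gamma>(x, w) s_xw\<close>, read at an element
  \<open>z\<close> of the product coset. The last argument may be \<open>z\<close> itself, since its
  coset is that of \<open>x\<close> times \<open>w\<close> and \<open>\<gamma>\<close> is 1 on the
  diagonal.\<close>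

lemma tau_convolution:
  assumes x: "x \<in> K" and z: "z \<in> K"
  shows "(\<Sum>y\<in>q x. tau y * tau (inv y \<otimes> z)) = \<gamma> (q x) (q z) * tau z"
proof -
  have z': "inv z \<in> K" using K_inv[OF z] .
  have "(\<Sum>y\<in>q x. tau y * tau (inv y \<otimes> z)) = (\<Sum>y\<in>q x. \<gamma> (q x) (q z) * (of_nat d / of_nat (card L)) * (tau y * mat_trace (R (inv z) * R y)))"
  proof (rule sum.cong[OF refl])
    fix y assume yx: "y \<in> q x"
    then have y: "y \<in> K" "q y = q x" using q_sub_K[OF x yx] K_closed[OF x] by (simp_all add: mem_q_iff)
    have "mat_trace (R (inv z) * R y) = \<gamma> (q x) (q (inv z)) * mat_trace (R (inv z \<otimes> y))"
      unfolding R_mult[OF z' y(1)] y(2) by (rule mat_trace_smult[OF R_carrier[OF K_mult[OF z' y(1)]]])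
    then have "mat_trace (R (inv z \<otimes> y)) = \<gamma> (q x) (q z) * mat_trace (R (inv z) * R y)"
      using \<gamma>_inv(2)[OF z x] \<gamma>_nz[OF q_E[OF x] q_E[OF z]] by simp
    moreover have "inv (inv y \<otimes> z) = inv z \<otimes> y" using K_closed[OF y(1)] K_closed[OF z] by (simp add: inv_mult_group)
    ultimately show "tau y * tau (inv y \<otimes> z) = \<gamma> (q x) (q z) * (of_nat d / of_nat (card L)) * (tau y * mat_trace (R (inv z) * R y))"
      by (simp add: tau_def)
  qed
  also have "\<dots> = \<gamma> (q x) (q z) * (of_nat d / of_nat (card L)) * mat_trace (R (inv z))"
    unfolding sum_distrib_left[symmetric] tau_sum_trace[OF x R_carrier[OF z']] ..
  finally show ?thesis by (simp add: tau_def)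
qed

lemma phi_R: "l \<in> L \<Longrightarrow> \<phi> l = mat_trace (R l)"
  by (simp add: phi R_L)

lemma tau_conj_L:
  assumes "x \<in> K" "l \<in> L"
  shows "tau (l \<otimes> x \<otimes> inv l) = tau x"
proof -
  have c: "R (inv x) \<in> carrier_mat d d" "\<rho> l \<in> carrier_mat d d" "\<rho> (inv l) \<in> carrier_mat d d"
    using R_carrier K_inv rho_carrier L_inv assms by simp_all
  have "inv (l \<otimes> x \<otimes> inv l) = l \<otimes> inv x \<otimes> inv l" using assms K_closed L_closed by (simp add: inv_mult_group m_assoc)
  moreover have "R (l \<otimes> inv x \<otimes> inv l) = \<rho> l * R (inv x) * \<rho> (inv l)"
    using R_mult_L(1)[OF K_mult[OF L_K[OF assms(2)] K_inv[OF assms(1)]] L_inv[OF assms(2)]]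
      R_mult_L(2)[OF K_inv[OF assms(1)] assms(2)] by simp
  ultimately show ?thesis unfolding tau_def using mat_trace_conj[OF c(2,1,3) rho_inv(2)[OF assms(2)]] by simp
qed

text \<open>Multiplying \<open>s_x\<close> by the idempotent of \<open>\<phi>\<close> reproduces it.
  Together with \<open>tau_conj_L\<close> this places \<open>s_x\<close> in
  \<open>S\<close>.\<close>

lemma tau_idem:
  assumes x: "x \<in> K"
  shows "of_nat d / of_nat (card L) * (\<Sum>y\<in>q x. tau y * \<phi> (inv x \<otimes> y)) = tau x"
proof -
  have "(\<Sum>y\<in>q x. tau y * \<phi> (inv x \<otimes> y)) = (\<Sum>y\<in>q x. tau y * mat_trace (R (inv x) * R y))"
  proof (rule sum.cong[OF refl])
    fix y assume y: "y \<in> q x"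
    then have "inv x \<otimes> y \<in> L" using q_eq_iff[of x y] K_closed[OF x] by (simp add: mem_q_iff)
    then show "tau y * \<phi> (inv x \<otimes> y) = tau y * mat_trace (R (inv x) * R y)"
      using R_mult_same[OF x y] phi_R by simp
  qed
  then show ?thesis using tau_sum_trace[OF x R_carrier[OF K_inv[OF x]]] by (simp add: tau_def)
qed

text \<open>On one coset form the sum \<open>M\<close> of the matrices \<open>R y\<close> with
  weights \<open>a y\<close>. Invariance makes \<open>M\<close> commute with \<open>\<rho>\<close>,
  so it is a scalar \<open>t\<close>; the idempotent condition recovers \<open>a x\<close> from the
  trace of \<open>R (inv x) * M\<close> as \<open>t * tau x\<close>. So \<open>S\<close> is spanned
  by the \<open>s_x\<close>, one for each coset.\<close>

lemma centralizer_form: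
  assumes conj: "\<And>x l. x \<in> K \<Longrightarrow> l \<in> L \<Longrightarrow> a (l \<otimes> x \<otimes> inv l) = a x"
    and idem: "\<And>x. x \<in> K \<Longrightarrow> a x = of_nat d / of_nat (card L) * (\<Sum>y\<in>q x. a y * \<phi> (inv x \<otimes> y))"
  shows "\<exists>t. \<forall>x\<in>K. a x = t (q x) * tau x"
proof -
  have "\<exists>t. \<forall>x\<in>K. q x = X \<longrightarrow> a x = t * tau x" if X: "X \<in> carrier E" for X
  proof -
    obtain x0 where x0: "x0 \<in> K" "q x0 = X" using rp[OF X] by (elim conjE) (rule that)
    define M where "M = msum d d (\<lambda>y. a y \<cdot>\<^sub>m R y) X"
    have M: "M \<in> carrier_mat d d" by (simp add: M_def)
    have XK: "y \<in> K" if "y \<in> X" for y using q_sub_K[OF x0(1)] that x0(2) by simp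
    have ac: "a y \<cdot>\<^sub>m R y \<in> carrier_mat d d" if "y \<in> X" for y by (rule smult_carrier_mat[OF R_carrier[OF XK[OF that]]])
    have comm: "M * \<rho> l = \<rho> l * M" if l: "l \<in> L" for l
    proof -
      have eqX: "q (l \<otimes> x0 \<otimes> inv l) = X"
      proof -
        have ql: "q l = L" "q (inv l) = L" using l L_inv[OF l] L_closed q_eq_L_iff by simp_all
        have "q (l \<otimes> x0 \<otimes> inv l) = q \<one> <#> q x0 <#> q \<one>"
          unfolding q_one using ql q_mult[OF m_closed[OF L_closed[OF l] K_closed[OF x0(1)]] inv_closed[OF L_closed[OF l]]]
            q_mult[OF L_closed[OF l] K_closed[OF x0(1)]] by simp
        also have "\<dots> = q x0" using K_closed[OF x0(1)] by (simp only: q_mult one_closed m_closed l_one r_one)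
        finally show ?thesis using x0(2) by simp
      qed
      have "M * \<rho> l = msum d d (\<lambda>y. a (l \<otimes> y \<otimes> inv l) \<cdot>\<^sub>m R (l \<otimes> y \<otimes> inv l)) (q x0) * \<rho> l"
        unfolding M_def using msum_reindex[OF bij_conj[OF K_closed[OF x0(1)] L_closed[OF l]], of d d "\<lambda>y. a y \<cdot>\<^sub>m R y"] eqX by simp
      also have "\<dots> = msum d d (\<lambda>y. a (l \<otimes> y \<otimes> inv l) \<cdot>\<^sub>m R (l \<otimes> y \<otimes> inv l) * \<rho> l) (q x0)"
        by (rule msum_mult[OF rho_carrier[OF l]]) (rule smult_carrier_mat[OF R_carrier[OF K_mult[OF K_mult[OF L_K[OF l] q_sub_K[OF x0(1)]] L_K[OF L_inv[OF l]]]]])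
      also have "\<dots> = msum d d (\<lambda>y. \<rho> l * (a y \<cdot>\<^sub>m R y)) X"
      proof (rule msum_cong[OF x0(2)])
        fix y assume "y \<in> X"
        then have y: "y \<in> K" by (rule XK)
        have yl: "l \<otimes> y \<otimes> inv l \<in> K" by (rule K_mult[OF K_mult[OF L_K[OF l] y] L_K[OF L_inv[OF l]]])
        have "R (l \<otimes> y \<otimes> inv l) * \<rho> l = R (l \<otimes> y \<otimes> inv l \<otimes> l)" by (rule R_mult_L(1)[OF yl l, symmetric])
        also have "l \<otimes> y \<otimes> inv l \<otimes> l = l \<otimes> y" using K_closed[OF y] L_closed[OF l] by (simp add: m_assoc)
        also have "R (l \<otimes> y) = \<rho> l * R y" by (rule R_mult_L(2)[OF y l])
        finally show "a (l \<otimes> y \<otimes> inv l) \<cdot>\<^sub>m R (l \<otimes> y \<otimes> inv l) * \<rho> l = \<rho> l * (a y \<cdot>\<^sub>m R y)"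
          unfolding mult_smult_assoc_mat[OF R_carrier[OF yl] rho_carrier[OF l]] mult_smult_distrib[OF rho_carrier[OF l] R_carrier[OF y]] conj[OF y l]
          by simp
      qed
      also have "\<dots> = \<rho> l * M" unfolding M_def by (rule mult_msum[OF rho_carrier[OF l], symmetric]) (rule ac)
      finally show ?thesis .
    qed
    obtain t where t: "M = t \<cdot>\<^sub>m 1\<^sub>m d" using Lg.schur[OF irr M] comm by auto
    have "a x = t * tau x" if x: "x \<in> K" "q x = X" for x
    proof -
      note Rx = R_carrier[OF K_inv[OF x(1)]]
      have "(\<Sum>y\<in>q x. a y * \<phi> (inv x \<otimes> y)) = (\<Sum>y\<in>X. mat_trace (R (inv x) * (a y \<cdot>\<^sub>m R y)))"
      proof (rule sum.cong[OF x(2)])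
        fix y assume y: "y \<in> X"
        then have yx: "y \<in> q x" using x(2) by simp
        then have "inv x \<otimes> y \<in> L" using q_eq_iff[of x y] K_closed[OF x(1)] by (simp add: mem_q_iff)
        then have "\<phi> (inv x \<otimes> y) = mat_trace (R (inv x) * R y)" using phi_R R_mult_same[OF x(1) yx] by simp
        then show "a y * \<phi> (inv x \<otimes> y) = mat_trace (R (inv x) * (a y \<cdot>\<^sub>m R y))"
          unfolding mult_smult_distrib[OF Rx R_carrier[OF XK[OF y]]] mat_trace_smult[OF mult_carrier_mat[OF Rx R_carrier[OF XK[OF y]]]] by simp
      qed
      also have "\<dots> = mat_trace (msum d d (\<lambda>y. R (inv x) * (a y \<cdot>\<^sub>m R y)) X)"
        by (rule mat_trace_msum'[symmetric]) (rule mult_carrier_mat[OF Rx ac])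
      also have "msum d d (\<lambda>y. R (inv x) * (a y \<cdot>\<^sub>m R y)) X = R (inv x) * M"
        unfolding M_def by (rule mult_msum[OF Rx, symmetric]) (rule ac)
      also have "\<dots> = t \<cdot>\<^sub>m R (inv x)" unfolding t mult_smult_distrib[OF Rx one_carrier_mat] right_mult_one_mat[OF Rx] ..
      finally show ?thesis using idem[OF x(1)] mat_trace_smult[OF Rx] by (simp add: tau_def)
    qed
    then show ?thesis by (intro exI[of _ t]) simp
  qed
  then have "\<forall>X\<in>carrier E. \<exists>t. \<forall>x\<in>K. q x = X \<longrightarrow> a x = t * tau x" by (intro ballI)
  then obtain t where t: "\<forall>X\<in>carrier E. \<forall>x\<in>K. q x = X \<longrightarrow> a x = t X * tau x" by (elim bchoice[THEN exE])
  have "a x = t (q x) * tau x" if x: "x \<in> K" for x using bspec[OF bspec[OF t q_E[OF x]] x] by simp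
  then show ?thesis by (intro exI[of _ t]) simp
qed

text \<open>Normality of \<open>L\<close> and invariance of \<open>\<phi>\<close> under
  \<open>g\<close> let the conjugated function satisfy both conditions of
  \<open>centralizer_form\<close>. So \<open>g\<close> permutes the \<open>s_x\<close> up to
  scalars.\<close>

lemma tau_conj:
  assumes g: "g \<in> carrier G"
  shows "\<exists>m. \<forall>x\<in>K. tau (g \<otimes> x \<otimes> inv g) = m (q x) * tau x"
proof (rule centralizer_form)
  fix x l assume x: "x \<in> K" and l: "l \<in> L"
  note cl = K_closed[OF x] L_closed[OF l]
  have "g \<otimes> (l \<otimes> x \<otimes> inv l) \<otimes> inv g = (g \<otimes> l \<otimes> inv g) \<otimes> (g \<otimes> x \<otimes> inv g) \<otimes> inv (g \<otimes> l \<otimes> inv g)"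
    using g cl by (simp add: inv_mult_group m_assoc) (simp add: m_assoc[symmetric])
  then show "tau (g \<otimes> (l \<otimes> x \<otimes> inv l) \<otimes> inv g) = tau (g \<otimes> x \<otimes> inv g)"
    using tau_conj_L[OF K_conj[OF x g] L_conj[OF l g]] by simp
next
  fix x assume x: "x \<in> K"
  define x' where "x' = g \<otimes> x \<otimes> inv g"
  have x': "x' \<in> K" unfolding x'_def by (rule K_conj[OF x g])
  have "(\<Sum>y\<in>q x'. tau y * \<phi> (inv x' \<otimes> y)) = (\<Sum>y\<in>q x. tau (g \<otimes> y \<otimes> inv g) * \<phi> (inv x' \<otimes> (g \<otimes> y \<otimes> inv g)))"
    unfolding x'_def by (rule sum.reindex_bij_betw[OF bij_conj[OF K_closed[OF x] g], symmetric])
  also have "\<dots> = (\<Sum>y\<in>q x. tau (g \<otimes> y \<otimes> inv g) * \<phi> (inv x \<otimes> y))"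
  proof (rule sum.cong[OF refl])
    fix y assume y: "y \<in> q x"
    have yG: "y \<in> carrier G" using K_closed[OF q_sub_K[OF x y]] .
    have l: "inv x \<otimes> y \<in> L" using y q_eq_iff[of x y] K_closed[OF x] by (simp add: mem_q_iff)
    have "inv x' \<otimes> (g \<otimes> y \<otimes> inv g) = inv (inv g) \<otimes> (inv x \<otimes> y) \<otimes> inv g"
      unfolding x'_def using g yG K_closed[OF x] by (simp add: inv_mult_group m_assoc) (simp add: m_assoc[symmetric])
    then show "tau (g \<otimes> y \<otimes> inv g) * \<phi> (inv x' \<otimes> (g \<otimes> y \<otimes> inv g)) = tau (g \<otimes> y \<otimes> inv g) * \<phi> (inv x \<otimes> y)"
      using phi_invariant[of "inv g", OF _ l] g by simp
  qed
  finally show "tau (g \<otimes> x \<otimes> inv g) = of_nat d / of_nat (card L) * (\<Sum>y\<in>q x. tau (g \<otimes> y \<otimes> inv g) * \<phi> (inv x \<otimes> y))"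
    using tau_idem[OF x'] by (simp add: x'_def)
qed

end

section \<open>Nondegeneracy of the commutator form\<close>

context alternating_form
begin

text \<open>If \<open>f\<close> were not inverse to any \<open>\<beta> y\<close>, all sums of
  \<open>f x * \<beta> y x\<close> over \<open>x\<close> would vanish, while their sum over
  \<open>y\<close> is the order of \<open>E\<close>. The square root \<open>k\<close> of the
  resulting \<open>y\<close> exists by odd order; squares are wanted because conjugation in
  \<open>K\<close> scales \<open>s_x\<close> by squares.\<close>

lemma \<beta>_square_duality:
  assumes hom: "\<And>x z. x \<in> carrier E \<Longrightarrow> z \<in> carrier E \<Longrightarrow> f (x \<otimes> z) = f x * f z"
    and one: "f \<one> = 1"
  shows "\<exists>k\<in>carrier E. \<forall>x\<in>carrier E. f x = \<beta> x k * \<beta> x k"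
proof -
  have "\<exists>y\<in>carrier E. \<forall>x\<in>carrier E. f x * \<beta> y x = 1"
  proof (rule ccontr)
    assume "\<not> ?thesis"
    then have ex: "\<exists>x\<in>carrier E. f x * \<beta> y x \<noteq> 1" if "y \<in> carrier E" for y using that by blast
    have zero: "(\<Sum>x\<in>carrier E. f x * \<beta> y x) = 0" if y: "y \<in> carrier E" for y
    proof -
      obtain x where x: "x \<in> carrier E" "f x * \<beta> y x \<noteq> 1" using ex[OF y] by (elim bexE)
      show ?thesis by (rule sum_hom_zero[where f = "\<lambda>x. f x * \<beta> y x" and y = x]) (simp_all add: hom \<beta>_mult_right y x)
    qed
    have "0 = (\<Sum>y\<in>carrier E. \<Sum>x\<in>carrier E. f x * \<beta> y x)" using zero by simp
    also have "\<dots> = (\<Sum>x\<in>carrier E. \<Sum>y\<in>carrier E. f x * \<beta> y x)" by (rule sum.swap)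
    also have "\<dots> = (\<Sum>x\<in>carrier E. if x = \<one> then f x * of_nat (card (carrier E)) else 0)"
    proof (rule sum.cong[OF refl])
      fix x assume x: "x \<in> carrier E"
      have "(\<Sum>y\<in>carrier E. \<beta> y x) = (\<Sum>y\<in>carrier E. \<beta> (inv x) y)"
        by (rule sum.cong[OF refl]) (simp add: \<beta>_flip[of _ x] \<beta>_inv_left x)
      also have "\<dots> = (if x = \<one> then of_nat (card (carrier E)) else 0)"
        unfolding sum_\<beta>[OF inv_closed[OF x]] using x by simp
      finally have "(\<Sum>y\<in>carrier E. \<beta> y x) = (if x = \<one> then of_nat (card (carrier E)) else 0)" .
      then show "(\<Sum>y\<in>carrier E. f x * \<beta> y x) = (if x = \<one> then f x * of_nat (card (carrier E)) else 0)"
        unfolding sum_distrib_left[symmetric] by simp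
    qed
    also have "\<dots> = of_nat (card (carrier E))" using finite_E one by simp
    finally show False using card_E_pos by simp
  qed
  then obtain y where y: "y \<in> carrier E" and fy: "\<forall>x\<in>carrier E. f x * \<beta> y x = 1" by (elim bexE)
  define k where "k = y [^] ((card (carrier E) + 1) div 2)"
  have k: "k \<in> carrier E" using y by (simp add: k_def)
  have kk: "k \<otimes> k = y" using halve[OF y] y by (simp add: k_def pow_mult_distrib m_comm)
  have "f x = \<beta> x k * \<beta> x k" if x: "x \<in> carrier E" for x
  proof -
    have "f x * \<beta> y x = 1" using fy x by (rule bspec)
    then have "f x = 1 / \<beta> y x" using \<beta>_nz[OF y x] by (simp add: field_simps)
    also have "\<dots> = \<beta> x y" by (rule \<beta>_flip[OF x y, symmetric])
    finally show ?thesis using \<beta>_mult_right[OF x k k] unfolding kk by simp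
  qed
  then show ?thesis using k by (intro bexI[of _ k] ballI)
qed

end

context abelian_five
begin

lemma bij_mult_coset:
  assumes "y \<in> carrier G" "w \<in> carrier G"
  shows "bij_betw (\<lambda>v. y \<otimes> v) (q w) (q (y \<otimes> w))"
proof (rule bij_betwI[where g = "\<lambda>v. inv y \<otimes> v"])
  show "(\<lambda>v. y \<otimes> v) \<in> q w \<rightarrow> q (y \<otimes> w)"
  proof
    fix v assume "v \<in> q w"
    then have v: "v \<in> carrier G" "q v = q w" using assms by (simp_all add: mem_q_iff)
    have "q (y \<otimes> v) = q (y \<otimes> w)" using q_mult[OF assms(1) v(1)] q_mult[OF assms] v(2) by simp
    then show "y \<otimes> v \<in> q (y \<otimes> w)" using assms v by (simp add: mem_q_iff)
  qed
  show "(\<lambda>v. inv y \<otimes> v) \<in> q (y \<otimes> w) \<rightarrow> q w"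
  proof
    fix v assume "v \<in> q (y \<otimes> w)"
    then have v: "v \<in> carrier G" "q v = q (y \<otimes> w)" using assms by (simp_all add: mem_q_iff)
    have "q (inv y \<otimes> v) = q (inv y) <#> q (y \<otimes> w)" using q_mult[of "inv y" v] assms v by simp
    also have "\<dots> = q (inv y \<otimes> (y \<otimes> w))" by (rule q_mult) (use assms in simp_all)
    also have "inv y \<otimes> (y \<otimes> w) = w" using assms by (simp add: m_assoc[symmetric])
    finally show "inv y \<otimes> v \<in> q w" using assms v by (simp add: mem_q_iff)
  qed
qed (use assms in \<open>simp_all add: mem_q_iff m_assoc[symmetric]\<close>)

lemma q_conj_K:
  assumes "x \<in> K" "k \<in> K"
  shows "q (k \<otimes> x \<otimes> inv k) = q x"
proof -
  note G = K_closed[OF assms(1)] K_closed[OF assms(2)]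
  have "q (k \<otimes> x) = q (x \<otimes> k)"
    unfolding mult_E[OF G(2,1), symmetric] mult_E[OF G, symmetric] by (rule E.m_comm[OF q_E[OF assms(2)] q_E[OF assms(1)]])
  then have "q (k \<otimes> x \<otimes> inv k) = q (x \<otimes> k) <#> q (inv k)" using q_mult[of "k \<otimes> x" "inv k"] G by simp
  also have "\<dots> = q (x \<otimes> k \<otimes> inv k)" by (rule q_mult) (use G in simp_all)
  also have "x \<otimes> k \<otimes> inv k = x" using G by (simp add: m_assoc)
  finally show ?thesis .
qed

end

context projective_five
begin

definition mu where "mu g = (SOME m. \<forall>x\<in>K. tau (g \<otimes> x \<otimes> inv g) = m (q x) * tau x)"

lemma mu: "g \<in> carrier G \<Longrightarrow> x \<in> K \<Longrightarrow> tau (g \<otimes> x \<otimes> inv g) = mu g (q x) * tau x"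
  using someI_ex[OF tau_conj] unfolding mu_def by simp

lemma mu_nonzero:
  assumes "g \<in> carrier G" "x \<in> K"
  shows "mu g (q x) \<noteq> 0"
proof -
  obtain y where y: "y \<in> q (g \<otimes> x \<otimes> inv g)" "tau y \<noteq> 0" using tau_nonzero[OF K_conj[OF assms(2,1)]] by (elim bexE)
  obtain w where w: "w \<in> q x" "y = g \<otimes> w \<otimes> inv g"
    using y(1) bij_betw_imp_surj_on[OF bij_conj[OF K_closed[OF assms(2)] assms(1)]] by blast
  have "q w = q x" using w(1) assms by (simp add: mem_q_iff K_closed)
  then show ?thesis using y(2) mu[OF assms(1) q_sub_K[OF assms(2) w(1)]] w(2) by auto
qed

text \<open>Conjugate the relation \<open>s_x s_y = \<gamma>(x, y) s_xy\<close> by \<open>g\<close>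
  and compare coefficients at a point \<open>z\<close> where \<open>tau\<close> does not
  vanish.\<close>

lemma mu_twisted_mult:
  assumes g: "g \<in> carrier G" and x: "x \<in> K" and y: "y \<in> K"
  shows "mu g (q (x \<otimes> y)) * \<gamma> (q (g \<otimes> x \<otimes> inv g)) (q (g \<otimes> y \<otimes> inv g)) = mu g (q x) * mu g (q y) * \<gamma> (q x) (q y)"
proof -
  define c where "c u = g \<otimes> u \<otimes> inv g" for u
  have cK: "u \<in> K \<Longrightarrow> c u \<in> K" for u unfolding c_def by (rule K_conj[OF _ g])
  have cm: "c (u \<otimes> v) = c u \<otimes> c v" if "u \<in> K" "v \<in> K" for u v
    using g that[THEN K_closed] unfolding c_def by (simp add: m_assoc) (simp add: m_assoc[symmetric])
  have ci: "c (inv u) = inv (c u)" if "u \<in> K" for u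
    using g K_closed[OF that] unfolding c_def by (simp add: inv_mult_group m_assoc)
  obtain z where z0: "z \<in> q (x \<otimes> y)" "tau z \<noteq> 0" using tau_nonzero[OF K_mult[OF x y]] by (elim bexE)
  have z: "z \<in> K" "q z = q (x \<otimes> y)" using q_sub_K[OF K_mult[OF x y] z0(1)] z0(1) x y by (simp_all add: mem_q_iff K_closed)
  have qy: "q (inv u \<otimes> z) = q y" if u: "u \<in> q x" for u
  proof -
    have uK: "u \<in> K" "q u = q x" using q_sub_K[OF x u] u x by (simp_all add: mem_q_iff K_closed)
    have "q (inv u) = q (inv x)" using inv_E[OF uK(1)] inv_E[OF x] uK(2) by simp
    then have "q (inv u \<otimes> z) = q (inv x) <#> q (x \<otimes> y)"
      using q_mult[OF K_closed[OF K_inv[OF uK(1)]] K_closed[OF z(1)]] z(2) by simp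
    also have "\<dots> = q (inv x \<otimes> (x \<otimes> y))" by (rule q_mult) (simp_all add: x y K_closed)
    also have "inv x \<otimes> (x \<otimes> y) = y" using x y K_closed by (simp add: m_assoc[symmetric])
    finally show ?thesis .
  qed
  have "(\<Sum>u\<in>q (c x). tau u * tau (inv u \<otimes> c z)) = (\<Sum>u\<in>q x. tau (c u) * tau (inv (c u) \<otimes> c z))"
    unfolding c_def by (rule sum.reindex_bij_betw[OF bij_conj[OF K_closed[OF x] g], symmetric])
  also have "\<dots> = (\<Sum>u\<in>q x. mu g (q x) * mu g (q y) * (tau u * tau (inv u \<otimes> z)))"
  proof (rule sum.cong[OF refl])
    fix u assume u: "u \<in> q x"
    have uK: "u \<in> K" "q u = q x" using q_sub_K[OF x u] u x by (simp_all add: mem_q_iff K_closed)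
    have "tau (c u) = mu g (q x) * tau u" unfolding c_def uK(2)[symmetric] by (rule mu[OF g uK(1)])
    moreover have "tau (inv (c u) \<otimes> c z) = mu g (q y) * tau (inv u \<otimes> z)"
      unfolding ci[OF uK(1), symmetric] cm[OF K_inv[OF uK(1)] z(1), symmetric] qy[OF u, symmetric]
      unfolding c_def by (rule mu[OF g K_mult[OF K_inv[OF uK(1)] z(1)]])
    ultimately show "tau (c u) * tau (inv (c u) \<otimes> c z) = mu g (q x) * mu g (q y) * (tau u * tau (inv u \<otimes> z))" by simp
  qed
  also have "\<dots> = mu g (q x) * mu g (q y) * (\<gamma> (q x) (q z) * tau z)"
    unfolding sum_distrib_left[symmetric] tau_convolution[OF x z(1)] ..
  also have "(\<Sum>u\<in>q (c x). tau u * tau (inv u \<otimes> c z)) = \<gamma> (q (c x)) (q (c z)) * tau (c z)"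
    by (rule tau_convolution[OF cK[OF x] cK[OF z(1)]])
  also have "tau (c z) = mu g (q (x \<otimes> y)) * tau z" unfolding c_def z(2)[symmetric] by (rule mu[OF g z(1)])
  finally have "\<gamma> (q (c x)) (q (c z)) * mu g (q (x \<otimes> y)) = mu g (q x) * mu g (q y) * \<gamma> (q x) (q z)"
    using z0(2) by simp
  moreover have "\<gamma> (q x) (q z) = \<gamma> (q x) (q y)"
    unfolding z(2) \<gamma>_q_right[OF x y x] \<gamma>_self[OF q_E[OF x]] by simp
  moreover have "q (c z) = q (c x \<otimes> c y)"
    unfolding cm[OF x y, symmetric] unfolding c_def
    by (rule q_conj[OF K_closed[OF z(1)] K_closed[OF K_mult[OF x y]] g z(2)])
  then have "\<gamma> (q (c x)) (q (c z)) = \<gamma> (q (c x)) (q (c y))"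
    unfolding \<gamma>_q_right[OF cK[OF x] cK[OF y] cK[OF x]] \<gamma>_self[OF q_E[OF cK[OF x]]]
    by (simp only: \<gamma>_q_right[OF cK[OF x] cK[OF y] cK[OF x]] \<gamma>_self[OF q_E[OF cK[OF x]]] mult_1_left)
  ultimately have "\<gamma> (q (c x)) (q (c y)) * mu g (q (x \<otimes> y)) = mu g (q x) * mu g (q y) * \<gamma> (q x) (q y)" by simp
  then show ?thesis unfolding c_def by (simp only: mult.commute)
qed

lemma \<gamma>_pow_card:
  assumes "x \<in> K" "y \<in> K"
  shows "\<gamma> (q x) (q y) ^ card (carrier E) = 1"
proof -
  have one: "\<gamma> \<one>\<^bsub>E\<^esub> (q y) = 1" using \<gamma>_one(1)[OF assms(2) L_one] unfolding q_one one_E .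
  have "\<gamma> (q x [^]\<^bsub>E\<^esub> card (carrier E)) (q y) = \<gamma> (q x) (q y) ^ card (carrier E)"
    by (rule E.hom_pow[where f = "\<lambda>u. \<gamma> u (q y)"]) (rule \<gamma>_mult one q_E[OF assms(1)] q_E[OF assms(2)] | assumption)+
  then show ?thesis unfolding E.pow_card[OF q_E[OF assms(1)]] one by simp
qed

lemma \<gamma>_sq_eq_imp_eq:
  assumes K: "x \<in> K" "y \<in> K" "z \<in> K" "w \<in> K" 
    and sq: "\<gamma> (q x) (q y) * \<gamma> (q x) (q y) = \<gamma> (q z) (q w) * \<gamma> (q z) (q w)"
  shows "\<gamma> (q x) (q y) = \<gamma> (q z) (q w)"
proof -
  let ?u = "\<gamma> (q x) (q y)" and ?v = "\<gamma> (q z) (q w)"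
  have v: "?v \<noteq> 0" by (rule \<gamma>_nz[OF q_E[OF K(3)] q_E[OF K(4)]])
  have "(?u / ?v) ^ 2 = 1" using sq v by (simp add: power2_eq_square)
  moreover have "(?u / ?v) ^ card (carrier E) = 1" 
    unfolding power_divide \<gamma>_pow_card[OF K(1,2)] \<gamma>_pow_card[OF K(3,4)] by simp
  moreover have "coprime 2 (card (carrier E))" using odd_index unfolding Coset.order_def by simp
  ultimately have "?u / ?v = 1" by (rule coprime_powers_eq_1)
  then show ?thesis using v by simp
qed

text \<open>Interchanging \<open>x\<close> and \<open>y\<close> in \<open>mu_twisted_mult\<close>
  inverts both form values and leaves the factors \<open>mu\<close> alone. Comparing the two
  relations shows that the form values have equal squares, and odd order removes the square. Only
  afterwards is \<open>mu g\<close> seen to be a character.\<close>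

lemma \<gamma>_conj:
  assumes g: "g \<in> carrier G" and x: "x \<in> K" and y: "y \<in> K"
  shows "\<gamma> (q (g \<otimes> x \<otimes> inv g)) (q (g \<otimes> y \<otimes> inv g)) = \<gamma> (q x) (q y)"
proof (rule \<gamma>_sq_eq_imp_eq[OF K_conj[OF x g] K_conj[OF y g] x y])
  define u v where "u = \<gamma> (q (g \<otimes> x \<otimes> inv g)) (q (g \<otimes> y \<otimes> inv g))" and "v = \<gamma> (q x) (q y)"
  define M N where "M = mu g (q (x \<otimes> y))" and "N = mu g (q x) * mu g (q y)"
  have nz: "M \<noteq> 0" "N \<noteq> 0" "u \<noteq> 0" "v \<noteq> 0"
    unfolding M_def N_def u_def v_def using mu_nonzero[OF g] x y K_mult \<gamma>_nz[OF q_E q_E] K_conj[OF x g] K_conj[OF y g] by simp_all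
  have "q (y \<otimes> x) = q (x \<otimes> y)"
    unfolding mult_E[OF K_closed[OF y] K_closed[OF x], symmetric] mult_E[OF K_closed[OF x] K_closed[OF y], symmetric]
    by (rule E.m_comm[OF q_E[OF y] q_E[OF x]])
  then have 2: "M * (1 / u) = N * (1 / v)"
    using mu_twisted_mult[OF g y x] \<gamma>_flip[OF q_E[OF K_conj[OF y g]] q_E[OF K_conj[OF x g]]] \<gamma>_flip[OF q_E[OF y] q_E[OF x]]
    by (simp add: M_def N_def u_def v_def mult.commute)
  have 1: "M * u = N * v" using mu_twisted_mult[OF g x y] by (simp add: M_def N_def u_def v_def)
  have "M * v = N * u" using 2 nz by (simp add: field_simps)
  then have "(M * v) * (N * v) = (N * u) * (M * u)" using 1 by simp
  then have "(M * N) * (v * v) = (M * N) * (u * u)" by (simp add: algebra_simps)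
  then have "u * u = v * v" using nz by simp
  then show "\<gamma> (q (g \<otimes> x \<otimes> inv g)) (q (g \<otimes> y \<otimes> inv g)) * \<gamma> (q (g \<otimes> x \<otimes> inv g)) (q (g \<otimes> y \<otimes> inv g)) =
    \<gamma> (q x) (q y) * \<gamma> (q x) (q y)" by (simp add: u_def v_def)
qed

lemma mu_mult:
  assumes g: "g \<in> carrier G" and x: "x \<in> K" and y: "y \<in> K"
  shows "mu g (q (x \<otimes> y)) = mu g (q x) * mu g (q y)"
  using mu_twisted_mult[OF assms] \<gamma>_conj[OF assms] \<gamma>_nz[OF q_E[OF x] q_E[OF y]] by simp

text \<open>Conjugation inside \<open>K\<close> preserves each coset and scales \<open>s_x\<close>.
  The products with \<open>R k\<close> and with \<open>R (inv k)\<close> contribute one factor each: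
  the commutator form is the square of \<open>\<gamma>\<close>.\<close>

lemma tau_conj_K:
  assumes k: "k \<in> K" and x: "x \<in> K"
  shows "tau (k \<otimes> x \<otimes> inv k) = \<gamma> (q x) (q k) * \<gamma> (q x) (q k) * tau x"
proof -
  note k' = K_inv[OF k] and x' = K_inv[OF x]
  note c = R_carrier[OF k] R_carrier[OF x'] R_carrier[OF k']
  have inv: "inv (k \<otimes> x \<otimes> inv k) = k \<otimes> inv x \<otimes> inv k" using K_closed[OF x] K_closed[OF k] by (simp add: inv_mult_group m_assoc)
  have kx: "k \<otimes> inv x \<in> K" "k \<otimes> inv x \<otimes> inv k \<in> K" using k k' x' by (simp_all add: K_mult)
  have g1: "\<gamma> (q (inv x)) (q k) = \<gamma> (q k) (q x)"
    unfolding \<gamma>_inv(1)[OF x k] by (rule \<gamma>_flip[OF q_E[OF k] q_E[OF x], symmetric])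
  have g2: "\<gamma> (q (inv k)) (q (k \<otimes> inv x)) = \<gamma> (q k) (q x)"
    unfolding \<gamma>_q_right[OF k x' k'] \<gamma>_inv(1)[OF k k] \<gamma>_self[OF q_E[OF k]] \<gamma>_inv(1)[OF k x'] \<gamma>_inv(2)[OF x k] by simp
  have "R k * R (inv x) * R (inv k) = (\<gamma> (q k) (q x) * \<gamma> (q k) (q x)) \<cdot>\<^sub>m R (k \<otimes> inv x \<otimes> inv k)"
    unfolding R_mult[OF k x'] g1 mult_smult_assoc_mat[OF R_carrier[OF kx(1)] c(3)] R_mult[OF kx(1) k'] g2 smult_smult_mat ..
  then have tr: "mat_trace (R (inv x)) = \<gamma> (q k) (q x) * \<gamma> (q k) (q x) * mat_trace (R (k \<otimes> inv x \<otimes> inv k))"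
    using mat_trace_conj[OF c R_inv(2)[OF k]] mat_trace_smult[OF R_carrier[OF kx(2)]] by simp
  have "\<gamma> (q x) (q k) * \<gamma> (q x) (q k) * mat_trace (R (inv x))
     = (\<gamma> (q x) (q k) * \<gamma> (q k) (q x)) * (\<gamma> (q x) (q k) * \<gamma> (q k) (q x)) * mat_trace (R (k \<otimes> inv x \<otimes> inv k))"
    unfolding tr by (simp only: mult_ac)
  then have "mat_trace (R (k \<otimes> inv x \<otimes> inv k)) = \<gamma> (q x) (q k) * \<gamma> (q x) (q k) * mat_trace (R (inv x))"
    unfolding \<gamma>_anti[OF q_E[OF x] q_E[OF k]] by simp
  then show ?thesis unfolding tau_def inv by simp
qed

text \<open>A linear character \<open>f\<close> of \<open>K / L\<close> times
  \<open>\<theta>\<close> is irreducible with the same restriction to \<open>L\<close>. It lies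
  above \<open>\<phi>\<close> and so equals \<open>\<theta>\<close>; choosing \<open>f\<close>
  different from 1 at \<open>y\<close> gives the claim.\<close>

lemma theta_vanishes:
  assumes \<Theta>: "irreducible_representation (subgrp G K) e \<Theta>" and \<theta>: "\<theta> = (\<lambda>k\<in>carrier (subgrp G K). mat_trace (\<Theta> k))"
    and y: "y \<in> K" "y \<notin> L"
  shows "mat_trace (\<Theta> y) = 0"
proof -
  have ne: "q y \<noteq> \<one>\<^bsub>E\<^esub>" using y q_eq_L_iff[OF K_closed[OF y(1)]] by (simp add: one_E)
  obtain f where f0: "\<forall>x\<in>carrier E. f x \<noteq> (0 :: complex)" and fy: "f (q y) \<noteq> 1" 
    and fm: "\<forall>x\<in>carrier E. \<forall>z\<in>carrier E. f x * f z = f (x \<otimes>\<^bsub>E\<^esub> z)"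
    using E.characters_separate[OF q_E[OF y(1)] ne] by (elim exE conjE)
  note c = Kg.rep_carrier[OF Kg.irrepD[OF \<Theta>], simplified]
  define \<Theta>' where "\<Theta>' k = f (q k) \<cdot>\<^sub>m \<Theta> k" for k
  have fq: "f (q (x \<otimes> z)) = f (q x) * f (q z)" if "x \<in> K" "z \<in> K" for x z
    using bspec[OF bspec[OF fm q_E[OF that(1)]] q_E[OF that(2)]] unfolding mult_E[OF K_closed[OF that(1)] K_closed[OF that(2)]] by (rule sym)
  have fL: "f L = 1"
  proof -
    have "f (q \<one>) = f (q \<one>) * f (q \<one>)" using fq[OF K_one K_one] by simp
    then have "f (q \<one>) = 1" using bspec[OF f0 q_E[OF K_one]] by simp
    then show ?thesis unfolding q_one .
  qed
  have rep: "representation (subgrp G K) e \<Theta>'"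
  proof (rule Kg.representationI)
    fix x z assume "x \<in> carrier (subgrp G K)" "z \<in> carrier (subgrp G K)"
    then have x: "x \<in> K" "z \<in> K" by simp_all
    have "\<Theta> (x \<otimes> z) = \<Theta> x * \<Theta> z" using Kg.rep_mult[OF Kg.irrepD[OF \<Theta>], of x z] x by simp
    then show "\<Theta>' (x \<otimes>\<^bsub>subgrp G K\<^esub> z) = \<Theta>' x * \<Theta>' z"
      unfolding \<Theta>'_def mult_smult_assoc_mat[OF c[OF x(1)] smult_carrier_mat[OF c[OF x(2)]]] mult_smult_distrib[OF c[OF x(1)] c[OF x(2)]] smult_smult_mat
      using fq[OF x] by simp
  next
    have "\<Theta> \<one> = 1\<^sub>m e" using Kg.rep_one[OF Kg.irrepD[OF \<Theta>]] by simp
    then show "\<Theta>' \<one>\<^bsub>subgrp G K\<^esub> = 1\<^sub>m e" unfolding \<Theta>'_def by (simp add: q_one fL one_smult_mat)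
  qed (simp add: \<Theta>'_def c)
  have irr': "irreducible_representation (subgrp G K) e \<Theta>'"
    unfolding irreducible_representation_def
  proof (intro conjI allI impI rep Kg.irrep_pos[OF \<Theta>])
    fix W assume W: "VectorSpace.subspace class_ring W (module_vec TYPE(complex) e) \<and>
      (\<forall>g\<in>carrier (subgrp G K). \<forall>w\<in>W. \<Theta>' g *\<^sub>v w \<in> W)"
    note WD = subspaceD_vec[OF conjunct1[OF W]]
    have "\<Theta> k *\<^sub>v w \<in> W" if k: "k \<in> K" and w: "w \<in> W" for k w
    proof -
      have wc: "w \<in> carrier_vec e" using WD(1) w by (rule subsetD)
      have "(1 / f (q k)) \<cdot>\<^sub>v (\<Theta>' k *\<^sub>v w) \<in> W" using WD(4) W k w by simp
      moreover have "(1 / f (q k)) \<cdot>\<^sub>v (\<Theta>' k *\<^sub>v w) = \<Theta> k *\<^sub>v w"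
        unfolding \<Theta>'_def using c[OF k] wc bspec[OF f0 q_E[OF k]] by (intro eq_vecI) (simp_all)
      ultimately show ?thesis by simp
    qed
    then show "W = {0\<^sub>v e} \<or> W = carrier_vec e"
      using \<Theta> W unfolding irreducible_representation_def by simp
  qed
  define \<theta>' where "\<theta>' = (\<lambda>k\<in>carrier (subgrp G K). mat_trace (\<Theta>' k))"
  have "\<theta>' \<in> Irr (subgrp G K)" unfolding Irr_def affords_def \<theta>'_def using irr' rep by blast
  moreover have "restrict \<theta>' L = restrict \<theta> L"
  proof (rule restrict_ext)
    fix l assume l: "l \<in> L"
    have "q l = L" using q_eq_L_iff[OF L_closed[OF l]] l by simp
    then show "\<theta>' l = \<theta> l" using L_K[OF l] by (simp add: \<theta>'_def \<theta> \<Theta>'_def fL one_smult_mat)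
  qed
  moreover have "lies_above (subgrp G K) L \<theta> \<phi>" using fully_ramified by blast
  ultimately have "\<theta>' \<in> {\<xi> \<in> Irr (subgrp G K). lies_above (subgrp G K) L \<xi> \<phi>}" by (simp add: lies_above_def)
  then have "\<theta>' = \<theta>" unfolding fully_ramified by simp
  then have "\<theta>' y = \<theta> y" by simp
  then have "f (q y) * mat_trace (\<Theta> y) = mat_trace (\<Theta> y)"
    using y mat_trace_smult[OF c[OF y(1)]] by (simp add: \<theta>'_def \<theta> \<Theta>'_def)
  then show ?thesis using fy by simp
qed

lemma theta_phi_sum:
  assumes \<Theta>: "irreducible_representation (subgrp G K) e \<Theta>" and \<theta>: "\<theta> = (\<lambda>k\<in>carrier (subgrp G K). mat_trace (\<Theta> k))"
  shows "(\<Sum>l\<in>L. mat_trace (\<Theta> l) * \<phi> (inv l)) \<noteq> 0"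
proof -
  have LK: "subgroup L (subgrp G K)" by (rule subgroup_incl[OF subgroup_L subgroup_K L_le_K])
  have rep: "representation (subgrp G L) e \<Theta>" using Kg.restrict_representation[OF Kg.irrepD[OF \<Theta>] LK] by simp
  obtain m where m: "irr_decomposition (subgrp G L) (\<lambda>l\<in>carrier (subgrp G L). mat_trace (\<Theta> l)) m"
    using Lg.irr_decomposition_exists[OF rep] by (elim exE)
  have "restrict \<theta> L = (\<lambda>l\<in>carrier (subgrp G L). mat_trace (\<Theta> l))"
    unfolding \<theta> using L_K by (auto simp: restrict_def)
  moreover have "lies_above (subgrp G K) L \<theta> \<phi>" using fully_ramified by blast
  ultimately have "m \<phi> \<noteq> 0" using Lg.irr_mult_eq[OF m] by (simp add: lies_above_def)
  moreover have "(\<Sum>l\<in>L. mat_trace (\<Theta> l) * \<phi> (inv l)) = of_nat (m \<phi>) * of_nat (card L)"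
    using Lg.irr_decomposition_coeff[OF m phi_Irr] by (simp add: inv_L)
  ultimately show ?thesis using card_L by simp
qed

text \<open>For \<open>x\<close> in the radical \<open>s_x\<close> is fixed under conjugation by
  \<open>K\<close>, so it acts on the module of \<open>\<theta>\<close> as a scalar. If
  \<open>x\<close> is not in \<open>L\<close>, its trace is 0 because \<open>\<theta>\<close>
  vanishes off \<open>L\<close>, and \<open>s_x\<close> acts as 0. But \<open>s_x\<close> times its
  partner for \<open>inv x\<close> is \<open>e_\<phi>\<close>, whose trace is nonzero.\<close>

lemma radical_trivial:
  assumes x: "x \<in> K" and rad: "\<And>k. k \<in> K \<Longrightarrow> \<gamma> (q x) (q k) = 1"
  shows "x \<in> L"
proof (rule ccontr)
  assume xL: "x \<notin> L"
  have "\<theta> \<in> Irr (subgrp G K)" using fully_ramified by blast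
  then obtain e \<Theta> where \<Theta>: "irreducible_representation (subgrp G K) e \<Theta>" and \<theta>: "\<theta> = (\<lambda>k\<in>carrier (subgrp G K). mat_trace (\<Theta> k))"
    unfolding Irr_def affords_def by blast
  note repT = Kg.irrepD[OF \<Theta>]
  note c = Kg.rep_carrier[OF repT, simplified]
  have mult: "\<Theta> (u \<otimes> v) = \<Theta> u * \<Theta> v" if "u \<in> K" "v \<in> K" for u v
    using Kg.rep_mult[OF repT, of u v] that by simp
  have qK: "u \<in> K" "q u = q x" if "u \<in> q x" for u
    using q_sub_K[OF x that] that x by (simp_all add: mem_q_iff K_closed)
  define A where "A = msum e e (\<lambda>y. tau y \<cdot>\<^sub>m \<Theta> y) (q x)"
  have A: "A \<in> carrier_mat e e" by (simp add: A_def)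
  have sc: "tau y \<cdot>\<^sub>m \<Theta> y \<in> carrier_mat e e" if "y \<in> q x" for y by (rule smult_carrier_mat[OF c[OF qK(1)[OF that]]])
  have comm: "A * \<Theta> k = \<Theta> k * A" if k: "k \<in> K" for k
  proof -
    have bij: "bij_betw (\<lambda>y. k \<otimes> y \<otimes> inv k) (q x) (q x)"
      using bij_conj[OF K_closed[OF x] K_closed[OF k]] unfolding q_conj_K[OF x k] .
    have "A * \<Theta> k = msum e e (\<lambda>y. tau (k \<otimes> y \<otimes> inv k) \<cdot>\<^sub>m \<Theta> (k \<otimes> y \<otimes> inv k)) (q x) * \<Theta> k"
      unfolding A_def msum_reindex[OF bij, of e e "\<lambda>y. tau y \<cdot>\<^sub>m \<Theta> y"] ..
    also have "\<dots> = msum e e (\<lambda>y. tau (k \<otimes> y \<otimes> inv k) \<cdot>\<^sub>m \<Theta> (k \<otimes> y \<otimes> inv k) * \<Theta> k) (q x)"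
      by (rule msum_mult[OF c[OF k]]) (rule smult_carrier_mat[OF c[OF K_conj[OF qK(1) K_closed[OF k]]]])
    also have "\<dots> = msum e e (\<lambda>y. \<Theta> k * (tau y \<cdot>\<^sub>m \<Theta> y)) (q x)"
    proof (rule msum_cong[OF refl])
      fix y assume y: "y \<in> q x"
      note yK = qK(1)[OF y]
      have "tau (k \<otimes> y \<otimes> inv k) = tau y" unfolding tau_conj_K[OF k yK] qK(2)[OF y] rad[OF k] by simp
      moreover have "\<Theta> (k \<otimes> y \<otimes> inv k) * \<Theta> k = \<Theta> k * \<Theta> y"
        unfolding mult[OF K_conj[OF yK K_closed[OF k]] k, symmetric] mult[OF k yK, symmetric]
        using K_closed[OF k] K_closed[OF yK] by (simp add: m_assoc)
      ultimately show "tau (k \<otimes> y \<otimes> inv k) \<cdot>\<^sub>m \<Theta> (k \<otimes> y \<otimes> inv k) * \<Theta> k = \<Theta> k * (tau y \<cdot>\<^sub>m \<Theta> y)"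
        unfolding mult_smult_assoc_mat[OF c[OF K_conj[OF yK K_closed[OF k]]] c[OF k]] mult_smult_distrib[OF c[OF k] c[OF yK]] by simp
    qed
    also have "\<dots> = \<Theta> k * A" unfolding A_def by (rule mult_msum[OF c[OF k], symmetric]) (rule sc)
    finally show ?thesis .
  qed
  obtain b where b: "A = b \<cdot>\<^sub>m 1\<^sub>m e" using Kg.schur[OF \<Theta> A] comm by auto
  have "mat_trace A = (\<Sum>y\<in>q x. mat_trace (tau y \<cdot>\<^sub>m \<Theta> y))" unfolding A_def by (rule mat_trace_msum') (rule sc)
  also have "\<dots> = 0"
  proof (rule sum.neutral, rule ballI)
    fix y assume y: "y \<in> q x"
    have "q y \<noteq> L" unfolding qK(2)[OF y] q_eq_L_iff[OF K_closed[OF x]] by (rule xL)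
    then have "y \<notin> L" unfolding q_eq_L_iff[OF K_closed[OF qK(1)[OF y]]] .
    then show "mat_trace (tau y \<cdot>\<^sub>m \<Theta> y) = 0"
      using theta_vanishes[OF \<Theta> \<theta> qK(1)[OF y]] mat_trace_smult[OF c[OF qK(1)[OF y]]] by simp
  qed
  finally have "b = 0" using b Kg.irrep_pos[OF \<Theta>] by simp
  then have A0: "A = 0\<^sub>m e e" unfolding b by (intro eq_matI) simp_all
  \<comment> \<open>That \<open>s_x\<close> acts as 0 is tested against every
    \<open>\<Theta> w\<close> by taking traces; the products with the coset of \<open>inv x\<close>
    need this form.\<close>
  have vanish: "(\<Sum>y\<in>q x. tau y * mat_trace (\<Theta> (y \<otimes> w))) = 0" if w: "w \<in> K" for w
  proof -
    have "A * \<Theta> w = msum e e (\<lambda>y. tau y \<cdot>\<^sub>m \<Theta> y * \<Theta> w) (q x)" unfolding A_def by (rule msum_mult[OF c[OF w]]) (rule sc)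
    then have "mat_trace (A * \<Theta> w) = (\<Sum>y\<in>q x. mat_trace (tau y \<cdot>\<^sub>m \<Theta> y * \<Theta> w))"
      using mat_trace_msum'[of "q x" "\<lambda>y. tau y \<cdot>\<^sub>m \<Theta> y * \<Theta> w" e] mult_carrier_mat[OF sc c[OF w]] by simp
    also have "\<dots> = (\<Sum>y\<in>q x. tau y * mat_trace (\<Theta> (y \<otimes> w)))"
    proof (rule sum.cong[OF refl])
      fix y assume y: "y \<in> q x"
      note yK = qK(1)[OF y]
      show "mat_trace (tau y \<cdot>\<^sub>m \<Theta> y * \<Theta> w) = tau y * mat_trace (\<Theta> (y \<otimes> w))"
        unfolding mult_smult_assoc_mat[OF c[OF yK] c[OF w]] mat_trace_smult[OF mult_carrier_mat[OF c[OF yK] c[OF w]]] mult[OF yK w] ..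
    qed
    also have "mat_trace (A * \<Theta> w) = 0" unfolding A0 using c[OF w] by simp
    finally show ?thesis by simp
  qed
  \<comment> \<open>The trace of \<open>e_\<phi>\<close> under \<open>\<Theta>\<close>, expanded by
    writing \<open>e_\<phi>\<close> as the product of \<open>s_x\<close> with the element of the
    coset of \<open>inv x\<close>.\<close>
  have "(\<Sum>z\<in>L. tau z * mat_trace (\<Theta> z)) = (\<Sum>z\<in>L. (\<Sum>y\<in>q x. tau y * tau (inv y \<otimes> z)) * mat_trace (\<Theta> z))"
    by (rule sum.cong[OF refl]) (simp add: tau_convolution[OF x L_K] \<gamma>_one(2)[OF x])
  also have "\<dots> = (\<Sum>z\<in>L. \<Sum>y\<in>q x. tau y * (tau (inv y \<otimes> z) * mat_trace (\<Theta> z)))"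
    by (simp only: sum_distrib_right mult.assoc)
  also have "\<dots> = (\<Sum>y\<in>q x. \<Sum>z\<in>L. tau y * (tau (inv y \<otimes> z) * mat_trace (\<Theta> z)))" by (rule sum.swap)
  also have "\<dots> = (\<Sum>y\<in>q x. \<Sum>w\<in>q (inv x). tau y * (tau w * mat_trace (\<Theta> (y \<otimes> w))))"
  proof (rule sum.cong[OF refl])
    fix y assume y: "y \<in> q x"
    note yG = K_closed[OF qK(1)[OF y]] and x'G = K_closed[OF K_inv[OF x]]
    have "q (y \<otimes> inv x) = q (x \<otimes> inv x)"
      using q_mult[OF yG x'G] q_mult[OF K_closed[OF x] x'G] qK(2)[OF y] by simp
    then have qL: "q (y \<otimes> inv x) = L" using K_closed[OF x] q_one by simp
    have "(\<Sum>z\<in>L. tau y * (tau (inv y \<otimes> z) * mat_trace (\<Theta> z)))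
        = (\<Sum>w\<in>q (inv x). tau y * (tau (inv y \<otimes> (y \<otimes> w)) * mat_trace (\<Theta> (y \<otimes> w))))"
      by (rule sum.reindex_bij_betw[OF bij_mult_coset[OF yG x'G, unfolded qL], symmetric])
    also have "\<dots> = (\<Sum>w\<in>q (inv x). tau y * (tau w * mat_trace (\<Theta> (y \<otimes> w))))"
    proof (rule sum.cong[OF refl])
      fix w assume "w \<in> q (inv x)"
      then have "w \<in> carrier G" using x'G by (simp add: mem_q_iff)
      then have "inv y \<otimes> (y \<otimes> w) = w" using yG by (simp add: m_assoc[symmetric])
      then show "tau y * (tau (inv y \<otimes> (y \<otimes> w)) * mat_trace (\<Theta> (y \<otimes> w))) = tau y * (tau w * mat_trace (\<Theta> (y \<otimes> w)))" by simp
    qed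
    finally show "(\<Sum>z\<in>L. tau y * (tau (inv y \<otimes> z) * mat_trace (\<Theta> z))) = (\<Sum>w\<in>q (inv x). tau y * (tau w * mat_trace (\<Theta> (y \<otimes> w))))" .
  qed
  also have "\<dots> = (\<Sum>w\<in>q (inv x). \<Sum>y\<in>q x. tau y * (tau w * mat_trace (\<Theta> (y \<otimes> w))))" by (rule sum.swap)
  also have "\<dots> = 0"
  proof (rule sum.neutral, rule ballI)
    fix w assume w: "w \<in> q (inv x)"
    have "(\<Sum>y\<in>q x. tau y * (tau w * mat_trace (\<Theta> (y \<otimes> w)))) = tau w * (\<Sum>y\<in>q x. tau y * mat_trace (\<Theta> (y \<otimes> w)))"
      unfolding sum_distrib_left by (rule sum.cong[OF refl]) (rule mult.left_commute)
    then show "(\<Sum>y\<in>q x. tau y * (tau w * mat_trace (\<Theta> (y \<otimes> w)))) = 0"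
      using vanish[OF q_sub_K[OF K_inv[OF x] w]] by simp
  qed
  finally have "(\<Sum>z\<in>L. tau z * mat_trace (\<Theta> z)) = 0" .
  moreover have "(\<Sum>z\<in>L. tau z * mat_trace (\<Theta> z)) = of_nat d / of_nat (card L) * (\<Sum>l\<in>L. mat_trace (\<Theta> l) * \<phi> (inv l))"
    unfolding sum_distrib_left by (rule sum.cong[OF refl]) (simp add: tau_def phi_R L_inv)
  ultimately show False using theta_phi_sum[OF \<Theta> \<theta>] card_L d_pos by simp
qed

lemma alternating_form_E: "alternating_form E \<gamma>"
proof (unfold_locales)
  show "odd (card (carrier E))" using odd_index unfolding Coset.order_def .
  fix X assume X: "X \<in> carrier E" and rad: "\<And>Y. Y \<in> carrier E \<Longrightarrow> \<gamma> X Y = 1"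
  obtain x where x: "x \<in> K" "X = q x" using X unfolding carrier_E by (elim imageE) (rule that)
  have "x \<in> L" by (rule radical_trivial[OF x(1)]) (use rad[OF q_E] x(2) in simp)
  then show "X = \<one>\<^bsub>E\<^esub>" using q_eq_L_iff[OF K_closed[OF x(1)]] x(2) by (simp add: one_E)
qed (rule \<gamma>_mult \<gamma>_anti \<gamma>_self; assumption)+

end

sublocale projective_five \<subseteq> A: alternating_form "quot G K L" \<gamma> by (rule alternating_form_E)

section \<open>The centralizer algebra as a matrix algebra\<close>

context alternating_form
begin

definition heis_sum :: "('a \<Rightarrow> complex) \<Rightarrow> complex mat" where
  "heis_sum t = msum deg deg (\<lambda>x. t x \<cdot>\<^sub>m heis x) (carrier E)"

lemma heis_sum_carrier [simp]: "heis_sum t \<in> carrier_mat deg deg"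
  by (simp add: heis_sum_def)

lemma heis_sum_cong: "(\<And>x. x \<in> carrier E \<Longrightarrow> t x = u x) \<Longrightarrow> heis_sum t = heis_sum u"
  unfolding heis_sum_def by (rule msum_cong) simp_all

lemma heis_sum_index: "i < deg \<Longrightarrow> j < deg \<Longrightarrow> heis_sum t $$ (i, j) = (\<Sum>x\<in>carrier E. t x * heis x $$ (i, j))"
  unfolding heis_sum_def by (simp add: carrier_matD[OF heis_carrier])

lemma heis_sum_add: "heis_sum (\<lambda>x. t x + u x) = heis_sum t + heis_sum u"
  by (rule eq_matI) (simp_all add: heis_sum_index carrier_matD[OF heis_sum_carrier] distrib_right sum.distrib)

lemma heis_sum_smult: "heis_sum (\<lambda>x. c * t x) = c \<cdot>\<^sub>m heis_sum t"
  by (rule eq_matI) (simp_all add: heis_sum_index carrier_matD[OF heis_sum_carrier] sum_distrib_left mult.assoc)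

lemma heis_sum_one: "heis_sum (\<lambda>x. if x = \<one> then 1 else 0) = 1\<^sub>m deg"
proof (rule eq_matI)
  fix i j assume ij: "i < dim_row (1\<^sub>m deg :: complex mat)" "j < dim_col (1\<^sub>m deg :: complex mat)"
  have "(\<Sum>x\<in>carrier E. (if x = \<one> then 1 else 0) * heis x $$ (i, j)) = (\<Sum>x\<in>carrier E. if x = \<one> then heis x $$ (i, j) else 0)"
    by (rule sum.cong) simp_all
  then show "heis_sum (\<lambda>x. if x = \<one> then 1 else 0) $$ (i, j) = 1\<^sub>m deg $$ (i, j)"
    using ij finite_E by (simp add: heis_sum_index heis_one)
qed (simp_all add: carrier_matD[OF heis_sum_carrier])

lemma mult_heis_sum: 
  assumes "X \<in> carrier_mat deg deg"
  shows "X * heis_sum t = msum deg deg (\<lambda>x. t x \<cdot>\<^sub>m (X * heis x)) (carrier E)"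
    "heis_sum t * X = msum deg deg (\<lambda>x. t x \<cdot>\<^sub>m (heis x * X)) (carrier E)"
proof -
  have "X * heis_sum t = msum deg deg (\<lambda>x. X * (t x \<cdot>\<^sub>m heis x)) (carrier E)"
    unfolding heis_sum_def by (rule mult_msum[OF assms]) simp
  then show "X * heis_sum t = msum deg deg (\<lambda>x. t x \<cdot>\<^sub>m (X * heis x)) (carrier E)"
    unfolding mult_smult_distrib[OF assms heis_carrier] .
  have "heis_sum t * X = msum deg deg (\<lambda>x. (t x \<cdot>\<^sub>m heis x) * X) (carrier E)"
    unfolding heis_sum_def by (rule msum_mult[OF assms]) simp
  then show "heis_sum t * X = msum deg deg (\<lambda>x. t x \<cdot>\<^sub>m (heis x * X)) (carrier E)"
    unfolding mult_smult_assoc_mat[OF heis_carrier assms] .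
qed

text \<open>Twisted convolution of coordinates. The factor is written \<open>\<beta> x z\<close> and
  not \<open>\<beta> x (inv x \<otimes> z)\<close>, which is the same because
  \<open>\<beta> x x = 1\<close>, so as to match multiplication in \<open>S\<close>.\<close>

lemma heis_sum_mult:
  "heis_sum t * heis_sum u = heis_sum (\<lambda>z. \<Sum>x\<in>carrier E. t x * u (inv x \<otimes> z) * \<beta> x z)"
proof (rule eq_matI)
  fix i j assume "i < dim_row (heis_sum (\<lambda>z. \<Sum>x\<in>carrier E. t x * u (inv x \<otimes> z) * \<beta> x z))"
    "j < dim_col (heis_sum (\<lambda>z. \<Sum>x\<in>carrier E. t x * u (inv x \<otimes> z) * \<beta> x z))"
  then have ij: "i < deg" "j < deg" by (simp_all add: carrier_matD[OF heis_sum_carrier])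
  have step: "(heis x * heis_sum u) $$ (i, j) = (\<Sum>z\<in>carrier E. u (inv x \<otimes> z) * \<beta> x z * heis z $$ (i, j))"
    if x: "x \<in> carrier E" for x
  proof -
    have "(heis x * heis_sum u) $$ (i, j) = (\<Sum>y\<in>carrier E. u y * (heis x * heis y) $$ (i, j))"
      unfolding mult_heis_sum(1)[OF heis_carrier] using ij by (simp add: carrier_matD[OF heis_carrier])
    also have "\<dots> = (\<Sum>y\<in>carrier E. u y * \<beta> x y * heis (x \<otimes> y) $$ (i, j))"
      using ij x by (intro sum.cong) (simp_all add: heis_mult carrier_matD[OF heis_carrier])
    also have "\<dots> = (\<Sum>z\<in>carrier E. u (inv x \<otimes> z) * \<beta> x (inv x \<otimes> z) * heis (x \<otimes> (inv x \<otimes> z)) $$ (i, j))"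
    proof (rule sum.reindex_bij_betw[symmetric])
      show "bij_betw (\<lambda>z. inv x \<otimes> z) (carrier E) (carrier E)"
        by (rule bij_betwI[where g = "\<lambda>z. x \<otimes> z"]) (use x in \<open>simp_all add: m_assoc[symmetric]\<close>)
    qed
    also have "\<dots> = (\<Sum>z\<in>carrier E. u (inv x \<otimes> z) * \<beta> x z * heis z $$ (i, j))"
    proof (rule sum.cong[OF refl])
      fix z assume z: "z \<in> carrier E"
      have "x \<otimes> (inv x \<otimes> z) = z" using x z by (simp add: m_assoc[symmetric])
      moreover have "\<beta> x (inv x \<otimes> z) = \<beta> x z" using x z by (simp add: \<beta>_mult_right \<beta>_inv_right \<beta>_self)
      ultimately show "u (inv x \<otimes> z) * \<beta> x (inv x \<otimes> z) * heis (x \<otimes> (inv x \<otimes> z)) $$ (i, j) = u (inv x \<otimes> z) * \<beta> x z * heis z $$ (i, j)" by simp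
    qed
    finally show ?thesis .
  qed
  have "(heis_sum t * heis_sum u) $$ (i, j) = (\<Sum>x\<in>carrier E. t x * (heis x * heis_sum u) $$ (i, j))"
    unfolding mult_heis_sum(2)[OF heis_sum_carrier] using ij by (simp add: carrier_matD[OF heis_carrier] carrier_matD[OF heis_sum_carrier])
  also have "\<dots> = (\<Sum>x\<in>carrier E. \<Sum>z\<in>carrier E. t x * u (inv x \<otimes> z) * \<beta> x z * heis z $$ (i, j))"
    by (rule sum.cong[OF refl]) (simp only: step sum_distrib_left mult.assoc)
  also have "\<dots> = (\<Sum>z\<in>carrier E. \<Sum>x\<in>carrier E. t x * u (inv x \<otimes> z) * \<beta> x z * heis z $$ (i, j))"
    by (rule sum.swap)
  also have "\<dots> = heis_sum (\<lambda>z. \<Sum>x\<in>carrier E. t x * u (inv x \<otimes> z) * \<beta> x z) $$ (i, j)"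
    unfolding heis_sum_index[OF ij] sum_distrib_right ..
  finally show "(heis_sum t * heis_sum u) $$ (i, j) = heis_sum (\<lambda>z. \<Sum>x\<in>carrier E. t x * u (inv x \<otimes> z) * \<beta> x z) $$ (i, j)" .
qed (simp_all add: carrier_matD[OF heis_sum_carrier])

text \<open>Only the term \<open>x = y\<close> has nonzero trace, by \<open>heis_trace\<close>.
  Traces thus read off coordinates, which gives injectivity and suggests the preimage used for
  surjectivity.\<close>

lemma heis_sum_coefficient:
  assumes y: "y \<in> carrier E"
  shows "mat_trace (heis_sum t * heis (inv y)) = of_nat deg * t y"
proof -
  note yi = inv_closed[OF y]
  have c: "t x \<cdot>\<^sub>m (heis x * heis (inv y)) \<in> carrier_mat deg deg" for x
    by (rule smult_carrier_mat[OF mult_carrier_mat[OF heis_carrier heis_carrier]])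
  have "mat_trace (heis_sum t * heis (inv y)) = (\<Sum>x\<in>carrier E. mat_trace (t x \<cdot>\<^sub>m (heis x * heis (inv y))))"
    unfolding mult_heis_sum(2)[OF heis_carrier] by (rule mat_trace_msum') (rule c)
  also have "\<dots> = (\<Sum>x\<in>carrier E. if x = y then of_nat deg * t x else 0)"
  proof (rule sum.cong[OF refl])
    fix x assume x: "x \<in> carrier E"
    have e: "x \<otimes> inv y = \<one> \<longleftrightarrow> x = y" using x y inv_equality[of x "inv y"] by (auto simp: )
    have "mat_trace (heis x * heis (inv y)) = \<beta> x (inv y) * (if x = y then of_nat deg else 0)"
      unfolding heis_mult[OF x yi] mat_trace_smult[OF heis_carrier] heis_trace[OF m_closed[OF x yi]] e ..
    then show "mat_trace (t x \<cdot>\<^sub>m (heis x * heis (inv y))) = (if x = y then of_nat deg * t x else 0)"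
      unfolding mat_trace_smult[OF mult_carrier_mat[OF heis_carrier heis_carrier]] using y by (simp add: \<beta>_inv_right \<beta>_self)
  qed
  also have "\<dots> = of_nat deg * t y" using y finite_E by simp
  finally show ?thesis .
qed

lemma heis_sum_inj:
  assumes "heis_sum t = heis_sum u" "y \<in> carrier E"
  shows "t y = u y"
  using heis_sum_coefficient[OF assms(2), of t] heis_sum_coefficient[OF assms(2), of u] assms(1) deg_pos by simp

lemma heis_sum_surj:
  assumes M: "M \<in> carrier_mat deg deg"
  shows "heis_sum (\<lambda>y. mat_trace (heis (inv y) * M) / of_nat deg) = M"
proof (rule eq_matI)
  fix i j assume "i < dim_row M" "j < dim_col M"
  then have ij: "i < deg" "j < deg" using M by auto
  have "of_nat deg * heis_sum (\<lambda>y. mat_trace (heis (inv y) * M) / of_nat deg) $$ (i, j)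
      = (\<Sum>y\<in>carrier E. mat_trace (heis (inv y) * M) * heis y $$ (i, j))"
    unfolding heis_sum_index[OF ij] sum_distrib_left using deg_pos by (intro sum.cong) simp_all
  also have "\<dots> = (\<Sum>y\<in>carrier E. \<Sum>k<deg. \<Sum>l<deg. M $$ (l, k) * (heis (inv y) $$ (k, l) * heis y $$ (i, j)))"
    using M by (intro sum.cong) (simp_all add: mat_trace_mult[of _ deg deg] sum_distrib_right sum_distrib_left mult_ac)
  also have "\<dots> = (\<Sum>k<deg. \<Sum>l<deg. M $$ (l, k) * (\<Sum>y\<in>carrier E. heis (inv y) $$ (k, l) * heis y $$ (i, j)))"
    unfolding sum_distrib_left by (subst sum.swap, rule sum.cong, simp, subst sum.swap) simp
  also have "\<dots> = (\<Sum>k<deg. \<Sum>l<deg. if k = j then (if l = i then M $$ (l, k) * of_nat deg else 0) else 0)"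
    using ij by (intro sum.cong refl) (simp add: heis_entries_orthogonal)
  also have "\<dots> = (\<Sum>k<deg. if k = j then M $$ (i, k) * of_nat deg else 0)"
    using ij by (intro sum.cong refl) simp
  also have "\<dots> = of_nat deg * M $$ (i, j)" using ij by simp
  finally show "heis_sum (\<lambda>y. mat_trace (heis (inv y) * M) / of_nat deg) $$ (i, j) = M $$ (i, j)" using deg_pos by simp
qed (use M in \<open>simp_all add: carrier_matD[OF heis_sum_carrier]\<close>)

end

section \<open>Multiplication and conjugation in the group algebra\<close>

context fin_group
begin

lemma ga_mult: "(a \<otimes>\<^bsub>group_algebra G\<^esub> b) x = (if x \<in> carrier G then \<Sum>y\<in>carrier G. a y * b (inv y \<otimes> x) else 0)"
  by (simp add: group_algebra_def)

lemma ga_of_mult_left: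
  assumes "g \<in> carrier G" "x \<in> carrier G"
  shows "(ga_of g \<otimes>\<^bsub>group_algebra G\<^esub> s) x = s (inv g \<otimes> x)"
proof -
  have "(\<Sum>y\<in>carrier G. ga_of g y * s (inv y \<otimes> x)) = (\<Sum>y\<in>carrier G. if y = g then s (inv y \<otimes> x) else 0)"
    by (rule sum.cong) (simp_all add: ga_of_def)
  then show ?thesis using assms finite_G by (simp add: ga_mult)
qed

lemma ga_of_mult_right:
  assumes "g \<in> carrier G" "x \<in> carrier G"
  shows "(s \<otimes>\<^bsub>group_algebra G\<^esub> ga_of g) x = s (x \<otimes> inv g)"
proof -
  have "(\<Sum>y\<in>carrier G. s y * ga_of g (inv y \<otimes> x)) = (\<Sum>y\<in>carrier G. if y = x \<otimes> inv g then s y else 0)"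
  proof (rule sum.cong[OF refl])
    fix y assume y: "y \<in> carrier G"
    have "inv y \<otimes> x = g \<longleftrightarrow> y = x \<otimes> inv g"
    proof
      assume "inv y \<otimes> x = g"
      then show "y = x \<otimes> inv g" using y assms by (auto simp: inv_mult_group m_assoc[symmetric])
    next
      assume "y = x \<otimes> inv g"
      then show "inv y \<otimes> x = g" using assms by (simp add: inv_mult_group m_assoc)
    qed
    then show "s y * ga_of g (inv y \<otimes> x) = (if y = x \<otimes> inv g then s y else 0)" by (simp add: ga_of_def)
  qed
  then show ?thesis using assms finite_G by (simp add: ga_mult)
qed

lemma ga_conj_apply:
  assumes "g \<in> carrier G" "x \<in> carrier G"
  shows "ga_conj G s g x = s (g \<otimes> x \<otimes> inv g)"
  unfolding ga_conj_def using assms by (simp add: ga_of_mult_right ga_of_mult_left m_assoc)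

lemma ga_conj_outside: "x \<notin> carrier G \<Longrightarrow> ga_conj G s g x = 0"
  unfolding ga_conj_def by (simp add: ga_mult)

end

section \<open>Coordinates on the centralizer algebra\<close>

context projective_five
begin

text \<open>The element of \<open>S\<close> with coordinate \<open>t X\<close> at the basis element
  of the coset \<open>X\<close>.\<close>

definition elt where "elt t = (\<lambda>y. if y \<in> K then t (q y) * tau y else 0)"

text \<open>\<open>tau\<close> may vanish at some elements of a coset but not on all of it. A
  coordinate is recovered by evaluating at a point where it is nonzero.\<close>

definition pt where "pt X = (SOME y. y \<in> K \<and> q y = X \<and> tau y \<noteq> 0)"

definition coef where "coef a X = a (pt X) / tau (pt X)"

abbreviation S where "S \<equiv> centralizer_algebra G K L \<phi>"

lemma pt:
  assumes "X \<in> carrier E"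
  shows "pt X \<in> K" "q (pt X) = X" "tau (pt X) \<noteq> 0"
proof -
  obtain x where x: "x \<in> K" "X = q x" using assms unfolding carrier_E by (elim imageE) (rule that)
  obtain y where y: "y \<in> q x" "tau y \<noteq> 0" using tau_nonzero[OF x(1)] by (elim bexE)
  have "y \<in> K \<and> q y = X \<and> tau y \<noteq> 0" using q_sub_K[OF x(1) y(1)] y x by (simp add: mem_q_iff K_closed)
  then have "pt X \<in> K \<and> q (pt X) = X \<and> tau (pt X) \<noteq> 0" unfolding pt_def by (rule someI)
  then show "pt X \<in> K" "q (pt X) = X" "tau (pt X) \<noteq> 0" by simp_all
qed

lemma coef_elt: "X \<in> carrier E \<Longrightarrow> coef (elt t) X = t X"
  using pt by (simp add: coef_def elt_def)

lemma elt_cong: "(\<And>X. X \<in> carrier E \<Longrightarrow> t X = u X) \<Longrightarrow> elt t = elt u"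
  unfolding elt_def using q_E by (intro ext) simp

lemma sum_K_cosets:
  fixes h :: "'a \<Rightarrow> complex"
  shows "(\<Sum>y\<in>K. h y) = (\<Sum>X\<in>carrier E. \<Sum>y\<in>X. h y)"
proof -
  have "(\<Sum>X\<in>carrier E. sum h {y \<in> K. q y = X}) = sum h K"
    by (rule sum.group[OF finite_K E.finite_E]) (simp only: carrier_E subset_refl)
  moreover have "{y \<in> K. q y = X} = X" if X: "X \<in> carrier E" for X
  proof -
    obtain x where x: "x \<in> K" "X = q x" using X unfolding carrier_E by (elim imageE) (rule that)
    show ?thesis unfolding x(2) using q_sub_K[OF x(1)] by (auto simp: mem_q_iff K_closed x(1))
  qed
  ultimately show ?thesis by simp
qed

text \<open>The same convolution of coordinates as in \<open>heis_sum_mult\<close>. This agreement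
  makes the passage from \<open>elt t\<close> to the Heisenberg matrices multiplicative.\<close>

lemma elt_mult:
  "elt t \<otimes>\<^bsub>group_algebra G\<^esub> elt u = elt (\<lambda>Z. \<Sum>X\<in>carrier E. t X * u (inv\<^bsub>E\<^esub> X \<otimes>\<^bsub>E\<^esub> Z) * \<gamma> X Z)"
proof
  fix x
  have KG: "K \<subseteq> carrier G" by (rule subgroup.subset[OF subgroup_K])
  have restr: "(\<Sum>y\<in>carrier G. elt t y * elt u (inv y \<otimes> x)) = (\<Sum>y\<in>K. t (q y) * tau y * elt u (inv y \<otimes> x))"
    by (rule sum.mono_neutral_cong_right[OF finite_G KG]) (auto simp: elt_def)
  show "(elt t \<otimes>\<^bsub>group_algebra G\<^esub> elt u) x = elt (\<lambda>Z. \<Sum>X\<in>carrier E. t X * u (inv\<^bsub>E\<^esub> X \<otimes>\<^bsub>E\<^esub> Z) * \<gamma> X Z) x"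
  proof (cases "x \<in> K")
    case x: True
    have "(\<Sum>y\<in>K. t (q y) * tau y * elt u (inv y \<otimes> x)) = (\<Sum>X\<in>carrier E. \<Sum>y\<in>X. t (q y) * tau y * elt u (inv y \<otimes> x))"
      by (rule sum_K_cosets)
    also have "\<dots> = (\<Sum>X\<in>carrier E. t X * u (inv\<^bsub>E\<^esub> X \<otimes>\<^bsub>E\<^esub> q x) * \<gamma> X (q x) * tau x)"
    proof (rule sum.cong[OF refl])
      fix X assume "X \<in> carrier E"
      then obtain w where w: "w \<in> K" "X = q w" unfolding carrier_E by (elim imageE) (rule that)
      have "(\<Sum>y\<in>X. t (q y) * tau y * elt u (inv y \<otimes> x)) = (\<Sum>y\<in>X. t X * u (inv\<^bsub>E\<^esub> X \<otimes>\<^bsub>E\<^esub> q x) * (tau y * tau (inv y \<otimes> x)))"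
      proof (rule sum.cong[OF refl])
        fix y assume yX: "y \<in> X"
        then have y: "y \<in> K" "q y = X" using q_sub_K[OF w(1)] w by (simp_all add: mem_q_iff K_closed)
        have "inv\<^bsub>E\<^esub> X \<otimes>\<^bsub>E\<^esub> q x = q (inv y \<otimes> x)"
          unfolding y(2)[symmetric] inv_E[OF y(1)] by (rule mult_E[OF K_closed[OF K_inv[OF y(1)]] K_closed[OF x]])
        then show "t (q y) * tau y * elt u (inv y \<otimes> x) = t X * u (inv\<^bsub>E\<^esub> X \<otimes>\<^bsub>E\<^esub> q x) * (tau y * tau (inv y \<otimes> x))"
          using K_mult[OF K_inv[OF y(1)] x] y(2) by (simp add: elt_def)
      qed
      also have "\<dots> = t X * u (inv\<^bsub>E\<^esub> X \<otimes>\<^bsub>E\<^esub> q x) * \<gamma> X (q x) * tau x"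
        unfolding sum_distrib_left[symmetric] w(2) tau_convolution[OF w(1) x] by (simp only: mult.assoc)
      finally show "(\<Sum>y\<in>X. t (q y) * tau y * elt u (inv y \<otimes> x)) = t X * u (inv\<^bsub>E\<^esub> X \<otimes>\<^bsub>E\<^esub> q x) * \<gamma> X (q x) * tau x" .
    qed
    finally show ?thesis
      unfolding ga_mult restr using x K_closed[OF x] by (simp only: elt_def if_True sum_distrib_right)
  next
    case False
    have "(\<Sum>y\<in>K. t (q y) * tau y * elt u (inv y \<otimes> x)) = 0" if xG: "x \<in> carrier G"
    proof (rule sum.neutral, rule ballI)
      fix y assume y: "y \<in> K"
      have "inv y \<otimes> x \<notin> K"
      proof
        assume "inv y \<otimes> x \<in> K"
        then have "y \<otimes> (inv y \<otimes> x) \<in> K" by (rule K_mult[OF y])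
        then show False using False y xG K_closed by (simp add: m_assoc[symmetric])
      qed
      then show "t (q y) * tau y * elt u (inv y \<otimes> x) = 0" by (simp add: elt_def)
    qed
    then show ?thesis unfolding ga_mult restr using False by (simp add: elt_def)
  qed
qed

lemma char_idem_elt: "char_idem G L \<phi> = elt (\<lambda>X. if X = \<one>\<^bsub>E\<^esub> then 1 else 0)"
proof
  fix x
  show "char_idem G L \<phi> x = elt (\<lambda>X. if X = \<one>\<^bsub>E\<^esub> then 1 else 0) x"
  proof (cases "x \<in> L")
    case True
    have "q x = L" using q_eq_L_iff[OF L_closed[OF True]] True by simp
    moreover have "\<phi> \<one> = of_nat d" using phi_R[OF L_one] R_one by simp
    ultimately show ?thesis using True L_K[OF True] L_inv[OF True] by (simp add: char_idem_def elt_def tau_def one_E phi_R)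
  next
    case False
    then show ?thesis using q_eq_L_iff[OF K_closed] by (simp add: char_idem_def elt_def one_E)
  qed
qed

lemma elt_mult_idem: "elt t \<otimes>\<^bsub>group_algebra G\<^esub> char_idem G L \<phi> = elt t"
  unfolding char_idem_elt elt_mult
proof (rule elt_cong)
  fix Z assume Z: "Z \<in> carrier E"
  have "(\<Sum>X\<in>carrier E. t X * (if inv\<^bsub>E\<^esub> X \<otimes>\<^bsub>E\<^esub> Z = \<one>\<^bsub>E\<^esub> then 1 else 0) * \<gamma> X Z) = (\<Sum>X\<in>carrier E. if X = Z then t Z else 0)"
  proof (rule sum.cong[OF refl])
    fix X assume X: "X \<in> carrier E"
    have "inv\<^bsub>E\<^esub> X \<otimes>\<^bsub>E\<^esub> Z = \<one>\<^bsub>E\<^esub> \<longleftrightarrow> X = Z"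
      using E.inv_solve_left[OF E.one_closed X Z] E.r_one[OF X] by (metis E.l_inv Z)
    then show "t X * (if inv\<^bsub>E\<^esub> X \<otimes>\<^bsub>E\<^esub> Z = \<one>\<^bsub>E\<^esub> then 1 else 0) * \<gamma> X Z = (if X = Z then t Z else 0)"
      using \<gamma>_self[OF Z] by simp
  qed
  then show "(\<Sum>X\<in>carrier E. t X * (if inv\<^bsub>E\<^esub> X \<otimes>\<^bsub>E\<^esub> Z = \<one>\<^bsub>E\<^esub> then 1 else 0) * \<gamma> X Z) = t Z"
    using Z E.finite_E by (simp only: sum.delta if_True)
qed

lemma S_carrier: "s \<in> carrier S \<longleftrightarrow> (\<exists>a\<in>carrier (group_algebra G). (\<forall>x. x \<notin> K \<longrightarrow> a x = 0) \<and>
      s = a \<otimes>\<^bsub>group_algebra G\<^esub> char_idem G L \<phi>) \<and>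
    (\<forall>l\<in>L. s \<otimes>\<^bsub>group_algebra G\<^esub> ga_of l = ga_of l \<otimes>\<^bsub>group_algebra G\<^esub> s)"
  by (simp add: centralizer_algebra_def)

lemma S_mult [simp]: "a \<otimes>\<^bsub>S\<^esub> b = a \<otimes>\<^bsub>group_algebra G\<^esub> b" and S_one: "\<one>\<^bsub>S\<^esub> = char_idem G L \<phi>"
  and S_add: "a \<oplus>\<^bsub>S\<^esub> b = (\<lambda>x. a x + b x)"
  by (simp_all add: centralizer_algebra_def group_algebra_def)

lemma elt_in_S: "elt t \<in> carrier S"
  unfolding S_carrier
proof (intro conjI ballI bexI[of _ "elt t"])
  show "elt t \<in> carrier (group_algebra G)" using K_closed by (auto simp: group_algebra_def elt_def)
  show "\<forall>x. x \<notin> K \<longrightarrow> elt t x = 0" by (simp add: elt_def)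
  show "elt t = elt t \<otimes>\<^bsub>group_algebra G\<^esub> char_idem G L \<phi>" by (rule elt_mult_idem[symmetric])
  fix l assume l: "l \<in> L"
  note lG = L_closed[OF l]
  show "elt t \<otimes>\<^bsub>group_algebra G\<^esub> ga_of l = ga_of l \<otimes>\<^bsub>group_algebra G\<^esub> elt t"
  proof
    fix x
    show "(elt t \<otimes>\<^bsub>group_algebra G\<^esub> ga_of l) x = (ga_of l \<otimes>\<^bsub>group_algebra G\<^esub> elt t) x"
    proof (cases "x \<in> carrier G")
      case x: True
      define y where "y = inv l \<otimes> x"
      have yG: "y \<in> carrier G" using x lG by (simp add: y_def)
      have y: "l \<otimes> y \<otimes> inv l = x \<otimes> inv l" using x lG by (simp add: y_def m_assoc[symmetric])
      have "elt t (l \<otimes> y \<otimes> inv l) = elt t y"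
      proof (cases "y \<in> K")
        case True
        then show ?thesis using K_conj[OF True lG] q_conj_K[OF True L_K[OF l]] tau_conj_L[OF True l] by (simp add: elt_def)
      next
        case False
        have "l \<otimes> y \<otimes> inv l \<notin> K"
        proof
          assume "l \<otimes> y \<otimes> inv l \<in> K"
          then have "inv l \<otimes> (l \<otimes> y \<otimes> inv l) \<otimes> l \<in> K" by (rule K_conj'[OF _ lG])
          moreover have "inv l \<otimes> (l \<otimes> y \<otimes> inv l) \<otimes> l = y" using lG yG by (simp add: m_assoc) (simp add: m_assoc[symmetric])
          ultimately show False using False by simp
        qed
        then show ?thesis using False by (simp add: elt_def)
      qed
      then show ?thesis unfolding ga_of_mult_right[OF lG x] ga_of_mult_left[OF lG x] y by (simp add: y_def)
    qed (simp add: ga_mult)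
  qed
qed

lemma idem_idem: "x \<in> carrier G \<Longrightarrow> (\<Sum>y\<in>carrier G. char_idem G L \<phi> y * char_idem G L \<phi> (inv y \<otimes> x)) = char_idem G L \<phi> x"
  using fun_cong[OF elt_mult_idem[of "\<lambda>X. if X = \<one>\<^bsub>E\<^esub> then 1 else 0"], of x] 
  unfolding char_idem_elt[symmetric] by (simp add: ga_mult)

text \<open>An element of \<open>S\<close> is supported on \<open>K\<close>, is invariant under
  conjugation by \<open>L\<close>, and is fixed by the idempotent of \<open>\<phi>\<close>, so
  \<open>centralizer_form\<close> applies to it.\<close>

lemma S_form:
  assumes s: "s \<in> carrier S"
  shows "s = elt (coef s)"
proof -
  let ?e = "char_idem G L \<phi>"
  obtain a where a: "\<And>x. x \<notin> K \<Longrightarrow> a x = 0" and sa: "s = a \<otimes>\<^bsub>group_algebra G\<^esub> ?e"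
    using s unfolding S_carrier by blast
  have cent: "s \<otimes>\<^bsub>group_algebra G\<^esub> ga_of l = ga_of l \<otimes>\<^bsub>group_algebra G\<^esub> s" if "l \<in> L" for l
    using s that unfolding S_carrier by blast
  have s0: "s x = 0" if x: "x \<notin> K" for x
  proof (cases "x \<in> carrier G")
    case xG: True
    have "(\<Sum>y\<in>carrier G. a y * ?e (inv y \<otimes> x)) = 0"
    proof (rule sum.neutral, rule ballI)
      fix y assume y: "y \<in> carrier G"
      show "a y * ?e (inv y \<otimes> x) = 0"
      proof (cases "y \<in> K")
        case True
        have "inv y \<otimes> x \<notin> L"
        proof
          assume "inv y \<otimes> x \<in> L"
          then have "y \<otimes> (inv y \<otimes> x) \<in> K" by (rule K_mult[OF True L_K])
          then show False using x y xG by (simp add: m_assoc[symmetric])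
        qed
        then show ?thesis by (simp add: char_idem_def)
      qed (simp add: a)
    qed
    then show ?thesis unfolding sa ga_mult using xG by simp
  qed (simp add: sa ga_mult)
  have "\<exists>t. \<forall>x\<in>K. s x = t (q x) * tau x"
  proof (rule centralizer_form)
    fix x l assume x: "x \<in> K" and l: "l \<in> L"
    note G = K_closed[OF x] L_closed[OF l]
    have "(s \<otimes>\<^bsub>group_algebra G\<^esub> ga_of l) (l \<otimes> x) = (ga_of l \<otimes>\<^bsub>group_algebra G\<^esub> s) (l \<otimes> x)" unfolding cent[OF l] ..
    then show "s (l \<otimes> x \<otimes> inv l) = s x"
      unfolding ga_of_mult_right[OF G(2) m_closed[OF G(2,1)]] ga_of_mult_left[OF G(2) m_closed[OF G(2,1)]]
      using G by (simp add: m_assoc[symmetric])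
  next
    fix x assume x: "x \<in> K"
    note xG = K_closed[OF x]
    \<comment> \<open>With \<open>s = a e\<close>, the identity \<open>s e = s\<close> is checked
      pointwise from \<open>e e = e\<close>, since associativity of the group algebra is not at hand
      here.\<close>
    have "(\<Sum>y\<in>carrier G. s y * ?e (inv y \<otimes> x)) = (\<Sum>y\<in>carrier G. \<Sum>z\<in>carrier G. a z * (?e (inv z \<otimes> y) * ?e (inv y \<otimes> x)))"
      unfolding sa ga_mult by (rule sum.cong[OF refl]) (simp only: if_True sum_distrib_right mult.assoc)
    also have "\<dots> = (\<Sum>z\<in>carrier G. \<Sum>y\<in>carrier G. a z * (?e (inv z \<otimes> y) * ?e (inv y \<otimes> x)))" by (rule sum.swap)
    also have "\<dots> = (\<Sum>z\<in>carrier G. a z * ?e (inv z \<otimes> x))"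
    proof (rule sum.cong[OF refl])
      fix z assume z: "z \<in> carrier G"
      have "(\<Sum>y\<in>carrier G. ?e (inv z \<otimes> y) * ?e (inv y \<otimes> x))
          = (\<Sum>y\<in>carrier G. ?e (inv z \<otimes> (z \<otimes> y)) * ?e (inv (z \<otimes> y) \<otimes> x))"
        by (rule sum.reindex_bij_betw[OF bij_mult_left[OF z], symmetric])
      also have "\<dots> = (\<Sum>y\<in>carrier G. ?e y * ?e (inv y \<otimes> (inv z \<otimes> x)))"
        by (rule sum.cong[OF refl]) (use z xG in \<open>simp add: inv_mult_group m_assoc[symmetric]\<close>)
      also have "\<dots> = ?e (inv z \<otimes> x)" by (rule idem_idem) (use z xG in simp)
      finally show "(\<Sum>y\<in>carrier G. a z * (?e (inv z \<otimes> y) * ?e (inv y \<otimes> x))) = a z * ?e (inv z \<otimes> x)"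
        unfolding sum_distrib_left[symmetric] by simp
    qed
    also have "\<dots> = s x" unfolding sa ga_mult using xG by simp
    finally have "s x = (\<Sum>y\<in>carrier G. s y * ?e (inv y \<otimes> x))" by simp
    also have "\<dots> = (\<Sum>y\<in>q x. of_nat d / of_nat (card L) * (s y * \<phi> (inv x \<otimes> y)))"
    proof (rule sum.mono_neutral_cong_right[OF finite_G])
      show "q x \<subseteq> carrier G" using xG by (auto simp: mem_q_iff)
      have l: "inv y \<otimes> x \<in> L \<longleftrightarrow> y \<in> q x" if "y \<in> carrier G" for y
        using q_eq_iff[OF that xG] that xG by (simp add: mem_q_iff)
      show "\<forall>y\<in>carrier G - q x. s y * ?e (inv y \<otimes> x) = 0"
        using l by (simp add: char_idem_def)
      fix y assume y: "y \<in> q x"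
      then have yG: "y \<in> carrier G" using xG by (simp add: mem_q_iff)
      moreover have "inv y \<otimes> x \<in> L" using l[OF yG] y by simp
      moreover have "inv (inv y \<otimes> x) = inv x \<otimes> y" using yG xG by (simp add: inv_mult_group)
      moreover have "\<phi> \<one> = of_nat d" using phi_R[OF L_one] R_one by simp
      ultimately show "s y * ?e (inv y \<otimes> x) = of_nat d / of_nat (card L) * (s y * \<phi> (inv x \<otimes> y))"
        by (simp add: char_idem_def)
    qed
    finally show "s x = of_nat d / of_nat (card L) * (\<Sum>y\<in>q x. s y * \<phi> (inv x \<otimes> y))" unfolding sum_distrib_left .
  qed
  then obtain t where t: "\<forall>x\<in>K. s x = t (q x) * tau x" by (elim exE)
  have st: "s = elt t" unfolding elt_def using t s0 by (intro ext) simp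
  then have "coef s X = t X" if "X \<in> carrier E" for X using coef_elt[OF that] by simp
  then have "elt (coef s) = elt t" by (rule elt_cong)
  then show ?thesis using st by simp
qed

definition to_mat where "to_mat s = A.heis_sum (coef s)"

lemma to_mat_elt: "to_mat (elt t) = A.heis_sum t"
  unfolding to_mat_def by (rule A.heis_sum_cong) (rule coef_elt)

lemma to_mat_mult:
  assumes "a \<in> carrier S" "b \<in> carrier S"
  shows "a \<otimes>\<^bsub>S\<^esub> b \<in> carrier S" "to_mat (a \<otimes>\<^bsub>S\<^esub> b) = to_mat a * to_mat b"
proof -
  have ab: "a \<otimes>\<^bsub>S\<^esub> b = elt (\<lambda>Z. \<Sum>X\<in>carrier E. coef a X * coef b (inv\<^bsub>E\<^esub> X \<otimes>\<^bsub>E\<^esub> Z) * \<gamma> X Z)"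
    unfolding S_mult elt_mult[symmetric] S_form[OF assms(1), symmetric] S_form[OF assms(2), symmetric] ..
  show "a \<otimes>\<^bsub>S\<^esub> b \<in> carrier S" unfolding ab by (rule elt_in_S)
  show "to_mat (a \<otimes>\<^bsub>S\<^esub> b) = to_mat a * to_mat b"
    unfolding ab to_mat_elt unfolding to_mat_def by (rule A.heis_sum_mult[symmetric])
qed

lemma to_mat_bij: "bij_betw to_mat (carrier S) (carrier_mat A.deg A.deg)"
proof (rule bij_betwI')
  fix a b assume a: "a \<in> carrier S" and b: "b \<in> carrier S"
  show "to_mat a = to_mat b \<longleftrightarrow> a = b"
  proof
    assume "to_mat a = to_mat b"
    then have "coef a X = coef b X" if "X \<in> carrier E" for X unfolding to_mat_def by (rule A.heis_sum_inj[OF _ that])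
    then have "elt (coef a) = elt (coef b)" by (rule elt_cong)
    then show "a = b" using S_form[OF a] S_form[OF b] by simp
  qed simp
next
  show "to_mat a \<in> carrier_mat A.deg A.deg" for a by (simp add: to_mat_def)
next
  fix M :: "complex mat" assume "M \<in> carrier_mat A.deg A.deg"
  then have "M = to_mat (elt (\<lambda>Y. mat_trace (A.heis (inv\<^bsub>E\<^esub> Y) * M) / of_nat A.deg))"
    unfolding to_mat_elt by (rule A.heis_sum_surj[symmetric])
  then show "\<exists>a\<in>carrier S. M = to_mat a" using elt_in_S by (intro bexI)
qed

lemma to_mat_one: "to_mat \<one>\<^bsub>S\<^esub> = 1\<^sub>m A.deg" "\<one>\<^bsub>S\<^esub> \<in> carrier S"
  unfolding S_one char_idem_elt to_mat_elt by (rule A.heis_sum_one, rule elt_in_S)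

lemma to_mat_iso: "to_mat \<in> matrix_isos G K L \<phi>"
proof -
  have add: "to_mat (a \<oplus>\<^bsub>S\<^esub> b) = to_mat a + to_mat b" for a b
    unfolding S_add to_mat_def A.heis_sum_add[symmetric] by (rule A.heis_sum_cong) (simp add: coef_def add_divide_distrib)
  have smult: "to_mat (\<lambda>x. c * s x) = c \<cdot>\<^sub>m to_mat s" for c s
    unfolding to_mat_def A.heis_sum_smult[symmetric] by (rule A.heis_sum_cong) (simp add: coef_def)
  have "to_mat \<in> ring_iso S (ring_mat TYPE(complex) A.deg ())"
    unfolding ring_iso_def Ring.ring_hom_def
    using to_mat_bij to_mat_mult(2) add to_mat_one(1) bij_betw_imp_funcset[OF to_mat_bij]
    by (simp add: ring_mat_def Pi_def)
  moreover have "A.deg ^ 2 = Coset.order E" using A.deg_square by (simp add: Coset.order_def power2_eq_square)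
  ultimately show ?thesis unfolding matrix_isos_def using smult by blast
qed

text \<open>Associativity and the unit laws are pulled back from matrices along the injective
  multiplicative map \<open>to_mat\<close>. They are needed to identify inverses in
  \<open>S\<close>.\<close>

lemma S_monoid: "monoid S"
proof (rule monoidI)
  fix x y z assume x: "x \<in> carrier S" and y: "y \<in> carrier S" and z: "z \<in> carrier S"
  have inj: "inj_on to_mat (carrier S)" by (rule bij_betw_imp_inj_on[OF to_mat_bij])
  have c: "to_mat u \<in> carrier_mat A.deg A.deg" for u by (simp add: to_mat_def)
  show "x \<otimes>\<^bsub>S\<^esub> y \<in> carrier S" by (rule to_mat_mult(1)[OF x y])
  note xy = to_mat_mult(1)[OF x y] and yz = to_mat_mult(1)[OF y z]
  show "x \<otimes>\<^bsub>S\<^esub> y \<otimes>\<^bsub>S\<^esub> z = x \<otimes>\<^bsub>S\<^esub> (y \<otimes>\<^bsub>S\<^esub> z)"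
    by (rule inj_onD[OF inj _ to_mat_mult(1)[OF xy z] to_mat_mult(1)[OF x yz]])
      (simp only: to_mat_mult(2)[OF xy z] to_mat_mult(2)[OF x yz] to_mat_mult(2)[OF x y] to_mat_mult(2)[OF y z] assoc_mult_sq[OF c c c])
next
  fix x assume x: "x \<in> carrier S"
  have inj: "inj_on to_mat (carrier S)" by (rule bij_betw_imp_inj_on[OF to_mat_bij])
  have c: "to_mat u \<in> carrier_mat A.deg A.deg" for u by (simp add: to_mat_def)
  show "\<one>\<^bsub>S\<^esub> \<otimes>\<^bsub>S\<^esub> x = x"
    by (rule inj_onD[OF inj _ to_mat_mult(1)[OF to_mat_one(2) x] x])
      (simp only: to_mat_mult(2)[OF to_mat_one(2) x] to_mat_one(1) left_mult_one_mat[OF c])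
  show "x \<otimes>\<^bsub>S\<^esub> \<one>\<^bsub>S\<^esub> = x"
    by (rule inj_onD[OF inj _ to_mat_mult(1)[OF x to_mat_one(2)] x])
      (simp only: to_mat_mult(2)[OF x to_mat_one(2)] to_mat_one(1) right_mult_one_mat[OF c])
qed (rule to_mat_one(2))

end

section \<open>The complement and its canonical magic character\<close>

lemma trivial_unique_odd_subgrp:
  "trivial_unique_odd (subgrp G H) W \<psi> \<longleftrightarrow> trivial_unique_odd G W \<psi>"
  by (simp add: trivial_unique_odd_def)

lemma det_pow_mat:
  assumes "A \<in> carrier_mat n n"
  shows "det (A ^\<^sub>m k) = det (A :: complex mat) ^ k"
proof (induction k)
  case (Suc k)
  have "det (A ^\<^sub>m k * A) = det (A ^\<^sub>m k) * det A" by (rule det_mult) (use assms in simp_all)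
  then show ?case using Suc by simp
qed simp

text \<open>The chosen representation and \<open>\<rho>\<close> have equal traces on all powers of
  \<open>g\<close>, hence the same eigenvalues with multiplicity and the same determinant.\<close>

lemma (in fin_group) det_character_eq:
  assumes rep: "representation G n \<rho>" and g: "g \<in> carrier G" and \<psi>: "\<psi> = (\<lambda>h\<in>carrier G. mat_trace (\<rho> h))"
  shows "det_character G \<psi> g = det (\<rho> g)"
proof -
  define \<rho>' where "\<rho>' = (SOME \<rho>. affords G \<rho> \<psi>)"
  have "affords G \<rho> \<psi>" unfolding affords_def using rep \<psi> by blast
  then have aff: "affords G \<rho>' \<psi>" unfolding \<rho>'_def by (rule someI[of "\<lambda>\<rho>. affords G \<rho> \<psi>"])
  then obtain k where rep': "representation G k \<rho>'" and \<psi>': "\<psi> = (\<lambda>h\<in>carrier G. mat_trace (\<rho>' h))"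
    unfolding affords_def by (elim conjE exE) (rule that)
  have tr: "mat_trace (\<rho>' h) = mat_trace (\<rho> h)" if "h \<in> carrier G" for h
    using fun_cong[OF \<psi>, of h] fun_cong[OF \<psi>', of h] that by simp
  have "det (\<rho>' g) = det (\<rho> g)"
  proof (rule det_eq_of_trace_pow_eq[OF rep_carrier[OF rep' g] rep_carrier[OF rep g]])
    show "mat_trace (\<rho>' g ^\<^sub>m m) = mat_trace (\<rho> g ^\<^sub>m m)" for m
      unfolding rep_pow[OF rep' g, symmetric] rep_pow[OF rep g, symmetric] by (rule tr) (use g in simp)
  qed
  then show ?thesis using g by (simp add: det_character_def \<rho>'_def)
qed

text \<open>If a prime \<open>p\<close> outside \<open>\<pi>\<close> divided the order
  \<open>m\<close>, then every \<open>\<mu> g ^ (m div p)\<close> would be killed both by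
  \<open>p\<close> and by the part of the group order prime to \<open>p\<close>. So
  \<open>m div p\<close> would already be an exponent, against minimality.\<close>

lemma (in fin_group) linear_character_order_pi:
  assumes pow: "\<And>g. g \<in> carrier G \<Longrightarrow> \<mu> g ^ card (carrier G) = 1"
    and part: "\<And>p a N g. prime p \<Longrightarrow> p \<notin> \<pi> \<Longrightarrow> card (carrier G) = p ^ a * N \<Longrightarrow> \<not> p dvd N \<Longrightarrow> g \<in> carrier G \<Longrightarrow> \<mu> g ^ N = 1"
  shows "pi_number \<pi> (linear_character_order G \<mu>)"
proof -
  let ?P = "\<lambda>k. k > 0 \<and> (\<forall>g\<in>carrier G. \<mu> g ^ k = 1)"
  define m where "m = linear_character_order G \<mu>"
  have cpos: "card (carrier G) > 0" using finite_G one_closed by (auto simp: card_gt_0_iff)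
  have "?P (card (carrier G))" using pow cpos by simp
  then have m: "?P m" unfolding m_def linear_character_order_def by (rule LeastI)
  have "p \<in> \<pi>" if p: "prime p" "p dvd m" for p
  proof (rule ccontr)
    assume np: "p \<notin> \<pi>"
    obtain N where N: "card (carrier G) = p ^ multiplicity p (card (carrier G)) * N" "\<not> p dvd N"
      by (rule multiplicity_decompose'[of "card (carrier G)" p]) (use cpos p prime_gt_1_nat[of p] in auto)
    obtain m' where m': "m = p * m'" using p(2) by (elim dvdE)
    have "\<mu> g ^ m' = 1" if g: "g \<in> carrier G" for g
    proof (rule coprime_powers_eq_1)
      show "(\<mu> g ^ m') ^ p = 1" using m g unfolding m' power_mult[symmetric] mult.commute[of m' p] by simp
      have "\<mu> g ^ N = 1" by (rule part[OF p(1) np N g])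
      then show "(\<mu> g ^ m') ^ N = 1" unfolding power_mult[symmetric] mult.commute[of m' N] unfolding power_mult by simp
      show "coprime p N" using p(1) N(2) by (rule prime_imp_coprime)
    qed
    moreover have "m' > 0" using m m' by (cases m') simp_all
    ultimately have "m \<le> m'" unfolding m_def linear_character_order_def by (intro Least_le) simp
    then show False using m' \<open>m' > 0\<close> prime_gt_1_nat[OF p(1)] by simp
  qed
  then show ?thesis using m unfolding pi_number_def m_def[symmetric] by (auto simp: prime_factors_dvd)
qed

section \<open>Factor groups modulo \<open>L\<close> and complements\<close>

context abelian_five
begin

lemma carrier_quot: "carrier (quot G X L) = q ` X"
  by (auto simp: FactGroup_def RCOSETS_def r_coset_def)

lemma mult_quot [simp]: "a \<otimes>\<^bsub>quot G X L\<^esub> b = a <#> b"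
  by (simp add: FactGroup_def set_mult_def)

lemma one_quot [simp]: "\<one>\<^bsub>quot G X L\<^esub> = L"
  by (simp add: FactGroup_def)

lemma mult_Mod: "a \<otimes>\<^bsub>G Mod L\<^esub> b = a <#> b" and carrier_Mod: "carrier (G Mod L) = q ` carrier G"
  and one_Mod: "\<one>\<^bsub>G Mod L\<^esub> = L"
  by (auto simp: FactGroup_def RCOSETS_def)

lemma quot_complement:
  assumes H: "subgroup H G" "L \<subseteq> H" "\<And>x. x \<in> H \<Longrightarrow> x \<in> K \<Longrightarrow> x \<in> L"
    and HK: "\<And>g. g \<in> carrier G \<Longrightarrow> \<exists>h\<in>H. \<exists>k\<in>K. g = h \<otimes> k"
  shows "is_complement (G Mod L) (carrier (quot G K L)) (carrier (quot G H L))"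
proof -
  have HG: "x \<in> carrier G" if "x \<in> H" for x using subgroup.mem_carrier[OF H(1) that] .
  interpret M: group "G Mod L" by (rule normal.factorgroup_is_group[OF normal_L])
  have minv: "inv\<^bsub>G Mod L\<^esub> (q x) = q (inv x)" if x: "x \<in> carrier G" for x
  proof (rule M.inv_equality)
    have "q (inv x) <#> q x = q (inv x \<otimes> x)" by (rule q_mult) (use x in simp_all)
    then show "q (inv x) \<otimes>\<^bsub>G Mod L\<^esub> q x = \<one>\<^bsub>G Mod L\<^esub>" unfolding mult_Mod one_Mod using x q_one by simp
  qed (use x in \<open>simp_all add: carrier_Mod\<close>)
  have sub: "subgroup (q ` H) (G Mod L)"
  proof (rule M.subgroupI)
    show "q ` H \<subseteq> carrier (G Mod L)" unfolding carrier_Mod using HG by auto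
    show "q ` H \<noteq> {}" using subgroup.one_closed[OF H(1)] by auto
  next
    fix a assume "a \<in> q ` H"
    then obtain x where x: "x \<in> H" "a = q x" by (elim imageE) (rule that)
    show "inv\<^bsub>G Mod L\<^esub> a \<in> q ` H" unfolding x(2) minv[OF HG[OF x(1)]] using subgroup.m_inv_closed[OF H(1) x(1)] by (rule imageI)
  next
    fix a b assume "a \<in> q ` H" "b \<in> q ` H"
    then obtain x y where x: "x \<in> H" "a = q x" and y: "y \<in> H" "b = q y" by (elim imageE) (rule that)
    show "a \<otimes>\<^bsub>G Mod L\<^esub> b \<in> q ` H"
      unfolding x(2) y(2) mult_Mod q_mult[OF HG[OF x(1)] HG[OF y(1)]] using subgroup.m_closed[OF H(1) x(1) y(1)] by (rule imageI)
  qed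
  have prod: "q ` H <#>\<^bsub>G Mod L\<^esub> q ` K = carrier (G Mod L)"
  proof
    show "q ` H <#>\<^bsub>G Mod L\<^esub> q ` K \<subseteq> carrier (G Mod L)"
      by (rule M.set_mult_closed) (use HG K_closed in \<open>auto simp: carrier_Mod\<close>)
    show "carrier (G Mod L) \<subseteq> q ` H <#>\<^bsub>G Mod L\<^esub> q ` K"
    proof
      fix X assume "X \<in> carrier (G Mod L)"
      then obtain g where g: "g \<in> carrier G" "X = q g" unfolding carrier_Mod by (elim imageE) (rule that)
      obtain h k where hk: "h \<in> H" "k \<in> K" "g = h \<otimes> k" using HK[OF g(1)] by (elim bexE) (rule that)
      have "X = q h \<otimes>\<^bsub>G Mod L\<^esub> q k" unfolding mult_Mod q_mult[OF HG[OF hk(1)] K_closed[OF hk(2)]] g(2) hk(3) ..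
      then show "X \<in> q ` H <#>\<^bsub>G Mod L\<^esub> q ` K" unfolding set_mult_def using hk by blast
    qed
  qed
  have "q ` H \<inter> q ` K = {L}"
  proof
    show "q ` H \<inter> q ` K \<subseteq> {L}"
    proof
      fix X assume "X \<in> q ` H \<inter> q ` K"
      then obtain h k where h: "h \<in> H" "X = q h" and k: "k \<in> K" "X = q k" by auto
      have "h \<in> q k" using h k mem_q_iff[OF K_closed[OF k(1)]] HG[OF h(1)] by simp
      then have "h \<in> K" by (rule q_sub_K[OF k(1)])
      then have "h \<in> L" by (rule H(3)[OF h(1)])
      then show "X \<in> {L}" using h q_eq_L_iff[OF HG[OF h(1)]] by simp
    qed
    have "q \<one> \<in> q ` H" "q \<one> \<in> q ` K" using subgroup.one_closed[OF H(1)] K_one by simp_all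
    then show "{L} \<subseteq> q ` H \<inter> q ` K" unfolding q_one by simp
  qed
  then show ?thesis unfolding is_complement_def carrier_quot one_Mod using sub prod by blast
qed

lemma q_pow:
  assumes "w \<in> carrier G" 
  shows "q w [^]\<^bsub>quot G V L\<^esub> (n :: nat) = q (w [^] n)"
proof (induction n)
  case (Suc n)
  then show ?case using q_mult[of "w [^] n" w] assms by simp
qed (simp add: q_one)

lemma pow_index_in_L:
  assumes V: "subgroup V G" "L \<subseteq> V" and w: "w \<in> V"
  shows "w [^] Coset.order (quot G V L) \<in> L"
proof -
  have wG: "w \<in> carrier G" using subgroup.mem_carrier[OF V(1) w] .
  interpret Q: group "quot G V L"
    by (rule normal.factorgroup_is_group[OF normal_restrict_supergroup[OF V(1) normal_L V(2)]])
  have "q w [^]\<^bsub>quot G V L\<^esub> Coset.order (quot G V L) = L"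
    using Q.pow_order_eq_1[of "q w"] w by (simp add: carrier_quot)
  then show ?thesis unfolding q_pow[OF wG] using q_eq_L_iff[of "w [^] Coset.order (quot G V L)"] wG by simp
qed

end

section \<open>The stabiliser of the basis elements\<close>

context projective_five
begin

definition compl where "compl = {g \<in> carrier G. \<forall>x\<in>K. tau (g \<otimes> x \<otimes> inv g) = tau x}"

lemma compl_closed: "h \<in> compl \<Longrightarrow> h \<in> carrier G" and compl_tau: "h \<in> compl \<Longrightarrow> x \<in> K \<Longrightarrow> tau (h \<otimes> x \<otimes> inv h) = tau x"
  by (simp_all add: compl_def)

lemma subgroup_compl: "subgroup compl G"
proof (rule subgroupI)
  show "compl \<subseteq> carrier G" by (auto simp: compl_def)
  have "\<one> \<in> compl" using K_closed by (simp add: compl_def)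
  then show "compl \<noteq> {}" by auto
next
  fix a assume a: "a \<in> compl"
  note aG = compl_closed[OF a]
  have "tau (inv a \<otimes> x \<otimes> inv (inv a)) = tau x" if x: "x \<in> K" for x
  proof -
    have "tau (a \<otimes> (inv a \<otimes> x \<otimes> a) \<otimes> inv a) = tau (inv a \<otimes> x \<otimes> a)" by (rule compl_tau[OF a K_conj'[OF x aG]])
    moreover have "a \<otimes> (inv a \<otimes> x \<otimes> a) \<otimes> inv a = x" using aG K_closed[OF x] by (simp add: m_assoc) (simp add: m_assoc[symmetric])
    ultimately show ?thesis using aG by simp
  qed
  then show "inv a \<in> compl" using aG by (simp add: compl_def)
next
  fix a b assume a: "a \<in> compl" and b: "b \<in> compl"
  note aG = compl_closed[OF a] and bG = compl_closed[OF b]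
  have "tau (a \<otimes> b \<otimes> x \<otimes> inv (a \<otimes> b)) = tau x" if x: "x \<in> K" for x
  proof -
    have "a \<otimes> b \<otimes> x \<otimes> inv (a \<otimes> b) = a \<otimes> (b \<otimes> x \<otimes> inv b) \<otimes> inv a" using aG bG K_closed[OF x] by (simp add: inv_mult_group m_assoc)
    then show ?thesis using compl_tau[OF a K_conj[OF x bG]] compl_tau[OF b x] by simp
  qed
  then show "a \<otimes> b \<in> compl" using aG bG by (simp add: compl_def)
qed

lemma L_compl: "L \<subseteq> compl"
  using L_closed tau_conj_L by (auto simp: compl_def)

text \<open>An element of \<open>K\<close> scales \<open>s_x\<close> by the square of
  \<open>\<gamma>\<close>. If no scaling is allowed, all these squares are 1, hence by odd order the
  values too, and the element is in the radical.\<close>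

lemma compl_Int_K:
  assumes h: "h \<in> compl" and k: "h \<in> K"
  shows "h \<in> L"
proof (rule radical_trivial[OF k])
  fix x assume x: "x \<in> K"
  have nz: "tau (pt (q x)) \<noteq> 0" and p: "pt (q x) \<in> K" "q (pt (q x)) = q x" using pt[OF q_E[OF x]] by simp_all
  have "\<gamma> (q x) (q h) * \<gamma> (q x) (q h) = 1"
    using tau_conj_K[OF k p(1)] compl_tau[OF h p(1)] nz p(2) by simp
  then have "\<gamma> (q x) (q h) = 1" by (rule A.\<beta>_sq_eq_1[OF q_E[OF x] q_E[OF k]])
  then show "\<gamma> (q h) (q x) = 1" using \<gamma>_flip[OF q_E[OF k] q_E[OF x]] by simp
qed

text \<open>The scalars of \<open>g\<close> form a character of \<open>K / L\<close>, so duality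
  provides \<open>y\<close> in \<open>K\<close> with the same scalars. They cancel in
  \<open>g \<otimes> inv y\<close>.\<close>

lemma compl_mult_K:
  assumes g: "g \<in> carrier G"
  shows "\<exists>h\<in>compl. \<exists>k\<in>K. g = h \<otimes> k"
proof -
  have mE: "mu g (X \<otimes>\<^bsub>E\<^esub> Y) = mu g X * mu g Y" if XY: "X \<in> carrier E" "Y \<in> carrier E" for X Y
  proof -
    obtain x y where x: "x \<in> K" "X = q x" and y: "y \<in> K" "Y = q y"
      using XY unfolding carrier_E by (elim imageE) (rule that)
    show ?thesis unfolding x(2) y(2) mult_E[OF K_closed[OF x(1)] K_closed[OF y(1)]] by (rule mu_mult[OF g x(1) y(1)])
  qed
  have m1: "mu g \<one>\<^bsub>E\<^esub> = 1"
    using mE[OF E.one_closed E.one_closed] mu_nonzero[OF g K_one] E.r_one[OF E.one_closed] unfolding q_one one_E by simp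
  have "\<exists>k\<in>carrier E. \<forall>x\<in>carrier E. mu g x = \<gamma> x k * \<gamma> x k" by (rule A.\<beta>_square_duality[OF mE m1])
  then obtain Y where Y: "Y \<in> carrier E" and mY: "\<forall>x\<in>carrier E. mu g x = \<gamma> x Y * \<gamma> x Y" by (elim bexE)
  obtain y where y: "y \<in> K" "Y = q y" using Y unfolding carrier_E by (elim imageE) (rule that)
  have mu_y: "mu g (q x) = \<gamma> (q x) (q y) * \<gamma> (q x) (q y)" if "x \<in> K" for x using bspec[OF mY q_E[OF that]] y(2) by simp
  note yG = K_closed[OF y(1)] and y' = K_inv[OF y(1)]
  have "tau (g \<otimes> inv y \<otimes> x \<otimes> inv (g \<otimes> inv y)) = tau x" if x: "x \<in> K" for x
  proof -
    note xG = K_closed[OF x]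
    have "g \<otimes> inv y \<otimes> x \<otimes> inv (g \<otimes> inv y) = g \<otimes> (inv y \<otimes> x \<otimes> inv (inv y)) \<otimes> inv g"
      using g yG xG by (simp add: inv_mult_group m_assoc)
    then have "tau (g \<otimes> inv y \<otimes> x \<otimes> inv (g \<otimes> inv y)) = mu g (q x) * (\<gamma> (q x) (q (inv y)) * \<gamma> (q x) (q (inv y)) * tau x)"
      using mu[OF g K_conj[OF x K_closed[OF y']]] q_conj_K[OF x y'] tau_conj_K[OF y' x] by simp
    also have "\<dots> = tau x" unfolding mu_y[OF x] \<gamma>_inv(2)[OF y(1) x] using \<gamma>_nz[OF q_E[OF x] q_E[OF y(1)]] by simp
    finally show ?thesis .
  qed
  then have "g \<otimes> inv y \<in> compl" using g yG by (simp add: compl_def)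
  moreover have "g = g \<otimes> inv y \<otimes> y" using g yG by (simp add: m_assoc)
  ultimately show ?thesis using y(1) by blast
qed

text \<open>Conjugation as in the exponent notation, hence a right action. The representative is
  immaterial by \<open>cact_q\<close>.\<close>

definition cact where "cact h X = q (inv h \<otimes> rp X \<otimes> h)"

lemma cact_q:
  assumes "h \<in> carrier G" "x \<in> K"
  shows "cact h (q x) = q (inv h \<otimes> x \<otimes> h)"
proof -
  have "q (inv h \<otimes> rp (q x) \<otimes> inv (inv h)) = q (inv h \<otimes> x \<otimes> inv (inv h))"
    by (rule q_conj) (use rp[OF q_E[OF assms(2)]] K_closed assms in simp_all)
  then show ?thesis using assms by (simp add: cact_def)
qed

lemma cact_L: "l \<in> L \<Longrightarrow> X \<in> carrier E \<Longrightarrow> cact l X = X"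
  using rp[of X] q_conj_K[of "rp X" "inv l"] L_K[of l] K_inv[of l] L_closed[of l] by (simp add: cact_def)

lemma isometric_action_compl: "isometric_action E \<gamma> (subgrp G compl) cact"
proof -
  interpret H: fin_group "subgrp G compl" by (rule subgrp_fin_group[OF subgroup_compl])
  have ex: "\<exists>x\<in>K. X = q x" if "X \<in> carrier E" for X using that unfolding carrier_E by auto
  show ?thesis
  proof (unfold_locales)
    fix h assume "h \<in> carrier (subgrp G compl)"
    then have h: "h \<in> carrier G" by (simp add: compl_closed)
    show "A.isom (cact h)" unfolding A.isom_def
    proof (intro conjI ballI)
      fix X assume X: "X \<in> carrier E"
      obtain x where x: "x \<in> K" "X = q x" using ex[OF X] by (elim bexE)
      show "cact h X \<in> carrier E" unfolding x(2) cact_q[OF h x(1)] by (rule q_E[OF K_conj'[OF x(1) h]])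
      fix Y assume Y: "Y \<in> carrier E"
      obtain y where y: "y \<in> K" "Y = q y" using ex[OF Y] by (elim bexE)
      note xG = K_closed[OF x(1)] and yG = K_closed[OF y(1)]
      have "inv h \<otimes> (x \<otimes> y) \<otimes> h = (inv h \<otimes> x \<otimes> h) \<otimes> (inv h \<otimes> y \<otimes> h)"
        using h xG yG by (simp add: m_assoc) (simp add: m_assoc[symmetric])
      then show "cact h (X \<otimes>\<^bsub>E\<^esub> Y) = cact h X \<otimes>\<^bsub>E\<^esub> cact h Y"
        unfolding x(2) y(2) mult_E[OF xG yG] cact_q[OF h x(1)] cact_q[OF h y(1)] cact_q[OF h K_mult[OF x(1) y(1)]]
          mult_E[OF K_closed[OF K_conj'[OF x(1) h]] K_closed[OF K_conj'[OF y(1) h]]] by simp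
      show "\<gamma> (cact h X) (cact h Y) = \<gamma> X Y"
        unfolding x(2) y(2) cact_q[OF h x(1)] cact_q[OF h y(1)] using \<gamma>_conj[of "inv h", OF _ x(1) y(1)] h by simp
    qed
  next
    fix X assume X: "X \<in> carrier E"
    show "cact \<one>\<^bsub>subgrp G compl\<^esub> X = X" using cact_L[OF L_one X] by simp
    fix h k assume "h \<in> carrier (subgrp G compl)" "k \<in> carrier (subgrp G compl)"
    then have hk: "h \<in> carrier G" "k \<in> carrier G" by (simp_all add: compl_closed)
    obtain x where x: "x \<in> K" "X = q x" using ex[OF X] by (elim bexE)
    have "inv (h \<otimes> k) \<otimes> x \<otimes> (h \<otimes> k) = inv k \<otimes> (inv h \<otimes> x \<otimes> h) \<otimes> k"
      using hk K_closed[OF x(1)] by (simp add: inv_mult_group m_assoc)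
    then show "cact (h \<otimes>\<^bsub>subgrp G compl\<^esub> k) X = cact k (cact h X)"
      unfolding x(2) cact_q[OF hk(1) x(1)] cact_q[OF hk(2) K_conj'[OF x(1) hk(1)]]
      using cact_q[OF m_closed[OF hk] x(1)] by simp
  qed
qed

text \<open>Since \<open>h\<close> permutes the basis elements without scalars, conjugation only
  substitutes in the coordinates. Coordinates move contravariantly, which is why
  \<open>inv h\<close> appears.\<close>

lemma ga_conj_in_S:
  assumes h: "h \<in> compl"
  shows "ga_conj G (elt t) h = elt (\<lambda>X. t (cact (inv h) X))"
proof
  fix x
  note hG = compl_closed[OF h]
  show "ga_conj G (elt t) h x = elt (\<lambda>X. t (cact (inv h) X)) x"
  proof (cases "x \<in> carrier G")
    case xG: True
    show ?thesis
    proof (cases "x \<in> K")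
      case True
      have "cact (inv h) (q x) = q (h \<otimes> x \<otimes> inv h)" using cact_q[of "inv h", OF _ True] hG by simp
      then show ?thesis unfolding ga_conj_apply[OF hG xG] elt_def
        using True K_conj[OF True hG] compl_tau[OF h True] by simp
    next
      case False
      have "h \<otimes> x \<otimes> inv h \<notin> K"
      proof
        assume "h \<otimes> x \<otimes> inv h \<in> K"
        then have "inv h \<otimes> (h \<otimes> x \<otimes> inv h) \<otimes> h \<in> K" by (rule K_conj'[OF _ hG])
        moreover have "inv h \<otimes> (h \<otimes> x \<otimes> inv h) \<otimes> h = x" using hG xG by (simp add: m_assoc) (simp add: m_assoc[symmetric])
        ultimately show False using False by simp
      qed
      then show ?thesis unfolding ga_conj_apply[OF hG xG] elt_def using False by simp
    qed
  next
    case False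
    then show ?thesis using ga_conj_outside[OF False] K_closed by (auto simp: elt_def)
  qed
qed

theorem canonical_complement:
  "\<exists>H \<psi>. subgroup H G \<and> L \<subseteq> H \<and>
     is_complement (G Mod L) (carrier (quot G K L)) (carrier (quot G H L)) \<and>
     canonical_magic_character G K L \<phi> H \<psi> \<and>
     (\<forall>V. subgroup V (subgrp G H) \<and> L \<subseteq> V \<and> odd (Coset.order (quot G V L)) \<longrightarrow> trivial_unique_odd G V \<psi>)"
proof -
  interpret I: isometric_action E \<gamma> "subgrp G compl" cact by (rule isometric_action_compl)
  obtain \<Sigma> where rep: "representation (subgrp G compl) A.deg \<Sigma>"
    and comm: "\<forall>h\<in>carrier (subgrp G compl). \<forall>y\<in>carrier E. A.heis y * \<Sigma> h = \<Sigma> h * A.heis (cact h y)"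
    and triv: "\<forall>h\<in>carrier (subgrp G compl). (\<forall>x\<in>carrier E. cact h x = x) \<longrightarrow> \<Sigma> h = 1\<^sub>m A.deg"
    and dets: "\<forall>h\<in>carrier (subgrp G compl). \<forall>p a N. prime p \<and> \<not> p dvd A.deg \<and>
        card (carrier (subgrp G compl)) = p ^ a * N \<and> \<not> p dvd N \<longrightarrow> det (\<Sigma> h) ^ N = 1"
    and odds: "\<forall>W \<psi> s. subgroup W (subgrp G compl) \<and> odd s \<and>
        (\<forall>w\<in>W. \<forall>x\<in>carrier E. cact (w [^]\<^bsub>subgrp G compl\<^esub> (s::nat)) x = x) \<and> (\<forall>w\<in>W. \<psi> w = mat_trace (\<Sigma> w)) \<longrightarrow>
        trivial_unique_odd (subgrp G compl) W \<psi>"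
    using I.canonical_weil_representation by (elim exE conjE) (rule that)
  define \<psi> where "\<psi> = (\<lambda>h\<in>compl. mat_trace (\<Sigma> h))"
  have \<Sigma>c: "\<Sigma> h \<in> carrier_mat A.deg A.deg" if "h \<in> compl" for h using I.H.rep_carrier[OF rep] that by simp
  have \<Sigma>m: "\<Sigma> (h \<otimes> k) = \<Sigma> h * \<Sigma> k" if "h \<in> compl" "k \<in> compl" for h k
    using I.H.rep_mult[OF rep, of h k] that by simp
  have cinv: "inv h \<in> compl" if "h \<in> compl" for h using subgroup.m_inv_closed[OF subgroup_compl that] .
  have cmul: "h \<otimes> k \<in> compl" if "h \<in> compl" "k \<in> compl" for h k using subgroup.m_closed[OF subgroup_compl that] .
  have cone: "\<one> \<in> compl" using subgroup.one_closed[OF subgroup_compl] .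
  have \<Sigma>L: "\<Sigma> l = 1\<^sub>m A.deg" if l: "l \<in> L" for l
    using triv[rule_format, of l] cact_L[OF l] L_compl l by auto
  \<comment> \<open>\<open>L\<close> acts trivially on \<open>K / L\<close>, so
    \<open>\<Sigma>\<close> is the identity on \<open>L\<close> and constant on its cosets. It
    therefore descends to \<open>H / L\<close>.\<close>
  have \<Sigma>q: "\<Sigma> h = \<Sigma> k" if "h \<in> compl" "k \<in> compl" "q h = q k" for h k
  proof -
    have l: "inv h \<otimes> k \<in> L" using q_eq_iff[OF compl_closed[OF that(1)] compl_closed[OF that(2)]] that(3) by simp
    have "h \<otimes> (inv h \<otimes> k) = k" using that(1,2)[THEN compl_closed] by (simp add: m_assoc[symmetric])
    then have "\<Sigma> k = \<Sigma> h * \<Sigma> (inv h \<otimes> k)" using \<Sigma>m[OF that(1) cmul[OF cinv[OF that(1)] that(2)]] by simp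
    then show ?thesis unfolding \<Sigma>L[OF l] right_mult_one_mat[OF \<Sigma>c[OF that(1)]] by simp
  qed
  \<comment> \<open>The magic representation takes cosets to elements of \<open>S\<close>, while
    \<open>\<Sigma>\<close> takes group elements to matrices. \<open>hr\<close> picks a
    representative of a coset, and \<open>to_mat\<close> is then inverted.\<close>
  define hr where "hr X = (SOME h. h \<in> compl \<and> q h = X)" for X
  have hr: "hr (q h) \<in> compl" "q (hr (q h)) = q h" if "h \<in> compl" for h
    using someI[of "\<lambda>k. k \<in> compl \<and> q k = q h" h] that unfolding hr_def by simp_all
  define \<sigma> where "\<sigma> X = inv_into (carrier S) to_mat (\<Sigma> (hr X))" for X
  have inj: "inj_on to_mat (carrier S)" by (rule bij_betw_imp_inj_on[OF to_mat_bij])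
  have \<sigma>S: "\<sigma> (q h) \<in> carrier S" and \<sigma>F: "to_mat (\<sigma> (q h)) = \<Sigma> h" if h: "h \<in> compl" for h
  proof -
    have "\<Sigma> (hr (q h)) = \<Sigma> h" by (rule \<Sigma>q[OF hr(1)[OF h] h hr(2)[OF h]])
    then have im: "\<Sigma> (hr (q h)) \<in> to_mat ` carrier S" using \<Sigma>c[OF h] bij_betw_imp_surj_on[OF to_mat_bij] by simp
    show "\<sigma> (q h) \<in> carrier S" unfolding \<sigma>_def by (rule inv_into_into[OF im])
    show "to_mat (\<sigma> (q h)) = \<Sigma> h" unfolding \<sigma>_def f_inv_into_f[OF im] by fact
  qed
  have \<sigma>m: "\<sigma> (q (h \<otimes> k)) = \<sigma> (q h) \<otimes>\<^bsub>S\<^esub> \<sigma> (q k)" if hk: "h \<in> compl" "k \<in> compl" for h k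
    by (rule inj_onD[OF inj _ \<sigma>S[OF cmul[OF hk]] to_mat_mult(1)[OF \<sigma>S[OF hk(1)] \<sigma>S[OF hk(2)]]])
      (simp only: to_mat_mult(2)[OF \<sigma>S[OF hk(1)] \<sigma>S[OF hk(2)]] \<sigma>F hk cmul \<Sigma>m)
  have \<sigma>1: "\<sigma> (q \<one>) = \<one>\<^bsub>S\<^esub>"
    by (rule inj_onD[OF inj _ \<sigma>S[OF cone] to_mat_one(2)]) (simp only: \<sigma>F[OF cone] to_mat_one(1) \<Sigma>L[OF L_one])
  have inv1: "\<sigma> (q h) \<otimes>\<^bsub>S\<^esub> \<sigma> (q (inv h)) = \<one>\<^bsub>S\<^esub>" and inv2: "\<sigma> (q (inv h)) \<otimes>\<^bsub>S\<^esub> \<sigma> (q h) = \<one>\<^bsub>S\<^esub>" if h: "h \<in> compl" for h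
    unfolding \<sigma>m[OF h cinv[OF h], symmetric] \<sigma>m[OF cinv[OF h] h, symmetric] using compl_closed[OF h] \<sigma>1 by simp_all
  interpret SM: monoid S by (rule S_monoid)
  have inv\<sigma>: "inv\<^bsub>S\<^esub> (\<sigma> (q h)) = \<sigma> (q (inv h))" if h: "h \<in> compl" for h
    using SM.inv_unique'[OF \<sigma>S[OF h] \<sigma>S[OF cinv[OF h]] inv1[OF h] inv2[OF h]] by simp
  have unit: "\<sigma> (q h) \<in> Units S" if h: "h \<in> compl" for h
    unfolding Units_def using \<sigma>S[OF h] \<sigma>S[OF cinv[OF h]] inv1[OF h] inv2[OF h] by blast
  have magic: "ga_conj G s h = inv\<^bsub>S\<^esub> (\<sigma> (q h)) \<otimes>\<^bsub>S\<^esub> s \<otimes>\<^bsub>S\<^esub> \<sigma> (q h)" if h: "h \<in> compl" and s: "s \<in> carrier S" for h s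
  proof -
    define t where "t = coef s"
    have st: "s = elt t" unfolding t_def by (rule S_form[OF s])
    define u where "u X = t (cact (inv h) X)" for X
    have conj: "ga_conj G s h = elt u" unfolding st u_def by (rule ga_conj_in_S[OF h])
    note c = \<Sigma>c[OF h] and c' = \<Sigma>c[OF cinv[OF h]]
    have hH: "h \<in> carrier (subgrp G compl)" using h by simp
    have ihH: "inv\<^bsub>subgrp G compl\<^esub> h = inv h" by (rule m_inv_consistent[OF subgroup_compl h])
    \<comment> \<open>The magic relation, read through \<open>to_mat\<close>. Reindexing by the
      action of \<open>h\<close> undoes the substitution in \<open>u\<close>, and the intertwining
      rule moves \<open>\<Sigma> h\<close> to the other side.\<close>
    have "\<Sigma> h * A.heis_sum u = msum A.deg A.deg (\<lambda>X. u X \<cdot>\<^sub>m (\<Sigma> h * A.heis X)) (carrier E)"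
      by (rule A.mult_heis_sum(1)[OF c])
    also have "\<dots> = msum A.deg A.deg (\<lambda>X. u (cact h X) \<cdot>\<^sub>m (\<Sigma> h * A.heis (cact h X))) (carrier E)"
      by (rule msum_reindex[OF I.act_bij[OF hH]])
    also have "\<dots> = msum A.deg A.deg (\<lambda>X. t X \<cdot>\<^sub>m (A.heis X * \<Sigma> h)) (carrier E)"
    proof (rule msum_cong[OF refl])
      fix X assume X: "X \<in> carrier E"
      have "u (cact h X) = t X" unfolding u_def using I.act_inv(2)[OF hH X] by (simp only: ihH)
      moreover have "\<Sigma> h * A.heis (cact h X) = A.heis X * \<Sigma> h" using bspec[OF bspec[OF comm hH] X] by (rule sym)
      ultimately show "u (cact h X) \<cdot>\<^sub>m (\<Sigma> h * A.heis (cact h X)) = t X \<cdot>\<^sub>m (A.heis X * \<Sigma> h)" by simp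
    qed
    also have "\<dots> = A.heis_sum t * \<Sigma> h" by (rule A.mult_heis_sum(2)[OF c, symmetric])
    finally have e: "\<Sigma> h * A.heis_sum u = A.heis_sum t * \<Sigma> h" .
    have one: "\<Sigma> (inv h) * \<Sigma> h = 1\<^sub>m A.deg"
      using \<Sigma>m[OF cinv[OF h] h] \<Sigma>L[OF L_one] compl_closed[OF h] by simp
    have "A.heis_sum u = \<Sigma> (inv h) * \<Sigma> h * A.heis_sum u" unfolding one by (rule left_mult_one_mat[OF A.heis_sum_carrier, symmetric])
    also have "\<dots> = \<Sigma> (inv h) * (A.heis_sum t * \<Sigma> h)" unfolding assoc_mult_sq[OF c' c A.heis_sum_carrier] e ..
    also have "\<dots> = \<Sigma> (inv h) * A.heis_sum t * \<Sigma> h" by (rule assoc_mult_sq[OF c' A.heis_sum_carrier c, symmetric])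
    finally have F: "A.heis_sum u = \<Sigma> (inv h) * A.heis_sum t * \<Sigma> h" .
    note p1 = to_mat_mult[OF \<sigma>S[OF cinv[OF h]] s]
    note p2 = to_mat_mult[OF p1(1) \<sigma>S[OF h]]
    show ?thesis unfolding inv\<sigma>[OF h]
    proof (rule inj_onD[OF inj _ _ p2(1)])
      show "ga_conj G s h \<in> carrier S" unfolding conj by (rule elt_in_S)
      show "to_mat (ga_conj G s h) = to_mat (\<sigma> (q (inv h)) \<otimes>\<^bsub>S\<^esub> s \<otimes>\<^bsub>S\<^esub> \<sigma> (q h))"
        unfolding p2(2) p1(2) conj to_mat_elt \<sigma>F[OF h] \<sigma>F[OF cinv[OF h]] F by (simp only: st to_mat_elt)
    qed
  qed
  have hom: "\<sigma> \<in> hom (quot G compl L) (units_of S)"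
  proof (rule homI)
    fix X assume "X \<in> carrier (quot G compl L)"
    then obtain h where h: "h \<in> compl" "X = q h" unfolding carrier_quot by (elim imageE) (rule that)
    show "\<sigma> X \<in> carrier (units_of S)" unfolding units_of_carrier h(2) by (rule unit[OF h(1)])
    fix Y assume "Y \<in> carrier (quot G compl L)"
    then obtain k where k: "k \<in> compl" "Y = q k" unfolding carrier_quot by (elim imageE) (rule that)
    show "\<sigma> (X \<otimes>\<^bsub>quot G compl L\<^esub> Y) = \<sigma> X \<otimes>\<^bsub>units_of S\<^esub> \<sigma> Y"
      unfolding units_of_mult mult_quot h(2) k(2) q_mult[OF compl_closed[OF h(1)] compl_closed[OF k(1)]] by (rule \<sigma>m[OF h(1) k(1)])
  qed
  have magic_rep: "magic_representation G K L \<phi> compl \<sigma>"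
    unfolding magic_representation_def Let_def by (intro conjI ballI hom magic)
  have "\<psi> = (\<lambda>h\<in>compl. mat_trace (to_mat (\<sigma> (q h))))" unfolding \<psi>_def by (rule restrict_ext) (simp only: \<sigma>F)
  then have magic_char: "magic_character G K L \<phi> compl \<psi>"
    unfolding magic_character_def using magic_rep to_mat_iso by (intro exI[of _ \<sigma>] exI[of _ to_mat] conjI)
  \<comment> \<open>The two applications differ only in the odd exponent that carries
    \<open>W\<close> into \<open>L\<close>: the order of a Sylow subgroup, or the index of
    \<open>L\<close> in \<open>V\<close>. The subgroup \<open>V\<close> itself may have even
    order.\<close>
  have odd_sub: "trivial_unique_odd G W \<psi>"
    if W: "subgroup W (subgrp G compl)" and s: "odd s" "\<And>w. w \<in> W \<Longrightarrow> w [^] (s :: nat) \<in> L" for W s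
  proof -
    have WH: "w \<in> compl" if "w \<in> W" for w using subgroup.mem_carrier[OF W that] by simp
    have act: "\<forall>w\<in>W. \<forall>X\<in>carrier E. cact (w [^]\<^bsub>subgrp G compl\<^esub> s) X = X"
      unfolding nat_pow_consistent[symmetric] by (intro ballI cact_L s(2))
    have tr: "\<forall>w\<in>W. \<psi> w = mat_trace (\<Sigma> w)" using WH by (simp add: \<psi>_def)
    have "trivial_unique_odd (subgrp G compl) W \<psi>"
      using odds[THEN spec, THEN spec, THEN spec, of W s \<psi>] W s(1) act tr by simp
    then show ?thesis unfolding trivial_unique_odd_subgrp .
  qed
  define \<pi> where "\<pi> = prime_factors (Coset.order E)"
  have cE: "card (carrier E) \<noteq> 0" using E.card_E_pos by simp
  have \<pi>: "p \<in> \<pi> \<longleftrightarrow> prime p \<and> p dvd A.deg" for p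
    unfolding \<pi>_def Coset.order_def A.deg_square[symmetric] using A.deg_pos by (auto simp: prime_factors_dvd prime_dvd_mult_iff)
  have pi: "pi_number \<pi> (linear_character_order (subgrp G compl) (det_character (subgrp G compl) \<psi>))"
  proof (rule I.H.linear_character_order_pi)
    have det: "det_character (subgrp G compl) \<psi> h = det (\<Sigma> h)" if "h \<in> carrier (subgrp G compl)" for h
      by (rule I.H.det_character_eq[OF rep that]) (simp add: \<psi>_def)
    fix h assume h: "h \<in> carrier (subgrp G compl)"
    have mu_pow: "det (\<Sigma> h) ^ n = det (\<Sigma> (h [^]\<^bsub>subgrp G compl\<^esub> n))" for n :: nat
      unfolding I.H.rep_pow[OF rep h] by (rule det_pow_mat[OF I.H.rep_carrier[OF rep h], symmetric])
    show "det_character (subgrp G compl) \<psi> h ^ card (carrier (subgrp G compl)) = 1"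
      unfolding det[OF h] mu_pow using I.H.pow_order_eq_1[OF h] I.H.rep_one[OF rep] by (simp add: Coset.order_def)
    fix p a N assume "prime p" "p \<notin> \<pi>" "card (carrier (subgrp G compl)) = p ^ a * N" "\<not> p dvd N"
    then show "det_character (subgrp G compl) \<psi> h ^ N = 1"
      unfolding det[OF h] \<pi> using dets[rule_format, OF h, of p a N] by simp
  qed
  have sylow: "trivial_unique_odd G Q \<psi>" if p: "p \<in> \<pi>" and Q: "sylow_subgroup p (subgrp G compl) Q" for p Q
  proof -
    have QH: "subgroup Q (subgrp G compl)" and cQ: "card Q = p ^ multiplicity p (Coset.order (subgrp G compl))"
      using Q by (simp_all add: sylow_subgroup_def)
    \<comment> \<open>Primes in \<open>\<pi>\<close> divide the odd order of \<open>K / L\<close>,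
      so a Sylow subgroup for such a prime has odd order.\<close>
    have "odd p"
    proof
      assume "even p"
      moreover have "p dvd Coset.order E" 
        unfolding Coset.order_def A.deg_square[symmetric] using p unfolding \<pi> by simp
      ultimately have "even (Coset.order E)" by (rule dvd_trans)
      then show False using odd_index by simp
    qed
    then have "odd (card Q)" unfolding cQ by simp
    moreover have "w [^] card Q \<in> L" if w: "w \<in> Q" for w
    proof -
      interpret Qg: fin_group "subgrp (subgrp G compl) Q" by (rule I.H.subgrp_fin_group[OF QH])
      have "w [^]\<^bsub>subgrp (subgrp G compl) Q\<^esub> card Q = \<one>"
        using Qg.pow_order_eq_1[of w] w by (simp add: Coset.order_def)
      then show ?thesis using L_one nat_pow_consistent[of w "card Q" Q] by simp
    qed
    ultimately show ?thesis by (rule odd_sub[OF QH])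
  qed
  have canon: "canonical_magic_character G K L \<phi> compl \<psi>"
    unfolding canonical_magic_character_def Let_def \<pi>_def[symmetric] using magic_char pi sylow by (intro conjI ballI allI impI)
  have oddV: "trivial_unique_odd G V \<psi>"
    if V: "subgroup V (subgrp G compl)" "L \<subseteq> V" "odd (Coset.order (quot G V L))" for V
  proof (rule odd_sub[OF V(1,3)])
    have "subgroup V G" using V(1) subgroup_compl incl_subgroup by blast
    then show "w [^] Coset.order (quot G V L) \<in> L" if "w \<in> V" for w by (rule pow_index_in_L[OF _ V(2) that])
  qed
  show ?thesis
  proof (rule exI[of _ compl], rule exI[of _ \<psi>], intro conjI allI impI)
    show "is_complement (G Mod L) (carrier (quot G K L)) (carrier (quot G compl L))"
      by (rule quot_complement[OF subgroup_compl L_compl compl_Int_K compl_mult_K])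
    fix V assume "subgroup V (subgrp G compl) \<and> L \<subseteq> V \<and> odd (Coset.order (quot G V L))"
    then show "trivial_unique_odd G V \<psi>" by (elim conjE) (rule oddV)
  qed (rule subgroup_compl L_compl canon)+
qed

end

theorem theorem8p4:
  fixes G :: "('a, 'b) monoid_scheme" and K L :: "'a set" and \<theta> \<phi> :: "'a \<Rightarrow> complex"
  assumes "character_five G K L \<theta> \<phi>"
    and "comm_group (quot G K L)"
    and "odd (Coset.order (quot G K L))"
  shows "\<exists>H \<psi>. subgroup H G \<and> L \<subseteq> H \<and>
           is_complement (G Mod L) (carrier (quot G K L)) (carrier (quot G H L)) \<and>
           canonical_magic_character G K L \<phi> H \<psi> \<and>
           (\<forall>V. subgroup V (subgrp G H) \<and> L \<subseteq> V \<and> odd (Coset.order (quot G V L)) \<longrightarrow>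
                trivial_unique_odd G V \<psi>)"
proof -
  interpret F: abelian_five G K L \<theta> \<phi>
    using assms by (simp add: abelian_five_def abelian_five_axioms_def)
  obtain d \<rho> where irr: "irreducible_representation (subgrp G L) d \<rho>"
    and phi: "\<phi> = (\<lambda>l\<in>carrier (subgrp G L). mat_trace (\<rho> l))"
    using F.phi_Irr unfolding Irr_def affords_def by blast
  interpret F: afforded_five G K L \<theta> \<phi> d \<rho> by unfold_locales (rule irr, rule phi)
  obtain R \<beta> where R: "\<forall>y\<in>K. R y \<in> carrier_mat d d" "\<forall>l\<in>L. R l = \<rho> l"
     "\<forall>y\<in>K. \<forall>w\<in>K. R y * R w = \<beta> (L #>\<^bsub>G\<^esub> y) (L #>\<^bsub>G\<^esub> w) \<cdot>\<^sub>m R (y \<otimes>\<^bsub>G\<^esub> w)"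
    and \<beta>: "\<forall>x\<in>carrier (quot G K L). \<forall>y\<in>carrier (quot G K L). \<forall>z\<in>carrier (quot G K L). \<beta> (x \<otimes>\<^bsub>quot G K L\<^esub> y) z = \<beta> x z * \<beta> y z"
     "\<forall>x\<in>carrier (quot G K L). \<forall>y\<in>carrier (quot G K L). \<beta> x y * \<beta> y x = 1" "\<forall>x\<in>carrier (quot G K L). \<beta> x x = 1"
    using F.projective_extension by (elim exE conjE) (rule that)
  have flip: "\<beta> x y = 1 / \<beta> y x" if "x \<in> carrier (quot G K L)" "y \<in> carrier (quot G K L)" for x y
    using bspec[OF bspec[OF \<beta>(2) that(1)] that(2)] by (auto simp: eq_divide_eq)
  \<comment> \<open>By antisymmetry the inverse of \<open>\<beta>\<close> is its transpose, which is
    the form in which the cocycle of \<open>R\<close> enters the elements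
    \<open>s_x\<close>.\<close>
  interpret F: projective_five G K L \<theta> \<phi> d \<rho> R "\<lambda>x y. 1 / \<beta> x y"
  proof
    show "R y \<in> carrier_mat d d" if "y \<in> K" for y using R(1) that by (rule bspec)
    show "R l = \<rho> l" if "l \<in> L" for l using R(2) that by (rule bspec)
    show "R y * R w = (1 / \<beta> (L #>\<^bsub>G\<^esub> w) (L #>\<^bsub>G\<^esub> y)) \<cdot>\<^sub>m R (y \<otimes>\<^bsub>G\<^esub> w)" if "y \<in> K" "w \<in> K" for y w
      unfolding flip[OF F.q_E[OF that(1)] F.q_E[OF that(2)], symmetric] using bspec[OF bspec[OF R(3) that(1)] that(2)] .
    show "1 / \<beta> (x \<otimes>\<^bsub>quot G K L\<^esub> y) z = 1 / \<beta> x z * (1 / \<beta> y z)"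
      if "x \<in> carrier (quot G K L)" "y \<in> carrier (quot G K L)" "z \<in> carrier (quot G K L)" for x y z
      unfolding bspec[OF bspec[OF bspec[OF \<beta>(1) that(1)] that(2)] that(3)] by simp
    show "1 / \<beta> x y * (1 / \<beta> y x) = 1" if "x \<in> carrier (quot G K L)" "y \<in> carrier (quot G K L)" for x y
      using bspec[OF bspec[OF \<beta>(2) that(1)] that(2)] by simp
    show "1 / \<beta> x x = 1" if "x \<in> carrier (quot G K L)" for x using bspec[OF \<beta>(3) that] by simp
  qed
  show ?thesis by (rule F.canonical_complement)
qed

end
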